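(* Let $k \geq 3$ be an integer. There is a function $f_k:\mathbb{N}\to\mathbb{R}$ with $f_k(n)/n \to 0$ as $n\to\infty$ such that, for any integer $n \geq 6(k+1)$ with $nk$ even, \[ \max\left\{\frac{k(5k-3)}{4(k+1)(4k-3)}n-6,\ \frac{31k}{98(k+1)}n-f_k(n)\right\} \leq \mathrm{cms}(n,k) \leq \frac{kn}{2(k+1)} \] and \[ \max\left\{\frac{5k-8}{4(4k-7)}n-6,\ \frac{31}{98}n-f_k(n)\right\} \leq \mathrm{cms}_1(n,k) \leq \frac{n-1}{2}. \]
   Context: All graphs are finite and simple. For a graph $G$ with $m$ edges, an ordering of $G$ is a bijection $\ell: E(G)\to\mathbb{Z}_m$. For distinct edges $e,e'$, the forward distance $d_\ell(e,e')$ is the smallest positive integer $d$ with $\ell(e)+d=\ell(e')$ in $\mathbb{Z}_m$, and $d_\ell\{e,e'\}=\min\{d_\ell(e,e'),d_\ell(e',e)\}$. Two edges are adjacent if they share a vertex. $\mathrm{cms}(\ell)$ is the largest $s\in\{1,\dots,m\}$ such that $d_\ell\{e,e'\}\geq s$ for every pair of adjacent edges $e,e'$; the cyclic matching sequenceability $\mathrm{cms}(G)$ is the maximum of $\mathrm{cms}(\ell)$ over all orderings $\ell$ of $G$ (equivalently, the largest $s$ such that some cyclic ordering of $E(G)$ has every $s$ cyclically consecutive edges forming a matching). A $k$-regular graph is class 1 if its edges can be properly coloured with $k$ colours. For $n>k$ with $nk$ even, $\mathrm{cms}(n,k)$ is the minimum of $\mathrm{cms}(G)$ over all $k$-regular graphs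 $G$ on $n$ vertices, and $\mathrm{cms}_1(n,k)$ is the minimum of $\mathrm{cms}(G)$ over all $k$-regular class 1 graphs $G$ on $n$ vertices (when such graphs exist). *)

theory Defs
  imports Complex_Main "HOL-Number_Theory.Cong"
begin

text \<open>A graph is a pair of a vertex set and a set of edges, each edge being a
  two-element set of vertices.\<close>

type_synonym 'a graph = "'a set \<times> 'a set set"

abbreviation verts :: "'a graph \<Rightarrow> 'a set" where
  "verts G \<equiv> fst G"

abbreviation edges :: "'a graph \<Rightarrow> 'a set set" where
  "edges G \<equiv> snd G"

definition simple_graph :: "'a graph \<Rightarrow> bool" where
  "simple_graph G \<longleftrightarrow> finite (verts G) \<and> (\<forall>e\<in>edges G. e \<subseteq> verts G \<and> card e = 2)"

definition regular :: "nat \<Rightarrow> 'a graph \<Rightarrow> bool" where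
  "regular k G \<longleftrightarrow> (\<forall>v\<in>verts G. card {e \<in> edges G. v \<in> e} = k)"

definition adjacent :: "'a set \<Rightarrow> 'a set \<Rightarrow> bool" where
  "adjacent e e' \<longleftrightarrow> e \<noteq> e' \<and> e \<inter> e' \<noteq> {}"

definition edge_colourable :: "nat \<Rightarrow> 'a graph \<Rightarrow> bool" where
  "edge_colourable k G \<longleftrightarrow>
     (\<exists>c :: 'a set \<Rightarrow> nat. (\<forall>e\<in>edges G. c e < k) \<and>
        (\<forall>e\<in>edges G. \<forall>e'\<in>edges G. adjacent e e' \<longrightarrow> c e \<noteq> c e'))"

text \<open>The elements of \<open>\<int>\<^sub>m\<close> are represented by the residues \<open>0, \<dots>, m - 1\<close>,
  where \<open>m\<close> is the number of edges. Only the values of an ordering on the edge set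
  matter.\<close>

definition ordering :: "'a graph \<Rightarrow> ('a set \<Rightarrow> nat) \<Rightarrow> bool" where
  "ordering G l \<longleftrightarrow> bij_betw l (edges G) {0..<card (edges G)}"

definition forward_dist :: "'a graph \<Rightarrow> ('a set \<Rightarrow> nat) \<Rightarrow> 'a set \<Rightarrow> 'a set \<Rightarrow> nat" where
  "forward_dist G l e e' = (LEAST d. 0 < d \<and> [l e + d = l e'] (mod card (edges G)))"

definition cyclic_dist :: "'a graph \<Rightarrow> ('a set \<Rightarrow> nat) \<Rightarrow> 'a set \<Rightarrow> 'a set \<Rightarrow> nat" where
  "cyclic_dist G l e e' = min (forward_dist G l e e') (forward_dist G l e' e)"

definition cms_ordering :: "'a graph \<Rightarrow> ('a set \<Rightarrow> nat) \<Rightarrow> nat" where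
  "cms_ordering G l =
     Max {s \<in> {1..card (edges G)}.
            \<forall>e\<in>edges G. \<forall>e'\<in>edges G. adjacent e e' \<longrightarrow> cyclic_dist G l e e' \<ge> s}"

text \<open>The set of orderings (as total functions) is infinite, but for a simple graph with
  at least one edge the maximum is over a nonempty subset of \<open>{1..m}\<close>.\<close>

definition cms_graph :: "'a graph \<Rightarrow> nat" where
  "cms_graph G = Max {cms_ordering G l | l. ordering G l}"

text \<open>Every finite graph is isomorphic to one whose vertices are natural numbers.\<close>

definition regular_graphs :: "nat \<Rightarrow> nat \<Rightarrow> nat graph set" where
  "regular_graphs n k = {G. simple_graph G \<and> card (verts G) = n \<and> regular k G}"

definition class1_regular_graphs :: "nat \<Rightarrow> nat \<Rightarrow> nat graph set" where
  "class1_regular_graphs n k = {G \<in> regular_graphs n k. edge_colourable k G}"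

text \<open>For \<open>n, k > 0\<close> these are minima over subsets of \<open>{1..n * k div 2}\<close>. They are
  meaningful only if there is a graph of the required kind; for class 1 graphs and
  \<open>0 < k < n\<close> this is the case exactly if \<open>n\<close> is even.\<close>

definition cms :: "nat \<Rightarrow> nat \<Rightarrow> nat" where
  "cms n k = Min (cms_graph ` regular_graphs n k)"

definition cms1 :: "nat \<Rightarrow> nat \<Rightarrow> nat" where
  "cms1 n k = Min (cms_graph ` class1_regular_graphs n k)"

end

theory Submission imports Defs "HOL-Library.Infinite_Set" begin

text \<open>\<^emph>\<open>Lower bounds.\<close> Split the edges into matchings of almost equal size \<open>q\<close>: \<open>k + 1\<close> of them
  by Vizing's theorem with colour classes balanced by Kempe exchanges, or \<open>k\<close> of them in class 1.
  List them one after another; then only edges in cyclically successive matchings can come too close.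
  The union of two matchings consists of paths and cycles, so both can be numbered such that adjacent
  edges get numbers differing by at most one. A matching whose two neighbours in the list are
  already ordered is a scheduling problem with release times and deadlines, solvable under Hall's
  condition. For at least four matchings this gives distance about \<open>2 q / 3\<close>. For cubic class 1
  graphs \<open>7 q / 10\<close> is needed, which is achieved by cutting the third matching into a short block
  between the first two and a long block after them. All losses are constants, so \<open>f = 6\<close>.

  \<^emph>\<open>Upper bounds.\<close> If \<open>s = n / 2\<close>, then \<open>s\<close> consecutive edges are a perfect matching, so the
  edges \<open>0\<close> and \<open>s\<close> in the list coincide. For \<open>cms(n, k)\<close> take a graph with an odd set \<open>T\<close> of
  about \<open>k\<close> vertices spanning almost all their edges: a window of \<open>s\<close> edges has at most
  \<open>(|T| - 1) / 2\<close> edges inside \<open>T\<close>.\<close>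

text \<open>With \<open>K\<close> matchings of size \<open>q\<close> the required ratio of distance
  to \<open>q\<close> is (5 K - 8) / (2 (4 K - 7)): this is 7/10 for K = 3, exactly 2/3 for K = 4
  and at most 17/26 from K = 5 on; 31/49 lies below 2/3 and 17/26. Vizing colourings have K = k + 1
  >= 4, so a construction of ratio 2/3 serves everything except class 1 cubic graphs. The obstacle
  is that a class aligned with one neighbour in the list is in uncontrolled order as seen from the
  other neighbour. Each class is therefore split into a part of size about s, aligned with one
  neighbour, and a buffer of size about s / 2 towards the other, which gives q about 3 s / 2. In the
  upper bound with odd k, an even set of k + 1 vertices yields no parity gain. An odd set of k + 2 =
  2 M + 1 vertices spans at most 2 M^2 - 1 edges once one edge has to leave it, one edge fewer than
  averaging over windows needs. Hence even and odd k are treated by different arguments.\<close>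

section \<open>Rankings and the scheduling of unit jobs\<close>

lemma ranking_exists:
  fixes key :: "'a \<Rightarrow> 'b::linorder"
  assumes "finite S"
  shows "\<exists>i. bij_betw i S {..<card S} \<and> (\<forall>x\<in>S. \<forall>y\<in>S. key x < key y \<longrightarrow> i x < i y)"
  using assms
proof (induction S rule: finite_ranking_induct[where f = key])
  case empty
  then show ?case by (simp add: bij_betw_def)
next
  case (insert x S)
  show ?case
  proof (cases "x \<in> S")
    case True
    then show ?thesis using insert by (simp add: insert_absorb)
  next
    case False
    obtain i where i: "bij_betw i S {..<card S}" "\<forall>x\<in>S. \<forall>y\<in>S. key x < key y \<longrightarrow> i x < i y"
      using insert by blast
    define j where "j = i(x := card S)"
    have bj: "bij_betw j S {..<card S}"
      using i(1) False by (subst bij_betw_cong[where g = i]) (auto simp: j_def)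
    have "bij_betw j (insert x S) (insert (j x) {..<card S})"
      using notIn_Un_bij_betw[of x S j "{..<card S}"] False bj by (auto simp: j_def)
    moreover have "insert (j x) {..<card S} = {..<card (insert x S)}"
      using False insert by (auto simp: j_def)
    moreover have "j y < j z" if "y \<in> insert x S" "z \<in> insert x S" "key y < key z" for y z
    proof (cases "z = x")
      case True
      then have "y \<in> S" using that by auto
      then have "i y < card S" using i(1) by (auto simp: bij_betw_def)
      then show ?thesis using True \<open>y \<in> S\<close> False by (auto simp: j_def)
    next
      case z: False
      then have "z \<in> S" using that by auto
      then have "y \<noteq> x" using insert that by force
      then show ?thesis using i(2) that z by (auto simp: j_def)
    qed
    ultimately show ?thesis by metis
  qed
qed

lemma card_rank_below:
  assumes "bij_betw i S {..<card S}" "x \<in> S"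
  shows "card {y\<in>S. i y < i x} = i x" "card {y\<in>S. i y \<le> i x} = Suc (i x)"
proof -
  have inj: "inj_on i S" and im: "i ` S = {..<card S}" using assms by (auto simp: bij_betw_def)
  have ix: "i x < card S" using im assms by blast
  have "i ` {y\<in>S. i y < i x} = {..<i x}"
  proof
    show "{..<i x} \<subseteq> i ` {y\<in>S. i y < i x}"
    proof
      fix t assume t: "t \<in> {..<i x}"
      then have "t \<in> i ` S" using im ix by auto
      then show "t \<in> i ` {y\<in>S. i y < i x}" using t by auto
    qed
  qed auto
  moreover have "inj_on i {y\<in>S. i y < i x}" using inj by (rule inj_on_subset) auto
  ultimately show "card {y\<in>S. i y < i x} = i x" by (metis card_image card_lessThan)
  have "i ` {y\<in>S. i y \<le> i x} = {..i x}"
  proof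
    show "{..i x} \<subseteq> i ` {y\<in>S. i y \<le> i x}"
    proof
      fix t assume t: "t \<in> {..i x}"
      then have "t \<in> i ` S" using im ix by auto
      then show "t \<in> i ` {y\<in>S. i y \<le> i x}" using t by auto
    qed
  qed auto
  moreover have "inj_on i {y\<in>S. i y \<le> i x}" using inj by (rule inj_on_subset) auto
  ultimately show "card {y\<in>S. i y \<le> i x} = Suc (i x)" by (metis card_image card_atMost)
qed

text \<open>Ties of the key are broken arbitrarily, so a rank is only known to lie between the
  number of smaller keys and the number of keys that are not larger. The later estimates work with
  these two counts.\<close>

lemma ranking:
  fixes key :: "'a \<Rightarrow> 'b::linorder"
  assumes "finite S"
  obtains i where "bij_betw i S {..<card S}"
    "\<And>x y. x \<in> S \<Longrightarrow> y \<in> S \<Longrightarrow> key x < key y \<Longrightarrow> i x < i y"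
    "\<And>x. x \<in> S \<Longrightarrow> i x < card {y\<in>S. key y \<le> key x}"
    "\<And>x. x \<in> S \<Longrightarrow> card {y\<in>S. key y < key x} \<le> i x"
proof -
  obtain i where i: "bij_betw i S {..<card S}" "\<And>x y. x \<in> S \<Longrightarrow> y \<in> S \<Longrightarrow> key x < key y \<Longrightarrow> i x < i y"
    using ranking_exists[OF assms, of key] by blast
  show thesis
  proof
    show "bij_betw i S {..<card S}" by fact
    show "\<And>x y. x \<in> S \<Longrightarrow> y \<in> S \<Longrightarrow> key x < key y \<Longrightarrow> i x < i y" by fact
    fix x assume x: "x \<in> S"
    have "{y\<in>S. i y \<le> i x} \<subseteq> {y\<in>S. key y \<le> key x}"
      using i(2) x by (force simp: not_less[symmetric])
    then have "card {y\<in>S. i y \<le> i x} \<le> card {y\<in>S. key y \<le> key x}"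
      using assms by (intro card_mono) auto
    then show "i x < card {y\<in>S. key y \<le> key x}" using card_rank_below[OF i(1) x] by simp
    have "{y\<in>S. key y < key x} \<subseteq> {y\<in>S. i y < i x}" using i(2) x by auto
    then have "card {y\<in>S. key y < key x} \<le> card {y\<in>S. i y < i x}"
      using assms by (intro card_mono) auto
    then show "card {y\<in>S. key y < key x} \<le> i x" using card_rank_below[OF i(1) x] by simp
  qed
qed

text \<open>Unit jobs with release times \<open>lo\<close> and deadlines \<open>up\<close>, scheduled by earliest deadline first.\<close>

lemma interval_scheduling:
  fixes lo up :: "'a \<Rightarrow> nat"
  assumes "finite F" "card F = n"
    and "\<And>f. f \<in> F \<Longrightarrow> up f < n"
    and "\<And>l t. l \<le> Suc t \<Longrightarrow> card {f\<in>F. l \<le> lo f \<and> up f \<le> t} \<le> Suc t - l"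
  shows "\<exists>z. bij_betw z F {..<n} \<and> (\<forall>f\<in>F. lo f \<le> z f \<and> z f \<le> up f)"
  using assms
proof (induction n arbitrary: F lo up)
  case 0
  then show ?case by (simp add: bij_betw_def)
next
  case (Suc n)
  note hall = Suc.prems(4)
  have fin: "finite F" by fact
  \<comment> \<open>Hall's condition for the window from 1 to \<open>n\<close> leaves a job of
    release time 0, so slot 0 can be filled.\<close>
  have "card {f\<in>F. 1 \<le> lo f \<and> up f \<le> n} \<le> Suc n - 1" by (rule hall) simp
  moreover have "{f\<in>F. 1 \<le> lo f \<and> up f \<le> n} = {f\<in>F. 1 \<le> lo f}"
    using Suc.prems(3) by (auto simp: less_Suc_eq_le)
  ultimately have "card {f\<in>F. 1 \<le> lo f} < card F" using Suc.prems by simp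
  then have "{f\<in>F. 1 \<le> lo f} \<noteq> F" by auto
  then obtain f1 where f1: "f1 \<in> F" "lo f1 = 0" by fastforce
  define Z where "Z = {f\<in>F. lo f = 0}"
  have "finite Z" "Z \<noteq> {}" using f1 fin by (auto simp: Z_def)
  then obtain f0 where f0: "f0 \<in> Z" "\<And>f. f \<in> Z \<Longrightarrow> up f0 \<le> up f"
    using arg_min_if_finite(1)[of Z up] arg_min_least[of Z _ up] by blast
  have f0F: "f0 \<in> F" "lo f0 = 0" using f0 by (auto simp: Z_def)
  define F' where "F' = F - {f0}"
  have up0: "up f \<ge> 1" if "f \<in> F'" for f
  proof (rule ccontr)
    assume "\<not> up f \<ge> 1"
    then have uf: "up f = 0" by simp
    have fF: "f \<in> F" "f \<noteq> f0" using that by (auto simp: F'_def)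
    have "card {f\<in>F. 1 \<le> lo f \<and> up f \<le> 0} \<le> Suc 0 - 1" by (rule hall) simp
    then have "{f\<in>F. 1 \<le> lo f \<and> up f \<le> 0} = {}" using fin by simp
    then have "lo f = 0" using fF uf by force
    then have "f \<in> Z" using fF by (simp add: Z_def)
    then have "up f0 = 0" using f0 uf by force
    then have sub: "{f0, f} \<subseteq> {f\<in>F. 0 \<le> lo f \<and> up f \<le> 0}" using fF f0F uf by auto
    have "card {f0, f} \<le> card {f\<in>F. 0 \<le> lo f \<and> up f \<le> 0}" using fin by (intro card_mono sub) auto
    moreover have "card {f\<in>F. 0 \<le> lo f \<and> up f \<le> 0} \<le> Suc 0 - 0" by (rule hall) simp
    ultimately show False using fF by auto
  qed
  \<comment> \<open>Slot 0 is removed and everything moves down by one. Truncation identifies the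
    release times 0 and 1, so windows with \<open>l = 0\<close> need a separate argument: if the
    deadline of \<open>f0\<close> lies in the window, the old window from 0 loses \<open>f0\<close>;
    otherwise no job of release time 0 ends there, by the choice of \<open>f0\<close>, and the old
    window from 1 suffices.\<close>
  have "\<exists>z. bij_betw z F' {..<n} \<and> (\<forall>f\<in>F'. (lo f - 1) \<le> z f \<and> z f \<le> up f - 1)"
  proof (rule Suc.IH)
    show "finite F'" using fin by (simp add: F'_def)
    show "card F' = n" using Suc.prems f0F by (simp add: F'_def)
    show "up f - 1 < n" if "f \<in> F'" for f using up0[OF that] Suc.prems(3)[of f] that by (auto simp: F'_def)
    fix l t :: nat assume lt: "l \<le> Suc t"
    show "card {f \<in> F'. l \<le> lo f - 1 \<and> up f - 1 \<le> t} \<le> Suc t - l"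
    proof (cases "l = 0")
      case False
      have "{f \<in> F'. l \<le> lo f - 1 \<and> up f - 1 \<le> t} \<subseteq> {f\<in>F. Suc l \<le> lo f \<and> up f \<le> Suc t}"
        using False by (auto simp: F'_def)
      then have "card {f \<in> F'. l \<le> lo f - 1 \<and> up f - 1 \<le> t} \<le> card {f\<in>F. Suc l \<le> lo f \<and> up f \<le> Suc t}"
        using fin by (intro card_mono) auto
      also have "\<dots> \<le> Suc (Suc t) - Suc l" by (rule hall) (use lt in simp)
      finally show ?thesis by simp
    next
      case True
      show ?thesis
      proof (cases "up f0 \<le> Suc t")
        case u: True
        have "{f \<in> F'. l \<le> lo f - 1 \<and> up f - 1 \<le> t} \<subseteq> {f\<in>F. 0 \<le> lo f \<and> up f \<le> Suc t} - {f0}"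
          by (auto simp: F'_def)
        then have "card {f \<in> F'. l \<le> lo f - 1 \<and> up f - 1 \<le> t} \<le> card ({f\<in>F. 0 \<le> lo f \<and> up f \<le> Suc t} - {f0})"
          using fin by (intro card_mono) auto
        also have "\<dots> = card {f\<in>F. 0 \<le> lo f \<and> up f \<le> Suc t} - 1"
          using f0F u fin by (intro card_Diff_singleton) auto
        also have "\<dots> \<le> (Suc (Suc t) - 0) - 1" by (intro diff_le_mono hall) simp
        finally show ?thesis using True by simp
      next
        case u: False
        have "{f \<in> F'. l \<le> lo f - 1 \<and> up f - 1 \<le> t} \<subseteq> {f\<in>F. 1 \<le> lo f \<and> up f \<le> Suc t}"
        proof
          fix f assume f: "f \<in> {f \<in> F'. l \<le> lo f - 1 \<and> up f - 1 \<le> t}"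
          then have "f \<in> F" "up f \<le> Suc t" by (auto simp: F'_def)
          moreover from this have "f \<notin> Z" using f0(2)[of f] u by force
          ultimately show "f \<in> {f\<in>F. 1 \<le> lo f \<and> up f \<le> Suc t}" by (auto simp: Z_def)
        qed
        then have "card {f \<in> F'. l \<le> lo f - 1 \<and> up f - 1 \<le> t} \<le> card {f\<in>F. 1 \<le> lo f \<and> up f \<le> Suc t}"
          using fin by (intro card_mono) auto
        also have "\<dots> \<le> Suc (Suc t) - 1" by (rule hall) simp
        finally show ?thesis using True by simp
      qed
    qed
  qed
  then obtain z where z: "bij_betw z F' {..<n}" "\<And>f. f \<in> F' \<Longrightarrow> lo f - 1 \<le> z f \<and> z f \<le> up f - 1" by blast
  define w where "w f = (if f = f0 then 0 else Suc (z f))" for f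
  have "bij_betw (Suc \<circ> z) F' (Suc ` {..<n})"
    by (rule bij_betw_trans[OF z(1)]) (auto simp: bij_betw_def)
  then have wb: "bij_betw w F' (Suc ` {..<n})"
    by (subst bij_betw_cong[where g = "Suc \<circ> z"]) (auto simp: w_def F'_def)
  have "bij_betw w (insert f0 F') (insert (w f0) (Suc ` {..<n}))"
    using notIn_Un_bij_betw[of f0 F' w "Suc ` {..<n}"] wb by (auto simp: w_def F'_def)
  moreover have "insert f0 F' = F" using f0F by (auto simp: F'_def)
  moreover have "insert (w f0) (Suc ` {..<n}) = {..<Suc n}" by (auto simp: w_def lessThan_Suc_eq_insert_0)
  ultimately have "bij_betw w F {..<Suc n}" by simp
  moreover have "lo f \<le> w f \<and> w f \<le> up f" if "f \<in> F" for f
  proof (cases "f = f0")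
    case True
    then show ?thesis using f0F by (simp add: w_def)
  next
    case False
    then have "f \<in> F'" using that by (simp add: F'_def)
    then show ?thesis using z(2)[of f] up0[of f] False by (auto simp: w_def)
  qed
  ultimately show ?case by blast
qed

section \<open>Aligned numberings of two matchings\<close>

text \<open>The total deficits of the two sides are equal, so while a row is deficient some column
  is too, and the weight between them can be raised by one. Weights are used instead of sets of
  edges because a deficient pair may already be adjacent.\<close>

lemma two_regular_extension:
  fixes m :: "'a \<Rightarrow> 'b \<Rightarrow> nat"
  assumes "finite P" "finite Q" "card P = card Q"
    and "\<And>e. e \<in> P \<Longrightarrow> (\<Sum>g\<in>Q. m e g) \<le> 2"
    and "\<And>g. g \<in> Q \<Longrightarrow> (\<Sum>e\<in>P. m e g) \<le> 2"
  shows "\<exists>m'. (\<forall>e g. m e g \<le> m' e g) \<and> (\<forall>e\<in>P. (\<Sum>g\<in>Q. m' e g) = 2) \<and> (\<forall>g\<in>Q. (\<Sum>e\<in>P. m' e g) = 2)"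
  using assms(4,5)
proof (induction "2 * card P - (\<Sum>e\<in>P. \<Sum>g\<in>Q. m e g)" arbitrary: m rule: less_induct)
  case less
  note row = less.prems(1) and col = less.prems(2)
  have tot: "(\<Sum>e\<in>P. \<Sum>g\<in>Q. m e g) \<le> 2 * card P"
    using sum_bounded_above[of P "\<lambda>e. \<Sum>g\<in>Q. m e g" 2] row by simp
  have swap: "(\<Sum>e\<in>P. \<Sum>g\<in>Q. m e g) = (\<Sum>g\<in>Q. \<Sum>e\<in>P. m e g)" by (rule sum.swap)
  show ?case
  proof (cases "\<exists>e\<in>P. (\<Sum>g\<in>Q. m e g) < 2")
    case False
    then have r: "\<forall>e\<in>P. (\<Sum>g\<in>Q. m e g) = 2" using row by (force simp: not_less)
    have "\<forall>g\<in>Q. (\<Sum>e\<in>P. m e g) = 2"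
    proof (rule ccontr)
      assume "\<not> ?thesis"
      then obtain g where g: "g \<in> Q" "(\<Sum>e\<in>P. m e g) < 2" using col by force
      have "(\<Sum>g\<in>Q. \<Sum>e\<in>P. m e g) < (\<Sum>g\<in>Q. 2)"
        using assms(2) g col by (intro sum_strict_mono_ex1) auto
      moreover have "(\<Sum>e\<in>P. \<Sum>g\<in>Q. m e g) = (\<Sum>e\<in>P. 2)" using r by (intro sum.cong) auto
      ultimately show False using swap assms(3) by simp
    qed
    then show ?thesis using r by blast
  next
    case True
    then obtain e where e: "e \<in> P" "(\<Sum>g\<in>Q. m e g) < 2" by blast
    have lt: "(\<Sum>e\<in>P. \<Sum>g\<in>Q. m e g) < 2 * card P"
    proof -
      have "(\<Sum>e\<in>P. \<Sum>g\<in>Q. m e g) < (\<Sum>e\<in>P. 2)"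
        using assms(1) e row by (intro sum_strict_mono_ex1) auto
      then show ?thesis by simp
    qed
    have "\<exists>g\<in>Q. (\<Sum>e\<in>P. m e g) < 2"
    proof (rule ccontr)
      assume "\<not> ?thesis"
      then have "(\<Sum>g\<in>Q. 2) \<le> (\<Sum>g\<in>Q. \<Sum>e\<in>P. m e g)" by (intro sum_mono) (force simp: not_less)
      then show False using swap lt assms(3) by simp
    qed
    then obtain g where g: "g \<in> Q" "(\<Sum>e\<in>P. m e g) < 2" by blast
    define m1 where "m1 x y = m x y + (if x = e \<and> y = g then 1 else 0)" for x y
    have r1: "(\<Sum>y\<in>Q. m1 x y) = (\<Sum>y\<in>Q. m x y) + (if x = e then 1 else 0)" for x
      using assms(2) g by (auto simp: m1_def sum.distrib)
    have c1: "(\<Sum>x\<in>P. m1 x y) = (\<Sum>x\<in>P. m x y) + (if y = g then 1 else 0)" for y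
      using assms(1) e by (auto simp: m1_def sum.distrib)
    have t1: "(\<Sum>x\<in>P. \<Sum>y\<in>Q. m1 x y) = (\<Sum>x\<in>P. \<Sum>y\<in>Q. m x y) + 1"
      using assms(1) e by (simp add: r1 sum.distrib)
    have "\<exists>m'. (\<forall>e g. m1 e g \<le> m' e g) \<and> (\<forall>e\<in>P. (\<Sum>g\<in>Q. m' e g) = 2) \<and> (\<forall>g\<in>Q. (\<Sum>e\<in>P. m' e g) = 2)"
    proof (rule less.hyps)
      show "2 * card P - (\<Sum>e\<in>P. \<Sum>g\<in>Q. m1 e g) < 2 * card P - (\<Sum>e\<in>P. \<Sum>g\<in>Q. m e g)"
        using t1 lt by simp
      show "(\<Sum>g\<in>Q. m1 x g) \<le> 2" if "x \<in> P" for x using r1[of x] row[OF that] e by auto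
      show "(\<Sum>x\<in>P. m1 x y) \<le> 2" if "y \<in> Q" for y using c1[of y] col[OF that] g by auto
    qed
    then obtain m' where m': "\<forall>x y. m1 x y \<le> m' x y" "\<forall>e\<in>P. (\<Sum>g\<in>Q. m' e g) = 2" "\<forall>g\<in>Q. (\<Sum>e\<in>P. m' e g) = 2"
      by blast
    have "m x y \<le> m' x y" for x y using m'(1)[rule_format, of x y] by (simp add: m1_def)
    then show ?thesis using m' by blast
  qed
qed

text \<open>Breadth-first numbering of a weighted 2-regular graph: at any time only the last two
  numbered vertices still have unnumbered neighbours, and the number of edges leaving the
  numbered part is at most two. The latter bounds the imbalance of a bipartition.\<close>

lemma two_regular_numbering:
  fixes W :: "'v \<Rightarrow> 'v \<Rightarrow> nat" and sg :: "'v \<Rightarrow> int"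
  assumes fin: "finite V"
    and sym: "\<And>x y. W x y = W y x"
    and reg: "\<And>x. x \<in> V \<Longrightarrow> (\<Sum>y\<in>V. W x y) = 2"
    and sg: "\<And>x y. W x y > 0 \<Longrightarrow> sg x = - sg y" and sg1: "\<And>x. \<bar>sg x\<bar> = 1"
  shows "\<exists>f. bij_betw f {..<card V} V
    \<and> (\<forall>j<card V. \<forall>i<j. W (f i) (f j) > 0 \<longrightarrow> j \<le> i + 2)
    \<and> (\<forall>n\<le>card V. \<bar>\<Sum>i<n. sg (f i)\<bar> \<le> 1)"
proof -
  define ou where "ou D x = (\<Sum>y\<in>V - D. W x y)" for D x
  \<comment> \<open>In the sum of sign times degree over \<open>D\<close>, edges inside
    \<open>D\<close> cancel because their ends have opposite signs. Only the weight leaving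
    \<open>D\<close> remains; if it is at most 2, so is twice the signed count in absolute
    value.\<close>
  have balance: "\<bar>\<Sum>x\<in>D. sg x\<bar> \<le> 1" if D: "D \<subseteq> V" "(\<Sum>x\<in>D. ou D x) \<le> 2" for D
  proof -
    have fD: "finite D" using D fin finite_subset by blast
    have split: "(\<Sum>y\<in>V. W x y) = (\<Sum>y\<in>D. W x y) + ou D x" for x
      unfolding ou_def using sum.subset_diff[OF D(1) fin, of "W x"] by (simp add: add.commute)
    define S where "S = (\<Sum>x\<in>D. \<Sum>y\<in>D. sg x * int (W x y))"
    have "S = (\<Sum>y\<in>D. \<Sum>x\<in>D. sg x * int (W x y))" unfolding S_def by (rule sum.swap)
    also have "\<dots> = (\<Sum>y\<in>D. \<Sum>x\<in>D. - (sg y * int (W y x)))"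
    proof (intro sum.cong refl)
      fix x y show "sg x * int (W x y) = - (sg y * int (W y x))"
        using sym[of x y] sg[of x y] by (cases "W x y = 0") auto
    qed
    also have "\<dots> = - S" unfolding S_def by (simp add: sum_negf)
    finally have S0: "S = 0" by simp
    have "2 * (\<Sum>x\<in>D. sg x) = (\<Sum>x\<in>D. sg x * int (\<Sum>y\<in>V. W x y))"
    proof (subst sum_distrib_left, intro sum.cong refl)
      fix x assume "x \<in> D"
      then have "(\<Sum>y\<in>V. W x y) = 2" using reg D(1) by blast
      then show "2 * sg x = sg x * int (\<Sum>y\<in>V. W x y)" by (simp del: of_nat_sum)
    qed
    also have "\<dots> = S + (\<Sum>x\<in>D. sg x * int (ou D x))"
      unfolding S_def split by (simp add: distrib_left sum.distrib sum_distrib_left)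
    finally have eq: "2 * (\<Sum>x\<in>D. sg x) = (\<Sum>x\<in>D. sg x * int (ou D x))" using S0 by simp
    have "\<bar>\<Sum>x\<in>D. sg x * int (ou D x)\<bar> \<le> (\<Sum>x\<in>D. \<bar>sg x * int (ou D x)\<bar>)" by (rule sum_abs)
    also have "\<dots> = (\<Sum>x\<in>D. int (ou D x))" using sg1 by (simp add: abs_mult)
    also have "\<dots> \<le> 2" using D(2) by (simp flip: of_nat_sum)
    finally show ?thesis using eq by linarith
  qed
  \<comment> \<open>\<open>ou D x\<close> is the weight from \<open>x\<close> out of
    \<open>D\<close>. The last three conjuncts keep the induction going: at most 2 leaves the
    numbered set, nothing from before the last two vertices, and at most 1 from the last but one, so
    that a single new neighbour exhausts that vertex.\<close>
  define Inv where "Inv n f \<longleftrightarrow> inj_on f {..<n} \<and> f ` {..<n} \<subseteq> V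
    \<and> (\<forall>j<n. \<forall>i<j. W (f i) (f j) > 0 \<longrightarrow> j \<le> i + 2)
    \<and> (\<forall>k\<le>n. \<bar>\<Sum>i<k. sg (f i)\<bar> \<le> 1)
    \<and> (\<Sum>i<n. ou (f ` {..<n}) (f i)) \<le> 2
    \<and> (\<forall>i. i + 2 < n \<longrightarrow> ou (f ` {..<n}) (f i) = 0)
    \<and> (2 \<le> n \<longrightarrow> ou (f ` {..<n}) (f (n - 2)) \<le> 1)" for n and f :: "nat \<Rightarrow> 'v"
  have ex: "\<exists>f. Inv n f" if "n \<le> card V" for n
    using that
  proof (induction n)
    case 0
    show ?case by (auto simp: Inv_def)
  next
    case (Suc n)
    then obtain f where f: "Inv n f" by auto
    define D where "D = f ` {..<n}"
    have inj: "inj_on f {..<n}" and sub: "D \<subseteq> V"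
      and bw: "\<And>i j. j < n \<Longrightarrow> i < j \<Longrightarrow> W (f i) (f j) > 0 \<Longrightarrow> j \<le> i + 2"
      and bal: "\<And>k. k \<le> n \<Longrightarrow> \<bar>\<Sum>i<k. sg (f i)\<bar> \<le> 1"
      and tot: "(\<Sum>i<n. ou D (f i)) \<le> 2"
      and old: "\<And>i. i + 2 < n \<Longrightarrow> ou D (f i) = 0"
      and pre: "2 \<le> n \<Longrightarrow> ou D (f (n - 2)) \<le> 1"
      using f by (auto simp: Inv_def D_def)
    have fD: "finite D" by (simp add: D_def)
    have "card D = n" using inj by (simp add: D_def card_image)
    then have "D \<noteq> V" using Suc.prems by auto
    then obtain z0 where z0: "z0 \<in> V - D" using sub by blast
    have pick: "\<exists>z\<in>V - D. W x z > 0" if "ou D x > 0" for x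
    proof (rule ccontr)
      assume "\<not> ?thesis"
      then have "ou D x = 0" unfolding ou_def by (intro sum.neutral) auto
      then show False using that by simp
    qed
    have pos0: "(\<Sum>i<n. ou D (f i)) = 0"
      if "2 \<le> n \<Longrightarrow> ou D (f (n - 2)) = 0" "1 \<le> n \<Longrightarrow> ou D (f (n - 1)) = 0"
    proof (rule sum.neutral, rule ballI)
      fix i assume "i \<in> {..<n}"
      then consider "i + 2 < n" | "2 \<le> n" "i = n - 2" | "1 \<le> n" "i = n - 1" by fastforce
      then show "ou D (f i) = 0" using old that by cases auto
    qed
    \<comment> \<open>The older of the two open vertices is served first; if nothing is open, a new
      component starts at an arbitrary vertex.\<close>
    obtain z where z: "z \<in> V - D"
      and zc: "(2 \<le> n \<and> ou D (f (n - 2)) > 0 \<and> W (f (n - 2)) z > 0)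
         \<or> ((2 \<le> n \<longrightarrow> ou D (f (n - 2)) = 0) \<and> 1 \<le> n \<and> W (f (n - 1)) z > 0)
         \<or> ((2 \<le> n \<longrightarrow> ou D (f (n - 2)) = 0) \<and> (1 \<le> n \<longrightarrow> ou D (f (n - 1)) = 0))"
    proof (cases "2 \<le> n \<and> ou D (f (n - 2)) > 0")
      case True
      then show thesis using pick[of "f (n - 2)"] that by blast
    next
      case 1: False
      show thesis
      proof (cases "1 \<le> n \<and> ou D (f (n - 1)) > 0")
        case True
        then obtain z where z: "z \<in> V - D" "W (f (n - 1)) z > 0" using pick[of "f (n - 1)"] by blast
        have "2 \<le> n \<longrightarrow> ou D (f (n - 2)) = 0" using 1 by simp
        with True z show thesis by (intro that[of z] disjI2 disjI1) auto
      next
        case False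
        then have "2 \<le> n \<longrightarrow> ou D (f (n - 2)) = 0" "1 \<le> n \<longrightarrow> ou D (f (n - 1)) = 0" using 1 by simp_all
        with z0 show thesis by (intro that[of z0] disjI2) auto
      qed
    qed
    define h where "h = f(n := z)"
    have hf: "h i = f i" if "i < n" for i using that by (simp add: h_def)
    have hn: "h n = z" by (simp add: h_def)
    have him: "h ` {..<Suc n} = insert z D" by (auto simp: h_def D_def lessThan_Suc)
    have split: "ou D x = ou (insert z D) x + W x z" for x
    proof -
      have "V - insert z D = (V - D) - {z}" by auto
      then show ?thesis unfolding ou_def using fin z sum.remove[of "V - D" z "W x"] by (simp add: add.commute)
    qed
    define w where "w = (\<Sum>i<n. W (f i) z)"
    have ouz: "ou (insert z D) z + w \<le> 2"
    proof -
      have "w = (\<Sum>x\<in>D. W x z)" unfolding w_def D_def using inj by (simp add: sum.reindex)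
      also have "\<dots> = (\<Sum>y\<in>D. W z y)" using sym by (intro sum.cong) auto
      finally have "ou (insert z D) z + w = (\<Sum>y\<in>(V - insert z D) \<union> D. W z y)"
        unfolding ou_def using fin fD by (subst sum.union_disjoint) auto
      also have "\<dots> \<le> (\<Sum>y\<in>V. W z y)" using fin sub by (intro sum_mono2) auto
      finally show ?thesis using reg z by auto
    qed
    have sumold: "(\<Sum>i<n. ou D (f i)) = (\<Sum>i<n. ou (insert z D) (f i)) + w"
      unfolding w_def by (simp add: split sum.distrib)
    have newsum: "(\<Sum>i<Suc n. ou (insert z D) (h i)) = (\<Sum>i<n. ou (insert z D) (f i)) + ou (insert z D) z"
      by (simp add: hn hf)
    have wge: "w \<ge> W (f i) z" if "i < n" for i
      unfolding w_def using that by (intro member_le_sum) auto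
    \<comment> \<open>The new vertex has degree 2, so it adds at most \<open>2 - w\<close> to the
      outgoing weight and removes \<open>w\<close>. This is no increase if \<open>w\<close> is
      positive; for \<open>w = 0\<close> the choice of \<open>z\<close> shows that nothing was
      open.\<close>
    have tot': "(\<Sum>i<Suc n. ou (insert z D) (h i)) \<le> 2"
    proof (cases "w \<ge> 1")
      case True
      then show ?thesis using newsum sumold ouz tot by linarith
    next
      case False
      then have w0: "w = 0" by simp
      have no: "W (f i) z = 0" if "i < n" for i using wge[OF that] w0 by simp
      have "(\<Sum>i<n. ou D (f i)) = 0"
      proof (rule pos0)
        show "ou D (f (n - 2)) = 0" if "2 \<le> n" using zc no[of "n - 2"] no[of "n - 1"] that by auto
        show "ou D (f (n - 1)) = 0" if "1 \<le> n" using zc no[of "n - 2"] no[of "n - 1"] that by auto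
      qed
      then show ?thesis using newsum sumold ouz w0 by linarith
    qed
    have member: "ou D (f i) + ou D (f j) \<le> 2" if "i < n" "j < n" "i \<noteq> j" for i j
    proof -
      have "(\<Sum>k\<in>{i,j}. ou D (f k)) \<le> (\<Sum>k<n. ou D (f k))" using that by (intro sum_mono2) auto
      then show ?thesis using that tot by simp
    qed
    have single: "ou D (f i) \<le> 2" if "i < n" for i
    proof -
      have "ou D (f i) \<le> (\<Sum>k<n. ou D (f k))" using that by (intro member_le_sum) auto
      then show ?thesis using tot by simp
    qed
    have "Inv (Suc n) h"
      unfolding Inv_def him
    proof (intro conjI allI impI)
      show "inj_on h {..<Suc n}"
        using inj z by (auto simp: inj_on_def h_def D_def less_Suc_eq)
      show "insert z D \<subseteq> V" using z sub by auto
      show "(\<Sum>i<Suc n. ou (insert z D) (h i)) \<le> 2" by (rule tot')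
      show "\<bar>\<Sum>i<k. sg (h i)\<bar> \<le> 1" if "k \<le> Suc n" for k
      proof (cases "k = Suc n")
        case True
        have "(\<Sum>i<Suc n. sg (h i)) = (\<Sum>x\<in>insert z D. sg x)"
        proof -
          have "inj_on h {..<Suc n}" using inj z by (auto simp: inj_on_def h_def D_def less_Suc_eq)
          then show ?thesis unfolding him[symmetric] by (subst sum.reindex) auto
        qed
        moreover have "(\<Sum>x\<in>insert z D. ou (insert z D) x) \<le> 2"
        proof -
          have "inj_on h {..<Suc n}" using inj z by (auto simp: inj_on_def h_def D_def less_Suc_eq)
          then have "(\<Sum>x\<in>insert z D. ou (insert z D) x) = (\<Sum>i<Suc n. ou (insert z D) (h i))"
            unfolding him[symmetric] by (subst sum.reindex) auto
          then show ?thesis using tot' by simp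
        qed
        ultimately show ?thesis using balance[of "insert z D"] True z sub by auto
      next
        case False
        then have "k \<le> n" using that by simp
        moreover have "(\<Sum>i<k. sg (h i)) = (\<Sum>i<k. sg (f i))" using \<open>k \<le> n\<close> by (intro sum.cong) (auto simp: h_def)
        ultimately show ?thesis using bal by simp
      qed
      show "j \<le> i + 2" if "j < Suc n" "i < j" "0 < W (h i) (h j)" for i j
      proof (cases "j = n")
        case True
        then have "W (f i) z > 0" using that by (simp add: hf hn)
        then have "ou D (f i) \<noteq> 0" using split[of "f i"] by simp
        then show ?thesis using old[of i] True by linarith
      next
        case False
        then show ?thesis using that bw[of j i] by (simp add: hf)
      qed
      show "ou (insert z D) (h i) = 0" if "i + 2 < Suc n" for i
      proof (cases "i + 2 < n")
        case True
        then show ?thesis using old[of i] split[of "f i"] by (simp add: hf)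
      next
        case False
        then have i: "i = n - 2" "2 \<le> n" using that by auto
        then show ?thesis using zc pre split[of "f i"] by (auto simp: hf)
      qed
      show "ou (insert z D) (h (Suc n - 2)) \<le> 1" if "2 \<le> Suc n"
      proof -
        have n1: "Suc n - 2 = n - 1" "n - 1 < n" using that by auto
        have "ou (insert z D) (f (n - 1)) \<le> 1"
          using zc
        proof (elim disjE)
          assume a: "2 \<le> n \<and> 0 < ou D (f (n - 2)) \<and> 0 < W (f (n - 2)) z"
          then have "ou D (f (n - 2)) + ou D (f (n - 1)) \<le> 2" by (intro member) auto
          then show ?thesis using a split[of "f (n - 1)"] by linarith
        next
          assume a: "(2 \<le> n \<longrightarrow> ou D (f (n - 2)) = 0) \<and> 1 \<le> n \<and> 0 < W (f (n - 1)) z"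
          then show ?thesis using single[of "n - 1"] split[of "f (n - 1)"] n1 by linarith
        next
          assume a: "(2 \<le> n \<longrightarrow> ou D (f (n - 2)) = 0) \<and> (1 \<le> n \<longrightarrow> ou D (f (n - 1)) = 0)"
          then show ?thesis using split[of "f (n - 1)"] n1 by simp
        qed
        then show ?thesis using n1 by (simp add: hf)
      qed
    qed
    then show ?case by blast
  qed
  from ex[of "card V"] obtain f where "Inv (card V) f" by auto
  then have f: "inj_on f {..<card V}" "f ` {..<card V} \<subseteq> V"
    "\<forall>j<card V. \<forall>i<j. W (f i) (f j) > 0 \<longrightarrow> j \<le> i + 2"
    "\<forall>k\<le>card V. \<bar>\<Sum>i<k. sg (f i)\<bar> \<le> 1"
    by (auto simp: Inv_def)
  have "f ` {..<card V} = V"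
    using f(1,2) fin by (intro card_subset_eq) (auto simp: card_image)
  then have "bij_betw f {..<card V} V" using f(1) by (simp add: bij_betw_def)
  then show ?thesis using f by blast
qed

text \<open>Number the \<open>2 * p\<close> elements of both sides together by
  \<open>two_regular_numbering\<close> and cut this list into consecutive pairs. Even prefixes have
  an even signed count of absolute value at most 1, hence 0, so every pair contains one element of
  each side, and the index of the pair numbers both sides. Adjacent elements are at most two places
  apart, so their pairs are equal or consecutive.\<close>

lemma aligned_numbering:
  fixes A :: "'a \<Rightarrow> 'b \<Rightarrow> bool"
  assumes fin: "finite P" "finite Q" and cardP: "card P = p" and cardQ: "card Q = p"
    and dP: "\<And>e. e \<in> P \<Longrightarrow> card {g\<in>Q. A e g} \<le> 2"
    and dQ: "\<And>g. g \<in> Q \<Longrightarrow> card {e\<in>P. A e g} \<le> 2"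
  shows "\<exists>r r'. bij_betw r P {..<p} \<and> bij_betw r' Q {..<p}
    \<and> (\<forall>e\<in>P. \<forall>g\<in>Q. A e g \<longrightarrow> r e \<le> r' g + 1 \<and> r' g \<le> r e + 1)"
proof -
  have "\<exists>m'. (\<forall>e g. (if A e g then 1 else 0::nat) \<le> m' e g) \<and> (\<forall>e\<in>P. (\<Sum>g\<in>Q. m' e g) = 2) \<and> (\<forall>g\<in>Q. (\<Sum>e\<in>P. m' e g) = 2)"
  proof (rule two_regular_extension)
    show "(\<Sum>g\<in>Q. if A e g then 1 else 0::nat) \<le> 2" if "e \<in> P" for e
      using dP[OF that] fin by (simp add: sum.If_cases Int_def)
    show "(\<Sum>e\<in>P. if A e g then 1 else 0::nat) \<le> 2" if "g \<in> Q" for g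
      using dQ[OF that] fin by (simp add: sum.If_cases Int_def)
  qed (use assms in auto)
  then obtain m :: "'a \<Rightarrow> 'b \<Rightarrow> nat" where m: "\<And>e g. A e g \<Longrightarrow> m e g > 0"
    and row: "\<And>e. e \<in> P \<Longrightarrow> (\<Sum>g\<in>Q. m e g) = 2" and col: "\<And>g. g \<in> Q \<Longrightarrow> (\<Sum>e\<in>P. m e g) = 2"
    by (metis (full_types) less_le_trans zero_less_one)
  define V :: "('a + 'b) set" where "V = Inl ` P \<union> Inr ` Q"
  define W where "W x y = (case (x, y) of (Inl e, Inr g) \<Rightarrow> m e g | (Inr g, Inl e) \<Rightarrow> m e g | _ \<Rightarrow> 0)" for x y
  define sg :: "'a + 'b \<Rightarrow> int" where "sg x = (case x of Inl _ \<Rightarrow> 1 | Inr _ \<Rightarrow> -1)" for x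
  have finV: "finite V" using fin by (simp add: V_def)
  have cardV: "card V = 2 * p"
    unfolding V_def using fin cardP cardQ by (subst card_Un_disjoint) (auto simp: card_image)
  have sumV: "(\<Sum>y\<in>V. F y) = (\<Sum>e\<in>P. F (Inl e)) + (\<Sum>g\<in>Q. F (Inr g))" for F :: "'a + 'b \<Rightarrow> nat"
    unfolding V_def using fin by (subst sum.union_disjoint) (auto simp: sum.reindex)
  have "\<exists>f. bij_betw f {..<card V} V
    \<and> (\<forall>j<card V. \<forall>i<j. W (f i) (f j) > 0 \<longrightarrow> j \<le> i + 2)
    \<and> (\<forall>n\<le>card V. \<bar>\<Sum>i<n. sg (f i)\<bar> \<le> 1)"
  proof (rule two_regular_numbering[OF finV])
    show "W x y = W y x" for x y by (auto simp: W_def split: sum.splits)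
    show "(\<Sum>y\<in>V. W x y) = 2" if "x \<in> V" for x
      unfolding sumV using that row col by (auto simp: V_def W_def)
    show "sg x = - sg y" if "0 < W x y" for x y using that by (auto simp: W_def sg_def split: sum.splits)
    show "\<bar>sg x\<bar> = 1" for x by (auto simp: sg_def split: sum.splits)
  qed
  then obtain f where f: "bij_betw f {..<2 * p} V"
    and bw: "\<And>i j. j < 2 * p \<Longrightarrow> i < j \<Longrightarrow> W (f i) (f j) > 0 \<Longrightarrow> j \<le> i + 2"
    and bal: "\<And>n. n \<le> 2 * p \<Longrightarrow> \<bar>\<Sum>i<n. sg (f i)\<bar> \<le> 1"
    unfolding cardV by blast
  have sgpm: "sg x = 1 \<or> sg x = -1" for x by (auto simp: sg_def split: sum.splits)
  have par: "even (\<Sum>i<2 * k. sg (f i))" for k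
  proof (induction k)
    case (Suc k)
    have "(\<Sum>i<2 * Suc k. sg (f i)) = (\<Sum>i<2 * k. sg (f i)) + (sg (f (2 * k)) + sg (f (Suc (2 * k))))"
      by simp
    moreover have "even (sg (f (2 * k)) + sg (f (Suc (2 * k))))"
      using sgpm[of "f (2 * k)"] sgpm[of "f (Suc (2 * k))"] by auto
    ultimately show ?case using Suc by simp
  qed simp
  have zero: "(\<Sum>i<2 * k. sg (f i)) = 0" if "k \<le> p" for k
  proof -
    have "\<bar>\<Sum>i<2 * k. sg (f i)\<bar> \<le> 1" using that by (intro bal) simp
    then have "(\<Sum>i<2 * k. sg (f i)) \<in> {-1, 0, 1}" by auto
    then show ?thesis using par[of k] by auto
  qed
  have opp: "sg (f (2 * k)) + sg (f (Suc (2 * k))) = 0" if "k < p" for k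
  proof -
    have "(\<Sum>i<2 * Suc k. sg (f i)) = (\<Sum>i<2 * k. sg (f i)) + (sg (f (2 * k)) + sg (f (Suc (2 * k))))"
      by simp
    moreover have "(\<Sum>i<2 * Suc k. sg (f i)) = 0" using that by (intro zero) simp
    moreover have "(\<Sum>i<2 * k. sg (f i)) = 0" using that by (intro zero) simp
    ultimately show ?thesis by linarith
  qed
  define ix where "ix = the_inv_into {..<2 * p} f"
  have injf: "inj_on f {..<2 * p}" and imf: "f ` {..<2 * p} = V" using f by (auto simp: bij_betw_def)
  have ix: "ix x < 2 * p" "f (ix x) = x" if "x \<in> V" for x
    using the_inv_into_into[OF injf, of x "{..<2*p}"] f_the_inv_into_f[OF injf, of x] that imf
    by (auto simp: ix_def)
  have slot: "x = y" if "x \<in> V" "y \<in> V" "ix x div 2 = ix y div 2" "sg x = sg y" for x y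
  proof (rule ccontr)
    assume ne: "x \<noteq> y"
    define k where "k = ix x div 2"
    have k: "k < p" using ix(1)[OF that(1)] by (auto simp: k_def)
    have nei: "ix x \<noteq> ix y" using ne ix(2)[OF that(1)] ix(2)[OF that(2)] by metis
    have "ix x = 2 * k \<or> ix x = Suc (2 * k)" "ix y = 2 * k \<or> ix y = Suc (2 * k)"
      using that(3) unfolding k_def by presburger+
    then have "(ix x = 2 * k \<and> ix y = Suc (2 * k)) \<or> (ix y = 2 * k \<and> ix x = Suc (2 * k))" using nei by auto
    then have "sg x + sg y = 0"
    proof (elim disjE conjE)
      assume "ix x = 2 * k" "ix y = Suc (2 * k)"
      then show ?thesis using opp[OF k] ix(2)[OF that(1)] ix(2)[OF that(2)] by simp
    next
      assume "ix y = 2 * k" "ix x = Suc (2 * k)"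
      then show ?thesis using opp[OF k] ix(2)[OF that(1)] ix(2)[OF that(2)] by simp
    qed
    then show False using that(4) sgpm[of x] by auto
  qed
  define r where "r e = ix (Inl e) div 2" for e
  define r' where "r' g = ix (Inr g) div 2" for g
  have "inj_on r P"
  proof (rule inj_onI)
    fix e e' assume "e \<in> P" "e' \<in> P" "r e = r e'"
    then have "Inl e = (Inl e' :: 'a + 'b)" by (intro slot) (auto simp: V_def r_def sg_def)
    then show "e = e'" by simp
  qed
  moreover have "r ` P \<subseteq> {..<p}" using ix(1) by (fastforce simp: r_def V_def)
  ultimately have r: "bij_betw r P {..<p}"
    using cardP card_subset_eq[of "{..<p}" "r ` P"] by (simp add: bij_betw_def card_image)
  have "inj_on r' Q"
  proof (rule inj_onI)
    fix e e' assume "e \<in> Q" "e' \<in> Q" "r' e = r' e'"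
    then have "Inr e = (Inr e' :: 'a + 'b)" by (intro slot) (auto simp: V_def r'_def sg_def)
    then show "e = e'" by simp
  qed
  moreover have "r' ` Q \<subseteq> {..<p}" using ix(1) by (fastforce simp: r'_def V_def)
  ultimately have r': "bij_betw r' Q {..<p}"
    using cardQ card_subset_eq[of "{..<p}" "r' ` Q"] by (simp add: bij_betw_def card_image)
  have "r e \<le> r' g + 1 \<and> r' g \<le> r e + 1" if "e \<in> P" "g \<in> Q" "A e g" for e g
  proof -
    have V: "Inl e \<in> V" "Inr g \<in> V" using that by (auto simp: V_def)
    have ne: "ix (Inl e) \<noteq> ix (Inr g)" using ix(2)[OF V(1)] ix(2)[OF V(2)] by force
    have W: "W (Inl e) (Inr g) > 0" "W (Inr g) (Inl e) > 0" using m[OF that(3)] by (auto simp: W_def)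
    have "ix (Inl e) \<le> ix (Inr g) + 2 \<and> ix (Inr g) \<le> ix (Inl e) + 2"
    proof (cases "ix (Inl e) < ix (Inr g)")
      case True
      then show ?thesis using bw[of "ix (Inr g)" "ix (Inl e)"] ix[OF V(1)] ix[OF V(2)] W by simp
    next
      case False
      then show ?thesis using bw[of "ix (Inl e)" "ix (Inr g)"] ix[OF V(1)] ix[OF V(2)] W ne by simp
    qed
    then show ?thesis unfolding r_def r'_def by linarith
  qed
  then show ?thesis using r r' by blast
qed

section \<open>Discrete averaging on a circle\<close>

text \<open>Start where the prefix sum \<open>S\<close> is maximal. Sums that stop before index
  \<open>N\<close> are then at most 0, and sums that reach or pass \<open>N\<close> are at most the
  total, since \<open>S m\<close> is at least \<open>S 0 = 0\<close> and at least every other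
  value.\<close>

lemma rotation_with_small_prefix_sums:
  fixes w :: "nat \<Rightarrow> int"
  assumes "N > 0"
  shows "\<exists>m<N. \<forall>t\<le>N. (\<Sum>i<t. w ((m + i) mod N)) \<le> max 0 (\<Sum>i<N. w i)"
proof -
  define S where "S k = (\<Sum>i<k. w i)" for k
  have "\<exists>m\<in>{..<N}. \<forall>k\<in>{..<N}. S k \<le> S m"
    using Max_in[of "S ` {..<N}"] Max_ge[of "S ` {..<N}"] assms by fastforce
  then obtain m where m: "m < N" "\<And>k. k < N \<Longrightarrow> S k \<le> S m" by auto
  have eq: "(\<Sum>i<t. w ((m + i) mod N)) = (if m + t \<le> N then S (m + t) - S m else S N - S m + S (m + t - N))"
    if "t \<le> N" for t
    using that
  proof (induction t)
    case (Suc t)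
    consider "m + t < N" | "m + t = N" | "m + t > N" by linarith
    then show ?case
    proof cases
      case 3
      then have "(m + t) mod N = m + t - N" using Suc.prems m by (simp add: mod_if)
      moreover have "Suc (m + t) - N = Suc (m + t - N)" using 3 by simp
      ultimately show ?thesis using Suc 3 by (simp add: S_def)
    qed (use Suc in \<open>simp_all add: S_def\<close>)
  qed (use m in simp)
  have S0: "S 0 \<le> S m" using m assms by blast
  have "(\<Sum>i<t. w ((m + i) mod N)) \<le> max 0 (S N)" if "t \<le> N" for t
  proof (cases "m + t \<le> N")
    case True
    then show ?thesis using eq[OF that] m(2)[of "m + t"] S0 by (cases "m + t = N") (auto simp: S_def)
  next
    case False
    have "S (m + t - N) \<le> S m" using that m(1) False by (intro m(2)) linarith
    then show ?thesis using eq[OF that] False by simp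
  qed
  then show ?thesis using m(1) by (auto simp: S_def)
qed

text \<open>A step of at most 2 from a positive integer to a nonpositive one ends at 0 or
  -1.\<close>

lemma discrete_intermediate_value:
  fixes g :: "nat \<Rightarrow> int"
  assumes "\<And>s. \<bar>g (Suc s) - g s\<bar> \<le> 2" "g 0 \<ge> 0" "g N \<le> 0"
  shows "\<exists>s\<le>N. \<bar>g s\<bar> \<le> 1"
proof -
  define s where "s = (LEAST s. g s \<le> 0)"
  have s: "g s \<le> 0" "s \<le> N" "\<And>i. i < s \<Longrightarrow> g i > 0"
    unfolding s_def using assms(3) by (auto intro: LeastI Least_le dest: not_less_Least)
  show ?thesis
  proof (cases s)
    case 0
    then show ?thesis using s assms(2) by (intro exI[of _ 0]) auto
  next
    case (Suc k)
    then show ?thesis using s(1,2) s(3)[of k] assms(1)[of k] by (intro exI[of _ s]) auto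
  qed
qed

lemma card_sum_indicator: "finite S \<Longrightarrow> card {x\<in>S. Q x} = (\<Sum>x\<in>S. if Q x then 1 else 0)"
  by (simp add: sum.If_cases Int_def)

lemma less_card_mono: "S \<subseteq> T \<Longrightarrow> x < card S \<Longrightarrow> finite T \<Longrightarrow> x < card T"
  by (meson card_mono order.strict_trans2)

lemma card_le_antimono: "T \<subseteq> S \<Longrightarrow> card S \<le> x \<Longrightarrow> finite S \<Longrightarrow> card T \<le> x"
  by (meson card_mono order.trans)

lemma superset_of_card:
  assumes "finite P" "a \<subseteq> P" "card a \<le> L" "L \<le> card P"
  shows "\<exists>a'. a \<subseteq> a' \<and> a' \<subseteq> P \<and> card a' = L"
proof -
  have fa: "finite a" using assms finite_subset by blast
  have "L - card a \<le> card (P - a)" using assms fa by (simp add: card_Diff_subset)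
  then obtain c where c: "c \<subseteq> P - a" "card c = L - card a"
    using obtain_subset_with_card_n by metis
  have "finite c" using c assms finite_subset by blast
  then have "card (a \<union> c) = card a + card c" using c fa by (intro card_Un_disjoint) auto
  then show ?thesis using c assms by (intro exI[of _ "a \<union> c"]) auto
qed

section \<open>Cyclically arranged matchings\<close>

text \<open>\<open>D x\<close> compares the \<open>f\<close>-weight of a half circle with the
  \<open>g\<close>-weight of the opposite half. Moving on by \<open>h\<close> replaces both by their
  complements and negates \<open>D\<close>, while a unit step changes \<open>D\<close> by at most 2,
  so some \<open>D y\<close> is at most 1 in absolute value. There the two weights are both at most
  about \<open>L / 2\<close>, or else both complements are.\<close>

lemma cyclic_halves:
  fixes f g :: "nat \<Rightarrow> nat"
  assumes "h > 0" and sums: "(\<Sum>i<2 * h. f i) = L" "(\<Sum>i<2 * h. g i) = L"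
    and "\<And>i. f i \<le> 1" "\<And>i. g i \<le> 1"
  shows "\<exists>x<2 * h. 2 * (\<Sum>i<h. f ((x + i) mod (2 * h))) \<le> L + 1 \<and> 2 * (\<Sum>i<h. g ((x + h + i) mod (2 * h))) \<le> L + 1"
proof -
  define N where "N = 2 * h"
  have N: "N > 0" using assms by (simp add: N_def)
  define F where "F x = (\<Sum>i<h. f ((x + i) mod N))" for x
  define G where "G x = (\<Sum>i<h. g ((x + i) mod N))" for x
  have step: "(\<Sum>i<h. w ((Suc x + i) mod N)) + w (x mod N) = (\<Sum>i<h. w ((x + i) mod N)) + w ((x + h) mod N)"
    for w :: "nat \<Rightarrow> nat" and x
    using sum.lessThan_Suc_shift[of "\<lambda>i. w ((x + i) mod N)" h] by simp
  have total: "(\<Sum>i<h. w ((x + i) mod N)) + (\<Sum>i<h. w ((x + h + i) mod N)) = (\<Sum>i<N. w i)"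
    for w :: "nat \<Rightarrow> nat" and x
  proof -
    have "(\<Sum>i<h. w ((x + i) mod N)) + (\<Sum>i<h. w ((x + h + i) mod N)) = (\<Sum>i<N. w ((x + i) mod N))"
    proof -
      have "(\<Sum>i<h. u i) + (\<Sum>i<n. u (h + i)) = (\<Sum>i<h + n. u i)" for u :: "nat \<Rightarrow> nat" and n
        by (induction n) (simp_all add: add.assoc[symmetric])
      from this[of "\<lambda>i. w ((x + i) mod N)" h] show ?thesis by (simp add: N_def mult_2 add.assoc)
    qed
    also have "\<dots> = (\<Sum>i<N. w i)"
    proof (induction x)
      case 0
      show ?case using N by (intro sum.cong) auto
    next
      case (Suc x)
      have "(\<Sum>i<N. w ((Suc x + i) mod N)) + w (x mod N) = (\<Sum>i<N. w ((x + i) mod N)) + w ((x + N) mod N)"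
        using sum.lessThan_Suc_shift[of "\<lambda>i. w ((x + i) mod N)" N] by simp
      then show ?case using Suc by simp
    qed
    finally show ?thesis .
  qed
  define D where "D x = int (F x) - int (G (x + h))" for x
  have fl: "F x + F (x + h) = L" "G x + G (x + h) = L" for x
    using total[where w=f, of x] total[where w=g, of x] sums by (simp_all add: F_def G_def N_def)
  have per: "F (x + h + h) = F x" "G (x + h + h) = G x" for x
    using fl(1)[of x] fl(1)[of "x + h"] fl(2)[of x] fl(2)[of "x + h"] by linarith+
  have flipD: "D (x + h) = - D x" for x
    using fl(1)[of x] fl(2)[of x] per(2)[of x] by (simp add: D_def)
  have stepD: "\<bar>D (Suc x) - D x\<bar> \<le> 2" for x
  proof -
    have 1: "F (Suc x) + f (x mod N) = F x + f ((x + h) mod N)" using step[of f x] by (simp add: F_def)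
    have 2: "G (Suc x + h) + g ((x + h) mod N) = G (x + h) + g ((x + h + h) mod N)"
      using step[of g "x + h"] by (simp add: G_def)
    have "f (x mod N) \<le> 1" "f ((x + h) mod N) \<le> 1" "g ((x + h) mod N) \<le> 1" "g ((x + h + h) mod N) \<le> 1"
      using assms by auto
    then show ?thesis using 1 2 unfolding D_def by linarith
  qed
  have "\<exists>x. \<bar>D x\<bar> \<le> 1"
  proof (cases "D 0 \<ge> 0")
    case True
    then show ?thesis using discrete_intermediate_value[of D h] stepD flipD[of 0] by auto
  next
    case False
    define E where "E x = D (x + h)" for x
    have "\<exists>s\<le>h. \<bar>E s\<bar> \<le> 1"
      using stepD False flipD[of 0] flipD[of h] by (intro discrete_intermediate_value) (auto simp: E_def)
    then show ?thesis by (auto simp: E_def)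
  qed
  then obtain y where y: "\<bar>D y\<bar> \<le> 1" by blast
  have "\<exists>x. 2 * F x \<le> L + 1 \<and> 2 * G (x + h) \<le> L + 1"
  proof (cases "2 * F y \<le> L + 1 \<and> 2 * G (y + h) \<le> L + 1")
    case False
    have "F (y + h) = L - F y" "G (y + h + h) = L - G (y + h)" using fl[of y] fl[of "y + h"] by auto
    then show ?thesis using False y by (intro exI[of _ "y + h"]) (auto simp: D_def)
  qed blast
  then obtain x where x: "2 * F x \<le> L + 1" "2 * G (x + h) \<le> L + 1" by blast
  have m: "(x mod N + i) mod N = (x + i) mod N" "(x mod N + h + i) mod N = (x + h + i) mod N" for i
    by (simp_all add: mod_simps add.assoc)
  show ?thesis
    using x N by (intro exI[of _ "x mod N"]) (simp add: F_def G_def N_def[symmetric] m)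
qed

text \<open>The slots of an alignment of \<open>P\<close> and \<open>Q\<close> are placed on a
  circle. \<open>cyclic_halves\<close> chooses a starting point such that the first half has few
  members of \<open>a\<close> and the second half few of \<open>b\<close>; each half is then rotated
  within itself so that its prefixes, respectively its suffixes, are light. This separates adjacent
  elements at a few cuts. As only \<open>\<alpha> e \<le> \<beta> g + 5\<close> is wanted, the
  damage is repaired by moving \<open>P\<close>-elements at the cuts earlier and
  \<open>Q\<close>-elements later.\<close>

lemma two_sided_pairing:
  fixes A :: "'a \<Rightarrow> 'b \<Rightarrow> bool"
  assumes fin: "finite P" "finite Q" and cardP: "card P = 2 * h" and cardQ: "card Q = 2 * h"
    and dP: "\<And>e. e \<in> P \<Longrightarrow> card {g\<in>Q. A e g} \<le> 2"
    and dQ: "\<And>g. g \<in> Q \<Longrightarrow> card {e\<in>P. A e g} \<le> 2"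
    and a: "a \<subseteq> P" "card a \<le> L" and b: "b \<subseteq> Q" "card b \<le> L" and L: "L \<le> 2 * h" "L + 1 \<le> h + \<epsilon>"
  shows "\<exists>\<alpha> \<beta>. bij_betw \<alpha> P {..<2 * h} \<and> bij_betw \<beta> Q {..<2 * h}
    \<and> (\<forall>e\<in>P. \<forall>g\<in>Q. A e g \<longrightarrow> \<alpha> e \<le> \<beta> g + 5)
    \<and> (\<forall>t\<le>h. 2 * card {e\<in>a. \<alpha> e < t} \<le> t + \<epsilon>)
    \<and> (\<forall>t\<le>h. 2 * card {g\<in>b. 2 * h \<le> \<beta> g + t} \<le> t + \<epsilon>)"
proof (cases "h = 0")
  case True
  then show ?thesis using assms by (auto simp: bij_betw_def)
next
  case False
  obtain a' where a': "a \<subseteq> a'" "a' \<subseteq> P" "card a' = L" using superset_of_card[OF fin(1) a] L cardP by auto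
  obtain b' where b': "b \<subseteq> b'" "b' \<subseteq> Q" "card b' = L" using superset_of_card[OF fin(2) b] L cardQ by auto
  define N where "N = 2 * h"
  have N: "N > 0" "h > 0" using False by (simp_all add: N_def)
  obtain r r' where r: "bij_betw r P {..<N}" and r': "bij_betw r' Q {..<N}"
    and al: "\<And>e g. e \<in> P \<Longrightarrow> g \<in> Q \<Longrightarrow> A e g \<Longrightarrow> r e \<le> r' g + 1 \<and> r' g \<le> r e + 1"
    using aligned_numbering[OF fin cardP cardQ dP dQ] by (auto simp: N_def)
  define wa where "wa i = (if i \<in> r ` a' then 1 else 0::nat)" for i
  define wb where "wb i = (if i \<in> r' ` b' then 1 else 0::nat)" for i
  have ra: "r ` a' \<subseteq> {..<N}" "card (r ` a') = L" and rb: "r' ` b' \<subseteq> {..<N}" "card (r' ` b') = L"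
  proof -
    show "r ` a' \<subseteq> {..<N}" "r' ` b' \<subseteq> {..<N}" using r r' a' b' unfolding bij_betw_def by blast+
    show "card (r ` a') = L" "card (r' ` b') = L"
      using r r' a' b' inj_on_subset unfolding bij_betw_def by (metis card_image)+
  qed
  have sums: "(\<Sum>i<2 * h. wa i) = L" "(\<Sum>i<2 * h. wb i) = L"
    using ra rb unfolding wa_def wb_def N_def[symmetric]
    by (simp_all add: sum.If_cases Int_absorb1)
  obtain x where x: "x < N" and xa: "2 * (\<Sum>i<h. wa ((x + i) mod N)) \<le> L + 1"
    and xb: "2 * (\<Sum>i<h. wb ((x + h + i) mod N)) \<le> L + 1"
  proof -
    have "wa i \<le> 1" "wb i \<le> 1" for i by (simp_all add: wa_def wb_def)
    from cyclic_halves[OF N(2) sums this] show thesis using that unfolding N_def by blast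
  qed
  \<comment> \<open>Weight 1 on marked places and -1 on the others. \<open>vb\<close> reads the
    second half backwards, because suffixes are to be bounded there.\<close>
  define va where "va i = 2 * int (wa ((x + i) mod N)) - 1" for i
  define vb where "vb i = 2 * int (wb ((x + (N - 1 - i)) mod N)) - 1" for i
  obtain m where m: "m < h" and ma: "\<And>t. t \<le> h \<Longrightarrow> (\<Sum>i<t. va ((m + i) mod h)) \<le> max 0 (\<Sum>i<h. va i)"
    using rotation_with_small_prefix_sums[of h va] N by auto
  obtain m' where m': "m' < h" and mb: "\<And>t. t \<le> h \<Longrightarrow> (\<Sum>i<t. vb ((m' + i) mod h)) \<le> max 0 (\<Sum>i<h. vb i)"
    using rotation_with_small_prefix_sums[of h vb] N by auto
  have "(\<Sum>i<h. vb i) = (\<Sum>i<h. 2 * int (wb ((x + h + i) mod N)) - 1)"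
  proof (rule sum.reindex_bij_witness[of _ "\<lambda>i. h - 1 - i" "\<lambda>i. h - 1 - i"])
    fix i assume "i \<in> {..<h}"
    then have "x + h + (h - 1 - i) = x + (N - 1 - i)" by (auto simp: N_def)
    then show "2 * int (wb ((x + h + (h - 1 - i)) mod N)) - 1 = vb i" unfolding vb_def by (simp only:)
  qed auto
  then have tb: "(\<Sum>i<h. vb i) \<le> int \<epsilon>" using xb L(2) by (simp add: sum_subtractf sum_distrib_left[symmetric] of_nat_sum[symmetric] del: of_nat_sum)
  have ta: "(\<Sum>i<h. va i) \<le> int \<epsilon>"
    using xa L(2) by (simp add: va_def sum_subtractf sum_distrib_left[symmetric] of_nat_sum[symmetric] del: of_nat_sum)
  \<comment> \<open>\<open>c\<close> is the position on the circle counted from the start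
    \<open>x\<close>; \<open>\<pi>\<close> rotates the lower half by \<open>m\<close> and the upper
    half, seen from its top end, by \<open>m'\<close>.\<close>
  define c where "c i = (if x \<le> i then i - x else i + N - x)" for i
  define \<pi> where "\<pi> c = (if c < h then (if m \<le> c then c - m else c + h - m)
     else (let d = N - 1 - c in N - 1 - (if m' \<le> d then d - m' else d + h - m')))" for c
  have cN: "c i < N" "(x + c i) mod N = i" if "i < N" for i
    using that x by (auto simp: c_def mod_if)
  have cadj: "c i \<le> c j + 1 \<or> (c j = 0 \<and> c i = N - 1)" if "i < N" "j < N" "i \<le> j + 1" "j \<le> i + 1" for i j
    using that x by (auto simp: c_def)
  have pB: "\<pi> d < h" if "d < h" for d using that m by (auto simp: \<pi>_def)
  have pT: "\<pi> d \<ge> h" "\<pi> d < N" if "h \<le> d" "d < N" for d using that m' by (auto simp: \<pi>_def N_def Let_def)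
  have pN: "\<pi> d < N" if "d < N" for d using pB[of d] pT[of d] that by (cases "d < h") (auto simp: N_def)
  have pinj: "d = d'" if "d < N" "d' < N" "\<pi> d = \<pi> d'" for d d'
    using that m m' pB[of d] pB[of d'] pT[of d] pT[of d'] 
    by (cases "d < h"; cases "d' < h") (auto simp: \<pi>_def N_def Let_def split: if_splits)
  define \<pi>P where "\<pi>P e = \<pi> (c (r e))" for e
  define \<pi>Q where "\<pi>Q g = \<pi> (c (r' g))" for g
  have rN: "e \<in> P \<Longrightarrow> r e < N" "g \<in> Q \<Longrightarrow> r' g < N" for e g using r r' by (auto simp: bij_betw_def)
  have bij: "bij_betw (\<lambda>e. \<pi> (c (s e))) X {..<N}" if "bij_betw s X {..<N}" for s :: "'c \<Rightarrow> nat" and X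
  proof -
    have "inj_on (\<lambda>i. \<pi> (c i)) {..<N}"
      using pinj cN by (intro inj_onI) (metis lessThan_iff)
    moreover have "(\<lambda>i. \<pi> (c i)) ` {..<N} \<subseteq> {..<N}" using pN cN by auto
    ultimately have "bij_betw (\<lambda>i. \<pi> (c i)) {..<N} {..<N}"
      by (simp add: bij_betw_def endo_inj_surj)
    then show ?thesis using bij_betw_trans[OF that] by (simp add: comp_def)
  qed
  have bP: "bij_betw \<pi>P P {..<N}" unfolding \<pi>P_def[abs_def] by (rule bij[OF r])
  have bQ: "bij_betw \<pi>Q Q {..<N}" unfolding \<pi>Q_def[abs_def] by (rule bij[OF r'])
  have cnt: "card {e\<in>X. s e < t} = t" if "bij_betw s X {..<N}" "t \<le> N" for s :: "'c \<Rightarrow> nat" and X t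
  proof -
    have "bij_betw s {e\<in>X. s e < t} {..<t}"
      using that by (auto simp: bij_betw_def inj_on_def image_iff)
    then show ?thesis using bij_betw_same_card by fastforce
  qed
  \<comment> \<open>The cuts are the starting point of the circle, the border between the halves and
    the rotation point of each half. Elements of \<open>P\<close> can only do harm in the upper
    half, elements of \<open>Q\<close> only in the lower half, at three places each.\<close>
  define exP where "exP e \<longleftrightarrow> c (r e) \<in> {N - 1, N - 1 - m', h}" for e
  define exQ where "exQ g \<longleftrightarrow> c (r' g) \<in> {0, m, h - 1}" for g
  have cinj: "inj_on (\<lambda>i. c i) {..<N}" using cN by (intro inj_onI) (metis lessThan_iff)
  have cexP: "card {e\<in>P. exP e} \<le> 3"
  proof -
    have "inj_on (\<lambda>e. c (r e)) {e\<in>P. exP e}"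
      using r cinj rN by (auto simp: inj_on_def bij_betw_def)
    moreover have "(\<lambda>e. c (r e)) ` {e\<in>P. exP e} \<subseteq> {N - 1, N - 1 - m', h}" by (auto simp: exP_def)
    ultimately have "card {e\<in>P. exP e} \<le> card {N - 1, N - 1 - m', h}" by (intro card_inj_on_le) auto
    also have "\<dots> \<le> 3" by (simp add: card_insert_if)
    finally show ?thesis .
  qed
  have cexQ: "card {e\<in>Q. exQ e} \<le> 3"
  proof -
    have "inj_on (\<lambda>e. c (r' e)) {e\<in>Q. exQ e}"
      using r' cinj rN by (auto simp: inj_on_def bij_betw_def)
    moreover have "(\<lambda>e. c (r' e)) ` {e\<in>Q. exQ e} \<subseteq> {0, m, h - 1}" by (auto simp: exQ_def)
    ultimately have "card {e\<in>Q. exQ e} \<le> card {0, m, h - 1}" by (intro card_inj_on_le) auto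
    also have "\<dots> \<le> 3" by (simp add: card_insert_if)
    finally show ?thesis .
  qed
  \<comment> \<open>The key \<open>N = 2 * h\<close> lies between \<open>2 * (h - 1) + 1\<close> and
    \<open>2 * h + 1\<close>: exceptional elements of \<open>P\<close> go to the beginning of the
    upper half, those of \<open>Q\<close> to the end of the lower half. All other elements shift by
    at most 3.\<close>
  define kP where "kP e = (if exP e then N else 2 * \<pi>P e + 1)" for e
  define kQ where "kQ g = (if exQ g then N else 2 * \<pi>Q g + 1)" for g
  obtain \<alpha> where \<alpha>: "bij_betw \<alpha> P {..<card P}" and \<alpha>u: "\<And>e. e \<in> P \<Longrightarrow> \<alpha> e < card {y\<in>P. kP y \<le> kP e}"
    and \<alpha>l: "\<And>e. e \<in> P \<Longrightarrow> card {y\<in>P. kP y < kP e} \<le> \<alpha> e"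
    by (rule ranking[OF fin(1), of kP]) (rule that, blast+)
  obtain \<beta> where \<beta>: "bij_betw \<beta> Q {..<card Q}" and \<beta>u: "\<And>e. e \<in> Q \<Longrightarrow> \<beta> e < card {y\<in>Q. kQ y \<le> kQ e}"
    and \<beta>l: "\<And>e. e \<in> Q \<Longrightarrow> card {y\<in>Q. kQ y < kQ e} \<le> \<beta> e"
    by (rule ranking[OF fin(2), of kQ]) (rule that, blast+)
  have exPT: "c (r e) \<ge> h" if "exP e" for e using that m' by (auto simp: exP_def N_def)
  have exQB: "c (r' e) < h" if "exQ e" for e using that m by (auto simp: exQ_def)
  have PB: "\<pi>P e < h \<longleftrightarrow> c (r e) < h" if "e \<in> P" for e
    using pB[of "c (r e)"] pT[of "c (r e)"] cN[OF rN(1)[OF that]] by (fastforce simp: \<pi>P_def)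
  have QB: "\<pi>Q e < h \<longleftrightarrow> c (r' e) < h" if "e \<in> Q" for e
    using pB[of "c (r' e)"] pT[of "c (r' e)"] cN[OF rN(2)[OF that]] by (fastforce simp: \<pi>Q_def)
  have \<alpha>B: "\<alpha> e = \<pi>P e" if e: "e \<in> P" "\<pi>P e < h" for e
  proof -
    have k: "kP e = 2 * \<pi>P e + 1" using exPT PB e by (fastforce simp: kP_def)
    have "{y\<in>P. kP y \<le> kP e} \<subseteq> {y\<in>P. \<pi>P y < Suc (\<pi>P e)}"
      using k e(2) by (auto simp: kP_def N_def split: if_splits)
    then have "\<alpha> e < card {y\<in>P. \<pi>P y < Suc (\<pi>P e)}"
      using \<alpha>u[OF e(1)] by (rule less_card_mono) (use fin in auto)
    moreover have "{y\<in>P. \<pi>P y < \<pi>P e} \<subseteq> {y\<in>P. kP y < kP e}"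
      using k e(2) exPT PB by (fastforce simp: kP_def)
    then have "card {y\<in>P. \<pi>P y < \<pi>P e} \<le> \<alpha> e"
      using \<alpha>l[OF e(1)] by (rule card_le_antimono) (use fin in auto)
    ultimately show ?thesis using cnt[OF bP, of "\<pi>P e"] cnt[OF bP, of "Suc (\<pi>P e)"] e(2) by (simp add: N_def)
  qed
  have \<beta>T: "\<beta> e = \<pi>Q e" if e: "e \<in> Q" "\<pi>Q e \<ge> h" for e
  proof -
    have k: "kQ e = 2 * \<pi>Q e + 1" using exQB QB e by (fastforce simp: kQ_def)
    have e3: "\<pi>Q e < N" using bQ e(1) by (auto simp: bij_betw_def)
    have "{y\<in>Q. kQ y \<le> kQ e} \<subseteq> {y\<in>Q. \<pi>Q y < Suc (\<pi>Q e)}"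
    proof clarify
      fix y assume y: "y \<in> Q" "kQ y \<le> kQ e"
      show "\<pi>Q y < Suc (\<pi>Q e)"
      proof (cases "exQ y")
        case True
        then show ?thesis using QB[OF y(1)] exQB e(2) by fastforce
      next
        case False
        then show ?thesis using y k by (simp add: kQ_def)
      qed
    qed
    then have "\<beta> e < card {y\<in>Q. \<pi>Q y < Suc (\<pi>Q e)}"
      using \<beta>u[OF e(1)] by (rule less_card_mono) (use fin in auto)
    moreover have "{y\<in>Q. \<pi>Q y < \<pi>Q e} \<subseteq> {y\<in>Q. kQ y < kQ e}"
      using k e(2) by (auto simp: kQ_def N_def)
    then have "card {y\<in>Q. \<pi>Q y < \<pi>Q e} \<le> \<beta> e"
      using \<beta>l[OF e(1)] by (rule card_le_antimono) (use fin in auto)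
    ultimately show ?thesis using cnt[OF bQ, of "\<pi>Q e"] cnt[OF bQ, of "Suc (\<pi>Q e)"] e3 by simp
  qed
  have \<alpha>T: "\<alpha> e \<le> \<pi>P e + 3" "exP e \<Longrightarrow> \<alpha> e \<le> h + 2" "\<alpha> e \<ge> h" if e: "e \<in> P" "\<pi>P e \<ge> h" for e
  proof -
    have e3: "\<pi>P e < N" using bP e(1) by (auto simp: bij_betw_def)
    have U: "card ({y\<in>P. \<pi>P y < t} \<union> {y\<in>P. exP y}) \<le> t + 3" if "t \<le> N" for t
      using card_Un_le[of "{y\<in>P. \<pi>P y < t}" "{y\<in>P. exP y}"] cnt[OF bP that] cexP by linarith
    show "\<alpha> e \<le> h + 2" if ex: "exP e"
    proof -
      have "{y\<in>P. kP y \<le> kP e} \<subseteq> {y\<in>P. \<pi>P y < h} \<union> {y\<in>P. exP y}"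
        using ex by (auto simp: kP_def N_def split: if_splits)
      then have "\<alpha> e < card ({y\<in>P. \<pi>P y < h} \<union> {y\<in>P. exP y})"
        using \<alpha>u[OF e(1)] by (rule less_card_mono) (use fin in auto)
      then show ?thesis using U[of h] by (simp add: N_def)
    qed
    then show "\<alpha> e \<le> \<pi>P e + 3"
    proof (cases "exP e")
      case False
      then have "{y\<in>P. kP y \<le> kP e} \<subseteq> {y\<in>P. \<pi>P y < Suc (\<pi>P e)} \<union> {y\<in>P. exP y}"
        by (auto simp: kP_def N_def split: if_splits)
      then have "\<alpha> e < card ({y\<in>P. \<pi>P y < Suc (\<pi>P e)} \<union> {y\<in>P. exP y})"
        using \<alpha>u[OF e(1)] by (rule less_card_mono) (use fin in auto)
      then show ?thesis using U[of "Suc (\<pi>P e)"] e3 by simp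
    qed (use e(2) in auto)
    have "{y\<in>P. \<pi>P y < h} \<subseteq> {y\<in>P. kP y < kP e}"
      using e(2) exPT PB by (fastforce simp: kP_def N_def)
    then have "card {y\<in>P. \<pi>P y < h} \<le> \<alpha> e"
      using \<alpha>l[OF e(1)] by (rule card_le_antimono) (use fin in auto)
    then show "\<alpha> e \<ge> h" using cnt[OF bP, of h] by (simp add: N_def)
  qed
  have \<beta>B: "\<pi>Q e \<le> \<beta> e + 3" "exQ e \<Longrightarrow> h \<le> \<beta> e + 3" "\<beta> e < h" if e: "e \<in> Q" "\<pi>Q e < h" for e
  proof -
    have U: "card ({y\<in>Q. \<pi>Q y < t} - {y\<in>Q. exQ y}) + 3 \<ge> t" if "t \<le> N" for t
      using diff_card_le_card_Diff[of "{y\<in>Q. exQ y}" "{y\<in>Q. \<pi>Q y < t}"] fin cnt[OF bQ that] cexQ by simp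
    show "h \<le> \<beta> e + 3" if ex: "exQ e"
    proof -
      have "{y\<in>Q. \<pi>Q y < h} - {y\<in>Q. exQ y} \<subseteq> {y\<in>Q. kQ y < kQ e}"
        using ex by (auto simp: kQ_def N_def split: if_splits)
      then have "card ({y\<in>Q. \<pi>Q y < h} - {y\<in>Q. exQ y}) \<le> \<beta> e"
        using \<beta>l[OF e(1)] by (rule card_le_antimono) (use fin in auto)
      then show ?thesis using U[of h] by (simp add: N_def)
    qed
    then show "\<pi>Q e \<le> \<beta> e + 3"
    proof (cases "exQ e")
      case False
      then have "{y\<in>Q. \<pi>Q y < \<pi>Q e} - {y\<in>Q. exQ y} \<subseteq> {y\<in>Q. kQ y < kQ e}"
        by (auto simp: kQ_def)
      then have "card ({y\<in>Q. \<pi>Q y < \<pi>Q e} - {y\<in>Q. exQ y}) \<le> \<beta> e"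
        using \<beta>l[OF e(1)] by (rule card_le_antimono) (use fin in auto)
      then show ?thesis using U[of "\<pi>Q e"] e(2) by (simp add: N_def)
    qed (use e(2) in auto)
    have "{y\<in>Q. kQ y \<le> kQ e} \<subseteq> {y\<in>Q. \<pi>Q y < h}"
      using e(2) exQB QB by (fastforce simp: kQ_def N_def split: if_splits)
    then have "\<beta> e < card {y\<in>Q. \<pi>Q y < h}"
      using \<beta>u[OF e(1)] by (rule less_card_mono) (use fin in auto)
    then show "\<beta> e < h" using cnt[OF bQ, of h] by (simp add: N_def)
  qed
  \<comment> \<open>An ordinary pair loses 1 by alignment and at most 3 by the shift. Two
    exceptional elements have \<open>\<alpha> e \<le> h + 2\<close> and
    \<open>h \<le> \<beta> g + 3\<close>; this is where 5 comes from.\<close>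
  have "\<alpha> e \<le> \<beta> g + 5" if eg: "e \<in> P" "g \<in> Q" "A e g" for e g
  proof -
    define i j where "i = c (r e)" and "j = c (r' g)"
    have ij: "i < N" "j < N" using cN rN eg by (auto simp: i_def j_def)
    have "r e \<le> r' g + 1" "r' g \<le> r e + 1" using al[OF eg] by auto
    then have adj: "i \<le> j + 1 \<or> (j = 0 \<and> i = N - 1)" "j \<le> i + 1 \<or> (i = 0 \<and> j = N - 1)"
      using cadj[of "r e" "r' g"] cadj[of "r' g" "r e"] rN eg by (auto simp: i_def j_def)
    have pe: "\<pi>P e = \<pi> i" "\<pi>Q g = \<pi> j" by (simp_all add: i_def j_def \<pi>P_def \<pi>Q_def)
    consider "i < h" "j < h" | "i < h" "j \<ge> h" | "i \<ge> h" "j < h" | "i \<ge> h" "j \<ge> h" by linarith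
    then show ?thesis
    proof cases
      case 1
      have \<alpha>: "\<alpha> e = \<pi> i" using \<alpha>B[OF eg(1)] pB[OF 1(1)] pe by simp
      have \<beta>: "\<pi> j \<le> \<beta> g + 3" "exQ g \<Longrightarrow> h \<le> \<beta> g + 3" using \<beta>B[OF eg(2)] pB[OF 1(2)] pe by auto
      show ?thesis
      proof (cases "j = m")
        case True
        then have "exQ g" by (simp add: exQ_def j_def)
        then show ?thesis using \<alpha> \<beta>(2) pB[OF 1(1)] by simp
      next
        case False
        then have "\<pi> i \<le> \<pi> j + 1" using 1 adj m by (auto simp: \<pi>_def N_def)
        then show ?thesis using \<alpha> \<beta>(1) by simp
      qed
    next
      case 2
      then show ?thesis using \<alpha>B[OF eg(1)] \<beta>T[OF eg(2)] pe pB[OF 2(1)] pT[OF 2(2)] ij by simp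
    next
      case 3
      then have "(i = h \<and> j = h - 1) \<or> (i = N - 1 \<and> j = 0)" using adj ij by (auto simp: N_def)
      then have "exP e" "exQ g" by (auto simp: exP_def exQ_def i_def j_def)
      then show ?thesis using \<alpha>T(2)[OF eg(1)] \<beta>B(2)[OF eg(2)] pe pT[OF 3(1)] pB[OF 3(2)] ij by simp
    next
      case 4
      have \<beta>: "\<beta> g = \<pi> j" using \<beta>T[OF eg(2)] pT[OF 4(2)] ij pe by simp
      have \<alpha>: "\<alpha> e \<le> \<pi> i + 3" "exP e \<Longrightarrow> \<alpha> e \<le> h + 2" using \<alpha>T[OF eg(1)] pT[OF 4(1)] ij pe by auto
      show ?thesis
      proof (cases "i = N - 1 - m'")
        case True
        then have "exP e" by (simp add: exP_def i_def)
        then show ?thesis using \<alpha>(2) \<beta> pT[OF 4(2)] ij by simp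
      next
        case False
        then have "\<pi> i \<le> \<pi> j + 1" using 4 adj m' ij by (auto simp: \<pi>_def N_def Let_def)
        then show ?thesis using \<alpha>(1) \<beta> by simp
      qed
    qed
  qed
  moreover have "2 * card {e\<in>a. \<alpha> e < t} \<le> t + \<epsilon>" if t: "t \<le> h" for t
  proof -
    have sub: "(\<lambda>e. \<alpha> e) ` {e\<in>a. \<alpha> e < t} \<subseteq> {i\<in>{..<t}. wa ((x + (m + i) mod h) mod N) = 1}"
    proof (rule image_subsetI)
      fix e assume "e \<in> {e\<in>a. \<alpha> e < t}"
      then have e: "e \<in> a" "\<alpha> e < t" by auto
      have eP: "e \<in> P" using e a by auto
      have B: "\<pi>P e < h" using \<alpha>T(3)[OF eP] e t by linarith
      then have "\<alpha> e = \<pi>P e" using \<alpha>B eP by simp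
      moreover have "(m + \<pi> (c (r e))) mod h = c (r e)"
        using B PB[OF eP] m by (auto simp: \<pi>_def \<pi>P_def mod_if)
      ultimately have "(x + (m + \<alpha> e) mod h) mod N = r e" using cN(2)[OF rN(1)[OF eP]] by (simp add: \<pi>P_def)
      then show "\<alpha> e \<in> {i\<in>{..<t}. wa ((x + (m + i) mod h) mod N) = 1}"
        using e a' by (auto simp: wa_def)
    qed
    have "card {e\<in>a. \<alpha> e < t} = card ((\<lambda>e. \<alpha> e) ` {e\<in>a. \<alpha> e < t})"
      using \<alpha> a by (intro card_image[symmetric]) (auto simp: bij_betw_def inj_on_def)
    also have "\<dots> \<le> card {i\<in>{..<t}. wa ((x + (m + i) mod h) mod N) = 1}"
      by (intro card_mono sub) auto
    also have "\<dots> = (\<Sum>i<t. wa ((x + (m + i) mod h) mod N))"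
      by (subst card_sum_indicator) (auto simp: wa_def intro!: sum.cong)
    finally have "2 * int (card {e\<in>a. \<alpha> e < t}) - int t \<le> (\<Sum>i<t. va ((m + i) mod h))"
      by (simp add: va_def sum_subtractf sum_distrib_left[symmetric] of_nat_sum[symmetric] del: of_nat_sum)
    also have "\<dots> \<le> int \<epsilon>" using ma[OF t] ta by simp
    finally show ?thesis by linarith
  qed
  moreover have "2 * card {g\<in>b. 2 * h \<le> \<beta> g + t} \<le> t + \<epsilon>" if t: "t \<le> h" for t
  proof -
    have sub: "(\<lambda>e. N - 1 - \<beta> e) ` {g\<in>b. 2 * h \<le> \<beta> g + t} \<subseteq> {i\<in>{..<t}. wb ((x + (N - 1 - (m' + i) mod h)) mod N) = 1}"
    proof (rule image_subsetI)
      fix e assume "e \<in> {g\<in>b. 2 * h \<le> \<beta> g + t}"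
      then have e: "e \<in> b" "2 * h \<le> \<beta> e + t" by auto
      have eQ: "e \<in> Q" using e b by auto
      have B: "\<pi>Q e \<ge> h" using \<beta>B(3)[OF eQ] e t by linarith
      have \<pi>N: "\<pi>Q e < N" using bQ eQ by (auto simp: bij_betw_def)
      have b1: "\<beta> e = \<pi>Q e" using \<beta>T eQ B by simp
      have "N - 1 - (m' + (N - 1 - \<pi> (c (r' e)))) mod h = c (r' e)"
      proof -
        define d where "d = N - 1 - c (r' e)"
        define q where "q = (if m' \<le> d then d - m' else d + h - m')"
        have cc: "c (r' e) \<ge> h" "c (r' e) < N" using B QB[OF eQ] cN(1)[OF rN(2)[OF eQ]] by auto
        then have d: "d < h" "N - 1 - d = c (r' e)" by (auto simp: d_def N_def)
        have q: "q < h" "(m' + q) mod h = d" using d m' by (auto simp: q_def)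
        have "\<pi> (c (r' e)) = N - 1 - q" using cc by (simp add: \<pi>_def Let_def d_def q_def)
        then have "N - 1 - \<pi> (c (r' e)) = q" using q(1) by (simp add: N_def)
        then show ?thesis using q d by simp
      qed
      then have "(x + (N - 1 - (m' + (N - 1 - \<beta> e)) mod h)) mod N = r' e" 
        using cN(2)[OF rN(2)[OF eQ]] b1 by (simp add: \<pi>Q_def)
      then show "N - 1 - \<beta> e \<in> {i\<in>{..<t}. wb ((x + (N - 1 - (m' + i) mod h)) mod N) = 1}"
        using e b' b1 \<pi>N by (auto simp: wb_def N_def)
    qed
    have "card {g\<in>b. 2 * h \<le> \<beta> g + t} = card ((\<lambda>e. N - 1 - \<beta> e) ` {g\<in>b. 2 * h \<le> \<beta> g + t})"
    proof (rule card_image[symmetric], rule inj_onI)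
      fix e e' assume H: "e \<in> {g\<in>b. 2 * h \<le> \<beta> g + t}" "e' \<in> {g\<in>b. 2 * h \<le> \<beta> g + t}" "N - 1 - \<beta> e = N - 1 - \<beta> e'"
      then have "\<beta> e < N" "\<beta> e' < N" "e \<in> Q" "e' \<in> Q" using \<beta> b cardQ by (auto simp: bij_betw_def N_def)
      then show "e = e'" using \<beta> H by (auto simp: bij_betw_def inj_on_def)
    qed
    also have "\<dots> \<le> card {i\<in>{..<t}. wb ((x + (N - 1 - (m' + i) mod h)) mod N) = 1}"
      by (intro card_mono sub) auto
    also have "\<dots> = (\<Sum>i<t. wb ((x + (N - 1 - (m' + i) mod h)) mod N))"
      by (subst card_sum_indicator) (auto simp: wb_def intro!: sum.cong)
    finally have "2 * int (card {g\<in>b. 2 * h \<le> \<beta> g + t}) - int t \<le> (\<Sum>i<t. vb ((m' + i) mod h))"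
      by (simp add: vb_def sum_subtractf sum_distrib_left[symmetric] of_nat_sum[symmetric] del: of_nat_sum)
    also have "\<dots> \<le> int \<epsilon>" using mb[OF t] tb by simp
    finally show ?thesis by linarith
  qed
  ultimately show ?thesis using \<alpha> \<beta> cardP cardQ by (intro exI[of _ \<alpha>] exI[of _ \<beta>]) auto
qed

section \<open>Choosing and ordering the ends of classes\<close>

text \<open>Sort \<open>U\<close> by the lowest \<open>\<alpha>\<close> of a neighbour in
  \<open>a\<close>, elements without neighbours last. The elements up to one of key
  \<open>k < h\<close> are adjacent to members of \<open>a\<close> below \<open>k + 1\<close>, of
  which there are at most \<open>(k + 1 + \<epsilon>) / 2\<close>, with two neighbours each. For
  larger keys the bound on \<open>card U\<close> suffices.\<close>

lemma sort_by_lowest_neighbour: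
  fixes A :: "'a \<Rightarrow> 'b \<Rightarrow> bool" and \<alpha> :: "'b \<Rightarrow> nat"
  assumes fin: "finite U" "finite a" and cardU: "card U \<le> h + \<epsilon> + 1"
    and deg: "\<And>f. f \<in> a \<Longrightarrow> card {e\<in>U. A e f} \<le> 2"
    and light: "\<And>t. t \<le> h \<Longrightarrow> 2 * card {f\<in>a. \<alpha> f < t} \<le> t + \<epsilon>"
  shows "\<exists>x. bij_betw x U {..<card U} \<and> (\<forall>e\<in>U. \<forall>f\<in>a. A e f \<longrightarrow> x e \<le> \<alpha> f + \<epsilon>)"
proof -
  define S where "S e = {f\<in>a. A e f}" for e
  define key where "key e = (if S e = {} then Suc (Max (insert 0 (\<alpha> ` a))) else Min (\<alpha> ` S e))" for e
  have fS: "finite (S e)" for e using fin by (simp add: S_def)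
  obtain x where x: "bij_betw x U {..<card U}" and xu: "\<And>e. e \<in> U \<Longrightarrow> x e < card {y\<in>U. key y \<le> key e}"
    using ranking[OF fin(1), of key] by metis
  have "x e \<le> \<alpha> f + \<epsilon>" if ef: "e \<in> U" "f \<in> a" "A e f" for e f
  proof -
    define k where "k = key e"
    have S: "f \<in> S e" using ef by (simp add: S_def)
    then have k: "k \<le> \<alpha> f" "k = Min (\<alpha> ` S e)" using fS by (auto simp: key_def k_def)
    show ?thesis
    proof (cases "Suc k \<le> h")
      case False
      have "x e < card U" using x ef(1) by (auto simp: bij_betw_def)
      then show ?thesis using False cardU k(1) by linarith
    next
      case True
      have kM: "k < Suc (Max (insert 0 (\<alpha> ` a)))"
      proof -
        have "\<alpha> f \<le> Max (insert 0 (\<alpha> ` a))" using ef(2) fin by (intro Max_ge) auto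
        then show ?thesis using k(1) by simp
      qed
      have "{y\<in>U. key y \<le> k} \<subseteq> (\<Union>f\<in>{f\<in>a. \<alpha> f < Suc k}. {e\<in>U. A e f})"
      proof clarify
        fix y assume y: "y \<in> U" "key y \<le> k"
        then have "S y \<noteq> {}" using kM by (auto simp: key_def split: if_splits)
        then have "Min (\<alpha> ` S y) \<in> \<alpha> ` S y" using fS by (intro Min_in) auto
        moreover have "key y = Min (\<alpha> ` S y)" using \<open>S y \<noteq> {}\<close> by (simp add: key_def)
        ultimately obtain g where "g \<in> S y" "\<alpha> g = key y" by auto
        then show "y \<in> (\<Union>f\<in>{f\<in>a. \<alpha> f < Suc k}. {e\<in>U. A e f})" using y by (auto simp: S_def)
      qed
      then have "card {y\<in>U. key y \<le> k} \<le> card (\<Union>f\<in>{f\<in>a. \<alpha> f < Suc k}. {e\<in>U. A e f})"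
        using fin by (intro card_mono) auto
      also have "\<dots> \<le> (\<Sum>f\<in>{f\<in>a. \<alpha> f < Suc k}. card {e\<in>U. A e f})"
        using fin by (intro card_UN_le) auto
      also have "\<dots> \<le> card {f\<in>a. \<alpha> f < Suc k} * 2"
        using sum_bounded_above[of "{f\<in>a. \<alpha> f < Suc k}" "\<lambda>f. card {e\<in>U. A e f}" 2] deg by simp
      also have "\<dots> \<le> Suc k + \<epsilon>" using light[OF True] by simp
      finally show ?thesis using xu[OF ef(1)] k(1) by (simp add: k_def)
    qed
  qed
  then show ?thesis using x by blast
qed

lemma card_slot_range:
  fixes r :: "'a \<Rightarrow> nat"
  assumes "inj_on r S" "X \<subseteq> {x\<in>S. l \<le> r x \<and> r x < t}"
  shows "card X \<le> t - l"
proof -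
  have "card X \<le> card {l..<t}"
  proof (rule card_inj_on_le[of r])
    show "inj_on r X" using assms by (auto intro: inj_on_subset)
    show "r ` X \<subseteq> {l..<t}" using assms(2) by auto
  qed simp
  then show ?thesis by simp
qed

lemma aligned_numbering_of_subsets:
  fixes A :: "'a \<Rightarrow> 'b \<Rightarrow> bool"
  assumes fin: "finite P" "finite Q"
    and dP: "\<forall>e\<in>P. card {g\<in>Q. A e g} \<le> 2"
    and dQ: "\<forall>g\<in>Q. card {e\<in>P. A e g} \<le> 2"
    and L: "L = min (card P) (card Q)"
  obtains P' Q' r r' where "P' \<subseteq> P" "Q' \<subseteq> Q" "card P' = L" "card Q' = L"
    "bij_betw r P' {..<L}" "bij_betw r' Q' {..<L}"
    "\<forall>e\<in>P'. \<forall>g\<in>Q'. A e g \<longrightarrow> r e \<le> r' g + 1 \<and> r' g \<le> r e + 1"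
proof -
  obtain P' where P': "P' \<subseteq> P" "card P' = L"
    using obtain_subset_with_card_n[of L P] L by auto
  obtain Q' where Q': "Q' \<subseteq> Q" "card Q' = L"
    using obtain_subset_with_card_n[of L Q] L by auto
  have fin': "finite P'" "finite Q'" using P' Q' fin finite_subset by auto
  have "\<exists>r r'. bij_betw r P' {..<L} \<and> bij_betw r' Q' {..<L}
    \<and> (\<forall>e\<in>P'. \<forall>g\<in>Q'. A e g \<longrightarrow> r e \<le> r' g + 1 \<and> r' g \<le> r e + 1)"
  proof (rule aligned_numbering[OF fin' P'(2) Q'(2)])
    show "card {g\<in>Q'. A e g} \<le> 2" if "e \<in> P'" for e
      using dP that P'(1) Q'(1) fin card_mono[of "{g\<in>Q. A e g}" "{g\<in>Q'. A e g}"] by fastforce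
    show "card {e\<in>P'. A e g} \<le> 2" if "g \<in> Q'" for g
      using dQ that P'(1) Q'(1) fin card_mono[of "{e\<in>P. A e g}" "{e\<in>P'. A e g}"] by fastforce
  qed
  then obtain r r' where "bij_betw r P' {..<L}" "bij_betw r' Q' {..<L}"
    "\<forall>e\<in>P'. \<forall>g\<in>Q'. A e g \<longrightarrow> r e \<le> r' g + 1 \<and> r' g \<le> r e + 1" by blast
  with P' Q' show thesis by (intro that[of P' Q' r r']) assumption+
qed

lemma card_slots_eq:
  fixes r :: "'a \<Rightarrow> nat"
  assumes "bij_betw r S {..<L}" "l \<le> t" "t \<le> L"
  shows "card {x\<in>S. l \<le> r x \<and> r x < t} = t - l"
proof -
  have "bij_betw r {x\<in>S. l \<le> r x \<and> r x < t} {l..<t}"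
  proof (rule bij_betw_imageI)
    show "inj_on r {x\<in>S. l \<le> r x \<and> r x < t}" using assms(1) by (auto simp: bij_betw_def inj_on_def)
    show "r ` {x\<in>S. l \<le> r x \<and> r x < t} = {l..<t}"
    proof
      show "{l..<t} \<subseteq> r ` {x\<in>S. l \<le> r x \<and> r x < t}"
      proof
        fix i assume i: "i \<in> {l..<t}"
        then have "i \<in> r ` S" using assms by (auto simp: bij_betw_def)
        then show "i \<in> r ` {x\<in>S. l \<le> r x \<and> r x < t}" using i by auto
      qed
    qed auto
  qed
  then show ?thesis using bij_betw_same_card by fastforce
qed

text \<open>In an alignment take the last \<open>u\<close> slots of one side and the first
  \<open>v\<close> slots of the other. Because \<open>u + v < L\<close> they are at least two slots
  apart, hence nonadjacent, and the neighbours of each fill only one slot more, apart from the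
  elements left out of the alignment.\<close>

lemma nonadjacent_ends:
  fixes A :: "'a \<Rightarrow> 'b \<Rightarrow> bool"
  assumes fin: "finite P" "finite Q"
    and dP: "\<And>e. e \<in> P \<Longrightarrow> card {g\<in>Q. A e g} \<le> 2"
    and dQ: "\<And>g. g \<in> Q \<Longrightarrow> card {e\<in>P. A e g} \<le> 2"
    and L: "L = min (card P) (card Q)" and uv: "u + v < L"
  shows "\<exists>U V. U \<subseteq> P \<and> V \<subseteq> Q \<and> card U = u \<and> card V = v \<and> (\<forall>e\<in>U. \<forall>g\<in>V. \<not> A e g)
    \<and> card {g\<in>Q. \<exists>e\<in>U. A e g} \<le> u + 1 + (card Q - L) \<and> card {e\<in>P. \<exists>g\<in>V. A e g} \<le> v + 1 + (card P - L)"
proof -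
  have d: "\<forall>e\<in>P. card {g\<in>Q. A e g} \<le> 2" "\<forall>g\<in>Q. card {e\<in>P. A e g} \<le> 2" using dP dQ by blast+
  obtain P' Q' r r' where sub: "P' \<subseteq> P" "Q' \<subseteq> Q" and c: "card P' = L" "card Q' = L"
    and r: "bij_betw r P' {..<L}" and r': "bij_betw r' Q' {..<L}"
    and al_all: "\<forall>e\<in>P'. \<forall>g\<in>Q'. A e g \<longrightarrow> r e \<le> r' g + 1 \<and> r' g \<le> r e + 1"
    by (rule aligned_numbering_of_subsets[OF fin d L]) (rule that, assumption+)
  have al: "\<And>e g. e \<in> P' \<Longrightarrow> g \<in> Q' \<Longrightarrow> A e g \<Longrightarrow> r e \<le> r' g + 1 \<and> r' g \<le> r e + 1"
    using al_all by blast
  define U where "U = {e\<in>P'. L - u \<le> r e \<and> r e < L}"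
  define V where "V = {g\<in>Q'. 0 \<le> r' g \<and> r' g < v}"
  have fin': "finite P'" "finite Q'" using sub fin finite_subset by auto
  have rL: "g \<in> Q' \<Longrightarrow> r' g < L" "e \<in> P' \<Longrightarrow> r e < L" for e g using r r' by (auto simp: bij_betw_def)
  have "card U = u" unfolding U_def using card_slots_eq[OF r, of "L - u" L] uv by simp
  moreover have "card V = v" unfolding V_def using card_slots_eq[OF r', of 0 v] uv by simp
  moreover have "\<forall>e\<in>U. \<forall>g\<in>V. \<not> A e g" using al uv by (force simp: U_def V_def)
  moreover have "card {g\<in>Q. \<exists>e\<in>U. A e g} \<le> u + 1 + (card Q - L)"
  proof -
    have "{g\<in>Q. \<exists>e\<in>U. A e g} \<subseteq> {g\<in>Q'. L - u - 1 \<le> r' g \<and> r' g < L} \<union> (Q - Q')"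
      using al rL by (fastforce simp: U_def)
    then have "card {g\<in>Q. \<exists>e\<in>U. A e g} \<le> card ({g\<in>Q'. L - u - 1 \<le> r' g \<and> r' g < L} \<union> (Q - Q'))"
      using fin fin' by (intro card_mono) auto
    also have "\<dots> \<le> card {g\<in>Q'. L - u - 1 \<le> r' g \<and> r' g < L} + card (Q - Q')" by (rule card_Un_le)
    also have "card {g\<in>Q'. L - u - 1 \<le> r' g \<and> r' g < L} = L - (L - u - 1)"
      by (rule card_slots_eq[OF r']) auto
    also have "card (Q - Q') = card Q - L" using sub fin' c by (simp add: card_Diff_subset)
    finally show ?thesis using uv by simp
  qed
  moreover have "card {e\<in>P. \<exists>g\<in>V. A e g} \<le> v + 1 + (card P - L)"
  proof -
    have "{e\<in>P. \<exists>g\<in>V. A e g} \<subseteq> {e\<in>P'. 0 \<le> r e \<and> r e < v + 1} \<union> (P - P')"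
      using al rL by (fastforce simp: V_def)
    then have "card {e\<in>P. \<exists>g\<in>V. A e g} \<le> card ({e\<in>P'. 0 \<le> r e \<and> r e < v + 1} \<union> (P - P'))"
      using fin fin' by (intro card_mono) auto
    also have "\<dots> \<le> card {e\<in>P'. 0 \<le> r e \<and> r e < v + 1} + card (P - P')" by (rule card_Un_le)
    also have "card {e\<in>P'. 0 \<le> r e \<and> r e < v + 1} = v + 1 - 0"
      using uv by (intro card_slots_eq[OF r]) auto
    also have "card (P - P') = card P - L" using sub fin' c by (simp add: card_Diff_subset)
    finally show ?thesis by simp
  qed
  moreover have "U \<subseteq> P" "V \<subseteq> Q" using sub by (auto simp: U_def V_def)
  ultimately show ?thesis by blast
qed

text \<open>Sort by the largest index of a neighbour in \<open>J\<close>. From an element adjacent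
  to \<open>f\<close> on, all elements have a neighbour of index at least \<open>j f\<close>; there
  are at most \<open>card J - j f\<close> such members of \<open>J\<close>, with two neighbours
  each, so this tail is short.\<close>

lemma sort_by_index:
  fixes A :: "'a \<Rightarrow> 'b \<Rightarrow> bool" and j :: "'b \<Rightarrow> nat"
  assumes fin: "finite U" "finite J" and j: "bij_betw j J {..<card J}"
    and deg: "\<And>f. f \<in> J \<Longrightarrow> card {e\<in>U. A e f} \<le> 2"
  shows "\<exists>x. bij_betw x U {..<card U} \<and> (\<forall>e\<in>U. \<forall>f\<in>J. A e f \<longrightarrow> card U \<le> x e + 2 * (card J - j f))"
proof -
  define S where "S e = {f\<in>J. A e f}" for e
  define key where "key e = Max (insert 0 (Suc ` j ` S e))" for e
  have fS: "finite (S e)" for e using fin by (simp add: S_def)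
  obtain x where x: "bij_betw x U {..<card U}" and xl: "\<And>e. e \<in> U \<Longrightarrow> card {y\<in>U. key y < key e} \<le> x e"
    by (rule ranking[OF fin(1), of key]) (rule that, blast+)
  have "card U \<le> x e + 2 * (card J - j f)" if ef: "e \<in> U" "f \<in> J" "A e f" for e f
  proof -
    have kge: "Suc (j f) \<le> key e"
      unfolding key_def using fS ef by (intro Max_ge) (auto simp: S_def)
    have "{y\<in>U. key e \<le> key y} \<subseteq> (\<Union>g\<in>{g\<in>J. j f \<le> j g}. {y\<in>U. A y g})"
    proof
      fix y assume "y \<in> {y\<in>U. key e \<le> key y}"
      then have y: "y \<in> U" "Suc (j f) \<le> key y" using kge by auto
      have "key y \<in> insert 0 (Suc ` j ` S y)" unfolding key_def using fS by (intro Max_in) auto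
      then obtain g where "g \<in> S y" "key y = Suc (j g)" using y by auto
      then show "y \<in> (\<Union>g\<in>{g\<in>J. j f \<le> j g}. {y\<in>U. A y g})" using y by (auto simp: S_def)
    qed
    then have "card {y\<in>U. key e \<le> key y} \<le> card (\<Union>g\<in>{g\<in>J. j f \<le> j g}. {y\<in>U. A y g})"
      using fin by (intro card_mono) auto
    also have "\<dots> \<le> (\<Sum>g\<in>{g\<in>J. j f \<le> j g}. card {y\<in>U. A y g})"
      using fin by (intro card_UN_le) auto
    also have "\<dots> \<le> card {g\<in>J. j f \<le> j g} * 2"
      using sum_bounded_above[of "{g\<in>J. j f \<le> j g}" "\<lambda>g. card {y\<in>U. A y g}" 2] deg by simp
    also have "card {g\<in>J. j f \<le> j g} \<le> card J - j f"
      using j by (intro card_slot_range[of j J]) (auto simp: bij_betw_def)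
    finally have "card {y\<in>U. key e \<le> key y} \<le> 2 * (card J - j f)" by simp
    moreover have "card {y\<in>U. key y < key e} + card {y\<in>U. key e \<le> key y} = card U"
      using fin by (subst card_Un_disjoint[symmetric]) (auto intro!: arg_cong[where f = card])
    ultimately show ?thesis using xl[OF ef(1)] by linarith
  qed
  then show ?thesis using x by blast
qed

text \<open>\<open>V\<close> is the best of three evenly spaced slot ranges of an alignment with
  \<open>F\<close>; hence the factor 3.\<close>

lemma free_class_ends:
  fixes A :: "'a \<Rightarrow> 'b \<Rightarrow> bool"
  assumes fin: "finite M" "finite M'" "finite F"
    and dM: "\<And>e. e \<in> M \<union> M' \<Longrightarrow> card {f\<in>F. A e f} \<le> 2"
    and dF: "\<And>f. f \<in> F \<Longrightarrow> card {e\<in>M. A e f} \<le> 2" "\<And>f. f \<in> F \<Longrightarrow> card {e\<in>M'. A e f} \<le> 2"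
    and L: "L = min (card M) (card F)" "L' = min (card M') (card F)"
    and uv: "u \<le> L" "v \<le> L'"
    and B: "u + 1 + (card F - L) + 2 * (v + 2 - (L' - v) div 2) + 2 * (card F - L') \<le> B"
  shows "\<exists>U V. U \<subseteq> M \<and> V \<subseteq> M' \<and> card U = u \<and> card V = v
    \<and> card {f\<in>F. \<exists>e\<in>U. A e f} \<le> u + 1 + (card F - L)
    \<and> card {f\<in>F. \<exists>e\<in>V. A e f} \<le> v + 2 + (card F - L')
    \<and> 3 * card {f\<in>F. (\<exists>e\<in>U. A e f) \<and> (\<exists>e\<in>V. A e f)} \<le> B"
proof -
  have d: "\<forall>e\<in>M. card {f\<in>F. A e f} \<le> 2" "\<forall>f\<in>F. card {e\<in>M. A e f} \<le> 2"
    "\<forall>e\<in>M'. card {f\<in>F. A e f} \<le> 2" "\<forall>f\<in>F. card {e\<in>M'. A e f} \<le> 2"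
    using dM dF by blast+
  obtain M1 F1 r1 r1' where sub1: "M1 \<subseteq> M" "F1 \<subseteq> F" and c1: "card M1 = L" "card F1 = L"
    and r1: "bij_betw r1 M1 {..<L}" and r1': "bij_betw r1' F1 {..<L}"
    and al1_all: "\<forall>e\<in>M1. \<forall>g\<in>F1. A e g \<longrightarrow> r1 e \<le> r1' g + 1 \<and> r1' g \<le> r1 e + 1"
    by (rule aligned_numbering_of_subsets[OF fin(1,3) d(1,2) L(1)]) (rule that, assumption+)
  have al1: "\<And>e g. e \<in> M1 \<Longrightarrow> g \<in> F1 \<Longrightarrow> A e g \<Longrightarrow> r1 e \<le> r1' g + 1 \<and> r1' g \<le> r1 e + 1"
    using al1_all by blast
  obtain M2 F2 r2 r2' where sub2: "M2 \<subseteq> M'" "F2 \<subseteq> F" and c2: "card M2 = L'" "card F2 = L'"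
    and r2: "bij_betw r2 M2 {..<L'}" and r2': "bij_betw r2' F2 {..<L'}"
    and al2_all: "\<forall>e\<in>M2. \<forall>g\<in>F2. A e g \<longrightarrow> r2 e \<le> r2' g + 1 \<and> r2' g \<le> r2 e + 1"
    by (rule aligned_numbering_of_subsets[OF fin(2,3) d(3,4) L(2)]) (rule that, assumption+)
  have al2: "\<And>e g. e \<in> M2 \<Longrightarrow> g \<in> F2 \<Longrightarrow> A e g \<Longrightarrow> r2 e \<le> r2' g + 1 \<and> r2' g \<le> r2 e + 1"
    using al2_all by blast
  have fin': "finite F1" "finite F2" using sub1 sub2 fin by (auto intro: finite_subset)
  define U where "U = {e\<in>M1. 0 \<le> r1 e \<and> r1 e < u}"
  define NU where "NU = {f\<in>F. \<exists>e\<in>U. A e f}"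
  \<comment> \<open>With this spacing three translates of a range of \<open>v\<close> slots fit into
    \<open>L'\<close> slots, and their neighbourhoods overlap in at most about
    \<open>v + 2 - w\<close> slots.\<close>
  define w where "w = (L' - v) div 2"
  define W where "W k = {e\<in>M2. k * w \<le> r2 e \<and> r2 e < k * w + v}" for k
  define NW where "NW k = {f\<in>F. \<exists>e\<in>W k. A e f}" for k
  have cU: "card U = u" unfolding U_def using card_slots_eq[OF r1, of 0 u] uv by simp
  have wL: "k * w + v \<le> L'" if "k < 3" for k
  proof -
    have "k * w \<le> 2 * w" using that by simp
    then show ?thesis using uv unfolding w_def by linarith
  qed
  have cW: "card (W k) = v" if "k < 3" for k
    unfolding W_def using card_slots_eq[OF r2, of "k * w" "k * w + v"] wL[OF that] by simp
  have NU: "card NU \<le> u + 1 + (card F - L)"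
  proof -
    have "NU \<subseteq> {f\<in>F1. 0 \<le> r1' f \<and> r1' f < u + 1} \<union> (F - F1)"
      using al1 by (fastforce simp: U_def NU_def)
    then have "card NU \<le> card ({f\<in>F1. 0 \<le> r1' f \<and> r1' f < u + 1} \<union> (F - F1))"
      using fin fin' by (intro card_mono) auto
    also have "\<dots> \<le> card {f\<in>F1. 0 \<le> r1' f \<and> r1' f < u + 1} + card (F - F1)" by (rule card_Un_le)
    also have "card {f\<in>F1. 0 \<le> r1' f \<and> r1' f < u + 1} \<le> u + 1 - 0"
      by (rule card_slot_range[of r1' F1]) (use r1' in \<open>auto simp: bij_betw_def\<close>)
    also have "card (F - F1) = card F - L" using sub1 fin' c1 by (simp add: card_Diff_subset)
    finally show ?thesis by simp
  qed
  have NW: "NW k \<subseteq> {f\<in>F2. k * w - 1 \<le> r2' f \<and> r2' f < k * w + v + 1} \<union> (F - F2)" for k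
    using al2 by (fastforce simp: W_def NW_def)
  have range: "card X \<le> t - l + (card F - L')"
    if "X \<subseteq> {f\<in>F2. l \<le> r2' f \<and> r2' f < t} \<union> (F - F2)" for X l t
  proof -
    have "card X \<le> card ({f\<in>F2. l \<le> r2' f \<and> r2' f < t} \<union> (F - F2))"
      using fin fin' that by (intro card_mono) auto
    also have "\<dots> \<le> card {f\<in>F2. l \<le> r2' f \<and> r2' f < t} + card (F - F2)" by (rule card_Un_le)
    also have "card {f\<in>F2. l \<le> r2' f \<and> r2' f < t} \<le> t - l"
      by (rule card_slot_range[of r2' F2]) (use r2' in \<open>auto simp: bij_betw_def\<close>)
    also have "card (F - F2) = card F - L'" using sub2 fin' c2 by (simp add: card_Diff_subset)
    finally show ?thesis by simp
  qed
  have NWc: "card (NW k) \<le> v + 2 + (card F - L')" for k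
    using range[OF NW[of k]] by linarith
  have ov1: "card (NW 0 \<inter> NW 1) \<le> v + 2 - w + (card F - L')"
  proof -
    have "card (NW 0 \<inter> NW 1) \<le> (v + 1) - (w - 1) + (card F - L')"
      by (rule range) (use NW[of 0] NW[of 1] in fastforce)
    also have "\<dots> \<le> v + 2 - w + (card F - L')" 
    proof (cases "w = 0")
      case True
      have "NW 0 \<inter> NW 1 \<subseteq> NW 0" by auto
      then show ?thesis using True by simp
    qed simp
    finally show ?thesis .
  qed
  have ov2: "card ((NW 0 \<union> NW 1) \<inter> NW 2) \<le> v + 2 - w + (card F - L')"
  proof -
    have "card ((NW 0 \<union> NW 1) \<inter> NW 2) \<le> (w + v + 1) - (2 * w - 1) + (card F - L')"
      by (rule range) (use NW[of 0] NW[of 1] NW[of 2] in fastforce)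
    also have "\<dots> \<le> v + 2 - w + (card F - L')" by (cases "w = 0") auto
    finally show ?thesis .
  qed
  define J where "J k = NU \<inter> NW k" for k
  have fJ: "finite (J k)" "finite NU" "finite (NW k)" for k using fin by (auto simp: J_def NU_def NW_def)
  \<comment> \<open>Inclusion and exclusion for three subsets of \<open>NU\<close>: their sizes add
    up to at most \<open>card NU\<close> plus two overlaps, so one of them has at most a third of
    \<open>B\<close>.\<close>
  have "card (J 0) + card (J 1) = card (J 0 \<union> J 1) + card (J 0 \<inter> J 1)"
    by (rule card_Un_Int) (auto simp: fJ)
  moreover have "card (J 0 \<union> J 1) + card (J 2) = card (J 0 \<union> J 1 \<union> J 2) + card ((J 0 \<union> J 1) \<inter> J 2)"
    by (rule card_Un_Int) (auto simp: fJ)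
  moreover have "card (J 0 \<inter> J 1) \<le> card (NW 0 \<inter> NW 1)"
    using fJ by (intro card_mono) (auto simp: J_def)
  moreover have "card ((J 0 \<union> J 1) \<inter> J 2) \<le> card ((NW 0 \<union> NW 1) \<inter> NW 2)"
    using fJ by (intro card_mono) (auto simp: J_def)
  moreover have "card (J 0 \<union> J 1 \<union> J 2) \<le> card NU"
    using fJ by (intro card_mono) (auto simp: J_def)
  ultimately have "card (J 0) + card (J 1) + card (J 2) \<le> B"
    using ov1 ov2 NU B by (simp add: w_def[symmetric])
  then have "3 * card (J 0) \<le> B \<or> 3 * card (J 1) \<le> B \<or> 3 * card (J 2) \<le> B" by linarith
  then obtain k where k: "k < 3" "3 * card (J k) \<le> B" using that[of 0] that[of 1] that[of 2] by auto
  have "J k = {f\<in>F. (\<exists>e\<in>U. A e f) \<and> (\<exists>e\<in>W k. A e f)}" by (auto simp: J_def NU_def NW_def)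
  moreover have "U \<subseteq> M" "W k \<subseteq> M'" using sub1 sub2 by (auto simp: U_def W_def)
  ultimately show ?thesis using cU cW[OF k(1)] NU NWc[of k] k(2)
    by (intro exI[of _ U] exI[of _ "W k"]) (auto simp: NU_def NW_def)
qed

section \<open>Ordering a class between two classes that are already ordered\<close>

text \<open>With release time \<open>s - 1 - d f\<close> and deadline \<open>n - s + y f\<close>, a
  window of slots cuts off a lower end, an upper end or both. These are the three hypotheses, with
  \<open>A = s - 1 - l\<close> and \<open>B = t - (n - s)\<close>.\<close>

lemma deadline_scheduling:
  fixes d y :: "'a \<Rightarrow> nat"
  assumes "finite F" "card F = n" "s \<le> n" "0 < s"
    and H1: "\<And>A. A < s \<Longrightarrow> card {f\<in>F. d f \<le> A} + s \<le> A + 1 + n"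
    and H2: "\<And>B. B < s \<Longrightarrow> card {f\<in>F. y f \<le> B} + s \<le> B + 1 + n"
    and H3: "\<And>A B. A < s \<Longrightarrow> B < s \<Longrightarrow> 2 * s \<le> A + B + 2 + n \<Longrightarrow>
      card {f\<in>F. d f \<le> A \<and> y f \<le> B} + 2 * s \<le> A + B + 2 + n"
  shows "\<exists>z. bij_betw z F {..<n} \<and> (\<forall>f\<in>F. s \<le> z f + 1 + d f \<and> z f + s \<le> n + y f)"
proof -
  define lo where "lo f = s - 1 - d f" for f
  define up where "up f = min (n - 1) (n - s + y f)" for f
  have "\<exists>z. bij_betw z F {..<n} \<and> (\<forall>f\<in>F. lo f \<le> z f \<and> z f \<le> up f)"
  proof (rule interval_scheduling[OF assms(1,2)])
    show "up f < n" if "f \<in> F" for f using assms(3,4) by (auto simp: up_def)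
    show "card {f\<in>F. l \<le> lo f \<and> up f \<le> t} \<le> Suc t - l" if lt: "l \<le> Suc t" for l t
    proof (cases "l < s")
      case False
      then have "{f\<in>F. l \<le> lo f \<and> up f \<le> t} = {}" using assms(4) by (auto simp: lo_def)
      then show ?thesis by (metis card.empty zero_le)
    next
      case ls: True
      have sub1: "{f\<in>F. l \<le> lo f \<and> up f \<le> t} \<subseteq> {f\<in>F. d f \<le> s - 1 - l}" if "l > 0"
        using that ls by (auto simp: lo_def)
      have fin: "finite {f\<in>F. P f}" for P using assms(1) by simp
      show ?thesis
      proof (cases "n - 1 \<le> t")
        case True
        show ?thesis
        proof (cases "l = 0")
          case True
          have "card {f\<in>F. l \<le> lo f \<and> up f \<le> t} \<le> card F" using assms(1) by (intro card_mono) auto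
          then show ?thesis using True \<open>n - 1 \<le> t\<close> assms(2) by simp
        next
          case False
          then show ?thesis using card_mono[OF fin sub1] H1[of "s - 1 - l"] ls True assms(4) by fastforce
        qed
      next
        case tn: False
        show ?thesis
        proof (cases "t < n - s")
          case True
          then have "{f\<in>F. l \<le> lo f \<and> up f \<le> t} = {}" using tn by (auto simp: up_def)
          then show ?thesis by (metis card.empty zero_le)
        next
          case False
          define B where "B = t - (n - s)"
          have B: "B < s" "t = B + (n - s)" using False tn assms(3) by (auto simp: B_def)
          have sub2: "{f\<in>F. l \<le> lo f \<and> up f \<le> t} \<subseteq> {f\<in>F. y f \<le> B}"
            using tn B by (auto simp: up_def)
          show ?thesis
          proof (cases "l = 0")
            case True
            then show ?thesis using card_mono[OF fin sub2] H2[OF B(1)] B assms(3) by simp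
          next
            case False
            then have "{f\<in>F. l \<le> lo f \<and> up f \<le> t} \<subseteq> {f\<in>F. d f \<le> s - 1 - l \<and> y f \<le> B}"
              using sub1 sub2 by blast
            then have "card {f\<in>F. l \<le> lo f \<and> up f \<le> t} \<le> card {f\<in>F. d f \<le> s - 1 - l \<and> y f \<le> B}"
              by (rule card_mono[OF fin])
            moreover have "2 * s \<le> (s - 1 - l) + B + 2 + n" "s - 1 - l < s"
              using B ls assms(3) lt False by linarith+
            moreover note H3[of "s - 1 - l" B]
            ultimately show ?thesis using B ls assms(3) by linarith
          qed
        qed
      qed
    qed
  qed
  then obtain z where z: "bij_betw z F {..<n}" "\<forall>f\<in>F. lo f \<le> z f \<and> z f \<le> up f" by blast
  then show ?thesis using assms(3) by (intro exI[of _ z]) (fastforce simp: lo_def up_def)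
qed

lemma card_incident_range:
  fixes D :: "'a \<Rightarrow> nat"
  assumes "finite M" "inj_on D M" "\<And>e. e \<in> M \<Longrightarrow> card {f\<in>F. A e f} \<le> 2" "finite F"
    and "X \<subseteq> {f\<in>F. \<exists>e\<in>M. A e f \<and> l \<le> D e \<and> D e < t}"
  shows "card X \<le> 2 * (t - l)"
proof -
  define S where "S = {e\<in>M. l \<le> D e \<and> D e < t}"
  have "card X \<le> card (\<Union>e\<in>S. {f\<in>F. A e f})"
    using assms by (intro card_mono) (auto simp: S_def)
  also have "\<dots> \<le> (\<Sum>e\<in>S. card {f\<in>F. A e f})" using assms by (intro card_UN_le) (auto simp: S_def)
  also have "\<dots> \<le> card S * 2"
    using sum_bounded_above[of S "\<lambda>e. card {f\<in>F. A e f}" 2] assms(3) by (auto simp: S_def)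
  also have "card S \<le> t - l" by (rule card_slot_range[OF assms(2)]) (auto simp: S_def)
  finally show ?thesis by simp
qed

text \<open>The members of \<open>X\<close> in \<open>J\<close> are limited by the index condition,
  \<open>2 * card (J \<inter> X) + u \<le> 2 * card J + A + 2\<close>, those outside
  \<open>J\<close> both by \<open>b\<close> and by the size of \<open>N\<close>. If
  \<open>J \<inter> X\<close> is nonempty, also \<open>u \<le> A + 2 * card J\<close>. Adding these
  bounds leads exactly to the hypothesis with \<open>3 * card J\<close>.\<close>

lemma mixed_deadline_count:
  fixes i :: "'f \<Rightarrow> nat"
  assumes fin: "finite N" and X: "X \<subseteq> N" "card X \<le> 2 * (A + 1)" and N: "card N \<le> u + c"
    and J: "J \<subseteq> N" "inj_on i J" and idx: "\<And>f. f \<in> J \<Longrightarrow> f \<in> X \<Longrightarrow> i f < card J \<and> u \<le> A + 2 * (card J - i f)"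
    and b: "card (X - J) \<le> 2 * b" and Au: "A < u"
    and "3 * card J + c + 4 * s \<le> u + 2 * v + 2 * n" "2 * s \<le> v + n"
  shows "card X + 2 * s \<le> A + b + v + 1 + n"
proof -
  have fX: "finite X" "finite J" using fin X J finite_subset by auto
  have s: "card X = card (J \<inter> X) + card (X - J)"
    using card_Un_disjoint[of "J \<inter> X" "X - J"] fX by (simp add: Int_commute Un_Diff_Int Int_Diff Un_commute)
      (metis Int_Diff_disjoint Int_commute Un_Diff_Int Un_commute card_Un_disjoint finite_Diff finite_Int)
  have "card (X - J) \<le> card (N - J)" using fin X by (intro card_mono) auto
  also have "\<dots> = card N - card J" using J fX by (simp add: card_Diff_subset)
  finally have k2: "card (X - J) + card J \<le> u + c" using N card_mono[OF fin J(1)] by linarith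
  show ?thesis
  proof (cases "J \<inter> X = {}")
    case True
    then show ?thesis using s X(2) b assms(11) by simp
  next
    case False
    then obtain f where f: "f \<in> J" "f \<in> X" by auto
    have "card (J \<inter> X) \<le> Suc (card J) - (u - A + 1) div 2 - 0"
    proof (rule card_slot_range[OF J(2)])
      show "J \<inter> X \<subseteq> {x\<in>J. 0 \<le> i x \<and> i x < Suc (card J) - (u - A + 1) div 2}"
      proof clarify
        fix x assume "x \<in> J" "x \<in> X"
        then show "0 \<le> i x \<and> i x < Suc (card J) - (u - A + 1) div 2" using idx[of x] by linarith
      qed
    qed
    then have "2 * card (J \<inter> X) + u \<le> 2 * card J + A + 2" using idx[OF f] Au by linarith
    moreover have "u \<le> A + 2 * card J" using idx[OF f] by linarith
    ultimately show ?thesis using s b k2 assms(10) by linarith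
  qed
qed

text \<open>\<open>D\<close> counts from the end of \<open>M\<close> and \<open>Y\<close> from the
  beginning of \<open>M'\<close>, so \<open>U\<close> and \<open>V\<close> are the parts next to the
  free class \<open>F\<close>. The critical elements are those of \<open>J\<close>, with neighbours
  in both. By \<open>P1\<close> and \<open>P2\<close> a high index forces \<open>D\<close> to be
  large and a low index forces \<open>Y\<close> to be large, so the two constraints on a member of
  \<open>J\<close> are not both tight.\<close>

lemma free_class_scheduling:
  fixes R :: "'a \<Rightarrow> 'b \<Rightarrow> bool"
  assumes fin: "finite M" "finite M'" "finite F" and n: "card F = n"
    and dM: "\<And>e. e \<in> M \<Longrightarrow> card {f\<in>F. R e f} \<le> 2" "\<And>e. e \<in> M' \<Longrightarrow> card {f\<in>F. R e f} \<le> 2"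
    and D: "inj_on D M" and Y: "inj_on Y M'"
    and U: "\<And>e. e \<in> M \<Longrightarrow> e \<in> U \<longleftrightarrow> D e < u" and V: "\<And>e. e \<in> M' \<Longrightarrow> e \<in> V \<longleftrightarrow> Y e < v"
    and UV: "U \<subseteq> M" "V \<subseteq> M'"
    and NU: "card {f\<in>F. \<exists>e\<in>U. R e f} \<le> u + c" and NV: "card {f\<in>F. \<exists>e\<in>V. R e f} \<le> v + c"
    and J: "J = {f\<in>F. (\<exists>e\<in>U. R e f) \<and> (\<exists>e\<in>V. R e f)}" and j: "bij_betw j J {..<card J}"
    and P1: "\<And>e f. e \<in> U \<Longrightarrow> f \<in> J \<Longrightarrow> R e f \<Longrightarrow> u \<le> D e + 2 * (card J - j f)"
    and P2: "\<And>e f. e \<in> V \<Longrightarrow> f \<in> J \<Longrightarrow> R e f \<Longrightarrow> v \<le> Y e + 2 * (j f + 1)"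
    and num: "0 < s" "s \<le> n" "u + s \<le> n" "v + s \<le> n" "c + 2 * s \<le> u + n" "c + 2 * s \<le> v + n"
      "2 * card J + 1 + 2 * s \<le> u + v + n" "3 * card J + c + 4 * s \<le> u + 2 * v + 2 * n"
      "3 * card J + c + 4 * s \<le> v + 2 * u + 2 * n"
  shows "\<exists>z. bij_betw z F {..<n} \<and> (\<forall>e\<in>M. \<forall>f\<in>F. R e f \<longrightarrow> s \<le> z f + 1 + D e)
    \<and> (\<forall>e\<in>M'. \<forall>f\<in>F. R e f \<longrightarrow> z f + s \<le> n + Y e)"
proof -
  \<comment> \<open>The value \<open>s\<close> stands for the absence of a near neighbour; it
    imposes no constraint.\<close>
  define d where "d f = Min (insert s (D ` {e\<in>M. R e f}))" for f
  define y where "y f = Min (insert s (Y ` {e\<in>M'. R e f}))" for f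
  have dle: "d f \<le> A \<longleftrightarrow> (\<exists>e\<in>M. R e f \<and> D e \<le> A)" if "A < s" for A f
    unfolding d_def using fin that by (subst Min_le_iff) auto
  have yle: "y f \<le> A \<longleftrightarrow> (\<exists>e\<in>M'. R e f \<and> Y e \<le> A)" if "A < s" for A f
    unfolding y_def using fin that by (subst Min_le_iff) auto
  define NU' where "NU' = {f\<in>F. \<exists>e\<in>U. R e f}"
  define NV' where "NV' = {f\<in>F. \<exists>e\<in>V. R e f}"
  have fN: "finite NU'" "finite NV'" "finite J" using fin by (auto simp: NU'_def NV'_def J)
  have cD: "card X \<le> 2 * (t - l)" if "X \<subseteq> {f\<in>F. \<exists>e\<in>M. R e f \<and> l \<le> D e \<and> D e < t}" for X l t
    by (rule card_incident_range[OF fin(1) D dM(1) fin(3) that])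
  have cY: "card X \<le> 2 * (t - l)" if "X \<subseteq> {f\<in>F. \<exists>e\<in>M'. R e f \<and> l \<le> Y e \<and> Y e < t}" for X l t
    by (rule card_incident_range[OF fin(2) Y dM(2) fin(3) that])
  have inU: "f \<in> NU'" if "A < s" "A < u" "d f \<le> A" "f \<in> F" for A f
    using that dle U by (fastforce simp: NU'_def)
  have inV: "f \<in> NV'" if "A < s" "A < v" "y f \<le> A" "f \<in> F" for A f
    using that yle V by (fastforce simp: NV'_def)
  have bigU: "card {f\<in>F. d f \<le> A} \<le> u + c + 2 * (A + 1 - u)" if "A < s" for A
  proof -
    have "{f\<in>F. d f \<le> A} \<subseteq> NU' \<union> {f\<in>F. \<exists>e\<in>M. R e f \<and> u \<le> D e \<and> D e < A + 1}"
      using dle[OF that] U by (fastforce simp: NU'_def)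
    then have "card {f\<in>F. d f \<le> A} \<le> card (NU' \<union> {f\<in>F. \<exists>e\<in>M. R e f \<and> u \<le> D e \<and> D e < A + 1})"
      using fin fN by (intro card_mono) auto
    also have "\<dots> \<le> card NU' + card {f\<in>F. \<exists>e\<in>M. R e f \<and> u \<le> D e \<and> D e < A + 1}" by (rule card_Un_le)
    finally show ?thesis using cD[OF subset_refl, of u "A + 1"] NU unfolding NU'_def by linarith
  qed
  have bigV: "card {f\<in>F. y f \<le> A} \<le> v + c + 2 * (A + 1 - v)" if "A < s" for A
  proof -
    have "{f\<in>F. y f \<le> A} \<subseteq> NV' \<union> {f\<in>F. \<exists>e\<in>M'. R e f \<and> v \<le> Y e \<and> Y e < A + 1}"
      using yle[OF that] V by (fastforce simp: NV'_def)
    then have "card {f\<in>F. y f \<le> A} \<le> card (NV' \<union> {f\<in>F. \<exists>e\<in>M'. R e f \<and> v \<le> Y e \<and> Y e < A + 1})"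
      using fin fN by (intro card_mono) auto
    also have "\<dots> \<le> card NV' + card {f\<in>F. \<exists>e\<in>M'. R e f \<and> v \<le> Y e \<and> Y e < A + 1}" by (rule card_Un_le)
    finally show ?thesis using cY[OF subset_refl, of v "A + 1"] NV unfolding NV'_def by linarith
  qed
  have smallD: "card {f\<in>F. d f \<le> A} \<le> 2 * (A + 1)" if "A < s" for A
    using cD[of "{f\<in>F. d f \<le> A}" 0 "A + 1"] dle[OF that] by fastforce
  have smallY: "card {f\<in>F. y f \<le> A} \<le> 2 * (A + 1)" if "A < s" for A
    using cY[of "{f\<in>F. y f \<le> A}" 0 "A + 1"] yle[OF that] by fastforce
  have mono: "card {f\<in>F. d f \<le> A \<and> y f \<le> B} \<le> card {f\<in>F. d f \<le> A}"
    "card {f\<in>F. d f \<le> A \<and> y f \<le> B} \<le> card {f\<in>F. y f \<le> B}" for A B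
    using fin by (auto intro!: card_mono)
  have jJ: "inj_on j J" "\<And>f. f \<in> J \<Longrightarrow> j f < card J" using j by (auto simp: bij_betw_def)
  have JN: "J \<subseteq> NU'" "J \<subseteq> NV'" by (auto simp: J NU'_def NV'_def)
  have idxU: "u \<le> A + 2 * (card J - j f)" if H: "A < s" "A < u" "d f \<le> A" "f \<in> J" for A f
  proof -
    have "f \<in> F" using that by (simp add: J)
    then obtain e where "e \<in> M" "R e f" "D e \<le> A" using dle H by blast
    then show ?thesis using P1[of e f] U H by fastforce
  qed
  have idxV: "v \<le> A + 2 * (j f + 1)" if H: "A < s" "A < v" "y f \<le> A" "f \<in> J" for A f
  proof -
    have "f \<in> F" using that by (simp add: J)
    then obtain e where "e \<in> M'" "R e f" "Y e \<le> A" using yle H by blast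
    then show ?thesis using P2[of e f] V H by fastforce
  qed
  have "\<exists>z. bij_betw z F {..<n} \<and> (\<forall>f\<in>F. s \<le> z f + 1 + d f \<and> z f + s \<le> n + y f)"
  proof (rule deadline_scheduling[OF fin(3) n num(2,1)])
    show "card {f\<in>F. d f \<le> A} + s \<le> A + 1 + n" if "A < s" for A
      using smallD[OF that] bigU[OF that] num that by (cases "A < u") auto
    show "card {f\<in>F. y f \<le> A} + s \<le> A + 1 + n" if "A < s" for A
      using smallY[OF that] bigV[OF that] num that by (cases "A < v") auto
    fix A B assume AB: "A < s" "B < s" "2 * s \<le> A + B + 2 + n"
    define X where "X = {f\<in>F. d f \<le> A \<and> y f \<le> B}"
    have XF: "\<And>f. f \<in> X \<Longrightarrow> f \<in> F \<and> d f \<le> A \<and> y f \<le> B" by (simp add: X_def)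
    have Xle: "card X \<le> 2 * (A + 1)" "card X \<le> 2 * (B + 1)"
      "card X \<le> u + c + 2 * (A + 1 - u)" "card X \<le> v + c + 2 * (B + 1 - v)"
      using mono[of A B] smallD[OF AB(1)] smallY[OF AB(2)] bigU[OF AB(1)] bigV[OF AB(2)]
      unfolding X_def by linarith+
    consider "A < u" "B < v" | "A < u" "v \<le> B" | "u \<le> A" "B < v" | "u \<le> A" "v \<le> B" by linarith
    then have "card X + 2 * s \<le> A + B + 2 + n"
    proof cases
      case 1
      \<comment> \<open>The indices of the elements of \<open>X\<close> are bounded from below
        through \<open>V\<close> and from above through \<open>U\<close>. The resulting count,
        combined with \<open>u + v \<le> A + B + 2 * card J + 2\<close>, is what
        \<open>num(7)\<close> is made for.\<close>
      have XJ: "X \<subseteq> J" using inU[OF AB(1) 1(1)] inV[OF AB(2) 1(2)] XF by (fastforce simp: J NU'_def NV'_def)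
      show ?thesis
      proof (cases "X = {}")
        case True
        then show ?thesis using AB by simp
      next
        case False
        then obtain f where f: "f \<in> X" by auto
        have b: "u \<le> A + 2 * (card J - j f)" "v \<le> B + 2 * (j f + 1)" "j f < card J" if "f \<in> X" for f
          using idxU[OF AB(1) 1(1)] idxV[OF AB(2) 1(2)] jJ XF XJ that by blast+
        have "card X \<le> (Suc (card J) - (u - A + 1) div 2) - ((v - B + 1) div 2 - 1)"
        proof (rule card_slot_range[OF jJ(1)])
          show "X \<subseteq> {x\<in>J. (v - B + 1) div 2 - 1 \<le> j x \<and> j x < Suc (card J) - (u - A + 1) div 2}"
          proof
            fix x assume x: "x \<in> X"
            have "v - B + 1 \<le> 2 * (j x + 1) + 1" using b(2)[OF x] by linarith
            then have "(v - B + 1) div 2 - 1 \<le> j x" by presburger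
            moreover have "u - A + 1 \<le> 2 * (card J - j x) + 1" using b(1)[OF x] by linarith
            then have "(u - A + 1) div 2 \<le> card J - j x" by presburger
            then have "j x < Suc (card J) - (u - A + 1) div 2" using b(3)[OF x] by arith
            ultimately show "x \<in> {x\<in>J. (v - B + 1) div 2 - 1 \<le> j x \<and> j x < Suc (card J) - (u - A + 1) div 2}"
              using x XJ by auto
          qed
        qed
        moreover have "u \<le> A + 2 * card J" using b(1)[OF f] by linarith
        moreover obtain k where k: "card J = j f + k" using b(3)[OF f] by (metis less_imp_add_positive)
        have "u \<le> A + 2 * k" using b(1)[OF f] k by simp
        then have uv: "u + v \<le> A + B + 2 * card J + 2" using b(2)[OF f] k by simp
        ultimately have "2 * card X + u + v \<le> 2 * card J + 4 + A + B" using 1 by arith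
        then show ?thesis using num(7) uv by linarith
      qed
    next
      case 2
      have "X - J \<subseteq> {f\<in>F. \<exists>e\<in>M'. R e f \<and> v \<le> Y e \<and> Y e < B + 1}"
      proof
        fix f assume f: "f \<in> X - J"
        then have fF: "f \<in> F" "d f \<le> A" "y f \<le> B" using XF by auto
        have "f \<notin> NV'" using f inU[OF AB(1) 2(1) fF(2,1)] fF by (auto simp: J NU'_def NV'_def)
        moreover obtain e where "e \<in> M'" "R e f" "Y e \<le> B" using yle[OF AB(2)] fF by blast
        ultimately show "f \<in> {f\<in>F. \<exists>e\<in>M'. R e f \<and> v \<le> Y e \<and> Y e < B + 1}"
          using fF V by (force simp: NV'_def)
      qed
      then have k: "card (X - J) \<le> 2 * (B + 1 - v)" by (rule cY)
      have "card X + 2 * s \<le> A + (B + 1 - v) + v + 1 + n"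
      proof (rule mixed_deadline_count[where N = NU' and J = J and i = j and A = A and u = u and c = c])
        show "X \<subseteq> NU'" using inU[OF AB(1) 2(1)] XF by blast
        show "j f < card J \<and> u \<le> A + 2 * (card J - j f)" if "f \<in> J" "f \<in> X" for f
          using that jJ(2) idxU[OF AB(1) 2(1)] XF by blast
        show "2 * s \<le> v + n" using num by linarith
      qed (use k fN Xle JN jJ(1) NU num(8) 2 in \<open>simp_all add: NU'_def\<close>)
      then show ?thesis using 2 by simp
    next
      case 3
      have "X - J \<subseteq> {f\<in>F. \<exists>e\<in>M. R e f \<and> u \<le> D e \<and> D e < A + 1}"
      proof
        fix f assume f: "f \<in> X - J"
        then have fF: "f \<in> F" "d f \<le> A" "y f \<le> B" using XF by auto
        have "f \<notin> NU'" using f inV[OF AB(2) 3(2) fF(3,1)] fF by (auto simp: J NU'_def NV'_def)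
        moreover obtain e where "e \<in> M" "R e f" "D e \<le> A" using dle[OF AB(1)] fF by blast
        ultimately show "f \<in> {f\<in>F. \<exists>e\<in>M. R e f \<and> u \<le> D e \<and> D e < A + 1}"
          using fF U by (force simp: NU'_def)
      qed
      then have k: "card (X - J) \<le> 2 * (A + 1 - u)" by (rule cD)
      have "card X + 2 * s \<le> B + (A + 1 - u) + u + 1 + n"
      proof (rule mixed_deadline_count[where N = NV' and J = J and i = "\<lambda>f. card J - 1 - j f" and A = B and u = v and c = c])
        show "X \<subseteq> NV'" using inV[OF AB(2) 3(2)] XF by blast
        show "card J - 1 - j f < card J \<and> v \<le> B + 2 * (card J - (card J - 1 - j f))" if "f \<in> J" "f \<in> X" for f
        proof -
          have "v \<le> B + 2 * (j f + 1)" using idxV[OF AB(2) 3(2)] XF that by blast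
          moreover have "card J - (card J - 1 - j f) = j f + 1" using jJ(2)[OF that(1)] by simp
          ultimately show ?thesis using jJ(2)[OF that(1)] by simp
        qed
        show "2 * s \<le> u + n" using num by linarith
        show "inj_on (\<lambda>f. card J - 1 - j f) J"
        proof (rule inj_onI)
          fix x y assume H: "x \<in> J" "y \<in> J" "card J - 1 - j x = card J - 1 - j y"
          then have "j x = j y" using jJ(2)[OF H(1)] jJ(2)[OF H(2)] by linarith
          then show "x = y" using jJ(1) H by (simp add: inj_on_def)
        qed
      qed (use k fN Xle JN NV num(9) 3 in \<open>simp_all add: NV'_def\<close>)
      then show ?thesis using 3 by simp
    next
      case 4
      then show ?thesis using Xle num by linarith
    qed
    then show "card {f\<in>F. d f \<le> A \<and> y f \<le> B} + 2 * s \<le> A + B + 2 + n" by (simp add: X_def)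
  qed
  then obtain z where z: "bij_betw z F {..<n}" "\<And>f. f \<in> F \<Longrightarrow> s \<le> z f + 1 + d f \<and> z f + s \<le> n + y f" by blast
  have "d f \<le> D e" if "e \<in> M" "R e f" for e f unfolding d_def using fin that by (intro Min_le) auto
  moreover have "y f \<le> Y e" if "e \<in> M'" "R e f" for e f unfolding y_def using fin that by (intro Min_le) auto
  ultimately show ?thesis using z by (intro exI[of _ z]) (meson add_le_mono le_refl order.trans)
qed

lemma bij_betw_append:
  fixes f g :: "'a \<Rightarrow> nat"
  assumes "bij_betw f A {..<a}" "bij_betw g B {..<b}" "A \<inter> B = {}"
  shows "bij_betw (\<lambda>e. if e \<in> B then a + g e else f e) (A \<union> B) {..<a + b}"
proof -
  define H where "H e = (if e \<in> B then a + g e else f e)" for e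
  have 1: "bij_betw H A {..<a}"
    using assms(1,3) by (subst bij_betw_cong[of A _ f]) (auto simp: H_def)
  have 2: "bij_betw H B {a..<a + b}"
  proof (rule bij_betw_imageI)
    show "inj_on H B" using assms(2) by (auto simp: bij_betw_def inj_on_def H_def)
    have "H ` B = (+) a ` g ` B" by (auto simp: image_image H_def)
    also have "\<dots> = {a..<a + b}"
      using assms(2) image_add_atLeastLessThan[of a 0 b] by (simp add: bij_betw_def lessThan_atLeast0 add.commute)
    finally show "H ` B = {a..<a + b}" .
  qed
  have "{..<a} \<union> {a..<a + b} = {..<a + b}" "{..<a} \<inter> {a..<a + b} = {}" by auto
  then show ?thesis using bij_betw_combine[OF 1 2] unfolding H_def[abs_def] by simp
qed

lemma bij_betw_reverse:
  fixes f :: "'a \<Rightarrow> nat"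
  assumes "bij_betw f A {..<n}"
  shows "bij_betw (\<lambda>e. n - 1 - f e) A {..<n}"
proof -
  have "bij_betw (\<lambda>i. n - 1 - i) {..<n} {..<n}"
    by (rule bij_betw_byWitness[where f' = "\<lambda>i. n - 1 - i"]) auto
  then show ?thesis using bij_betw_trans[OF assms] by (simp add: comp_def)
qed

text \<open>The list is \<open>M - U\<close>, \<open>U\<close>, \<open>V\<close>,
  \<open>M' - V\<close>. Between \<open>U\<close> and \<open>V\<close> there are no adjacencies, and
  \<open>M - U\<close> and \<open>M' - V\<close> are separated by both ends together. An element of
  \<open>U\<close> and its neighbour beyond \<open>V\<close> are kept apart by sorting
  \<open>U\<close> by lowest neighbour, which works because these neighbours are sparse in prefixes;
  \<open>V\<close> is sorted likewise and then reversed.\<close>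

lemma opposite_end_orders:
  fixes R :: "'a \<Rightarrow> 'a \<Rightarrow> bool"
  assumes fin: "finite M" "finite M'" and UV: "U \<subseteq> M" "V \<subseteq> M'" and c: "card U = u" "card V = v"
    and deg: "\<And>e. e \<in> M \<Longrightarrow> card {g\<in>M'. R e g} \<le> 2" "\<And>g. g \<in> M' \<Longrightarrow> card {e\<in>M. R e g} \<le> 2"
    and non: "\<And>e g. e \<in> U \<Longrightarrow> g \<in> V \<Longrightarrow> \<not> R e g"
    and \<beta>: "\<And>e. e \<in> M - U \<Longrightarrow> \<beta> e < p"
    and a: "\<And>t. t \<le> h \<Longrightarrow> 2 * card {f\<in>{f\<in>M' - V. \<exists>e\<in>U. R e f}. \<alpha> f < t} \<le> t + \<epsilon>"
    and b: "\<And>t. t \<le> h \<Longrightarrow> 2 * card {e\<in>{e\<in>M - U. \<exists>f\<in>V. R e f}. p \<le> \<beta> e + t} \<le> t + \<epsilon>"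
    and num: "u \<le> h + \<epsilon> + 1" "v \<le> h + \<epsilon> + 1" "s + \<epsilon> \<le> u + v"
  shows "\<exists>x y. bij_betw x U {..<u} \<and> bij_betw y V {..<v} \<and> (\<forall>e\<in>M. \<forall>f\<in>M'. R e f \<longrightarrow>
    s + (if e \<in> U then p + x e else \<beta> e) \<le> p + u + (if f \<in> V then y f else v + \<alpha> f))"
proof -
  define a where "a = {f\<in>M' - V. \<exists>e\<in>U. R e f}"
  define b where "b = {e\<in>M - U. \<exists>f\<in>V. R e f}"
  have f: "finite U" "finite V" "finite a" "finite b" using fin UV by (auto intro: finite_subset simp: a_def b_def)
  have "\<exists>x. bij_betw x U {..<card U} \<and> (\<forall>e\<in>U. \<forall>f\<in>a. R e f \<longrightarrow> x e \<le> \<alpha> f + \<epsilon>)"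
  proof (rule sort_by_lowest_neighbour[OF f(1,3)])
    show "card {e\<in>U. R e f} \<le> 2" if "f \<in> a" for f
      using deg(2)[of f] that UV card_mono[of "{e\<in>M. R e f}" "{e\<in>U. R e f}"] fin by (fastforce simp: a_def)
  qed (use assms in \<open>auto simp: a_def\<close>)
  then obtain x where x: "bij_betw x U {..<u}" "\<And>e f. e \<in> U \<Longrightarrow> f \<in> a \<Longrightarrow> R e f \<Longrightarrow> x e \<le> \<alpha> f + \<epsilon>"
    using c by auto
  have "\<exists>y. bij_betw y V {..<card V} \<and> (\<forall>e\<in>V. \<forall>f\<in>b. R f e \<longrightarrow> y e \<le> p - 1 - \<beta> f + \<epsilon>)"
  proof (rule sort_by_lowest_neighbour[OF f(2,4)])
    show "card {e\<in>V. R f e} \<le> 2" if "f \<in> b" for f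
      using deg(1)[of f] that UV card_mono[of "{e\<in>M'. R f e}" "{e\<in>V. R f e}"] fin by (fastforce simp: b_def)
    show "2 * card {f\<in>b. p - 1 - \<beta> f < t} \<le> t + \<epsilon>" if "t \<le> h" for t
    proof -
      have "{f\<in>b. p - 1 - \<beta> f < t} \<subseteq> {f\<in>b. p \<le> \<beta> f + t}" by auto
      then have "card {f\<in>b. p - 1 - \<beta> f < t} \<le> card {f\<in>b. p \<le> \<beta> f + t}" using f by (intro card_mono) auto
      then show ?thesis using b[OF that] by (simp add: b_def)
    qed
  qed (use assms in auto)
  then obtain y where y: "bij_betw y V {..<v}" "\<And>e f. e \<in> V \<Longrightarrow> f \<in> b \<Longrightarrow> R f e \<Longrightarrow> y e \<le> p - 1 - \<beta> f + \<epsilon>"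
    using c by auto
  have "s + (if e \<in> U then p + x e else \<beta> e) \<le> p + u + (if f \<in> V then v - 1 - y f else v + \<alpha> f)"
    if ef: "e \<in> M" "f \<in> M'" "R e f" for e f
  proof (cases "e \<in> U"; cases "f \<in> V")
    assume "e \<in> U" "f \<in> V"
    then show ?thesis using non ef by blast
  next
    assume H: "e \<in> U" "f \<notin> V"
    then have "f \<in> a" using ef by (auto simp: a_def)
    then show ?thesis using x(2)[OF H(1) _ ef(3)] H num by simp
  next
    assume H: "e \<notin> U" "f \<in> V"
    then have "e \<in> b" using ef by (auto simp: b_def)
    then have "y f \<le> p - 1 - \<beta> e + \<epsilon>" using y(2)[OF H(2) _ ef(3)] by simp
    moreover have "y f < v" "\<beta> e < p" using y(1) H ef \<beta> by (auto simp: bij_betw_def)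
    ultimately show ?thesis using H num by simp
  next
    assume H: "e \<notin> U" "f \<notin> V"
    then have "\<beta> e < p" using ef \<beta> by auto
    then show ?thesis using H num by simp
  qed
  then show ?thesis using x(1) bij_betw_reverse[OF y(1)] by blast
qed

text \<open>\<open>U\<close> is sorted by an index on \<open>J\<close> and \<open>V\<close> by the
  reversed index, so that a near neighbour on one side is paid for by a far one on the other. The
  orders of both ends are fixed before \<open>\<alpha>\<close> and \<open>\<beta>\<close> are known;
  only the order of \<open>F\<close> depends on them.\<close>

lemma free_class_orders:
  fixes R :: "'a \<Rightarrow> 'a \<Rightarrow> bool"
  assumes fin: "finite M" "finite M'" "finite F" and n: "card F = n"
    and dM: "\<And>e. e \<in> M \<Longrightarrow> card {f\<in>F. R e f} \<le> 2" "\<And>e. e \<in> M' \<Longrightarrow> card {f\<in>F. R e f} \<le> 2"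
    and dF: "\<And>f. f \<in> F \<Longrightarrow> card {e\<in>M. R e f} \<le> 2" "\<And>f. f \<in> F \<Longrightarrow> card {e\<in>M'. R e f} \<le> 2"
    and UV: "U \<subseteq> M" "V \<subseteq> M'" and cUV: "card U = u" "card V = v"
    and NU: "card {f\<in>F. \<exists>e\<in>U. R e f} \<le> u + c" and NV: "card {f\<in>F. \<exists>e\<in>V. R e f} \<le> v + c"
    and J: "card {f\<in>F. (\<exists>e\<in>U. R e f) \<and> (\<exists>e\<in>V. R e f)} = \<iota>"
    and num: "0 < s" "s \<le> n" "u + s \<le> n" "v + s \<le> n" "c + 2 * s \<le> u + n" "c + 2 * s \<le> v + n"
      "2 * \<iota> + 1 + 2 * s \<le> u + v + n" "3 * \<iota> + c + 4 * s \<le> u + 2 * v + 2 * n"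
      "3 * \<iota> + c + 4 * s \<le> v + 2 * u + 2 * n"
  shows "\<exists>x y. bij_betw x U {..<u} \<and> bij_betw y V {..<v} \<and> (\<forall>\<alpha> \<beta>.
    bij_betw \<beta> (M - U) {..<p} \<longrightarrow> bij_betw \<alpha> (M' - V) {..<p} \<longrightarrow>
    (\<exists>z. bij_betw z F {..<n}
      \<and> (\<forall>e\<in>M. \<forall>f\<in>F. R e f \<longrightarrow> s + (if e \<in> U then p + x e else \<beta> e) \<le> p + u + z f)
      \<and> (\<forall>f\<in>F. \<forall>e\<in>M'. R e f \<longrightarrow> s + z f \<le> n + (if e \<in> V then y e else v + \<alpha> e))))"
proof -
  define J where "J = {f\<in>F. (\<exists>e\<in>U. R e f) \<and> (\<exists>e\<in>V. R e f)}"
  have f: "finite U" "finite V" "finite J" using fin UV by (auto intro: finite_subset simp: J_def)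
  have cJ: "card J = \<iota>" using assms by (simp add: J_def)
  obtain j :: "'a \<Rightarrow> nat" where j: "bij_betw j J {..<\<iota>}"
    using ex_bij_betw_finite_nat[OF f(3)] cJ by (auto simp: lessThan_atLeast0)
  have "\<exists>x. bij_betw x U {..<card U} \<and> (\<forall>e\<in>U. \<forall>f\<in>J. R e f \<longrightarrow> card U \<le> x e + 2 * (card J - j f))"
  proof (rule sort_by_index[OF f(1,3)])
    show "card {e\<in>U. R e f} \<le> 2" if "f \<in> J" for f
      using dF(1)[of f] that UV card_mono[of "{e\<in>M. R e f}" "{e\<in>U. R e f}"] fin by (fastforce simp: J_def)
  qed (use j cJ in simp)
  then obtain x where x: "bij_betw x U {..<u}" "\<And>e f. e \<in> U \<Longrightarrow> f \<in> J \<Longrightarrow> R e f \<Longrightarrow> u \<le> x e + 2 * (\<iota> - j f)"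
    using cUV cJ by auto
  have "\<exists>y. bij_betw y V {..<card V} \<and> (\<forall>e\<in>V. \<forall>f\<in>J. R e f \<longrightarrow> card V \<le> y e + 2 * (card J - (\<iota> - 1 - j f)))"
  proof (rule sort_by_index[OF f(2,3)])
    show "card {e\<in>V. R e f} \<le> 2" if "f \<in> J" for f
      using dF(2)[of f] that UV card_mono[of "{e\<in>M'. R e f}" "{e\<in>V. R e f}"] fin by (fastforce simp: J_def)
  qed (use bij_betw_reverse[OF j] cJ in simp)
  then obtain y where y: "bij_betw y V {..<v}" "\<And>e f. e \<in> V \<Longrightarrow> f \<in> J \<Longrightarrow> R e f \<Longrightarrow> v \<le> y e + 2 * (\<iota> - (\<iota> - 1 - j f))"
    using cUV cJ by auto
  define x' where "x' e = u - 1 - x e" for e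
  have x': "bij_betw x' U {..<u}" unfolding x'_def[abs_def] by (rule bij_betw_reverse[OF x(1)])
  have "\<exists>z. bij_betw z F {..<n}
      \<and> (\<forall>e\<in>M. \<forall>f\<in>F. R e f \<longrightarrow> s + (if e \<in> U then p + x' e else \<beta> e) \<le> p + u + z f)
      \<and> (\<forall>f\<in>F. \<forall>e\<in>M'. R e f \<longrightarrow> s + z f \<le> n + (if e \<in> V then y e else v + \<alpha> e))"
    if \<beta>: "bij_betw \<beta> (M - U) {..<p}" and \<alpha>: "bij_betw \<alpha> (M' - V) {..<p}" for \<alpha> \<beta>
  proof -
    define P where "P e = (if e \<in> U then p + x' e else \<beta> e)" for e
    define D where "D e = p + u - 1 - P e" for e
    define Y where "Y e = (if e \<in> V then y e else v + \<alpha> e)" for e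
    have MU: "(M - U) \<union> U = M" "(M - U) \<inter> U = {}" "V \<union> (M' - V) = M'" "V \<inter> (M' - V) = {}" using UV by auto
    have bP: "bij_betw P M {..<p + u}"
      using bij_betw_append[OF \<beta> x' MU(2)] MU(1) by (simp add: P_def[abs_def])
    have bD: "bij_betw D M {..<p + u}" unfolding D_def[abs_def] by (rule bij_betw_reverse[OF bP])
    have bY: "bij_betw Y M' {..<v + p}"
    proof -
      have "bij_betw (\<lambda>e. if e \<in> M' - V then v + \<alpha> e else y e) M' {..<v + p}"
        using bij_betw_append[OF y(1) \<alpha> MU(4)] MU(3) by simp
      then show ?thesis by (subst bij_betw_cong[where g = "\<lambda>e. if e \<in> M' - V then v + \<alpha> e else y e"]) (auto simp: Y_def)
    qed
    have xr: "x e < u" if "e \<in> U" for e using x(1) that by (auto simp: bij_betw_def)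
    have yr: "y e < v" if "e \<in> V" for e using y(1) that by (auto simp: bij_betw_def)
    have DU: "D e = x e" if "e \<in> U" for e using xr[OF that] that by (simp add: D_def P_def x'_def)
    have "\<exists>z. bij_betw z F {..<n} \<and> (\<forall>e\<in>M. \<forall>f\<in>F. R e f \<longrightarrow> s \<le> z f + 1 + D e)
      \<and> (\<forall>e\<in>M'. \<forall>f\<in>F. R e f \<longrightarrow> z f + s \<le> n + Y e)"
    proof (rule free_class_scheduling[OF fin n dM _ _ _ _ UV NU NV J_def])
      show "inj_on D M" "inj_on Y M'" using bD bY by (auto simp: bij_betw_def)
      show "e \<in> U \<longleftrightarrow> D e < u" if "e \<in> M" for e
      proof (cases "e \<in> U")
        case False
        then have "\<beta> e < p" using \<beta> that by (auto simp: bij_betw_def)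
        then show ?thesis using False by (simp add: D_def P_def)
      qed (use DU xr in auto)
      show "e \<in> V \<longleftrightarrow> Y e < v" if "e \<in> M'" for e using yr by (auto simp: Y_def)
      show "bij_betw j J {..<card J}" using j cJ by simp
      show "u \<le> D e + 2 * (card J - j f)" if "e \<in> U" "f \<in> J" "R e f" for e f
        using x(2)[OF that] DU[OF that(1)] cJ by simp
      show "v \<le> Y e + 2 * (j f + 1)" if "e \<in> V" "f \<in> J" "R e f" for e f
      proof -
        have "j f < \<iota>" using j that by (auto simp: bij_betw_def)
        then have "\<iota> - (\<iota> - 1 - j f) = j f + 1" by simp
        then show ?thesis using y(2)[OF that] that(1) by (simp add: Y_def)
      qed
    qed (use num cJ in simp_all)
    then obtain z where z: "bij_betw z F {..<n}" "\<And>e f. e \<in> M \<Longrightarrow> f \<in> F \<Longrightarrow> R e f \<Longrightarrow> s \<le> z f + 1 + D e"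
      "\<And>e f. e \<in> M' \<Longrightarrow> f \<in> F \<Longrightarrow> R e f \<Longrightarrow> z f + s \<le> n + Y e" by blast
    have "s + P e \<le> p + u + z f" if "e \<in> M" "f \<in> F" "R e f" for e f
    proof -
      have "P e < p + u" using bP that by (auto simp: bij_betw_def)
      then show ?thesis using z(2)[OF that] by (simp add: D_def)
    qed
    moreover have "s + z f \<le> n + Y e" if "e \<in> M'" "f \<in> F" "R e f" for e f using z(3)[OF that] by simp
    ultimately show ?thesis using z(1) unfolding P_def Y_def by blast
  qed
  then show ?thesis using x' y(1) by blast
qed

text \<open>An even class is split as \<open>V\<close> followed by \<open>P\<close>, an odd class as \<open>Q\<close> followed by \<open>U\<close>.
  The large parts \<open>P\<close>, \<open>Q\<close> of classes \<open>2 i\<close> and \<open>2 i + 1\<close> are numbered by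
  \<open>two_sided_pairing\<close>; the small parts \<open>U\<close>, \<open>V\<close> of classes \<open>2 i + 1\<close> and \<open>2 i + 2\<close> are chosen
  nonadjacent. If \<open>K\<close> is odd, the last class is ordered afterwards, between one \<open>U\<close> and one \<open>V\<close>.\<close>

lemma many_class_positions:
  fixes M :: "nat \<Rightarrow> 'a set" and R :: "'a \<Rightarrow> 'a \<Rightarrow> bool"
  assumes K: "4 \<le> K" and sym: "\<And>e g. R e g \<Longrightarrow> R g e"
    and fin: "\<And>i. i < K \<Longrightarrow> finite (M i)"
    and size: "\<And>i. i < K \<Longrightarrow> card (M i) = q \<or> card (M i) = q + 1"
    and deg: "\<And>i j e. i < K \<Longrightarrow> j < K \<Longrightarrow> i \<noteq> j \<Longrightarrow> e \<in> M i \<Longrightarrow> card {g\<in>M j. R e g} \<le> 2"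
    and num: "3 * s + 14 \<le> 2 * q" "2 * q \<le> 3 * s + 16" "0 < s"
  shows "\<exists>pos. \<forall>i<K. bij_betw (pos i) (M i) {..<card (M i)}
    \<and> (\<forall>e\<in>M i. \<forall>g\<in>M ((i + 1) mod K). R e g \<longrightarrow> s + pos i e \<le> card (M i) + pos ((i + 1) mod K) g)"
proof -
  have deg': "card {e\<in>M j. R e g} \<le> 2" if "i < K" "j < K" "i \<noteq> j" "g \<in> M i" for i j g
  proof -
    have "{e\<in>M j. R e g} = {e\<in>M j. R g e}" using sym by blast
    then show ?thesis using deg[OF that] by simp
  qed
  \<comment> \<open>\<open>p\<close> is the size of the large parts; it is even for the sake of
    \<open>two_sided_pairing\<close> and at least \<open>s + 5\<close>, where 5 is the loss there.
    The small parts have size \<open>z\<close> or \<open>z + 1\<close>, and two of them make up for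
    \<open>s + \<epsilon>\<close>. The requirement \<open>z + 3 \<le> h + \<epsilon>\<close> forces
    \<open>z\<close> to be about \<open>s / 2\<close>, hence \<open>q\<close> about
    \<open>3 * s / 2\<close>.\<close>
  define h where "h = (s + 6) div 2"
  define p where "p = 2 * h"
  define z where "z = q - p"
  define \<epsilon> where "\<epsilon> = 2 * z - s"
  have p: "s + 5 \<le> p" "p \<le> s + 6" unfolding p_def h_def by linarith+
  have zp: "z + p = q" using p num by (simp add: z_def)
  have eps: "s + \<epsilon> = 2 * z" using p num zp by (simp add: \<epsilon>_def)
  have ar: "z + 3 \<le> h + \<epsilon>" "z + 2 \<le> p" "2 * z + 3 \<le> q" "z + 1 \<le> h + \<epsilon> + 1"
    using p num zp eps unfolding p_def by linarith+
  \<comment> \<open>The classes below the even number \<open>K'\<close> are joined in pairs of large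
    parts; \<open>nx\<close> and \<open>pv\<close> are their cyclic neighbours. \<open>sp i\<close>
    marks the gap that receives the last class \<open>F\<close> if \<open>K\<close> is odd.\<close>
  define K' where "K' = 2 * (K div 2)"
  have K': "even K'" "4 \<le> K'" "K' \<le> K" "odd K \<Longrightarrow> K = K' + 1" "even K \<Longrightarrow> K = K'"
    using K by (auto simp: K'_def elim!: oddE)
  define nx where "nx i = (if i + 1 = K' then 0 else i + 1)" for i
  define pv where "pv i = (if i = 0 then K' - 1 else i - 1)" for i
  define sp where "sp i \<longleftrightarrow> odd K \<and> i + 1 = K'" for i
  have nx: "nx i < K'" "nx i \<noteq> i" "even (nx i)" "pv (nx i) = i" if "odd i" "i < K'" for i
    using that K' by (auto simp: nx_def pv_def)
  have pv: "pv i < K'" "odd (pv i)" "nx (pv i) = i" if "even i" "i < K'" for i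
    using that K' by (auto simp: nx_def pv_def elim!: evenE)
  have finK: "finite (M i)" if "i < K'" for i using fin K' that by simp
  have szK: "card (M i) = q \<or> card (M i) = q + 1" if "i < K'" for i using size K' that by simp
  define F where "F = M (K - 1)"
  have F: "finite F" "card F = q \<or> card F = q + 1" using fin size K by (auto simp: F_def)
  \<comment> \<open>The demands on the small parts at the gap after an odd class. At an ordinary gap
    they are nonadjacent and have small neighbourhoods; at the special gap they face
    \<open>F\<close> instead, and few members of \<open>F\<close> may be adjacent to both.\<close>
  define EP where "EP i U V \<longleftrightarrow> U \<subseteq> M i \<and> V \<subseteq> M (nx i) \<and> card U + p = card (M i) \<and> card V + p = card (M (nx i))
    \<and> (if sp i then card {f\<in>F. \<exists>e\<in>U. R e f} \<le> card U + 3 \<and> card {f\<in>F. \<exists>e\<in>V. R e f} \<le> card V + 3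
         \<and> 3 * card {f\<in>F. (\<exists>e\<in>U. R e f) \<and> (\<exists>e\<in>V. R e f)} \<le> z + 12
       else (\<forall>e\<in>U. \<forall>g\<in>V. \<not> R e g) \<and> card {g\<in>M (nx i). \<exists>e\<in>U. R e g} \<le> z + 2
         \<and> card {e\<in>M i. \<exists>g\<in>V. R e g} \<le> z + 2)" for i U V
  have "\<exists>U V. EP i U V" if i: "odd i" "i < K'" for i
  proof -
    have j: "nx i < K'" "nx i \<noteq> i" using nx i by auto
    have iK: "i < K" "nx i < K" using i j K' by auto
    define u where "u = card (M i) - p"
    define v where "v = card (M (nx i)) - p"
    have u: "u + p = card (M i)" "u = z \<or> u = z + 1" and v: "v + p = card (M (nx i))" "v = z \<or> v = z + 1"
      using szK[OF i(2)] szK[OF j(1)] zp by (auto simp: u_def v_def)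
    show ?thesis
    proof (cases "sp i")
      case False
      define L where "L = min (card (M i)) (card (M (nx i)))"
      have "\<exists>U V. U \<subseteq> M i \<and> V \<subseteq> M (nx i) \<and> card U = u \<and> card V = v \<and> (\<forall>e\<in>U. \<forall>g\<in>V. \<not> R e g)
        \<and> card {g\<in>M (nx i). \<exists>e\<in>U. R e g} \<le> u + 1 + (card (M (nx i)) - L) \<and> card {e\<in>M i. \<exists>g\<in>V. R e g} \<le> v + 1 + (card (M i) - L)"
      proof (rule nonadjacent_ends[OF finK[OF i(2)] finK[OF j(1)] _ _ L_def])
        show "u + v < L" using u v ar zp by (auto simp: L_def)
      qed (use deg[OF iK] deg'[OF iK(2,1)] j in auto)
      then obtain U V where UV: "U \<subseteq> M i" "V \<subseteq> M (nx i)" "card U = u" "card V = v" "\<forall>e\<in>U. \<forall>g\<in>V. \<not> R e g"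
        "card {g\<in>M (nx i). \<exists>e\<in>U. R e g} \<le> u + 1 + (card (M (nx i)) - L)" "card {e\<in>M i. \<exists>g\<in>V. R e g} \<le> v + 1 + (card (M i) - L)"
        by blast
      have "u + 1 + (card (M (nx i)) - L) \<le> z + 2" "v + 1 + (card (M i) - L) \<le> z + 2"
        using u v zp by (auto simp: L_def min_def)
      then have "EP i U V" using UV u v False by (simp add: EP_def)
      then show ?thesis by blast
    next
      case True
      then have KF: "K - 1 < K" "i \<noteq> K - 1" "nx i \<noteq> K - 1" using K K' i j by (auto simp: sp_def)
      define L where "L = min (card (M i)) (card F)"
      define L' where "L' = min (card (M (nx i))) (card F)"
      \<comment> \<open>As \<open>3 * z \<le> q + 1\<close>, the spacing
        \<open>(L' - v) div 2\<close> is about \<open>v\<close> or more, so the three ranges in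
        \<open>free_class_ends\<close> hardly overlap; 12 collects the remaining losses.\<close>
      have "u + 1 + (card F - L) + 2 * (v + 2 - (L' - v) div 2) + 2 * (card F - L') \<le> z + 12"
      proof -
        have "u + (card F - L) \<le> z + 1" using u zp F(2) by (auto simp: L_def min_def)
        moreover have "2 * (v + 2 - (L' - v) div 2) + 2 * (card F - L') \<le> 10"
        proof -
          have "4 * p + 2 * 3 \<ge> 3 * z + p + z" using p num zp by linarith
          have "v + 3 * 1 + 1 \<le> z + 5" using v by auto
          consider "v = z" "L' = q" "card F - L' \<le> 1" | "v = z + 1" "L' \<ge> q" "card F - L' = 0"
            using v zp F(2) by (auto simp: L'_def min_def)
          then show ?thesis
          proof cases
            case 1
            have "3 * z \<le> q + 1" using p num zp by linarith
            then have "v + 2 - (L' - v) div 2 \<le> 4" using 1 by linarith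
            then show ?thesis using 1 by linarith
          next
            case 2
            have "3 * z \<le> q + 1" using p num zp by linarith
            then have "v + 2 - (L' - v) div 2 \<le> 5" using 2 by linarith
            then show ?thesis using 2 by linarith
          qed
        qed
        ultimately show ?thesis by linarith
      qed
      then have "\<exists>U V. U \<subseteq> M i \<and> V \<subseteq> M (nx i) \<and> card U = u \<and> card V = v
        \<and> card {f\<in>F. \<exists>e\<in>U. R e f} \<le> u + 1 + (card F - L)
        \<and> card {f\<in>F. \<exists>e\<in>V. R e f} \<le> v + 2 + (card F - L')
        \<and> 3 * card {f\<in>F. (\<exists>e\<in>U. R e f) \<and> (\<exists>e\<in>V. R e f)} \<le> z + 12"
      proof (intro free_class_ends[OF finK[OF i(2)] finK[OF j(1)] F(1) _ _ _ L_def L'_def])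
        show "card {f\<in>F. R e f} \<le> 2" if "e \<in> M i \<union> M (nx i)" for e
          using that deg[OF iK(1) KF(1,2)] deg[OF iK(2) KF(1,3)] by (auto simp: F_def)
        show "card {e\<in>M i. R e f} \<le> 2" "card {e\<in>M (nx i). R e f} \<le> 2" if "f \<in> F" for f
          using that deg'[OF KF(1) iK(1)] deg'[OF KF(1) iK(2)] KF by (auto simp: F_def)
        show "u \<le> L" "v \<le> L'" using u v ar zp F(2) by (auto simp: L_def L'_def)
      qed
      then obtain U V where UV: "U \<subseteq> M i" "V \<subseteq> M (nx i)" "card U = u" "card V = v"
        "card {f\<in>F. \<exists>e\<in>U. R e f} \<le> u + 1 + (card F - L)"
        "card {f\<in>F. \<exists>e\<in>V. R e f} \<le> v + 2 + (card F - L')"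
        "3 * card {f\<in>F. (\<exists>e\<in>U. R e f) \<and> (\<exists>e\<in>V. R e f)} \<le> z + 12" by blast
      have "card F - L \<le> 1" "card F - L' \<le> 1" using u v zp F(2) by (auto simp: L_def L'_def min_def)
      then have "EP i U V" using UV u v True by (simp add: EP_def)
      then show ?thesis by blast
    qed
  qed
  then have "\<forall>i. \<exists>U V. odd i \<and> i < K' \<longrightarrow> EP i U V" by blast
  then obtain UU VV where "\<forall>i. odd i \<and> i < K' \<longrightarrow> EP i (UU i) (VV i)" by metis
  then have EP: "EP i (UU i) (VV i)" if "odd i" "i < K'" for i using that by blast
  have sub: "UU i \<subseteq> M i" "VV i \<subseteq> M (nx i)" "card (UU i) + p = card (M i)" "card (VV i) + p = card (M (nx i))"
    if "odd i" "i < K'" for i using EP[OF that] by (auto simp: EP_def)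
  have csz: "z \<le> card (UU i)" "card (UU i) \<le> z + 1" "z \<le> card (VV i)" "card (VV i) \<le> z + 1" if "odd i" "i < K'" for i
    using sub(3,4)[OF that] szK[OF that(2)] szK[OF nx(1)[OF that]] zp by auto
  \<comment> \<open>At the special gap no sparsity is demanded, because the whole class
    \<open>F\<close> separates the two classes there.\<close>
  define RP where "RP i \<alpha> \<beta> \<longleftrightarrow> bij_betw \<alpha> (M i - VV (pv i)) {..<p} \<and> bij_betw \<beta> (M (i + 1) - UU (i + 1)) {..<p}
    \<and> (\<forall>e\<in>M i - VV (pv i). \<forall>g\<in>M (i + 1) - UU (i + 1). R e g \<longrightarrow> \<alpha> e \<le> \<beta> g + 5)
    \<and> (\<not> sp (pv i) \<longrightarrow> (\<forall>t\<le>h. 2 * card {f\<in>{f\<in>M i - VV (pv i). \<exists>e\<in>UU (pv i). R e f}. \<alpha> f < t} \<le> t + \<epsilon>))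
    \<and> (\<not> sp (i + 1) \<longrightarrow> (\<forall>t\<le>h. 2 * card {e\<in>{e\<in>M (i + 1) - UU (i + 1). \<exists>f\<in>VV (i + 1). R e f}. p \<le> \<beta> e + t} \<le> t + \<epsilon>))"
    for i and \<alpha> \<beta> :: "'a \<Rightarrow> nat"
  have "\<exists>\<alpha> \<beta>. RP i \<alpha> \<beta>" if i: "even i" "i < K'" for i
  proof -
    define k where "k = pv i"
    have k: "odd k" "k < K'" "nx k = i" using pv[OF i] by (auto simp: k_def)
    have i1: "odd (i + 1)" "i + 1 < K'" using i K' by (auto elim!: evenE)
    have iK: "i < K" "i + 1 < K" using i1 K' by auto
    define P where "P = M i - VV k"
    define Q where "Q = M (i + 1) - UU (i + 1)"
    define a where "a = (if sp k then {} else {f\<in>P. \<exists>e\<in>UU k. R e f})"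
    define b where "b = (if sp (i + 1) then {} else {e\<in>Q. \<exists>f\<in>VV (i + 1). R e f})"
    have fPQ: "finite P" "finite Q" using finK i i1 by (auto simp: P_def Q_def)
    have cP: "card P = 2 * h"
      using sub(2,4)[OF k(1,2)] finK[OF i(2)] k(3) unfolding P_def p_def[symmetric]
      by (subst card_Diff_subset) (auto intro: finite_subset)
    have cQ: "card Q = 2 * h"
      using sub(1,3)[OF i1] finK[OF i1(2)] unfolding Q_def p_def[symmetric]
      by (subst card_Diff_subset) (auto intro: finite_subset)
    have "\<exists>\<alpha> \<beta>. bij_betw \<alpha> P {..<2 * h} \<and> bij_betw \<beta> Q {..<2 * h}
      \<and> (\<forall>e\<in>P. \<forall>g\<in>Q. R e g \<longrightarrow> \<alpha> e \<le> \<beta> g + 5)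
      \<and> (\<forall>t\<le>h. 2 * card {e\<in>a. \<alpha> e < t} \<le> t + \<epsilon>)
      \<and> (\<forall>t\<le>h. 2 * card {g\<in>b. 2 * h \<le> \<beta> g + t} \<le> t + \<epsilon>)"
    proof (rule two_sided_pairing[OF fPQ cP cQ, where L = "z + 2"])
      show "card {g\<in>Q. R e g} \<le> 2" if "e \<in> P" for e
      proof -
        have "card {g\<in>Q. R e g} \<le> card {g\<in>M (i + 1). R e g}" using finK[OF i1(2)] by (intro card_mono) (auto simp: Q_def)
        then show ?thesis using deg[OF iK, of e] that by (simp add: P_def)
      qed
      show "card {e\<in>P. R e g} \<le> 2" if "g \<in> Q" for g
      proof -
        have "card {e\<in>P. R e g} \<le> card {e\<in>M i. R e g}" using finK[OF i(2)] by (intro card_mono) (auto simp: P_def)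
        then show ?thesis using deg'[OF iK(2,1), of g] that by (simp add: Q_def)
      qed
      show "a \<subseteq> P" "b \<subseteq> Q" by (auto simp: a_def b_def)
      show "card a \<le> z + 2"
      proof (cases "sp k")
        case False
        have "card a \<le> card {g\<in>M (nx k). \<exists>e\<in>UU k. R e g}"
          using finK[OF i(2)] k(3) by (intro card_mono) (auto simp: a_def P_def)
        then show ?thesis using EP[OF k(1,2)] False by (simp add: EP_def)
      qed (simp add: a_def)
      show "card b \<le> z + 2"
      proof (cases "sp (i + 1)")
        case False
        have "card b \<le> card {e\<in>M (i + 1). \<exists>g\<in>VV (i + 1). R e g}"
          using finK[OF i1(2)] by (intro card_mono) (auto simp: b_def Q_def)
        then show ?thesis using EP[OF i1] False by (simp add: EP_def)
      qed (simp add: b_def)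
      show "z + 2 \<le> 2 * h" "z + 2 + 1 \<le> h + \<epsilon>" using ar by (simp_all add: p_def)
    qed
    then obtain \<alpha> \<beta> where ab: "bij_betw \<alpha> P {..<2 * h}" "bij_betw \<beta> Q {..<2 * h}"
      "\<forall>e\<in>P. \<forall>g\<in>Q. R e g \<longrightarrow> \<alpha> e \<le> \<beta> g + 5" "\<forall>t\<le>h. 2 * card {e\<in>a. \<alpha> e < t} \<le> t + \<epsilon>"
      "\<forall>t\<le>h. 2 * card {g\<in>b. 2 * h \<le> \<beta> g + t} \<le> t + \<epsilon>" by blast
    have "RP i \<alpha> \<beta>"
      unfolding RP_def k_def[symmetric] P_def[symmetric] Q_def[symmetric]
      using ab by (auto simp: a_def b_def p_def)
    then show ?thesis by blast
  qed
  then have "\<forall>i. \<exists>\<alpha> \<beta>. even i \<and> i < K' \<longrightarrow> RP i \<alpha> \<beta>" by blast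
  then obtain \<alpha> \<beta> where "\<forall>i. even i \<and> i < K' \<longrightarrow> RP i (\<alpha> i) (\<beta> i)" by metis
  then have RP: "RP i (\<alpha> i) (\<beta> i)" if "even i" "i < K'" for i using that by blast
  have b\<alpha>: "bij_betw (\<alpha> (nx i)) (M (nx i) - VV i) {..<p}" and b\<beta>: "bij_betw (\<beta> (i - 1)) (M i - UU i) {..<p}"
    if "odd i" "i < K'" for i
  proof -
    show "bij_betw (\<alpha> (nx i)) (M (nx i) - VV i) {..<p}"
      using RP[of "nx i"] nx[OF that] by (simp add: RP_def)
    show "bij_betw (\<beta> (i - 1)) (M i - UU i) {..<p}"
      using RP[of "i - 1"] that by (auto simp: RP_def elim!: oddE)
  qed
  define po where "po i x e = (if e \<in> UU i then p + x e else \<beta> (i - 1) e)" for i x e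
  define pe where "pe i y e = (if e \<in> VV i then y e else card (VV i) + \<alpha> (nx i) e)" for i y e
  define OP where "OP i x y \<longleftrightarrow> bij_betw x (UU i) {..<card (UU i)} \<and> bij_betw y (VV i) {..<card (VV i)}
    \<and> (\<not> sp i \<longrightarrow> (\<forall>e\<in>M i. \<forall>f\<in>M (nx i). R e f \<longrightarrow> s + po i x e \<le> card (M i) + pe i y f))
    \<and> (sp i \<longrightarrow> (\<exists>z. bij_betw z F {..<card F} \<and> (\<forall>e\<in>M i. \<forall>f\<in>F. R e f \<longrightarrow> s + po i x e \<le> card (M i) + z f)
        \<and> (\<forall>f\<in>F. \<forall>e\<in>M (nx i). R e f \<longrightarrow> s + z f \<le> card F + pe i y e)))" for i x y
  have "\<exists>x y. OP i x y" if i: "odd i" "i < K'" for i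
  proof -
    have j: "nx i < K'" "nx i \<noteq> i" using nx i by auto
    have iK: "i < K" "nx i < K" using i j K' by auto
    have EPi: "EP i (UU i) (VV i)" using EP i by blast
    have cM: "card (M i) = p + card (UU i)" using sub(3)[OF i] by simp
    show ?thesis
    proof (cases "sp i")
      case False
      have "\<exists>x y. bij_betw x (UU i) {..<card (UU i)} \<and> bij_betw y (VV i) {..<card (VV i)} \<and> (\<forall>e\<in>M i. \<forall>f\<in>M (nx i). R e f \<longrightarrow>
        s + (if e \<in> UU i then p + x e else \<beta> (i - 1) e) \<le> p + card (UU i) + (if f \<in> VV i then y f else card (VV i) + \<alpha> (nx i) f))"
      proof (rule opposite_end_orders[OF finK[OF i(2)] finK[OF j(1)] sub(1,2)[OF i] refl refl, where h = h and \<epsilon> = \<epsilon>])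
        show "card {g\<in>M (nx i). R e g} \<le> 2" if "e \<in> M i" for e using deg[OF iK] j that by auto
        show "card {e\<in>M i. R e g} \<le> 2" if "g \<in> M (nx i)" for g using deg'[OF iK(2,1)] j that by auto
        show "\<not> R e g" if "e \<in> UU i" "g \<in> VV i" for e g using EPi False that by (auto simp: EP_def)
        show "\<beta> (i - 1) e < p" if "e \<in> M i - UU i" for e using b\<beta>[OF i] that by (auto simp: bij_betw_def)
        show "2 * card {f \<in> {f \<in> M (nx i) - VV i. \<exists>e\<in>UU i. R e f}. \<alpha> (nx i) f < t} \<le> t + \<epsilon>" if "t \<le> h" for t
          using RP[of "nx i"] nx[OF i] False that by (simp add: RP_def)
        show "2 * card {e \<in> {e \<in> M i - UU i. \<exists>f\<in>VV i. R e f}. p \<le> \<beta> (i - 1) e + t} \<le> t + \<epsilon>" if "t \<le> h" for t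
          using RP[of "i - 1"] i False that by (auto simp: RP_def elim!: oddE)
      qed (use csz[OF i] ar eps in simp_all)
      then show ?thesis using False cM by (simp add: OP_def po_def pe_def)
    next
      case True
      then have KF: "K - 1 < K" "i \<noteq> K - 1" "nx i \<noteq> K - 1" using K K' i j by (auto simp: sp_def)
      define \<iota> where "\<iota> = card {f\<in>F. (\<exists>e\<in>UU i. R e f) \<and> (\<exists>e\<in>VV i. R e f)}"
      have \<iota>3: "3 * \<iota> \<le> z + 12" "card {f\<in>F. \<exists>e\<in>UU i. R e f} \<le> card (UU i) + 3" "card {f\<in>F. \<exists>e\<in>VV i. R e f} \<le> card (VV i) + 3"
        using EPi True by (simp_all add: EP_def \<iota>_def)
      have Fq: "q \<le> card F" "card F \<le> q + 1" using F by auto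
      have "8 + 2 * s \<le> z + q" using num p zp by linarith
      then have nums: "3 + 2 * s \<le> z + q" "2 * \<iota> + 1 + 2 * s \<le> z + z + q" "3 * \<iota> + 3 + 4 * s \<le> z + 2 * z + 2 * q"
        using \<iota>3(1) num p zp by linarith+
      have "\<exists>x y. bij_betw x (UU i) {..<card (UU i)} \<and> bij_betw y (VV i) {..<card (VV i)} \<and> (\<forall>\<alpha> \<beta>.
        bij_betw \<beta> (M i - UU i) {..<p} \<longrightarrow> bij_betw \<alpha> (M (nx i) - VV i) {..<p} \<longrightarrow>
        (\<exists>z. bij_betw z F {..<card F}
          \<and> (\<forall>e\<in>M i. \<forall>f\<in>F. R e f \<longrightarrow> s + (if e \<in> UU i then p + x e else \<beta> e) \<le> p + card (UU i) + z f)
          \<and> (\<forall>f\<in>F. \<forall>e\<in>M (nx i). R e f \<longrightarrow> s + z f \<le> card F + (if e \<in> VV i then y e else card (VV i) + \<alpha> e))))"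
      proof (rule free_class_orders[OF finK[OF i(2)] finK[OF j(1)] F(1) refl _ _ _ _ sub(1,2)[OF i] refl refl \<iota>3(2,3) \<iota>_def[symmetric] num(3)])
        show "card {f\<in>F. R e f} \<le> 2" if "e \<in> M i" for e
          using that deg[OF iK(1) KF(1,2)] by (auto simp: F_def)
        show "card {f\<in>F. R e f} \<le> 2" if "e \<in> M (nx i)" for e
          using that deg[OF iK(2) KF(1,3)] by (auto simp: F_def)
        show "card {e\<in>M i. R e f} \<le> 2" "card {e\<in>M (nx i). R e f} \<le> 2" if "f \<in> F" for f
          using that deg'[OF KF(1) iK(1)] deg'[OF KF(1) iK(2)] KF by (auto simp: F_def)
      qed (use csz[OF i] nums Fq num p zp in linarith)+
      then obtain x y where xy: "bij_betw x (UU i) {..<card (UU i)}" "bij_betw y (VV i) {..<card (VV i)}"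
        "\<forall>\<alpha> \<beta>. bij_betw \<beta> (M i - UU i) {..<p} \<longrightarrow> bij_betw \<alpha> (M (nx i) - VV i) {..<p} \<longrightarrow>
        (\<exists>z. bij_betw z F {..<card F}
          \<and> (\<forall>e\<in>M i. \<forall>f\<in>F. R e f \<longrightarrow> s + (if e \<in> UU i then p + x e else \<beta> e) \<le> p + card (UU i) + z f)
          \<and> (\<forall>f\<in>F. \<forall>e\<in>M (nx i). R e f \<longrightarrow> s + z f \<le> card F + (if e \<in> VV i then y e else card (VV i) + \<alpha> e)))"
        by blast
      have "OP i x y" using xy(1,2) xy(3)[rule_format, OF b\<beta>[OF i] b\<alpha>[OF i]] True cM by (simp add: OP_def po_def pe_def)
      then show ?thesis by blast
    qed
  qed
  then have "\<forall>i. \<exists>x y. odd i \<and> i < K' \<longrightarrow> OP i x y" by blast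
  then obtain X Y where "\<forall>i. odd i \<and> i < K' \<longrightarrow> OP i (X i) (Y i)" by metis
  then have OP: "OP i (X i) (Y i)" if "odd i" "i < K'" for i using that by blast
  define k where "k = K' - 1"
  have k: "odd k" "k < K'" "nx k = 0" using K' by (auto simp: k_def nx_def)
  \<comment> \<open>For even \<open>K\<close> there is no free class and the three facts are
    vacuous.\<close>
  obtain zF where zF: "odd K \<Longrightarrow> bij_betw zF F {..<card F}"
    "\<And>e f. odd K \<Longrightarrow> e \<in> M k \<Longrightarrow> f \<in> F \<Longrightarrow> R e f \<Longrightarrow> s + po k (X k) e \<le> card (M k) + zF f"
    "\<And>e f. odd K \<Longrightarrow> e \<in> M 0 \<Longrightarrow> f \<in> F \<Longrightarrow> R e f \<Longrightarrow> s + zF f \<le> card F + pe k (Y k) e"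
  proof (cases "odd K")
    case True
    then have "sp k" using K' by (auto simp: sp_def k_def)
    then obtain z where "bij_betw z F {..<card F}" "\<forall>e\<in>M k. \<forall>f\<in>F. R e f \<longrightarrow> s + po k (X k) e \<le> card (M k) + z f"
      "\<forall>f\<in>F. \<forall>e\<in>M (nx k). R e f \<longrightarrow> s + z f \<le> card F + pe k (Y k) e"
      using OP[OF k(1,2)] by (auto simp: OP_def)
    then show thesis using that[of z] k(3) by auto
  next
    case False
    then show thesis using that by blast
  qed
  define pos where "pos i = (if i = K' then zF else if even i then pe (pv i) (Y (pv i)) else po i (X i))" for i
  have bpos: "bij_betw (pos i) (M i) {..<card (M i)}" if "i < K" for i
  proof -
    have "i < K' \<or> (i = K' \<and> odd K)" using \<open>i < K\<close> K' by (cases "even K") auto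
    then consider "i = K'" "odd K" | "even i" "i < K'" | "odd i" "i < K'" by blast
    then show ?thesis
    proof cases
      case 1
      then show ?thesis using zF(1) K' by (simp add: pos_def F_def)
    next
      case 2
      define m where "m = pv i"
      have m: "odd m" "m < K'" "nx m = i" using pv[OF 2] by (auto simp: m_def)
      have dis: "VV m \<inter> (M i - VV m) = {}" "VV m \<union> (M i - VV m) = M i" using sub(2)[OF m(1,2)] m(3) by auto
      have "bij_betw (Y m) (VV m) {..<card (VV m)}" using OP[OF m(1,2)] by (simp add: OP_def)
      from bij_betw_append[OF this b\<alpha>[OF m(1,2), unfolded m(3)] dis(1)] dis(2)
      have "bij_betw (\<lambda>e. if e \<in> M i - VV m then card (VV m) + \<alpha> i e else Y m e) (M i) {..<card (VV m) + p}" by simp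
      moreover have "card (VV m) + p = card (M i)" using sub(4)[OF m(1,2)] m(3) by simp
      ultimately have "bij_betw (\<lambda>e. if e \<in> M i - VV m then card (VV m) + \<alpha> i e else Y m e) (M i) {..<card (M i)}" by simp
      moreover have "pos i = pe m (Y m)" using 2 by (simp add: pos_def m_def)
      ultimately show ?thesis
        by (subst bij_betw_cong[where g = "\<lambda>e. if e \<in> M i - VV m then card (VV m) + \<alpha> i e else Y m e"])
          (auto simp: pe_def m(3))
    next
      case 3
      have dis: "(M i - UU i) \<inter> UU i = {}" "(M i - UU i) \<union> UU i = M i" using sub(1)[OF 3] by auto
      have "bij_betw (X i) (UU i) {..<card (UU i)}" using OP[OF 3] by (simp add: OP_def)
      from bij_betw_append[OF b\<beta>[OF 3] this dis(1)] dis(2) sub(3)[OF 3]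
      show ?thesis using 3 by (simp add: pos_def po_def[abs_def] add.commute)
    qed
  qed
  have "s + pos i e \<le> card (M i) + pos ((i + 1) mod K) g"
    if H: "i < K" "e \<in> M i" "g \<in> M ((i + 1) mod K)" "R e g" for i e g
  proof -
    have "i < K' \<or> (i = K' \<and> odd K)" using \<open>i < K\<close> K' by (cases "even K") auto
    \<comment> \<open>The four kinds of successive classes: leaving \<open>F\<close>, inside a pair,
      entering \<open>F\<close>, and across an ordinary gap.\<close>
    then consider "i = K'" "odd K" | "even i" "i < K'" | "odd i" "i < K'" "sp i" | "odd i" "i < K'" "\<not> sp i"
      by blast
    then show ?thesis
    proof cases
      case 1
      then have "(i + 1) mod K = 0" using K' by simp
      then show ?thesis using zF(3)[OF 1(2), of g e] H 1 K' sym by (simp add: pos_def F_def k_def pv_def)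
    next
      case 2
      then have i1: "i + 1 < K'" using K' by (auto elim!: evenE)
      then have m: "(i + 1) mod K = i + 1" using K' by simp
      define l where "l = pv i"
      have l: "odd l" "l < K'" "nx l = i" using pv[OF 2] by (auto simp: l_def)
      have o1: "odd (i + 1)" using 2 by simp
      have g: "g \<in> M (i + 1)" using H m by simp
      have P1: "pos i e = pe l (Y l) e" using 2 by (simp add: pos_def l_def)
      have P2: "pos ((i + 1) mod K) g = po (i + 1) (X (i + 1)) g" using i1 o1 m by (simp add: pos_def)
      have cM: "card (M i) = card (VV l) + p" using sub(4)[OF l(1,2)] l(3) by simp
      have y: "Y l e < card (VV l)" if "e \<in> VV l"
        using OP[OF l(1,2)] that by (auto simp: OP_def bij_betw_def)
      have a: "\<alpha> i e < p" if "e \<notin> VV l"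
        using b\<alpha>[OF l(1,2)] l(3) that H(2) by (auto simp: bij_betw_def)
      have "\<alpha> i e \<le> \<beta> i g + 5" if "e \<notin> VV l" "g \<notin> UU (i + 1)"
        using RP[OF 2] that H g by (auto simp: RP_def l_def)
      then show ?thesis using P1 P2 cM y a p by (auto simp: pe_def po_def l(3))
    next
      case 3
      then have ik: "i = k" "odd K" by (auto simp: sp_def k_def)
      then have m: "(i + 1) mod K = K'" using K' by (simp add: k_def)
      have "pos i = po k (X k)" using 3 ik K' by (simp add: pos_def)
      moreover have "pos K' = zF" by (simp add: pos_def)
      moreover have "g \<in> F" using H(3) m K' ik by (simp add: F_def)
      ultimately show ?thesis using zF(2)[OF ik(2), of e g] H ik m by simp
    next
      case 4
      have m: "(i + 1) mod K = nx i"
      proof (cases "i + 1 = K'")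
        case True
        then have "even K" using 4 by (auto simp: sp_def)
        then show ?thesis using True K' by (simp add: nx_def)
      next
        case False
        then show ?thesis using 4 K' by (simp add: nx_def)
      qed
      have "pos i = po i (X i)" "pos (nx i) = pe i (Y i)" using 4 nx[OF 4(1,2)] by (auto simp: pos_def)
      then show ?thesis using OP[OF 4(1,2)] 4(3) H m by (simp add: OP_def)
    qed
  qed
  then show ?thesis using bpos by (intro exI[of _ pos]) blast
qed

section \<open>Cyclic matching sequenceability\<close>

lemma forward_dist_eq:
  assumes "bij_betw l (edges G) {0..<card (edges G)}" "e \<in> edges G" "e' \<in> edges G" "l e < l e'"
  shows "forward_dist G l e e' = l e' - l e" "forward_dist G l e' e = card (edges G) - (l e' - l e)"
proof -
  define m where "m = card (edges G)"
  have l: "l e < m" "l e' < m" using assms by (auto simp: bij_betw_def m_def)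
  show "forward_dist G l e e' = l e' - l e"
    unfolding forward_dist_def m_def[symmetric]
  proof (rule Least_equality)
    show "0 < l e' - l e \<and> [l e + (l e' - l e) = l e'] (mod m)" using assms by simp
    fix d assume d: "0 < d \<and> [l e + d = l e'] (mod m)"
    show "l e' - l e \<le> d"
    proof (rule ccontr)
      assume "\<not> ?thesis"
      then have "l e + d < l e'" by simp
      then show False using d l by (auto simp: cong_def)
    qed
  qed
  show "forward_dist G l e' e = card (edges G) - (l e' - l e)"
    unfolding forward_dist_def m_def[symmetric]
  proof (rule Least_equality)
    have "l e' + (m - (l e' - l e)) = l e + m" using assms l by simp
    then show "0 < m - (l e' - l e) \<and> [l e' + (m - (l e' - l e)) = l e] (mod m)"
      using l by (simp add: cong_def)
    fix d assume d: "0 < d \<and> [l e' + d = l e] (mod m)"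
    show "m - (l e' - l e) \<le> d"
    proof (rule ccontr)
      assume "\<not> ?thesis"
      then have lt: "l e' + d < l e + m" by simp
      show False
      proof (cases "l e' + d < m")
        case True
        then show False using d l assms(4) by (simp add: cong_def)
      next
        case False
        then have "(l e' + d) mod m = l e' + d - m" using lt l by (simp add: le_mod_geq)
        then show False using d l lt False by (simp add: cong_def)
      qed
    qed
  qed
qed

text \<open>For \<open>l e < l e'\<close> the two forward distances are the difference of the labels
  and its complement to the number of edges; so this is the condition on cyclic distances without
  congruences.\<close>

definition separated :: "nat \<Rightarrow> 'a graph \<Rightarrow> ('a set \<Rightarrow> nat) \<Rightarrow> bool" where
  "separated s G l \<longleftrightarrow> (\<forall>e\<in>edges G. \<forall>e'\<in>edges G. adjacent e e' \<longrightarrow> l e < l e' \<longrightarrow>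
     s + l e \<le> l e' \<and> s + l e' \<le> card (edges G) + l e)"

lemma adjacent_sym: "adjacent e e' \<longleftrightarrow> adjacent e' e"
  by (auto simp: adjacent_def)

lemma cyclic_dist_ge_iff_separated:
  assumes "ordering G l"
  shows "(\<forall>e\<in>edges G. \<forall>e'\<in>edges G. adjacent e e' \<longrightarrow> cyclic_dist G l e e' \<ge> s) \<longleftrightarrow> separated s G l"
proof -
  define m where "m = card (edges G)"
  have b: "bij_betw l (edges G) {0..<card (edges G)}" using assms by (simp add: ordering_def)
  have key: "cyclic_dist G l e e' \<ge> s \<longleftrightarrow> s + l e \<le> l e' \<and> s + l e' \<le> m + l e"
    "cyclic_dist G l e' e \<ge> s \<longleftrightarrow> s + l e \<le> l e' \<and> s + l e' \<le> m + l e"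
    if H: "e \<in> edges G" "e' \<in> edges G" "l e < l e'" for e e'
  proof -
    have "l e' < m" using b H by (auto simp: bij_betw_def m_def)
    then show "cyclic_dist G l e e' \<ge> s \<longleftrightarrow> s + l e \<le> l e' \<and> s + l e' \<le> m + l e"
      "cyclic_dist G l e' e \<ge> s \<longleftrightarrow> s + l e \<le> l e' \<and> s + l e' \<le> m + l e"
      using forward_dist_eq[OF b H] H(3) by (auto simp: cyclic_dist_def m_def)
  qed
  show ?thesis
  proof
    assume "\<forall>e\<in>edges G. \<forall>e'\<in>edges G. adjacent e e' \<longrightarrow> cyclic_dist G l e e' \<ge> s"
    then show "separated s G l"
      unfolding separated_def m_def[symmetric] by (intro ballI impI key(1)[THEN iffD1]) auto
  next
    assume S: "separated s G l"
    show "\<forall>e\<in>edges G. \<forall>e'\<in>edges G. adjacent e e' \<longrightarrow> cyclic_dist G l e e' \<ge> s"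
    proof (intro ballI impI)
      fix e e' assume H: "e \<in> edges G" "e' \<in> edges G" "adjacent e e'"
      have "l e \<noteq> l e'" using b H by (auto simp: bij_betw_def inj_on_def adjacent_def)
      then consider "l e < l e'" | "l e' < l e" by linarith
      then show "cyclic_dist G l e e' \<ge> s"
      proof cases
        case 1
        then show ?thesis using key(1)[OF H(1,2)] S H by (simp add: separated_def m_def)
      next
        case 2
        then show ?thesis using key(2)[OF H(2,1)] S H adjacent_sym by (fastforce simp: separated_def m_def)
      qed
    qed
  qed
qed

lemma separated_one: "ordering G l \<Longrightarrow> separated 1 G l"
  unfolding separated_def ordering_def by (auto simp: bij_betw_def dest!: equalityD1)

lemma cms_ordering_range:
  assumes "ordering G l" "edges G \<noteq> {}" "finite (edges G)"
  shows "cms_ordering G l \<in> {s \<in> {1..card (edges G)}. separated s G l}"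
proof -
  have "cms_ordering G l = Max {s \<in> {1..card (edges G)}. separated s G l}"
    unfolding cms_ordering_def using cyclic_dist_ge_iff_separated[OF assms(1)] by simp
  moreover have "card (edges G) \<ge> 1" using assms by (simp add: Suc_leI card_gt_0_iff)
  then have "1 \<in> {s \<in> {1..card (edges G)}. separated s G l}" using separated_one[OF assms(1)] by simp
  ultimately show ?thesis using Max_in[of "{s \<in> {1..card (edges G)}. separated s G l}"] by fastforce
qed

lemma ex_ordering: "finite (edges G) \<Longrightarrow> \<exists>l. ordering G l"
  unfolding ordering_def using ex_bij_betw_finite_nat by blast

lemma finite_cms_orderings:
  assumes "edges G \<noteq> {}" "finite (edges G)"
  shows "finite {cms_ordering G l | l. ordering G l}"
proof (rule finite_subset)
  show "{cms_ordering G l | l. ordering G l} \<subseteq> {1..card (edges G)}"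
    using cms_ordering_range[OF _ assms] by auto
qed simp

lemma cms_graph_ge:
  assumes "ordering G l" "separated s G l" "edges G \<noteq> {}" "finite (edges G)" "1 \<le> s" "s \<le> card (edges G)"
  shows "s \<le> cms_graph G"
proof -
  have "cms_ordering G l = Max {s \<in> {1..card (edges G)}. separated s G l}"
    unfolding cms_ordering_def using cyclic_dist_ge_iff_separated[OF assms(1)] by simp
  then have "s \<le> cms_ordering G l" using assms by (auto intro!: Max_ge)
  also have "\<dots> \<le> cms_graph G"
    unfolding cms_graph_def using finite_cms_orderings[OF assms(3,4)] assms(1) by (intro Max_ge) auto
  finally show ?thesis .
qed

lemma cms_graph_attained:
  assumes "edges G \<noteq> {}" "finite (edges G)"
  obtains l where "ordering G l" "separated (cms_graph G) G l" "1 \<le> cms_graph G" "cms_graph G \<le> card (edges G)"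
proof -
  have "cms_graph G \<in> {cms_ordering G l | l. ordering G l}"
    unfolding cms_graph_def using finite_cms_orderings[OF assms] ex_ordering[OF assms(2)] by (intro Max_in) auto
  then obtain l where "ordering G l" "cms_graph G = cms_ordering G l" by auto
  then show thesis using that[of l] cms_ordering_range[OF _ assms, of l] by auto
qed

text \<open>Going round the circle from a class to one that is not its successor passes a whole
  class, which has at least \<open>s\<close> edges. With \<open>K \<ge> 3\<close> two classes are
  successive in at most one direction, and that direction is controlled by
  \<open>con\<close>.\<close>

lemma cms_graph_ge_of_classes:
  fixes G :: "'a graph" and M :: "nat \<Rightarrow> 'a set set"
  assumes fin: "finite (edges G)" and K: "3 \<le> K" and part: "edges G = (\<Union>i<K. M i)"
    and disj: "\<And>i j. i < K \<Longrightarrow> j < K \<Longrightarrow> i \<noteq> j \<Longrightarrow> M i \<inter> M j = {}"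
    and mat: "\<And>i e g. i < K \<Longrightarrow> e \<in> M i \<Longrightarrow> g \<in> M i \<Longrightarrow> \<not> adjacent e g"
    and size: "\<And>i. i < K \<Longrightarrow> s \<le> card (M i)" and s: "1 \<le> s"
    and pos: "\<And>i. i < K \<Longrightarrow> bij_betw (pos i) (M i) {..<card (M i)}"
    and con: "\<And>i e g. i < K \<Longrightarrow> e \<in> M i \<Longrightarrow> g \<in> M ((i + 1) mod K) \<Longrightarrow> adjacent e g \<Longrightarrow>
      s + pos i e \<le> card (M i) + pos ((i + 1) mod K) g"
  shows "s \<le> cms_graph G"
proof -
  define off where "off i = (\<Sum>j<i. card (M j))" for i
  define cl where "cl e = (THE i. i < K \<and> e \<in> M i)" for e
  have cl: "cl e = i" if "i < K" "e \<in> M i" for e i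
    unfolding cl_def using that disj by blast
  define l where "l e = off (cl e) + pos (cl e) e" for e
  have le: "l e = off i + pos i e" "pos i e < card (M i)" if "i < K" "e \<in> M i" for e i
    using cl[OF that] pos[OF that(1)] that(2) by (auto simp: l_def bij_betw_def)
  have offS: "off (Suc i) = off i + card (M i)" for i by (simp add: off_def)
  have mono: "off i \<le> off j" if "i \<le> j" for i j
    unfolding off_def using that by (intro sum_mono2) auto
  have step: "off i + card (M i) \<le> off j" if "i < j" for i j using mono[of "Suc i" j] offS that by simp
  have mK: "card (edges G) = off K"
  proof -
    have "finite (M i)" if "i < K" for i using fin part that by (auto intro: finite_subset)
    then show ?thesis unfolding part off_def using disj by (intro card_UN_disjoint) auto
  qed
  have order: "i < j \<longleftrightarrow> l e < l f" if "i < K" "j < K" "e \<in> M i" "f \<in> M j" "i \<noteq> j" for i j e f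
  proof (cases "i < j")
    case True
    then show ?thesis using le[OF that(1,3)] le[OF that(2,4)] step[OF True] by simp
  next
    case False
    then have "j < i" using that by simp
    then show ?thesis using le[OF that(1,3)] le[OF that(2,4)] step[of j i] by simp
  qed
  have inj: "inj_on l (edges G)"
  proof (rule inj_onI)
    fix e f assume H: "e \<in> edges G" "f \<in> edges G" "l e = l f"
    obtain i j where ij: "i < K" "e \<in> M i" "j < K" "f \<in> M j" using H part by auto
    show "e = f"
    proof (cases "i = j")
      case True
      then show ?thesis using le[OF ij(1,2)] le[OF ij(3,4)] H(3) pos[OF ij(1)] ij by (auto simp: bij_betw_def inj_on_def)
    next
      case False
      then show ?thesis using order[OF ij(1,3,2,4)] order[OF ij(3,1,4,2)] H(3) by auto
    qed
  qed
  have "l ` edges G \<subseteq> {0..<card (edges G)}"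
  proof (rule image_subsetI)
    fix e assume "e \<in> edges G"
    then obtain i where i: "i < K" "e \<in> M i" using part by auto
    then show "l e \<in> {0..<card (edges G)}" using le[OF i] step[OF i(1)] mK by simp
  qed
  then have "l ` edges G = {0..<card (edges G)}" using inj by (intro card_subset_eq) (auto simp: card_image)
  then have ord: "ordering G l" using inj by (simp add: ordering_def bij_betw_def)
  have "separated s G l"
    unfolding separated_def
  proof (intro ballI impI)
    fix e f assume H: "e \<in> edges G" "f \<in> edges G" "adjacent e f" "l e < l f"
    obtain i j where ij: "i < K" "e \<in> M i" "j < K" "f \<in> M j" using H part by auto
    have "i \<noteq> j" using mat ij H by blast
    then have lt: "i < j" using order[OF ij(1,3,2,4)] H by simp
    have e: "l e = off i + pos i e" "pos i e < card (M i)" using le[OF ij(1,2)] by auto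
    have f: "l f = off j + pos j f" "pos j f < card (M j)" using le[OF ij(3,4)] by auto
    show "s + l e \<le> l f \<and> s + l f \<le> card (edges G) + l e"
    proof
      show "s + l e \<le> l f"
      proof (cases "j = i + 1")
        case True
        then have "s + pos i e \<le> card (M i) + pos j f" using con[of i e f] ij H by simp
        then show ?thesis using e f True offS[of i] by simp
      next
        case False
        then have "off (Suc i) + card (M (Suc i)) \<le> off j" using lt by (intro step) simp
        moreover have "s \<le> card (M (Suc i))" using lt ij by (intro size) simp
        ultimately show ?thesis using e f offS[of i] by simp
      qed
      show "s + l f \<le> card (edges G) + l e"
      proof (cases "j + 1 = K")
        case jK: True
        show ?thesis
        proof (cases "i = 0")
          case True
          then have "s + pos j f \<le> card (M j) + pos 0 e"
            using con[of j f e] ij H jK adjacent_sym[of f e] by simp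
          then show ?thesis using e f True jK offS[of j] mK by (auto simp: off_def)
        next
          case False
          then have "off 0 + card (M 0) \<le> off i" by (intro step) simp
          moreover have "s \<le> card (M 0)" using K by (intro size) simp
          moreover have "l f < off K" using f jK offS[of j] by auto
          ultimately show ?thesis using e mK by simp
        qed
      next
        case False
        then have "off (Suc j) + card (M (Suc j)) \<le> off K" using ij by (intro step) simp
        moreover have "s \<le> card (M (Suc j))" using ij False by (intro size) simp
        ultimately show ?thesis using f offS[of j] mK by simp
      qed
    qed
  qed
  moreover have "off 1 \<le> off K" using K by (intro mono) simp
  then have "s \<le> card (edges G)" using size[of 0] K mK offS[of 0] by simp
  moreover have "edges G \<noteq> {}" using \<open>s \<le> card (edges G)\<close> s by auto
  ultimately show ?thesis using cms_graph_ge[OF ord _ _ fin s] by blast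
qed

text \<open>Each adjacent member of the matching picks a vertex of \<open>e\<close>, and no two
  members can pick the same one.\<close>

lemma card_adjacent_in_matching:
  assumes "card e = 2" "\<And>g g'. g \<in> M \<Longrightarrow> g' \<in> M \<Longrightarrow> \<not> adjacent g g'"
  shows "card {g\<in>M. adjacent e g} \<le> 2"
proof -
  have fe: "finite e" using assms(1) card.infinite by fastforce
  define p where "p g = (SOME v. v \<in> e \<inter> g)" for g
  have p: "p g \<in> e \<inter> g" if "adjacent e g" for g
  proof -
    have "\<exists>v. v \<in> e \<inter> g" using that by (auto simp: adjacent_def)
    then show ?thesis unfolding p_def by (rule someI_ex)
  qed
  have "card {g\<in>M. adjacent e g} \<le> card e"
  proof (rule card_inj_on_le[of p])
    show "inj_on p {g\<in>M. adjacent e g}"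
    proof (rule inj_onI)
      fix g g' assume H: "g \<in> {g\<in>M. adjacent e g}" "g' \<in> {g\<in>M. adjacent e g}" "p g = p g'"
      then have "p g \<in> g \<inter> g'" using p[of g] p[of g'] by auto
      then show "g = g'" using assms(2)[of g g'] H by (auto simp: adjacent_def)
    qed
    show "p ` {g\<in>M. adjacent e g} \<subseteq> e" using p by auto
  qed (rule fe)
  then show ?thesis using assms(1) by simp
qed

lemma finite_edges: "simple_graph G \<Longrightarrow> finite (edges G)"
  unfolding simple_graph_def by (rule finite_subset[of _ "Pow (fst G)"]) auto

lemma degree_sum:
  assumes "simple_graph G" "E \<subseteq> edges G"
  shows "(\<Sum>v\<in>verts G. card {e\<in>E. v \<in> e}) = 2 * card E"
proof -
  have fin: "finite (verts G)" "finite E"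
    using assms finite_edges[OF assms(1)] by (auto simp: simple_graph_def intro: finite_subset)
  have "(\<Sum>v\<in>verts G. card {e\<in>E. v \<in> e}) = (\<Sum>v\<in>verts G. \<Sum>e\<in>E. if v \<in> e then 1 else 0)"
    using fin by (simp add: sum.If_cases Int_def)
  also have "\<dots> = (\<Sum>e\<in>E. \<Sum>v\<in>verts G. if v \<in> e then 1 else 0)" by (rule sum.swap)
  also have "\<dots> = (\<Sum>e\<in>E. 2)"
  proof (rule sum.cong[OF refl])
    fix e assume "e \<in> E"
    then have e: "e \<subseteq> verts G" "card e = 2" using assms by (auto simp: simple_graph_def)
    have "{v\<in>verts G. v \<in> e} = e" using e by auto
    then show "(\<Sum>v\<in>verts G. if v \<in> e then 1 else 0) = (2::nat)" using e fin by (simp add: sum.If_cases Int_def)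
  qed
  finally show ?thesis by simp
qed

lemma card_edges_regular:
  assumes "simple_graph G" "regular k G"
  shows "2 * card (edges G) = card (verts G) * k"
  using degree_sum[OF assms(1) subset_refl] assms(2) by (simp add: regular_def)

lemma cms_graph_ge_of_colouring:
  fixes c :: "'a set \<Rightarrow> nat"
  assumes G: "simple_graph G" and K: "4 \<le> K"
    and c: "\<And>e. e \<in> edges G \<Longrightarrow> c e < K"
    and proper: "\<And>e e'. e \<in> edges G \<Longrightarrow> e' \<in> edges G \<Longrightarrow> adjacent e e' \<Longrightarrow> c e \<noteq> c e'"
    and size: "\<And>i. i < K \<Longrightarrow> card {e\<in>edges G. c e = i} = q \<or> card {e\<in>edges G. c e = i} = q + 1"
    and num: "3 * s + 14 \<le> 2 * q" "1 \<le> s"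
  shows "s \<le> cms_graph G"
proof -
  \<comment> \<open>\<open>many_class_positions\<close> requires a distance close to
    \<open>2 * q / 3\<close>. The largest admissible one is used, which settles smaller
    \<open>s\<close> as well.\<close>
  define t where "t = (2 * q - 14) div 3"
  have t: "3 * t + 14 \<le> 2 * q" "2 * q \<le> 3 * t + 16" "s \<le> t" "1 \<le> t"
    using num unfolding t_def by linarith+
  define M where "M i = {e\<in>edges G. c e = i}" for i
  have fE: "finite (edges G)" by (rule finite_edges[OF G])
  have mat: "\<not> adjacent e g" if "e \<in> M i" "g \<in> M i" for i e g
    using proper[of e g] that by (auto simp: M_def)
  have "\<exists>pos. \<forall>i<K. bij_betw (pos i) (M i) {..<card (M i)}
    \<and> (\<forall>e\<in>M i. \<forall>g\<in>M ((i + 1) mod K). adjacent e g \<longrightarrow> t + pos i e \<le> card (M i) + pos ((i + 1) mod K) g)"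
  proof (rule many_class_positions[OF K _ _ _ _ t(1,2)])
    show "card {g\<in>M j. adjacent e g} \<le> 2" if "e \<in> M i" for i j e
      using that G by (intro card_adjacent_in_matching mat) (auto simp: M_def simple_graph_def)
  qed (use size fE t adjacent_sym in \<open>auto simp: M_def\<close>)
  then obtain pos where pos: "\<And>i. i < K \<Longrightarrow> bij_betw (pos i) (M i) {..<card (M i)}"
    "\<And>i e g. i < K \<Longrightarrow> e \<in> M i \<Longrightarrow> g \<in> M ((i + 1) mod K) \<Longrightarrow> adjacent e g \<Longrightarrow>
      t + pos i e \<le> card (M i) + pos ((i + 1) mod K) g" by blast
  have "t \<le> cms_graph G"
  proof (rule cms_graph_ge_of_classes[where K = K and M = M and pos = pos, OF fE])
    show "edges G = (\<Union>i<K. M i)" using c by (auto simp: M_def)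
    show "t \<le> card (M i)" if "i < K" for i using size[OF that] t by (auto simp: M_def)
    show "1 \<le> t" by (rule t(4))
    show "bij_betw (pos i) (M i) {..<card (M i)}" if "i < K" for i by (rule pos(1)[OF that])
    show "t + pos i e \<le> card (M i) + pos ((i + 1) mod K) g"
      if "i < K" "e \<in> M i" "g \<in> M ((i + 1) mod K)" "adjacent e g" for i e g by (rule pos(2)[OF that])
  qed (use K mat in \<open>auto simp: M_def\<close>)
  then show ?thesis using t by simp
qed

section \<open>Equitable proper edge colourings\<close>

definition proper_on :: "'a set set \<Rightarrow> ('a set \<Rightarrow> nat) \<Rightarrow> bool" where
  "proper_on E c \<longleftrightarrow> (\<forall>e\<in>E. \<forall>e'\<in>E. adjacent e e' \<longrightarrow> c e \<noteq> c e')"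

definition component :: "'a set set \<Rightarrow> 'a \<Rightarrow> 'a set" where
  "component H x = {y. (x, y) \<in> {(a, b). {a, b} \<in> H}\<^sup>*}"

lemma component_refl: "x \<in> component H x"
  by (simp add: component_def)

lemma component_closed:
  assumes "\<forall>e\<in>H. card e = 2" "e \<in> H" "e \<inter> component H x \<noteq> {}"
  shows "e \<subseteq> component H x"
proof -
  obtain a where a: "a \<in> e" "a \<in> component H x" using assms by auto
  obtain b c where bc: "e = {b, c}" using assms by (metis card_2_iff)
  then have "(b, c) \<in> {(a, b). {a, b} \<in> H}" "(c, b) \<in> {(a, b). {a, b} \<in> H}"
    using assms(2) by (auto simp: insert_commute)
  then show ?thesis using a bc unfolding component_def by (auto intro: rtrancl.rtrancl_into_rtrancl)
qed

lemma component_sym: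
  assumes "y \<in> component H x"
  shows "component H y = component H x"
proof -
  define r where "r = {(a, b). {a, b} \<in> H}"
  have "sym r" by (auto simp: r_def sym_def insert_commute)
  then have s: "sym (r\<^sup>*)" by (rule sym_rtrancl)
  have "(x, y) \<in> r\<^sup>*" using assms by (simp add: component_def r_def)
  moreover have "(y, x) \<in> r\<^sup>*" using calculation s by (auto simp: sym_def)
  ultimately show ?thesis unfolding component_def r_def[symmetric] by (auto intro: rtrancl_trans)
qed

lemma finite_component:
  assumes "finite H" "\<forall>e\<in>H. card e = 2"
  shows "finite (component H x)"
proof -
  have "component H x \<subseteq> insert x (\<Union>H)"
  proof
    fix y assume "y \<in> component H x"
    then have "(x, y) \<in> {(a, b). {a, b} \<in> H}\<^sup>*" by (simp add: component_def)
    then show "y \<in> insert x (\<Union>H)" by (induction rule: rtrancl_induct) auto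
  qed
  moreover have "finite e" if "e \<in> H" for e
    using assms(2) that by (metis card.infinite zero_neq_numeral)
  then have "finite (insert x (\<Union>H))" using assms(1) by simp
  ultimately show ?thesis by (rule finite_subset)
qed

text \<open>A connected vertex set is grown from \<open>x\<close> one vertex at a time, and every
  new vertex brings a new edge.\<close>

lemma card_component_le:
  assumes "finite H" "\<forall>e\<in>H. card e = 2"
  shows "card (component H x) \<le> Suc (card {e\<in>H. e \<subseteq> component H x})"
proof -
  define C where "C = component H x"
  have fC: "finite C" unfolding C_def by (rule finite_component[OF assms])
  have "\<exists>S. S \<subseteq> C \<and> x \<in> S \<and> card S = Suc n \<and> n \<le> card {e\<in>H. e \<subseteq> S}" if "Suc n \<le> card C" for n
    using that
  proof (induction n)
    case 0
    show ?case by (rule exI[of _ "{x}"]) (auto simp: C_def component_refl)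
  next
    case (Suc n)
    then obtain S where S: "S \<subseteq> C" "x \<in> S" "card S = Suc n" "n \<le> card {e\<in>H. e \<subseteq> S}" by auto
    have "\<exists>a b. a \<in> S \<and> b \<notin> S \<and> {a, b} \<in> H"
    proof (rule ccontr)
      assume no: "\<not> ?thesis"
      have "C \<subseteq> S"
      proof
        fix y assume "y \<in> C"
        then have "(x, y) \<in> {(a, b). {a, b} \<in> H}\<^sup>*" by (simp add: C_def component_def)
        then show "y \<in> S" by (induction rule: rtrancl_induct) (use S no in auto)
      qed
      then have "card C \<le> Suc n" using S card_mono[of S C] fC by (metis finite_subset)
      then show False using Suc.prems by simp
    qed
    then obtain a b where ab: "a \<in> S" "b \<notin> S" "{a, b} \<in> H" by auto
    have "{a, b} \<inter> C \<noteq> {}" using ab S by auto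
    then have bC: "b \<in> C" using component_closed[OF assms(2) ab(3), of x] by (simp add: C_def)
    have "insert {a, b} {e\<in>H. e \<subseteq> S} \<subseteq> {e\<in>H. e \<subseteq> insert b S}" using ab by auto
    then have "card (insert {a, b} {e\<in>H. e \<subseteq> S}) \<le> card {e\<in>H. e \<subseteq> insert b S}"
      using assms(1) by (intro card_mono) auto
    moreover have "card (insert {a, b} {e\<in>H. e \<subseteq> S}) = Suc (card {e\<in>H. e \<subseteq> S})"
      using ab assms(1) by (subst card_insert_disjoint) auto
    moreover have "card (insert b S) = Suc (Suc n)"
      using S ab fC by (subst card_insert_disjoint) (auto intro: finite_subset)
    ultimately show ?case using S bC by (intro exI[of _ "insert b S"]) auto
  qed
  moreover have "C \<noteq> {}" using component_refl[of x H] by (auto simp: C_def)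
  then obtain n where n: "card C = Suc n" using fC by (metis card_gt_0_iff gr0_implies_Suc)
  ultimately obtain S where S: "S \<subseteq> C" "card S = card C" "n \<le> card {e\<in>H. e \<subseteq> S}" by auto
  then have "S = C" using fC by (intro card_subset_eq) auto
  then show ?thesis using S n by (simp add: C_def)
qed

text \<open>The sets \<open>C s\<close> are pairwise equal or disjoint and cover \<open>X\<close>.
  If none had more of \<open>X\<close> than of \<open>Y\<close>, summing over the distinct ones
  would contradict \<open>gt\<close>.\<close>

lemma larger_in_component:
  assumes fin: "finite X" "finite Y" and gt: "card X > card Y"
    and cl: "\<And>x y. x \<in> S \<Longrightarrow> y \<in> S \<Longrightarrow> C x \<inter> C y \<noteq> {} \<Longrightarrow> C x = C y"
    and cov: "\<And>x. x \<in> X \<Longrightarrow> \<exists>s\<in>S. x \<in> C s"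
  shows "\<exists>s\<in>S. card (C s \<inter> X) > card (C s \<inter> Y)"
proof (rule ccontr)
  assume no: "\<not> ?thesis"
  obtain r where r: "\<And>x. x \<in> X \<Longrightarrow> r x \<in> S \<and> x \<in> C (r x)" using cov by metis
  define D where "D = (C \<circ> r) ` X"
  have fD: "finite D" using fin by (simp add: D_def)
  have dis: "\<forall>A\<in>D. \<forall>B\<in>D. A \<noteq> B \<longrightarrow> (A \<inter> Z) \<inter> (B \<inter> Z) = {}" for Z
    using cl r unfolding D_def by fastforce
  have "X = (\<Union>A\<in>D. A \<inter> X)" using r by (auto simp: D_def)
  then have "card X = card (\<Union>A\<in>D. A \<inter> X)" by simp
  also have "\<dots> = (\<Sum>A\<in>D. card (A \<inter> X))" using fD fin dis by (intro card_UN_disjoint) auto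
  also have "\<dots> \<le> (\<Sum>A\<in>D. card (A \<inter> Y))" using no r by (intro sum_mono) (force simp: D_def not_less)
  also have "\<dots> = card (\<Union>A\<in>D. A \<inter> Y)" using fD fin dis by (intro card_UN_disjoint[symmetric]) auto
  also have "\<dots> \<le> card Y" using fin by (intro card_mono) auto
  finally show False using gt by simp
qed

definition exchange :: "nat \<Rightarrow> nat \<Rightarrow> nat \<Rightarrow> nat" where
  "exchange i j t = (if t = i then j else if t = j then i else t)"

lemma exchange_inj: "exchange i j s = exchange i j t \<longleftrightarrow> s = t"
  by (auto simp: exchange_def)

text \<open>Every edge meeting \<open>C\<close> is treated, but \<open>exchange\<close> fixes all
  colours other than \<open>i\<close> and \<open>j\<close>; for a component \<open>C\<close> of the
  edges of these two colours, only edges inside \<open>C\<close> can change.\<close>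

definition kempe :: "('a set \<Rightarrow> nat) \<Rightarrow> nat \<Rightarrow> nat \<Rightarrow> 'a set \<Rightarrow> 'a set \<Rightarrow> nat" where
  "kempe c i j C e = (if e \<inter> C \<noteq> {} then exchange i j (c e) else c e)"

lemma proper_on_kempe:
  assumes pr: "proper_on E c" and cl: "\<And>e. e \<in> E \<Longrightarrow> c e = i \<or> c e = j \<Longrightarrow> e \<inter> C \<noteq> {} \<Longrightarrow> e \<subseteq> C"
  shows "proper_on E (kempe c i j C)"
proof -
  have one: "kempe c i j C e \<noteq> kempe c i j C e'"
    if H: "e \<in> E" "e' \<in> E" "adjacent e e'" "e \<inter> C \<noteq> {}" "e' \<inter> C = {}" for e e'
  proof
    assume eq: "kempe c i j C e = kempe c i j C e'"
    have ne: "c e \<noteq> c e'" using pr H by (auto simp: proper_on_def)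
    have "\<not> e \<subseteq> C" using H by (auto simp: adjacent_def)
    then have "c e \<noteq> i" "c e \<noteq> j" using cl[OF H(1)] H(4) by auto
    then show False using eq ne H by (simp add: kempe_def exchange_def)
  qed
  show ?thesis
    unfolding proper_on_def
  proof (intro ballI impI)
    fix e e' assume H: "e \<in> E" "e' \<in> E" "adjacent e e'"
    have ne: "c e \<noteq> c e'" using pr H by (auto simp: proper_on_def)
    consider "e \<inter> C \<noteq> {}" "e' \<inter> C = {}" | "e \<inter> C = {}" "e' \<inter> C \<noteq> {}" | "(e \<inter> C \<noteq> {}) = (e' \<inter> C \<noteq> {})" by blast
    then show "kempe c i j C e \<noteq> kempe c i j C e'"
    proof cases
      case 1
      then show ?thesis using one H by blast
    next
      case 2
      then show ?thesis using one[of e' e] H adjacent_sym by metis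
    next
      case 3
      then show ?thesis using ne by (auto simp: kempe_def exchange_inj)
    qed
  qed
qed

text \<open>The decrease is \<open>2 * d * (a - b - d)\<close>. Sums of squares serve as the
  potential in both recolouring arguments.\<close>

lemma square_exchange:
  fixes a b d :: nat
  assumes "d < a - b" "0 < d"
  shows "(a - d)\<^sup>2 + (b + d)\<^sup>2 < a\<^sup>2 + b\<^sup>2"
proof -
  obtain t where a: "a = b + d + t" "0 < t" using assms by (metis add.commute add.left_commute less_diff_conv less_imp_add_positive)
  have "(a - d)\<^sup>2 + (b + d)\<^sup>2 + 2 * d * t = a\<^sup>2 + b\<^sup>2"
    using a by (simp add: power2_eq_square algebra_simps)
  then show ?thesis using a assms by (metis add_gr_0 less_add_same_cancel1 mult_pos_pos zero_less_numeral)
qed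

lemma sum_exchange_less:
  fixes f g :: "nat \<Rightarrow> nat"
  assumes "finite S" "i \<in> S" "j \<in> S" "i \<noteq> j" "\<And>t. t \<in> S \<Longrightarrow> t \<noteq> i \<Longrightarrow> t \<noteq> j \<Longrightarrow> f t = g t"
    and "f i + f j < g i + g j"
  shows "sum f S < sum g S"
proof -
  have split: "sum h S = h i + h j + sum h (S - {i, j})" for h :: "nat \<Rightarrow> nat"
  proof -
    have "sum h S = sum h {i, j} + sum h (S - {i, j})"
      using assms by (metis add.commute empty_subsetI insert_subset sum.subset_diff)
    then show ?thesis using assms by simp
  qed
  have "sum f (S - {i, j}) = sum g (S - {i, j})" using assms by (intro sum.cong) auto
  then show ?thesis using split[of f] split[of g] assms(6) by simp
qed

lemma kempe_edges:
  assumes E: "finite E" "\<forall>e\<in>E. card e = 2" and pr: "proper_on E c" and ij: "i \<noteq> j"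
  defines "H \<equiv> {e\<in>E. c e = i \<or> c e = j}"
  shows "\<And>e. e \<in> E \<Longrightarrow> c e = i \<or> c e = j \<Longrightarrow> e \<inter> component H x \<noteq> {} \<Longrightarrow> e \<subseteq> component H x"
    and "finite (component H x)"
    and "card (component H x) \<le> Suc (card {e\<in>H. e \<subseteq> component H x})"
  using E component_closed[of H _ x] finite_component[of H x] card_component_le[of H x] unfolding H_def by auto

text \<open>A component of the subgraph of two colours is a path or a cycle, so altogether at most
  two of these colours are missing at its vertices.\<close>

lemma missing_in_component:
  fixes E :: "'a set set" and x :: 'a
  assumes E: "finite E" "\<forall>e\<in>E. card e = 2" and pr: "proper_on E c" and ij: "i \<noteq> j"
    and X: "\<And>u e. u \<in> X \<Longrightarrow> e \<in> E \<Longrightarrow> u \<in> e \<Longrightarrow> c e \<noteq> i" and Y: "\<And>u e. u \<in> Y \<Longrightarrow> e \<in> E \<Longrightarrow> u \<in> e \<Longrightarrow> c e \<noteq> j"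
  defines "C \<equiv> component {e\<in>E. c e = i \<or> c e = j} x"
  shows "card (C \<inter> X) + card (C \<inter> Y) \<le> 2"
proof -
  define H where "H = {e\<in>E. c e = i \<or> c e = j}"
  have C: "C = component H x" by (simp add: C_def H_def)
  note ke = kempe_edges[OF E pr ij, where x = x, folded H_def, folded C]
  \<comment> \<open>The component has at least \<open>card C - 1\<close> edges of the two colours,
    each of which covers two vertices of \<open>B i\<close> or of \<open>B j\<close>, while a vertex
    missing a colour lies outside the respective set.\<close>
  define B where "B t = {u\<in>C. \<exists>e\<in>E. c e = t \<and> u \<in> e}" for t
  have cB: "2 * card {e\<in>E. c e = t \<and> e \<subseteq> C} \<le> card (B t)" for t
  proof -
    define T where "T = {e\<in>E. c e = t \<and> e \<subseteq> C}"
    have fe: "finite e" if "e \<in> T" for e using that ke(2) by (auto simp: T_def intro: finite_subset)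
    have "(\<Sum>e\<in>T. card e) = card (\<Union>T)"
    proof (rule card_Union_disjoint[symmetric])
      show "pairwise disjnt T"
        using pr unfolding pairwise_def disjnt_def by (fastforce simp: proper_on_def adjacent_def T_def)
    qed (use fe in auto)
    moreover have "(\<Sum>e\<in>T. card e) = 2 * card T" using E by (simp add: T_def)
    moreover have "card (\<Union>T) \<le> card (B t)" using ke(2) by (intro card_mono) (auto simp: B_def T_def)
    ultimately show ?thesis by (simp add: T_def)
  qed
  have "{e\<in>H. e \<subseteq> C} = {e\<in>E. c e = i \<and> e \<subseteq> C} \<union> {e\<in>E. c e = j \<and> e \<subseteq> C}" by (auto simp: H_def)
  then have "card {e\<in>H. e \<subseteq> C} \<le> card {e\<in>E. c e = i \<and> e \<subseteq> C} + card {e\<in>E. c e = j \<and> e \<subseteq> C}"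
    by (simp add: card_Un_le)
  then have "2 * card C \<le> 2 + card (B i) + card (B j)" using ke(3) cB[of i] cB[of j] by linarith
  moreover have "card (C \<inter> X) + card (B i) \<le> card C"
  proof -
    have "card (C \<inter> X) + card (B i) = card ((C \<inter> X) \<union> B i)"
      using ke(2) X by (intro card_Un_disjoint[symmetric]) (auto simp: B_def)
    also have "\<dots> \<le> card C" using ke(2) by (intro card_mono) (auto simp: B_def)
    finally show ?thesis .
  qed
  moreover have "card (C \<inter> Y) + card (B j) \<le> card C"
  proof -
    have "card (C \<inter> Y) + card (B j) = card ((C \<inter> Y) \<union> B j)"
      using ke(2) Y by (intro card_Un_disjoint[symmetric]) (auto simp: B_def)
    also have "\<dots> \<le> card C" using ke(2) by (intro card_mono) (auto simp: B_def)
    finally show ?thesis .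
  qed
  ultimately show ?thesis by linarith
qed

text \<open>Induction on the number of edges to be added at \<open>v\<close>; \<open>A u\<close>
  consists of colours missing at \<open>u\<close>. Let \<open>X i\<close> be the neighbours offering
  colour \<open>i\<close>. In a choice of colouring and offers that minimises the sum of squares of
  \<open>card (X i)\<close>, these numbers differ by at most 2, since otherwise a Kempe exchange
  would improve it. They add up to \<open>2 * card N - 1\<close>, which is odd and less than
  \<open>2 * card S\<close>, so some colour is offered by exactly one \<open>u\<close>. The edge to
  \<open>u\<close> receives it, all edges of this colour are set aside, and the induction continues
  with one colour and one neighbour less. The single neighbour \<open>w\<close> with only one offer
  makes the sum odd.\<close>

lemma extend_colouring_at_vertex:
  fixes c :: "'a set \<Rightarrow> nat"
  assumes "finite E" "\<forall>e\<in>E. card e = 2" "proper_on E c" "c ` E \<subseteq> S" "finite S" "finite N" "v \<notin> N"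
    "\<forall>e\<in>E. v \<notin> e" "card N \<le> card S" "\<forall>u\<in>N. A u \<subseteq> S \<and> (\<forall>e\<in>E. u \<in> e \<longrightarrow> c e \<notin> A u)"
    "N \<noteq> {} \<Longrightarrow> w \<in> N" "\<forall>u\<in>N. card (A u) = (if u = w then 1 else 2)"
  shows "\<exists>c'. proper_on (E \<union> (\<lambda>u. {v, u}) ` N) c' \<and> c' ` (E \<union> (\<lambda>u. {v, u}) ` N) \<subseteq> S"
  using assms
proof (induction "card N" arbitrary: N E c S A w)
  case 0
  then have "N = {}" by simp
  then show ?case using 0 by auto
next
  case (Suc n)
  note E = Suc.prems(1,2) and finS = Suc.prems(5) and finN = Suc.prems(6)
  have "N \<noteq> {}" using Suc.hyps(2) by auto
  then have wN: "w \<in> N" by (rule Suc.prems(11))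
  define X where "X A i = {u\<in>N. i \<in> A u}" for A :: "'a \<Rightarrow> nat set" and i
  define valid where "valid p \<longleftrightarrow> proper_on E (fst p) \<and> fst p ` E \<subseteq> S \<and>
    (\<forall>u\<in>N. snd p u \<subseteq> S \<and> (\<forall>e\<in>E. u \<in> e \<longrightarrow> fst p e \<notin> snd p u) \<and> card (snd p u) = (if u = w then 1 else 2))"
    for p :: "('a set \<Rightarrow> nat) \<times> ('a \<Rightarrow> nat set)"
  define \<mu> where "\<mu> p = (\<Sum>i\<in>S. (card (X (snd p) i))\<^sup>2)" for p :: "('a set \<Rightarrow> nat) \<times> ('a \<Rightarrow> nat set)"
  have "valid (c, A)" using Suc.prems by (auto simp: valid_def)
  then obtain p where p: "valid p" "\<And>p'. valid p' \<Longrightarrow> \<mu> p \<le> \<mu> p'"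
    using ex_has_least_nat[of valid "(c, A)" \<mu>] by blast
  define c0 where "c0 = fst p"
  define A0 where "A0 = snd p"
  have pr: "proper_on E c0" and im: "c0 ` E \<subseteq> S"
    and A0: "\<And>u. u \<in> N \<Longrightarrow> A0 u \<subseteq> S" "\<And>u e. u \<in> N \<Longrightarrow> e \<in> E \<Longrightarrow> u \<in> e \<Longrightarrow> c0 e \<notin> A0 u"
      "\<And>u. u \<in> N \<Longrightarrow> card (A0 u) = (if u = w then 1 else 2)"
    using p(1) by (auto simp: valid_def c0_def A0_def)
  have fX: "finite (X A0 i)" for i using finN by (simp add: X_def)
  have near: "card (X A0 i) \<le> card (X A0 j) + 2" if ij: "i \<in> S" "j \<in> S" for i j
  proof (rule ccontr)
    assume "\<not> ?thesis"
    then have gt: "card (X A0 i) > card (X A0 j) + 2" by simp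
    then have ne: "i \<noteq> j" by auto
    define H where "H = {e\<in>E. c0 e = i \<or> c0 e = j}"
    have "\<exists>s\<in>X A0 i. card (component H s \<inter> X A0 i) > card (component H s \<inter> X A0 j)"
    proof (rule larger_in_component[OF fX fX])
      show "component H x = component H y" if "component H x \<inter> component H y \<noteq> {}" for x y
        using that component_sym by (metis disjoint_iff)
      show "\<exists>s\<in>X A0 i. x \<in> component H s" if "x \<in> X A0 i" for x
        using that component_refl[of x H] by blast
    qed (use gt in simp)
    then obtain s where s: "card (component H s \<inter> X A0 i) > card (component H s \<inter> X A0 j)" by blast
    define C where "C = component H s"
    note ke = kempe_edges[OF E pr ne, where x = s, folded H_def, folded C_def]
    have two: "card (C \<inter> X A0 i) + card (C \<inter> X A0 j) \<le> 2"
      unfolding C_def H_def by (rule missing_in_component[OF E pr ne]) (use A0(2) in \<open>auto simp: X_def\<close>)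
    define d where "d = card (C \<inter> X A0 i) - card (C \<inter> X A0 j)"
    have d: "0 < d" "d \<le> 2" using s two by (auto simp: d_def C_def)
    define c1 where "c1 = kempe c0 i j C"
    define A1 where "A1 u = (if u \<in> C then exchange i j ` A0 u else A0 u)" for u
    have "valid (c1, A1)"
      unfolding valid_def fst_conv snd_conv
    proof (intro conjI ballI impI)
      show "proper_on E c1" unfolding c1_def by (rule proper_on_kempe[OF pr ke(1)])
      show "c1 ` E \<subseteq> S" using im ij by (auto simp: c1_def kempe_def exchange_def)
      fix u assume u: "u \<in> N"
      show "A1 u \<subseteq> S" using A0(1)[OF u] ij by (auto simp: A1_def exchange_def)
      show "card (A1 u) = (if u = w then 1 else 2)"
      proof -
        have "card (exchange i j ` A0 u) = card (A0 u)" by (rule card_image) (simp add: inj_on_def exchange_inj)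
        then show ?thesis using A0(3)[OF u] by (cases "u = w") (simp_all add: A1_def)
      qed
      fix e assume e: "e \<in> E" "u \<in> e"
      show "c1 e \<notin> A1 u"
      proof (cases "u \<in> C")
        case True
        then have "e \<inter> C \<noteq> {}" using e by auto
        then show ?thesis using True A0(2)[OF u e] by (auto simp: c1_def kempe_def A1_def exchange_inj)
      next
        case False
        then have "c1 e = c0 e" using ke(1)[OF e(1)] e(2) by (auto simp: c1_def kempe_def exchange_def)
        then show ?thesis using False A0(2)[OF u e] by (simp add: A1_def)
      qed
    qed
    moreover have "\<mu> (c1, A1) < \<mu> p"
      unfolding \<mu>_def snd_conv A0_def[symmetric]
    proof (rule sum_exchange_less[OF finS ij ne])
      fix t assume "t \<noteq> i" "t \<noteq> j"
      then have "X A1 t = X A0 t" by (auto simp: X_def A1_def exchange_def)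
      then show "(card (X A1 t))\<^sup>2 = (card (X A0 t))\<^sup>2" by simp
    next
      have X1: "X A1 i = (X A0 i - C) \<union> (C \<inter> X A0 j)" "X A1 j = (X A0 j - C) \<union> (C \<inter> X A0 i)"
        using ne by (auto simp: X_def A1_def exchange_def split: if_splits)
      have sp: "card (X A0 t - C) + card (C \<inter> X A0 t) = card (X A0 t)" for t
        using fX card_Diff_subset_Int[of "X A0 t" C] card_mono[of "X A0 t" "X A0 t \<inter> C"] by (simp add: Int_commute)
      moreover have "card (X A1 i) = card (X A0 i - C) + card (C \<inter> X A0 j)"
        unfolding X1 using fX by (intro card_Un_disjoint) auto
      moreover have "card (X A1 j) = card (X A0 j - C) + card (C \<inter> X A0 i)"
        unfolding X1 using fX by (intro card_Un_disjoint) auto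
      moreover have "card (C \<inter> X A0 i) = card (C \<inter> X A0 j) + d" using s by (simp add: d_def C_def)
      ultimately have "card (X A1 i) = card (X A0 i) - d" "card (X A1 j) = card (X A0 j) + d"
        using sp[of i] sp[of j] by linarith+
      then show "(card (X A1 i))\<^sup>2 + (card (X A1 j))\<^sup>2 < (card (X A0 i))\<^sup>2 + (card (X A0 j))\<^sup>2"
        using square_exchange[of d "card (X A0 i)" "card (X A0 j)"] gt d by simp
    qed
    ultimately show False using p(2) by (meson leD)
  qed
  have tot: "(\<Sum>i\<in>S. card (X A0 i)) + 1 = 2 * card N"
  proof -
    have "(\<Sum>i\<in>S. card (X A0 i)) = (\<Sum>i\<in>S. \<Sum>u\<in>N. if i \<in> A0 u then 1 else 0)"
      using finN by (simp add: X_def sum.If_cases Int_def)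
    also have "\<dots> = (\<Sum>u\<in>N. \<Sum>i\<in>S. if i \<in> A0 u then 1 else 0)" by (rule sum.swap)
    also have "\<dots> = (\<Sum>u\<in>N. if u = w then 1 else 2)"
    proof (rule sum.cong[OF refl])
      fix u assume u: "u \<in> N"
      have "{i\<in>S. i \<in> A0 u} = A0 u" using A0(1)[OF u] by auto
      then show "(\<Sum>i\<in>S. if i \<in> A0 u then 1 else 0) = (if u = w then 1 else 2::nat)"
        using finS A0(3)[OF u] by (simp add: sum.If_cases Int_def)
    qed
    also have "\<dots> = (\<Sum>u\<in>insert w (N - {w}). if u = w then 1 else 2)" using wN by (simp add: insert_absorb)
    also have "\<dots> = 1 + (\<Sum>u\<in>N - {w}. 2)" using finN by (subst sum.insert) (auto intro!: sum.cong)
    also have "\<dots> + 1 = 2 * card N" using finN wN card_gt_0_iff[of N] by (auto simp: card_Diff_singleton)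
    finally show ?thesis .
  qed
  \<comment> \<open>Some number is at most 1. If none were 1, one would be 0, and by
    \<open>near\<close> all would be 0 or 2, so the sum would be even.\<close>
  have "\<exists>\<kappa>\<in>S. card (X A0 \<kappa>) = 1"
  proof (rule ccontr)
    assume no: "\<not> ?thesis"
    have "\<exists>j\<in>S. card (X A0 j) \<le> 1"
    proof (rule ccontr)
      assume "\<not> ?thesis"
      then have "2 \<le> card (X A0 i)" if "i \<in> S" for i using that by force
      then have "(\<Sum>i\<in>S. 2) \<le> (\<Sum>i\<in>S. card (X A0 i))" by (intro sum_mono)
      then have "card S * 2 \<le> (\<Sum>i\<in>S. card (X A0 i))" by simp
      then show False using tot Suc.prems(9) by linarith
    qed
    then obtain j where "j \<in> S" "card (X A0 j) = 0" using no by (metis less_one linorder_neqE_nat not_le)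
    then have "card (X A0 i) = 0 \<or> card (X A0 i) = 2" if "i \<in> S" for i
      using near[OF that] no that by (metis One_nat_def Suc_1 add_0 le_SucE le_zero_eq)
    then have "even (\<Sum>i\<in>S. card (X A0 i))" by (intro dvd_sum) (metis dvd_0_right dvd_refl)
    then show False using tot by presburger
  qed
  then obtain \<kappa> u where \<kappa>: "\<kappa> \<in> S" "X A0 \<kappa> = {u}" by (metis card_1_singletonE)
  have u: "u \<in> N" "\<kappa> \<in> A0 u" and only: "\<And>u'. u' \<in> N \<Longrightarrow> \<kappa> \<in> A0 u' \<Longrightarrow> u' = u"
    using \<kappa>(2) by (auto simp: X_def)
  define E' where "E' = {e\<in>E. c0 e \<noteq> \<kappa>}"
  define N' where "N' = N - {u}"
  \<comment> \<open>If the served neighbour was \<open>w\<close>, another one takes over its role by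
    giving up one of its two offers.\<close>
  define w' where "w' = (if u = w then (SOME x. x \<in> N') else w)"
  define A' where "A' x = (if x = w' \<and> u = w then {SOME a. a \<in> A0 x} else A0 x)" for x
  have w': "w' \<in> N'" if "N' \<noteq> {}"
  proof (cases "u = w")
    case True
    then show ?thesis using that some_in_eq[of N'] by (simp add: w'_def)
  qed (use wN in \<open>auto simp: w'_def N'_def\<close>)
  have A'sub: "A' x \<subseteq> A0 x" if "x \<in> N'" for x
  proof -
    have "A0 x \<noteq> {}" using A0(3)[of x] that by (auto simp: N'_def split: if_splits)
    then show ?thesis using some_in_eq[of "A0 x"] by (auto simp: A'_def)
  qed
  have "\<exists>c'. proper_on (E' \<union> (\<lambda>u. {v, u}) ` N') c' \<and> c' ` (E' \<union> (\<lambda>u. {v, u}) ` N') \<subseteq> S - {\<kappa>}"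
  proof (rule Suc.hyps(1)[where c = c0 and A = A' and w = w'])
    show "n = card N'" using Suc.hyps(2) finN u by (simp add: N'_def card_Diff_singleton)
    show "proper_on E' c0" using pr by (auto simp: proper_on_def E'_def)
    show "card N' \<le> card (S - {\<kappa>})" using Suc.prems(9) finN finS u \<kappa> by (simp add: N'_def card_Diff_singleton)
    show "\<forall>x\<in>N'. A' x \<subseteq> S - {\<kappa>} \<and> (\<forall>e\<in>E'. x \<in> e \<longrightarrow> c0 e \<notin> A' x)"
      using A'sub A0(1,2) only by (fastforce simp: N'_def E'_def)
    show "\<forall>x\<in>N'. card (A' x) = (if x = w' then 1 else 2)"
      using A0(3) by (auto simp: A'_def N'_def w'_def)
  qed (use E finS finN im w' Suc.prems(7,8) in \<open>auto simp: E'_def N'_def\<close>)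
  then obtain c' where c': "proper_on (E' \<union> (\<lambda>u. {v, u}) ` N') c'" "c' ` (E' \<union> (\<lambda>u. {v, u}) ` N') \<subseteq> S - {\<kappa>}" by blast
  define c2 where "c2 e = (if e \<in> E' \<union> (\<lambda>u. {v, u}) ` N' then c' e else \<kappa>)" for e
  have rest: "e = {v, u} \<or> (e \<in> E \<and> c0 e = \<kappa>)"
    if "e \<in> E \<union> (\<lambda>u. {v, u}) ` N" "e \<notin> E' \<union> (\<lambda>u. {v, u}) ` N'" for e
    using that by (auto simp: E'_def N'_def)
  have vu: "u \<notin> e" if "e \<in> E" "c0 e = \<kappa>" for e using A0(2)[OF u(1) that(1)] u(2) that(2) by auto
  have "proper_on (E \<union> (\<lambda>u. {v, u}) ` N) c2"
    unfolding proper_on_def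
  proof (intro ballI impI)
    fix e e' assume H: "e \<in> E \<union> (\<lambda>u. {v, u}) ` N" "e' \<in> E \<union> (\<lambda>u. {v, u}) ` N" "adjacent e e'"
    let ?T = "E' \<union> (\<lambda>u. {v, u}) ` N'"
    consider "e \<in> ?T" "e' \<in> ?T" | "e \<in> ?T" "e' \<notin> ?T" | "e \<notin> ?T" "e' \<in> ?T" | "e \<notin> ?T" "e' \<notin> ?T" by blast
    then show "c2 e \<noteq> c2 e'"
    proof cases
      case 1
      then show ?thesis using c'(1) H by (simp add: c2_def proper_on_def)
    next
      case 2
      then have "c' e \<noteq> \<kappa>" using c'(2) by blast
      then show ?thesis using 2 by (simp add: c2_def)
    next
      case 3
      then have "c' e' \<noteq> \<kappa>" using c'(2) by blast
      then show ?thesis using 3 by (simp add: c2_def)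
    next
      case 4
      have False
        using rest[OF H(1) 4(1)] rest[OF H(2) 4(2)]
      proof (elim disjE conjE)
        assume "e = {v, u}" "e' = {v, u}"
        then show False using H by (simp add: adjacent_def)
      next
        assume "e = {v, u}" "e' \<in> E" "c0 e' = \<kappa>"
        then show False using H vu[of e'] Suc.prems(8) by (auto simp: adjacent_def)
      next
        assume "e \<in> E" "c0 e = \<kappa>" "e' = {v, u}"
        then show False using H vu[of e] Suc.prems(8) by (auto simp: adjacent_def)
      next
        assume "e \<in> E" "c0 e = \<kappa>" "e' \<in> E" "c0 e' = \<kappa>"
        then show False using pr H(3) unfolding proper_on_def by metis
      qed
      then show ?thesis ..
    qed
  qed
  moreover have "c2 ` (E \<union> (\<lambda>u. {v, u}) ` N) \<subseteq> S" using c'(2) \<kappa>(1) by (auto simp: c2_def)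
  ultimately show ?case by blast
qed

text \<open>Vertices are added one at a time. The edge from a neighbour \<open>u\<close> to the new
  vertex is not yet coloured, so at most \<open>k - 1\<close> colours occur at \<open>u\<close> and
  at least two of the \<open>k + 1\<close> colours are missing there.\<close>

theorem vizing:
  assumes G: "simple_graph G" and deg: "\<And>v. v \<in> verts G \<Longrightarrow> card {e\<in>edges G. v \<in> e} \<le> k"
  shows "\<exists>c. proper_on (edges G) c \<and> c ` edges G \<subseteq> {..k}"
proof -
  have fV: "finite (verts G)" and E2: "\<And>e. e \<in> edges G \<Longrightarrow> e \<subseteq> verts G \<and> card e = 2"
    using G by (auto simp: simple_graph_def)
  have fE: "finite (edges G)" by (rule finite_edges[OF G])
  define EW where "EW W = {e\<in>edges G. e \<subseteq> W}" for W
  have "W \<subseteq> verts G \<Longrightarrow> \<exists>c. proper_on (EW W) c \<and> c ` EW W \<subseteq> {..k}" if "finite W" for W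
    using that
  proof (induction W rule: finite_induct)
    case empty
    have "EW {} = {}" using E2 by (fastforce simp: EW_def)
    then show ?case by (auto simp: proper_on_def)
  next
    case (insert v W)
    then obtain c where c: "proper_on (EW W) c" "c ` EW W \<subseteq> {..k}" by auto
    define N where "N = {u\<in>W. {v, u} \<in> edges G}"
    have split: "EW (insert v W) = EW W \<union> (\<lambda>u. {v, u}) ` N"
    proof
      show "EW (insert v W) \<subseteq> EW W \<union> (\<lambda>u. {v, u}) ` N"
      proof
        fix e assume e: "e \<in> EW (insert v W)"
        then have eG: "e \<in> edges G" "e \<subseteq> insert v W" by (auto simp: EW_def)
        obtain a b where ab: "e = {a, b}" "a \<noteq> b" using E2[OF eG(1)] by (metis card_2_iff)
        show "e \<in> EW W \<union> (\<lambda>u. {v, u}) ` N"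
        proof (cases "v \<in> e")
          case True
          then obtain u where "e = {v, u}" "u \<noteq> v" using ab by (metis insert_commute insertE singletonD)
          then show ?thesis using eG by (auto simp: N_def)
        qed (use eG in \<open>auto simp: EW_def\<close>)
      qed
    qed (auto simp: EW_def N_def)
    have miss: "\<exists>A. A \<subseteq> {t\<in>{..k}. \<forall>e\<in>EW W. u \<in> e \<longrightarrow> c e \<noteq> t} \<and> card A = 2" if u: "u \<in> N" for u
    proof -
      define D where "D = {e\<in>EW W. u \<in> e}"
      have fD: "finite D" using fE by (simp add: D_def EW_def)
      have "insert {v, u} D \<subseteq> {e\<in>edges G. u \<in> e}" using u by (auto simp: D_def EW_def N_def)
      then have "card (insert {v, u} D) \<le> card {e\<in>edges G. u \<in> e}" using fE by (intro card_mono) auto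
      moreover have "card (insert {v, u} D) = Suc (card D)"
        using insert(2) fD by (subst card_insert_disjoint) (auto simp: D_def EW_def)
      moreover have "card {e\<in>edges G. u \<in> e} \<le> k" using u insert.prems by (intro deg) (auto simp: N_def)
      ultimately have "Suc (card D) \<le> k" by simp
      moreover have "card (c ` D) \<le> card D" by (rule card_image_le[OF fD])
      moreover have "card ({..k} - c ` D) \<ge> card {..k} - card (c ` D)" using fD by (intro diff_card_le_card_Diff) auto
      ultimately have "2 \<le> card ({..k} - c ` D)" by simp
      then obtain A where "A \<subseteq> {..k} - c ` D" "card A = 2" using obtain_subset_with_card_n by metis
      then show ?thesis by (intro exI[of _ A]) (auto simp: D_def)
    qed
    then have "\<forall>u\<in>N. \<exists>A. A \<subseteq> {t\<in>{..k}. \<forall>e\<in>EW W. u \<in> e \<longrightarrow> c e \<noteq> t} \<and> card A = 2" by blast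
    from bchoice[OF this] obtain A
      where A: "\<And>u. u \<in> N \<Longrightarrow> A u \<subseteq> {t\<in>{..k}. \<forall>e\<in>EW W. u \<in> e \<longrightarrow> c e \<noteq> t} \<and> card (A u) = 2"
      by auto
    define w where "w = (SOME u. u \<in> N)"
    have w: "w \<in> N" if "N \<noteq> {}" using that some_in_eq[of N] by (simp add: w_def)
    define A' where "A' u = (if u = w then {SOME a. a \<in> A u} else A u)" for u
    have A's: "A' u \<subseteq> A u" if "u \<in> N" for u
    proof -
      have "A u \<noteq> {}" using A[OF that] by auto
      then show ?thesis using some_in_eq[of "A u"] by (auto simp: A'_def)
    qed
    have "\<exists>c'. proper_on (EW W \<union> (\<lambda>u. {v, u}) ` N) c' \<and> c' ` (EW W \<union> (\<lambda>u. {v, u}) ` N) \<subseteq> {..k}"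
    proof (rule extend_colouring_at_vertex[OF _ _ c, where A = A' and w = w])
      show "card N \<le> card {..k}"
      proof -
        have "card N = card ((\<lambda>u. {v, u}) ` N)" by (intro card_image[symmetric]) (auto simp: inj_on_def doubleton_eq_iff)
        also have "\<dots> \<le> card {e\<in>edges G. v \<in> e}" using fE by (intro card_mono) (auto simp: N_def)
        also have "\<dots> \<le> k" using insert.prems by (intro deg) auto
        finally show ?thesis by simp
      qed
      show "\<forall>u\<in>N. A' u \<subseteq> {..k} \<and> (\<forall>e\<in>EW W. u \<in> e \<longrightarrow> c e \<notin> A' u)" using A A's by fastforce
      show "\<forall>u\<in>N. card (A' u) = (if u = w then 1 else 2)" using A by (simp add: A'_def)
    qed (use fE E2 insert w in \<open>auto simp: EW_def N_def\<close>)
    then show ?case unfolding split .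
  qed
  from this[OF fV subset_refl] show ?thesis
  proof -
    have "EW (verts G) = edges G" using E2 by (auto simp: EW_def)
    then show ?thesis using \<open>\<exists>c. proper_on (EW (verts G)) c \<and> c ` EW (verts G) \<subseteq> {..k}\<close> by simp
  qed
qed

text \<open>Minimise the sum of squares of the class sizes. If two sizes differ by more than 1, some
  component of the two classes has more edges of the larger one. Since its edges of one colour are
  disjoint and its vertices exceed its edges by at most 1, it has exactly one more, and exchanging
  the colours on it lowers the sum.\<close>

lemma equitable_colouring:
  fixes c :: "'a set \<Rightarrow> nat"
  assumes E: "finite E" "\<forall>e\<in>E. card e = 2" and c: "proper_on E c" "c ` E \<subseteq> {..<K}"
  shows "\<exists>c'. proper_on E c' \<and> c' ` E \<subseteq> {..<K} \<and>
    (\<forall>i<K. \<forall>j<K. card {e\<in>E. c' e = i} \<le> card {e\<in>E. c' e = j} + 1)"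
proof -
  define X where "X c i = {e\<in>E. c e = i}" for c :: "'a set \<Rightarrow> nat" and i
  define valid where "valid c \<longleftrightarrow> proper_on E c \<and> c ` E \<subseteq> {..<K}" for c :: "'a set \<Rightarrow> nat"
  define \<mu> where "\<mu> c = (\<Sum>i<K. (card (X c i))\<^sup>2)" for c
  have "valid c" using c by (simp add: valid_def)
  then obtain c0 where p: "valid c0" "\<And>c'. valid c' \<Longrightarrow> \<mu> c0 \<le> \<mu> c'"
    using ex_has_least_nat[of valid c \<mu>] by blast
  have pr: "proper_on E c0" and im: "c0 ` E \<subseteq> {..<K}" using p(1) by (auto simp: valid_def)
  have fX: "finite (X c i)" for c i using E by (simp add: X_def)
  have "card (X c0 i) \<le> card (X c0 j) + 1" if ij: "i < K" "j < K" for i j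
  proof (rule ccontr)
    assume "\<not> ?thesis"
    then have gt: "card (X c0 i) > card (X c0 j) + 1" by simp
    then have ne: "i \<noteq> j" by auto
    define H where "H = {e\<in>E. c0 e = i \<or> c0 e = j}"
    define Cs where "Cs x = {e\<in>H. e \<subseteq> component H x}" for x
    have H2: "\<forall>e\<in>H. card e = 2" using E by (simp add: H_def)
    have "\<exists>s\<in>UNIV. card (Cs s \<inter> X c0 i) > card (Cs s \<inter> X c0 j)"
    proof (rule larger_in_component[OF fX fX])
      show "Cs x = Cs y" if "Cs x \<inter> Cs y \<noteq> {}" for x y
      proof -
        obtain e where e: "e \<in> H" "e \<subseteq> component H x" "e \<subseteq> component H y" using \<open>Cs x \<inter> Cs y \<noteq> {}\<close> by (auto simp: Cs_def)
        have "e \<noteq> {}" using H2 e by auto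
        then obtain z where "z \<in> component H x" "z \<in> component H y" using e by auto
        then show ?thesis using component_sym by (metis Cs_def)
      qed
      show "\<exists>s\<in>UNIV. e \<in> Cs s" if "e \<in> X c0 i" for e
      proof -
        have e: "e \<in> H" using that by (auto simp: X_def H_def)
        then have "e \<noteq> {}" using H2 by auto
        then obtain z where "z \<in> e" by auto
        then have "e \<subseteq> component H z" using component_closed[OF H2 e, of z] component_refl[of z H] by auto
        then show ?thesis using e by (auto simp: Cs_def)
      qed
    qed (use gt in auto)
    then obtain s where s: "card (Cs s \<inter> X c0 i) > card (Cs s \<inter> X c0 j)" by blast
    define C where "C = component H s"
    note ke = kempe_edges[OF E pr ne, where x = s, folded H_def, folded C_def]
    have CsC: "Cs s = {e\<in>H. e \<subseteq> C}" by (simp add: Cs_def C_def)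
    have "2 * card (Cs s \<inter> X c0 i) \<le> card C"
    proof -
      define T where "T = Cs s \<inter> X c0 i"
      have fe: "finite e" if "e \<in> T" for e using that ke(2) by (auto simp: T_def CsC intro: finite_subset)
      have "(\<Sum>e\<in>T. card e) = card (\<Union>T)"
      proof (rule card_Union_disjoint[symmetric])
        show "pairwise disjnt T"
          using pr unfolding pairwise_def disjnt_def by (fastforce simp: proper_on_def adjacent_def T_def X_def)
      qed (use fe in auto)
      moreover have "(\<Sum>e\<in>T. card e) = 2 * card T" using E by (simp add: T_def X_def)
      moreover have "card (\<Union>T) \<le> card C" using ke(2) by (intro card_mono) (auto simp: T_def CsC)
      ultimately show ?thesis by (simp add: T_def)
    qed
    moreover have "card (Cs s) = card (Cs s \<inter> X c0 i) + card (Cs s \<inter> X c0 j)"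
    proof -
      have "Cs s = (Cs s \<inter> X c0 i) \<union> (Cs s \<inter> X c0 j)" by (auto simp: Cs_def H_def X_def)
      then have "card (Cs s) = card ((Cs s \<inter> X c0 i) \<union> (Cs s \<inter> X c0 j))" by simp
      also have "\<dots> = card (Cs s \<inter> X c0 i) + card (Cs s \<inter> X c0 j)"
        using fX ne by (intro card_Un_disjoint) (auto simp: X_def)
      finally show ?thesis .
    qed
    ultimately have one: "card (Cs s \<inter> X c0 i) = card (Cs s \<inter> X c0 j) + 1"
      using ke(3) s unfolding CsC[symmetric] by linarith
    define c1 where "c1 = kempe c0 i j C"
    have meet: "e \<in> Cs s \<longleftrightarrow> e \<inter> C \<noteq> {}" if "e \<in> H" for e
    proof -
      have "e \<noteq> {}" using H2 that by auto
      then show ?thesis using ke(1)[of e] that by (auto simp: CsC H_def)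
    qed
    have "valid c1"
      unfolding valid_def
    proof
      show "proper_on E c1" unfolding c1_def by (rule proper_on_kempe[OF pr ke(1)])
      show "c1 ` E \<subseteq> {..<K}" using im ij by (auto simp: c1_def kempe_def exchange_def)
    qed
    moreover have "\<mu> c1 < \<mu> c0"
      unfolding \<mu>_def
    proof (rule sum_exchange_less[OF _ _ _ ne])
      fix t assume "t \<noteq> i" "t \<noteq> j"
      then have "X c1 t = X c0 t" by (auto simp: X_def c1_def kempe_def exchange_def)
      then show "(card (X c1 t))\<^sup>2 = (card (X c0 t))\<^sup>2" by simp
    next
      have X1: "X c1 i = (X c0 i - Cs s) \<union> (Cs s \<inter> X c0 j)" "X c1 j = (X c0 j - Cs s) \<union> (Cs s \<inter> X c0 i)"
        using ne meet by (auto simp: X_def c1_def kempe_def exchange_def H_def split: if_splits)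
      have sp: "card (X c0 t - Cs s) + card (Cs s \<inter> X c0 t) = card (X c0 t)" for t
        using fX card_Diff_subset_Int[of "X c0 t" "Cs s"] card_mono[of "X c0 t" "X c0 t \<inter> Cs s"] by (simp add: Int_commute)
      moreover have "card (X c1 i) = card (X c0 i - Cs s) + card (Cs s \<inter> X c0 j)"
        unfolding X1 using fX by (intro card_Un_disjoint) auto
      moreover have "card (X c1 j) = card (X c0 j - Cs s) + card (Cs s \<inter> X c0 i)"
        unfolding X1 using fX by (intro card_Un_disjoint) auto
      ultimately have "card (X c1 i) = card (X c0 i) - 1" "card (X c1 j) = card (X c0 j) + 1"
        using one sp[of i] sp[of j] by linarith+
      then show "(card (X c1 i))\<^sup>2 + (card (X c1 j))\<^sup>2 < (card (X c0 i))\<^sup>2 + (card (X c0 j))\<^sup>2"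
        using square_exchange[of 1 "card (X c0 i)" "card (X c0 j)"] gt by simp
    qed (use ij in auto)
    ultimately show False using p(2) by (meson leD)
  qed
  then show ?thesis using pr im by (auto simp: X_def)
qed

section \<open>Upper bounds\<close>

lemma bij_betw_mod_window:
  fixes m :: nat
  assumes "0 < m"
  shows "bij_betw (\<lambda>y. y mod m) {a..<a + m} {..<m}"
proof -
  have "inj_on (\<lambda>y. y mod m) {a..<a + m}"
  proof (rule inj_onI)
    have key: "x = y" if "x \<in> {a..<a + m}" "y \<in> {a..<a + m}" "x mod m = y mod m" "x \<le> y" for x y
    proof -
      have "m dvd y - x" using that by (metis mod_eq_dvd_iff_nat)
      moreover have "y - x < m" using that by auto
      ultimately have "y - x = 0" by (metis dvd_imp_le gr0I leD)
      then show ?thesis using that(4) by simp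
    qed
    fix x y assume "x \<in> {a..<a + m}" "y \<in> {a..<a + m}" "x mod m = y mod m"
    then show "x = y" using key[of x y] key[of y x] by (cases "x \<le> y") auto
  qed
  moreover have "(\<lambda>y. y mod m) ` {a..<a + m} \<subseteq> {..<m}" using assms by auto
  ultimately show ?thesis
    using card_subset_eq[of "{..<m}" "(\<lambda>y. y mod m) ` {a..<a + m}"] by (simp add: bij_betw_def card_image)
qed

lemma bij_betw_Collect:
  assumes "bij_betw f A B"
  shows "bij_betw f {x\<in>A. Q (f x)} {y\<in>B. Q y}"
  using assms by (auto simp: bij_betw_def inj_on_def)

text \<open>A periodic list over the natural numbers turns cyclic windows into intervals, with no
  case distinction at the end of a period.\<close>

lemma periodic_listing:
  assumes ord: "ordering G l" and fin: "finite (edges G)" and ne: "edges G \<noteq> {}"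
    and sep: "separated s G l" and s: "s \<le> card (edges G)"
  obtains w :: "nat \<Rightarrow> 'a set" where "\<forall>a. bij_betw w {a..<a + card (edges G)} (edges G)"
    "\<forall>y y'. y < y' \<longrightarrow> y' < y + s \<longrightarrow> w y \<noteq> w y' \<and> w y \<inter> w y' = {}"
proof -
  define m where "m = card (edges G)"
  have m: "0 < m" using fin ne by (simp add: m_def card_gt_0_iff)
  define g where "g = the_inv_into (edges G) l"
  have bl: "bij_betw l (edges G) {..<m}" using ord by (simp add: ordering_def m_def lessThan_atLeast0)
  have bg: "bij_betw g {..<m} (edges G)" unfolding g_def by (rule bij_betw_the_inv_into[OF bl])
  have lg: "l (g i) = i" if "i < m" for i
    unfolding g_def using bl that by (intro f_the_inv_into_f_bij_betw[OF bl]) auto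
  have gE: "g i \<in> edges G" if "i < m" for i using bg that by (auto simp: bij_betw_def)
  define w where "w y = g (y mod m)" for y
  have "bij_betw w {a..<a + m} (edges G)" for a
    using bij_betw_trans[OF bij_betw_mod_window[OF m] bg] by (simp add: w_def[abs_def] comp_def)
  moreover have "w y \<noteq> w y' \<and> w y \<inter> w y' = {}" if y: "y < y'" "y' < y + s" for y y'
  proof -
    define d where "d = y' - y"
    have d: "0 < d" "d < s" "y' = y + d" using y by (auto simp: d_def)
    define i where "i = y mod m"
    have i: "i < m" using m by (simp add: i_def)
    have j: "y' mod m = (i + d) mod m" using d by (simp add: i_def mod_simps)
    have nadj: "\<not> adjacent (w y) (w y') \<and> w y \<noteq> w y'"
    proof (cases "i + d < m")
      case True
      then have jj: "y' mod m = i + d" using j by simp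
      have "\<not> adjacent (g i) (g (i + d))"
      proof
        assume "adjacent (g i) (g (i + d))"
        then have "s + i \<le> i + d"
          using sep gE[OF i] gE[OF True] lg[OF i] lg[OF True] d(1) by (force simp: separated_def)
        then show False using d by simp
      qed
      moreover have "g i \<noteq> g (i + d)" using lg[OF i] lg[OF True] d by force
      ultimately show ?thesis using jj by (simp add: w_def i_def)
    next
      case False
      define j' where "j' = i + d - m"
      have j': "j' < m" "y' mod m = j'" "j' + m = i + d" "j' < i"
        using False i d s j by (auto simp: j'_def m_def le_mod_geq)
      have "\<not> adjacent (g j') (g i)"
      proof
        assume "adjacent (g j') (g i)"
        then have "s + i \<le> m + j'"
          using sep gE[OF i] gE[OF j'(1)] lg[OF i] lg[OF j'(1)] j'(4) by (force simp: separated_def m_def)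
        then show False using d j' by simp
      qed
      moreover have "g i \<noteq> g j'" using lg[OF i] lg[OF j'(1)] j' by force
      ultimately show ?thesis using j' adjacent_sym by (metis w_def i_def)
    qed
    then show ?thesis by (auto simp: adjacent_def)
  qed
  ultimately show thesis using that[of w] by (simp add: m_def)
qed

lemma window_edges_le:
  fixes w :: "nat \<Rightarrow> 'a set"
  assumes "\<And>y y'. y < y' \<Longrightarrow> y' < y + s \<Longrightarrow> w y \<noteq> w y' \<and> w y \<inter> w y' = {}"
    and "finite T" "\<And>y. y \<in> Y \<Longrightarrow> w y \<subseteq> T \<and> card (w y) = 2" "Y \<subseteq> {a..<a + s}"
  shows "2 * card Y \<le> card T" "card (\<Union>(w ` Y)) = 2 * card Y"
proof -
  have fY: "finite Y" using assms(4) finite_subset by blast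
  have fw: "finite (w y)" if "y \<in> Y" for y using assms(2,3) that by (meson finite_subset)
  have dis: "w y \<inter> w y' = {}" if "y \<in> Y" "y' \<in> Y" "y \<noteq> y'" for y y'
  proof (cases "y < y'")
    case True
    have "y \<in> {a..<a + s}" "y' \<in> {a..<a + s}" using assms(4) that by blast+
    then show ?thesis using assms(1)[of y y'] True by auto
  next
    case False
    have "y \<in> {a..<a + s}" "y' \<in> {a..<a + s}" using assms(4) that by blast+
    then show ?thesis using assms(1)[of y' y] False that(3) by auto
  qed
  have "card (\<Union>(w ` Y)) = (\<Sum>y\<in>Y. card (w y))"
    using fY fw dis by (intro card_UN_disjoint) auto
  then show eq: "card (\<Union>(w ` Y)) = 2 * card Y" using assms(3) by simp
  have "card (\<Union>(w ` Y)) \<le> card T" using assms(2,3) by (intro card_mono) auto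
  then show "2 * card Y \<le> card T" using eq by simp
qed

lemma cms_graph_le_half:
  assumes G: "simple_graph G" and m: "card (verts G) \<le> card (edges G)" "edges G \<noteq> {}"
  shows "2 * cms_graph G + 1 \<le> card (verts G)"
proof -
  define s where "s = cms_graph G"
  have fE: "finite (edges G)" by (rule finite_edges[OF G])
  have fV: "finite (verts G)" and e2: "\<And>e. e \<in> edges G \<Longrightarrow> e \<subseteq> verts G \<and> card e = 2"
    using G by (auto simp: simple_graph_def)
  obtain l where l: "ordering G l" "separated s G l" "1 \<le> s" "s \<le> card (edges G)"
    by (rule cms_graph_attained[OF m(2) fE]) (simp add: s_def)
  obtain w where w_all: "\<forall>a. bij_betw w {a..<a + card (edges G)} (edges G)"
    and wd_all: "\<forall>y y'. y < y' \<longrightarrow> y' < y + s \<longrightarrow> w y \<noteq> w y' \<and> w y \<inter> w y' = {}"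
    by (rule periodic_listing[OF l(1) fE m(2) l(2,4)]) (rule that, assumption+)
  have w: "\<And>a. bij_betw w {a..<a + card (edges G)} (edges G)"
    and wd: "\<And>y y'. y < y' \<Longrightarrow> y' < y + s \<Longrightarrow> w y \<noteq> w y' \<and> w y \<inter> w y' = {}"
    using w_all wd_all by blast+
  have wE: "w y \<subseteq> verts G \<and> card (w y) = 2" for y
  proof -
    have "y \<in> {y..<y + card (edges G)}" using m(2) fE by (simp add: card_gt_0_iff)
    then have "w y \<in> edges G" using bij_betwE[OF w] by blast
    then show ?thesis using e2 by blast
  qed
  have le: "2 * s \<le> card (verts G)"
  proof -
    have "2 * card {0..<s} \<le> card (verts G)"
      by (rule window_edges_le(1)[OF wd fV, where a = 0]) (use wE in auto)
    then show ?thesis by simp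
  qed
  moreover have "2 * s \<noteq> card (verts G)"
  proof
    assume eq: "2 * s = card (verts G)"
    \<comment> \<open>The edges strictly between the places \<open>0\<close> and \<open>s\<close>
      cover all but two vertices. Both \<open>w 0\<close> and \<open>w s\<close> must be this
      remaining pair, although a period is longer than \<open>s\<close>.\<close>
    define B where "B = \<Union>(w ` {1..<s})"
    have cB: "card B = 2 * (s - 1)"
    proof -
      have "card (\<Union>(w ` {1..<s})) = 2 * card {1..<s}"
        by (rule window_edges_le(2)[OF wd fV, where a = 0]) (use wE in auto)
      then show ?thesis by (simp add: B_def)
    qed
    have BV: "B \<subseteq> verts G" using wE by (auto simp: B_def)
    have cR: "card (verts G - B) = 2"
      using cB BV fV eq l(3) by (subst card_Diff_subset) (auto intro: finite_subset)
    have "w 0 \<subseteq> verts G - B" "w s \<subseteq> verts G - B"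
    proof -
      have "w 0 \<inter> w y = {}" if "y \<in> {1..<s}" for y using wd[of 0 y] that by auto
      then show "w 0 \<subseteq> verts G - B" using wE[of 0] unfolding B_def by blast
      have "w y \<inter> w s = {}" if "y \<in> {1..<s}" for y using wd[of y s] that by auto
      then show "w s \<subseteq> verts G - B" using wE[of s] unfolding B_def by blast
    qed
    then have "w 0 = verts G - B" "w s = verts G - B"
      using card_subset_eq[of "verts G - B" "w 0"] card_subset_eq[of "verts G - B" "w s"] wE[of 0] wE[of s] cR fV by simp_all
    then have "w 0 = w s" by simp
    moreover have "s < card (edges G)" using eq m l(3) by simp
    moreover have "inj_on w {0..<0 + card (edges G)}" using w[of 0] by (simp add: bij_betw_def)
    ultimately show False using inj_onD[of w "{0..<0 + card (edges G)}" 0 s] l(3) by simp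
  qed
  ultimately show ?thesis by (simp add: s_def)
qed

text \<open>\<open>T\<close> spans a complete graph. Every window of \<open>s\<close> edges contains
  at most \<open>M\<close> edges inside \<open>T\<close>, and every such edge lies in
  \<open>s\<close> of the windows of a period; double counting gives the bound.\<close>

lemma cms_graph_dense_part_even:
  assumes G: "simple_graph G" and T: "T \<subseteq> verts G" "card T = 2 * M + 1"
    and S: "card {e\<in>edges G. e \<subseteq> T} = M * (2 * M + 1)" and M: "0 < M"
  shows "cms_graph G * (2 * M + 1) \<le> card (edges G)"
proof -
  define s where "s = cms_graph G"
  define m where "m = card (edges G)"
  have fE: "finite (edges G)" by (rule finite_edges[OF G])
  have fT: "finite T" and e2: "\<And>e. e \<in> edges G \<Longrightarrow> card e = 2"
    using G T by (auto simp: simple_graph_def intro: finite_subset)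
  have "{e\<in>edges G. e \<subseteq> T} \<noteq> {}" using S M by (metis add_gr_0 card.empty mult_pos_pos not_gr0 zero_less_one)
  then have ne: "edges G \<noteq> {}" by auto
  obtain l where l: "ordering G l" "separated s G l" "1 \<le> s" "s \<le> card (edges G)"
    by (rule cms_graph_attained[OF ne fE]) (simp add: s_def)
  obtain w where w_all: "\<forall>a. bij_betw w {a..<a + m} (edges G)"
    and wd_all: "\<forall>y y'. y < y' \<longrightarrow> y' < y + s \<longrightarrow> w y \<noteq> w y' \<and> w y \<inter> w y' = {}"
    by (rule periodic_listing[OF l(1) fE ne l(2,4), folded m_def]) (rule that, assumption+)
  have w: "\<And>a. bij_betw w {a..<a + m} (edges G)"
    and wd: "\<And>y y'. y < y' \<Longrightarrow> y' < y + s \<Longrightarrow> w y \<noteq> w y' \<and> w y \<inter> w y' = {}"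
    using w_all wd_all by blast+
  have m0: "0 < m" using ne fE by (simp add: m_def card_gt_0_iff)
  have wE: "w y \<in> edges G" for y
  proof -
    have "y \<in> {y..<y + m}" using m0 by simp
    then show ?thesis using bij_betwE[OF w] by blast
  qed
  have per: "card {y\<in>{a..<a + m}. w y \<subseteq> T} = M * (2 * M + 1)" for a
  proof -
    have "bij_betw w {y\<in>{a..<a + m}. w y \<subseteq> T} {e\<in>edges G. e \<subseteq> T}"
      by (rule bij_betw_Collect[OF w])
    from bij_betw_same_card[OF this] S show ?thesis by simp
  qed
  have "s * (M * (2 * M + 1)) = (\<Sum>d<s. card {y\<in>{d..<d + m}. w y \<subseteq> T})" using per by simp
  also have "\<dots> = (\<Sum>d<s. \<Sum>y<m. if w (y + d) \<subseteq> T then 1 else 0)"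
  proof (rule sum.cong[OF refl])
    fix d
    have "card {y\<in>{d..<d + m}. w y \<subseteq> T} = card {y\<in>{..<m}. w (y + d) \<subseteq> T}"
      by (rule bij_betw_same_card[of "\<lambda>y. y - d"], rule bij_betw_byWitness[where f' = "\<lambda>y. y + d"]) auto
    then show "card {y\<in>{d..<d + m}. w y \<subseteq> T} = (\<Sum>y<m. if w (y + d) \<subseteq> T then 1 else 0)"
      by (simp add: sum.If_cases Int_def)
  qed
  also have "\<dots> = (\<Sum>y<m. \<Sum>d<s. if w (y + d) \<subseteq> T then 1 else 0)" by (rule sum.swap)
  also have "\<dots> \<le> (\<Sum>y<m. M)"
  proof (rule sum_mono)
    fix y
    define Y where "Y = (\<lambda>d. y + d) ` {d\<in>{..<s}. w (y + d) \<subseteq> T}"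
    have "2 * card Y \<le> card T"
      using e2 wE by (intro window_edges_le(1)[OF wd fT, where a = y]) (auto simp: Y_def)
    moreover have "card Y = card {d\<in>{..<s}. w (y + d) \<subseteq> T}" unfolding Y_def by (rule card_image) simp
    ultimately show "(\<Sum>d<s. if w (y + d) \<subseteq> T then 1 else 0) \<le> M" using T(2) by (simp add: sum.If_cases Int_def)
  qed
  finally have "s * (M * (2 * M + 1)) \<le> m * M" by simp
  moreover have "s * (M * (2 * M + 1)) = M * (s * (2 * M + 1))" "m * M = M * m"
    by (simp_all only: mult.left_commute mult.commute)
  ultimately have "M * (s * (2 * M + 1)) \<le> M * m" by simp
  then show ?thesis using nat_mult_le_cancel1[OF M] unfolding s_def m_def by blast
qed

lemma infinite_enumeration_count:
  fixes P :: "nat set"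
  assumes inf: "infinite P"
  shows "Infinite_Set.enumerate P (i + t) < b \<longleftrightarrow> t < card {y\<in>P. Infinite_Set.enumerate P i \<le> y \<and> y < b}"
proof -
  define X where "X = Infinite_Set.enumerate P"
  have mono: "X a < X b \<longleftrightarrow> a < b" for a b unfolding X_def using inf by (rule enumerate_mono_iff)
  have inP: "X a \<in> P" for a unfolding X_def using inf by (rule enumerate_in_set)
  have ex: "\<exists>a. X a = y" if "y \<in> P" for y unfolding X_def by (rule enumerate_Ex[OF inf that])
  have cnt: "card {y\<in>P. X i \<le> y \<and> y < X (i + t)} = t" for t
  proof -
    have "bij_betw X {i..<i + t} {y\<in>P. X i \<le> y \<and> y < X (i + t)}"
    proof (rule bij_betw_imageI)
      show "inj_on X {i..<i + t}" using mono by (intro inj_onI) (metis linorder_neqE_nat less_irrefl)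
      show "X ` {i..<i + t} = {y\<in>P. X i \<le> y \<and> y < X (i + t)}"
      proof
        show "X ` {i..<i + t} \<subseteq> {y\<in>P. X i \<le> y \<and> y < X (i + t)}"
          using mono inP by (auto simp: not_less[symmetric])
        show "{y\<in>P. X i \<le> y \<and> y < X (i + t)} \<subseteq> X ` {i..<i + t}"
        proof
          fix y assume y: "y \<in> {y\<in>P. X i \<le> y \<and> y < X (i + t)}"
          then obtain a where a: "X a = y" using ex by auto
          then have "a < i + t" "i \<le> a" using y mono[of a "i + t"] mono[of a i] by auto
          then show "y \<in> X ` {i..<i + t}" using a by auto
        qed
      qed
    qed
    then show ?thesis using bij_betw_same_card by fastforce
  qed
  show ?thesis
  proof (cases "X (i + t) < b")
    case True
    have "X i \<le> X (i + t)" using mono[of "i + t" i] by simp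
    then have "insert (X (i + t)) {y\<in>P. X i \<le> y \<and> y < X (i + t)} \<subseteq> {y\<in>P. X i \<le> y \<and> y < b}"
      using True inP by auto
    then have "card (insert (X (i + t)) {y\<in>P. X i \<le> y \<and> y < X (i + t)}) \<le> card {y\<in>P. X i \<le> y \<and> y < b}"
      by (intro card_mono) auto
    then show ?thesis using True cnt[of t] by (simp add: X_def)
  next
    case False
    then have "{y\<in>P. X i \<le> y \<and> y < b} \<subseteq> {y\<in>P. X i \<le> y \<and> y < X (i + t)}" by auto
    then have "card {y\<in>P. X i \<le> y \<and> y < b} \<le> t" by (rule card_le_antimono) (simp_all add: cnt)
    then show ?thesis using False by (simp add: X_def)
  qed
qed

text \<open>If the bound failed, any \<open>M\<close> cyclically consecutive edges inside \<open>T\<close> would form a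
  matching, and two successive such matchings would cover \<open>T\<close>. So the few edges at \<open>u\<close>
  would have to meet every \<open>M + 1\<close> consecutive edges inside \<open>T\<close>.\<close>

lemma cms_graph_dense_part_odd:
  assumes G: "simple_graph G" and T: "T \<subseteq> verts G" "card T = 2 * M + 1"
    and S: "card {e\<in>edges G. e \<subseteq> T} = 2 * M\<^sup>2 - 1" and M: "2 \<le> M"
    and u: "u \<in> T" "card {e\<in>edges G. e \<subseteq> T \<and> u \<in> e} = 2 * M - 2"
  shows "cms_graph G * (2 * M) \<le> card (edges G)"
proof (rule ccontr)
  define s where "s = cms_graph G"
  define m where "m = card (edges G)"
  \<comment> \<open>Averaging over windows would only give
    \<open>s * (2 * M^2 - 1) <= m * M\<close>, which falls short of the claim by one edge inside
    \<open>T\<close>.\<close>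
  define E where "E = 2 * M\<^sup>2 - 1"
  assume "\<not> ?thesis"
  then have big: "m < s * (2 * M)" by (simp add: s_def m_def)
  have MM: "M < M\<^sup>2" using M by (simp add: power2_eq_square)
  have fE: "finite (edges G)" by (rule finite_edges[OF G])
  have fT: "finite T" and e2: "\<And>e. e \<in> edges G \<Longrightarrow> card e = 2"
    using G T by (auto simp: simple_graph_def intro: finite_subset)
  have "{e\<in>edges G. e \<subseteq> T} \<noteq> {}"
  proof
    assume A: "{e\<in>edges G. e \<subseteq> T} = {}"
    have "2 * M\<^sup>2 - 1 = 0" using S by (simp only: A card.empty)
    then show False using MM M by linarith
  qed
  then have ne: "edges G \<noteq> {}" by auto
  obtain l where l: "ordering G l" "separated s G l" "1 \<le> s" "s \<le> card (edges G)"
    by (rule cms_graph_attained[OF ne fE]) (simp add: s_def)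
  obtain w where w_all: "\<forall>a. bij_betw w {a..<a + m} (edges G)"
    and wd_all: "\<forall>y y'. y < y' \<longrightarrow> y' < y + s \<longrightarrow> w y \<noteq> w y' \<and> w y \<inter> w y' = {}"
    by (rule periodic_listing[OF l(1) fE ne l(2,4), folded m_def]) (rule that, assumption+)
  have w: "\<And>a. bij_betw w {a..<a + m} (edges G)"
    and wd: "\<And>y y'. y < y' \<Longrightarrow> y' < y + s \<Longrightarrow> w y \<noteq> w y' \<and> w y \<inter> w y' = {}"
    using w_all wd_all by blast+
  have m0: "0 < m" using ne fE by (simp add: m_def card_gt_0_iff)
  have wE: "w y \<in> edges G" for y
  proof -
    have "y \<in> {y..<y + m}" using m0 by simp
    then show ?thesis using bij_betwE[OF w] by blast
  qed
  have per: "card {y\<in>{a..<a + L * m}. Q (w y)} = L * card {e\<in>edges G. Q e}" for a L and Q :: "'a set \<Rightarrow> bool"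
  proof (induction L)
    case (Suc L)
    have "bij_betw w {y\<in>{a + L * m..<a + L * m + m}. Q (w y)} {e\<in>edges G. Q e}"
      by (rule bij_betw_Collect[OF w])
    then have 1: "card {y\<in>{a + L * m..<a + L * m + m}. Q (w y)} = card {e\<in>edges G. Q e}"
      by (rule bij_betw_same_card)
    define A where "A = {y\<in>{a..<a + L * m}. Q (w y)}"
    define B where "B = {y\<in>{a + L * m..<a + L * m + m}. Q (w y)}"
    have "{y\<in>{a..<a + Suc L * m}. Q (w y)} = A \<union> B" by (auto simp: A_def B_def)
    moreover have "card (A \<union> B) = card A + card B" by (rule card_Un_disjoint) (auto simp: A_def B_def)
    ultimately have "card {y\<in>{a..<a + Suc L * m}. Q (w y)} = card {y\<in>{a..<a + L * m}. Q (w y)} + card {y\<in>{a + L * m..<a + L * m + m}. Q (w y)}"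
      by (simp only: A_def B_def)
    then show ?case using 1 Suc by simp
  qed simp
  define P where "P = {y. w y \<subseteq> T}"
  have E0: "0 < E" using MM by (simp add: E_def)
  have infP: "infinite P"
  proof
    assume "finite P"
    then obtain b where b: "\<forall>y\<in>P. y < b" using finite_nat_set_iff_bounded by blast
    then have A: "{y\<in>{b..<b + 1 * m}. w y \<subseteq> T} = {}" by (auto simp: P_def)
    have "0 = 1 * E" using per[of b 1 "\<lambda>e. e \<subseteq> T"] unfolding A S E_def[symmetric] by simp
    then show False using E0 by simp
  qed
  define X where "X = Infinite_Set.enumerate P"
  have XP: "w (X i) \<subseteq> T" for i using enumerate_in_set[OF infP, of i] by (simp add: X_def P_def)
  have Xm: "X a < X b \<longleftrightarrow> a < b" for a b unfolding X_def using infP by (rule enumerate_mono_iff)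
  note cnt = infinite_enumeration_count[OF infP, folded X_def]
  have cper: "card {y\<in>P. X i \<le> y \<and> y < X i + L * m} = L * E" for i L
  proof -
    have "{y\<in>P. X i \<le> y \<and> y < X i + L * m} = {y\<in>{X i..<X i + L * m}. w y \<subseteq> T}" by (auto simp: P_def)
    then show ?thesis using per[of "X i" L "\<lambda>e. e \<subseteq> T"] S by (simp add: E_def)
  qed
  have win: "card {y\<in>P. a \<le> y \<and> y < a + s} \<le> M" for a
  proof -
    have "2 * card {y\<in>P. a \<le> y \<and> y < a + s} \<le> card T"
      using e2 wE by (intro window_edges_le(1)[OF wd fT, where a = a]) (auto simp: P_def)
    then show ?thesis using T(2) by simp
  qed
  \<comment> \<open>If \<open>M\<close> consecutive edges of \<open>T\<close> did not fit into a
    window, the first of \<open>2 * M\<close> successive windows would contain at most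
    \<open>M - 1\<close> of them and the others at most \<open>M\<close>, together at most
    \<open>E\<close>. By \<open>big\<close> these windows are longer than a period, which contains
    \<open>E\<close> such edges and is followed by its first one again.\<close>
  have consec: "X (i + (M - 1)) < X i + s" for i
  proof (rule ccontr)
    assume no: "\<not> ?thesis"
    have fw: "finite {y\<in>P. X i \<le> y \<and> y < X i + b}" for b by simp
    have "card {y\<in>P. X i \<le> y \<and> y < X i + s} \<le> M - 1" using no cnt[of i "M - 1" "X i + s"] by simp
    then have "card {y\<in>P. X i \<le> y \<and> y < X i + Suc j * s} \<le> M * j + (M - 1)" for j
    proof (induction j)
      case (Suc j)
      have "{y\<in>P. X i \<le> y \<and> y < X i + Suc (Suc j) * s} \<subseteq>
        {y\<in>P. X i \<le> y \<and> y < X i + Suc j * s} \<union> {y\<in>P. X i + Suc j * s \<le> y \<and> y < (X i + Suc j * s) + s}"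
        by auto
      then have "card {y\<in>P. X i \<le> y \<and> y < X i + Suc (Suc j) * s} \<le>
        card ({y\<in>P. X i \<le> y \<and> y < X i + Suc j * s} \<union> {y\<in>P. X i + Suc j * s \<le> y \<and> y < (X i + Suc j * s) + s})"
        by (intro card_mono) auto
      also have "\<dots> \<le> card {y\<in>P. X i \<le> y \<and> y < X i + Suc j * s} + card {y\<in>P. X i + Suc j * s \<le> y \<and> y < (X i + Suc j * s) + s}"
        by (rule card_Un_le)
      also have "\<dots> \<le> (M * j + (M - 1)) + M" using Suc win[of "X i + Suc j * s"] by (intro add_mono) auto
      finally show ?case by simp
    qed simp
    from this[of "2 * M - 1"] have "card {y\<in>P. X i \<le> y \<and> y < X i + s * (2 * M)} \<le> M * (2 * M - 1) + (M - 1)"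
      using M by (simp add: Suc_diff_Suc mult.commute numeral_2_eq_2)
    also have "\<dots> = E" using M by (simp add: E_def power2_eq_square diff_mult_distrib2)
    finally have a: "card {y\<in>P. X i \<le> y \<and> y < X i + s * (2 * M)} \<le> E" .
    have "\<not> X (i + E) < X i + m" using cnt[of i E "X i + m"] cper[of i 1] by simp
    have "X (i + E) \<le> X i + m"
    proof -
      have "card {y\<in>P. X i \<le> y \<and> y < X i + 1 * m + 1} > E"
      proof -
        have "X i + m \<in> P"
        proof -
          have "w (X i + m) = w (X i)"
          proof -
            have eq: "w ` {X i..<X i + m} = w ` {X i + 1..<X i + 1 + m}" using w[of "X i"] w[of "X i + 1"] by (simp add: bij_betw_def)
            have "w (X i) \<in> w ` {X i + 1..<X i + 1 + m}" unfolding eq[symmetric] using m0 by (intro imageI) simp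
            then obtain y where y: "y \<in> {X i + 1..<X i + 1 + m}" "w (X i) = w y" by auto
            show ?thesis
            proof (cases "y = X i + m")
              case False
              then have "y \<in> {X i..<X i + m}" using y by auto
              then have "y = X i" using w[of "X i"] y(2) m0 by (auto simp: bij_betw_def inj_on_def)
              then show ?thesis using y by simp
            qed (use y in simp)
          qed
          then show ?thesis using XP by (simp add: P_def)
        qed
        then have "insert (X i + m) {y\<in>P. X i \<le> y \<and> y < X i + 1 * m} \<subseteq> {y\<in>P. X i \<le> y \<and> y < X i + 1 * m + 1}" by auto
        then have "card (insert (X i + m) {y\<in>P. X i \<le> y \<and> y < X i + 1 * m}) \<le> card {y\<in>P. X i \<le> y \<and> y < X i + 1 * m + 1}"
          by (intro card_mono) auto
        then show ?thesis using cper[of i 1] by simp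
      qed
      then show ?thesis using cnt[of i E "X i + 1 * m + 1"] by simp
    qed
    then have "X (i + E) < X i + s * (2 * M)" using big by simp
    then show False using cnt[of i E "X i + s * (2 * M)"] a by simp
  qed
  \<comment> \<open>By \<open>consec\<close> the \<open>M - 1\<close> edges between
    \<open>X i\<close> and \<open>X (i + M)\<close> are disjoint from one another and from these
    two. They leave three vertices of \<open>T\<close>, and the two outer edges, being different,
    cover all three. So \<open>u\<close> is covered.\<close>
  have hit: "\<exists>t\<le>M. u \<in> w (X (i + t))" for i
  proof -
    define B where "B = \<Union>((\<lambda>t. w (X (i + t))) ` {1..M - 1})"
    have near: "w (X (i + t)) \<noteq> w (X (i + t')) \<and> w (X (i + t)) \<inter> w (X (i + t')) = {}" if "t < t'" "t' \<le> t + (M - 1)" for t t'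
    proof -
      have "X (i + t') \<le> X (i + t + (M - 1))" using Xm[of "i + t + (M - 1)" "i + t'"] that by (simp add: not_less[symmetric])
      then have "X (i + t') < X (i + t) + s" using consec[of "i + t"] by linarith
      then show ?thesis using wd[of "X (i + t)" "X (i + t')"] Xm[of "i + t" "i + t'"] that by simp
    qed
    have c2: "card (w y) = 2" for y using e2 wE by blast
    have fw: "finite (w (X j))" for j using XP fT finite_subset by blast
    have cB: "card B = 2 * (M - 1)"
    proof -
      have "card B = (\<Sum>t\<in>{1..M - 1}. card (w (X (i + t))))"
        unfolding B_def
      proof (rule card_UN_disjoint)
        show "\<forall>t\<in>{1..M - 1}. \<forall>t'\<in>{1..M - 1}. t \<noteq> t' \<longrightarrow> w (X (i + t)) \<inter> w (X (i + t')) = {}"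
        proof (intro ballI impI)
          fix t t' assume H: "t \<in> {1..M - 1}" "t' \<in> {1..M - 1}" "t \<noteq> t'"
          then consider "t < t'" | "t' < t" by linarith
          then show "w (X (i + t)) \<inter> w (X (i + t')) = {}"
          proof cases
            case 1
            moreover have "t' \<le> t + (M - 1)" using H by simp
            ultimately show ?thesis using near by blast
          next
            case 2
            moreover have "t \<le> t' + (M - 1)" using H by simp
            ultimately show ?thesis using near by blast
          qed
        qed
      qed (use fw in auto)
      then show ?thesis using c2 by simp
    qed
    have BT: "B \<subseteq> T" using XP by (auto simp: B_def)
    have cR: "card (T - B) = 3"
      using cB BT fT T(2) M by (subst card_Diff_subset) (auto intro: finite_subset)
    have s0: "w (X i) \<subseteq> T - B"
    proof -
      have "w (X i) \<inter> w (X (i + t)) = {}" if "t \<in> {1..M - 1}" for t using near[of 0 t] that by simp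
      then show ?thesis using XP[of i] unfolding B_def by blast
    qed
    have s1: "w (X (i + M)) \<subseteq> T - B"
    proof -
      have "w (X (i + t)) \<inter> w (X (i + M)) = {}" if "t \<in> {1..M - 1}" for t
      proof -
        have "t < M" "M \<le> t + (M - 1)" using that M by auto
        then show ?thesis using near by blast
      qed
      then show ?thesis using XP[of "i + M"] unfolding B_def by blast
    qed
    have "w (X i) \<noteq> w (X (i + M))"
    proof -
      have "M < E" using MM M by (simp add: E_def)
      then have "X (i + M) < X i + m" using cnt[of i M "X i + m"] cper[of i 1] by simp
      moreover have "X i < X (i + M)" using Xm M by simp
      moreover have "inj_on w {X i..<X i + m}" using w[of "X i"] by (simp add: bij_betw_def)
      ultimately show ?thesis using inj_onD[of w "{X i..<X i + m}" "X i" "X (i + M)"] m0 by auto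
    qed
    then have "w (X i) \<union> w (X (i + M)) = T - B"
    proof -
      assume ne: "w (X i) \<noteq> w (X (i + M))"
      have "\<not> w (X (i + M)) \<subseteq> w (X i)"
        using ne c2 card_subset_eq[OF fw[of i], of "w (X (i + M))"] by auto
      then have "w (X i) \<subset> w (X i) \<union> w (X (i + M))" by auto
      then have "card (w (X i)) < card (w (X i) \<union> w (X (i + M)))" using fw by (intro psubset_card_mono) auto
      then have "3 \<le> card (w (X i) \<union> w (X (i + M)))" using c2[of "X i"] by simp
      then show ?thesis using s0 s1 cR fT by (intro card_seteq) auto
    qed
    then have "u \<in> B \<or> u \<in> w (X i) \<or> u \<in> w (X (i + M))" using u(1) by auto
    then show ?thesis
    proof (elim disjE)
      assume "u \<in> B"
      then obtain t where "t \<in> {1..M - 1}" "u \<in> w (X (i + t))" by (auto simp: B_def)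
      then show ?thesis by (intro exI[of _ t]) auto
    qed (auto intro: exI[of _ 0] exI[of _ M])
  qed
  \<comment> \<open>\<open>E\<close> disjoint blocks of \<open>M + 1\<close> edges inside
    \<open>T\<close> fill \<open>M + 1\<close> periods, and each block contains an edge at
    \<open>u\<close>. But there are only \<open>(M + 1) * (2 * M - 2) = 2 * M^2 - 2\<close> such
    edges in these periods, fewer than \<open>E\<close>.\<close>
  define \<tau> where "\<tau> j = (SOME t. t \<le> M \<and> u \<in> w (X ((M + 1) * j + t)))" for j
  have \<tau>: "\<tau> j \<le> M \<and> u \<in> w (X ((M + 1) * j + \<tau> j))" for j
    unfolding \<tau>_def using hit[of "(M + 1) * j"] by (rule someI_ex)
  define Z where "Z = {y\<in>{X 0..<X 0 + (M + 1) * m}. w y \<subseteq> T \<and> u \<in> w y}"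
  have "E \<le> card Z"
  proof -
    have blocks: "(M + 1) * j + \<tau> j < (M + 1) * j' + \<tau> j'" if "j < j'" for j j'
    proof -
      have "(M + 1) * j + (M + 1) \<le> (M + 1) * j'" using that by (metis Suc_leI mult_Suc_right mult_le_mono2 add.commute)
      then show ?thesis using \<tau>[of j] by linarith
    qed
    have "card {..<E} \<le> card Z"
    proof (rule card_inj_on_le[of "\<lambda>j. X ((M + 1) * j + \<tau> j)"])
      show "inj_on (\<lambda>j. X ((M + 1) * j + \<tau> j)) {..<E}"
      proof (rule inj_onI)
        fix j j' assume eq: "X ((M + 1) * j + \<tau> j) = X ((M + 1) * j' + \<tau> j')"
        show "j = j'"
        proof (rule ccontr)
          assume "j \<noteq> j'"
          then consider "j < j'" | "j' < j" by linarith
          then show False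
          proof cases
            case 1
            from blocks[OF this] have "X ((M + 1) * j + \<tau> j) < X ((M + 1) * j' + \<tau> j')" by (simp only: Xm)
            then show False using eq by simp
          next
            case 2
            from blocks[OF this] have "X ((M + 1) * j' + \<tau> j') < X ((M + 1) * j + \<tau> j)" by (simp only: Xm)
            then show False using eq by simp
          qed
        qed
      qed
      show "(\<lambda>j. X ((M + 1) * j + \<tau> j)) ` {..<E} \<subseteq> Z"
      proof clarify
        fix j assume "j < E"
        then have "(M + 1) * j + (M + 1) \<le> (M + 1) * E" by (metis Suc_leI mult_Suc_right mult_le_mono2 add.commute)
        then have "(M + 1) * j + \<tau> j < (M + 1) * E" using \<tau>[of j] by linarith
        then have "X ((M + 1) * j + \<tau> j) < X 0 + (M + 1) * m"
          using cnt[of 0 "(M + 1) * j + \<tau> j"] cper[of 0 "M + 1"] by simp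
        moreover have "X 0 \<le> X ((M + 1) * j + \<tau> j)" using Xm[of "(M + 1) * j + \<tau> j" 0] by (simp add: not_less[symmetric])
        ultimately show "X ((M + 1) * j + \<tau> j) \<in> Z" using XP \<tau>[of j] by (simp add: Z_def)
      qed
      show "finite Z" by (simp add: Z_def)
    qed
    then show ?thesis by simp
  qed
  also have "card Z = (M + 1) * (2 * M - 2)"
    unfolding Z_def using per[of "X 0" "M + 1" "\<lambda>e. e \<subseteq> T \<and> u \<in> e"] u(2) by simp
  also have "\<dots> < E"
  proof -
    obtain k where "M = k + 2" using M by (metis add.commute le_Suc_ex)
    then show ?thesis by (simp add: E_def power2_eq_square algebra_simps)
  qed
  finally show False by simp
qed

section \<open>Three matchings\<close>

lemma card_below_slot:
  assumes "bij_betw r X {..<N}" "t \<le> N"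
  shows "card {x\<in>X. r x < t} = t"
  using card_slots_eq[OF assms(1), of 0 t] assms(2) by simp

section \<open>Delaying chosen elements of a numbering\<close>

text \<open>Ranking by a key that puts \<open>S\<close>, ordered by \<open>k\<close>, between the
  slots below \<open>L\<close> and those from \<open>L\<close> on. The other elements below
  \<open>L\<close> close up, so each moves forward by the number of members of \<open>S\<close> that
  were before it.\<close>

lemma delay_permutation:
  fixes r k :: "'a \<Rightarrow> nat"
  assumes fin: "finite X" and r: "bij_betw r X {..<N}" and L: "L \<le> N"
    and S: "S \<subseteq> X" "\<And>x. x \<in> S \<Longrightarrow> r x < L" and k: "inj_on k S"
  obtains \<rho> where "bij_betw \<rho> X {..<N}"
    "\<And>x. x \<in> X \<Longrightarrow> L \<le> r x \<Longrightarrow> \<rho> x = r x"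
    "\<And>x. x \<in> X \<Longrightarrow> x \<notin> S \<Longrightarrow> r x < L \<Longrightarrow> \<rho> x + card {y\<in>S. r y < r x} = r x"
    "\<And>x. x \<in> S \<Longrightarrow> \<rho> x + card {y\<in>S. k x \<le> k y} = L"
    "\<And>x y. x \<in> X \<Longrightarrow> x \<notin> S \<Longrightarrow> r x < L \<Longrightarrow> y \<in> S \<Longrightarrow> \<rho> x < \<rho> y"
    "\<And>x y. x \<in> X \<Longrightarrow> y \<in> X \<Longrightarrow> x \<notin> S \<Longrightarrow> y \<notin> S \<Longrightarrow> r x < r y \<Longrightarrow> \<rho> x < \<rho> y"
proof -
  have fS: "finite S" using S(1) fin finite_subset by blast
  define B where "B = L + Max (insert 0 (k ` S)) + 1"
  have kB: "L + k x < B" if "x \<in> S" for x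
  proof -
    have "k x \<le> Max (insert 0 (k ` S))" using that fS by (intro Max_ge) auto
    then show ?thesis by (simp add: B_def)
  qed
  have LB: "L < B" by (simp add: B_def)
  define key where "key x = (if L \<le> r x then B + r x else if x \<in> S then L + k x else r x)" for x
  have rinj: "r x = r y \<Longrightarrow> x = y" if "x \<in> X" "y \<in> X" for x y
    using r that by (auto simp: bij_betw_def inj_on_def)
  have kinj: "x = y" if "x \<in> X" "y \<in> X" "key x = key y" for x y
    using that rinj[OF that(1,2)] S(2)[of x] S(2)[of y] kB[of x] kB[of y] inj_onD[OF k, of x y] LB
    by (auto simp: key_def split: if_splits)
  have cX: "card X = N" using bij_betw_same_card[OF r] by simp
  obtain \<rho> where \<rho>: "bij_betw \<rho> X {..<card X}" and mono: "\<And>x y. x \<in> X \<Longrightarrow> y \<in> X \<Longrightarrow> key x < key y \<Longrightarrow> \<rho> x < \<rho> y"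
    using ranking_exists[OF fin, of key] by blast
  have iff: "\<rho> y < \<rho> x \<longleftrightarrow> key y < key x" if "x \<in> X" "y \<in> X" for x y
    using mono[OF that] mono[OF that(2,1)] kinj[OF that] by (metis linorder_neqE_nat less_asym less_irrefl)
  have rank: "\<rho> x = card {y\<in>X. key y < key x}" if "x \<in> X" for x
  proof -
    have "{y\<in>X. \<rho> y < \<rho> x} = {y\<in>X. key y < key x}" using iff that by blast
    then show ?thesis using card_rank_below(1)[OF \<rho> that] by simp
  qed
  show thesis
  proof (rule that[of \<rho>])
    show "bij_betw \<rho> X {..<N}" using \<rho> cX by simp
    show "\<rho> x = r x" if x: "x \<in> X" "L \<le> r x" for x
    proof -
      have "key y < key x \<longleftrightarrow> r y < r x" if "y \<in> X" for y
        using x(2) kB[of y] S(2)[of y] LB by (auto simp: key_def)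
      then have "{y\<in>X. key y < key x} = {y\<in>X. r y < r x}" by blast
      moreover have "r x \<le> N" using bij_betwE[OF r] x(1) by fastforce
      ultimately show ?thesis using rank[OF x(1)] card_below_slot[OF r, of "r x"] by simp
    qed
    show "\<rho> x + card {y\<in>S. r y < r x} = r x" if x: "x \<in> X" "x \<notin> S" "r x < L" for x
    proof -
      have e: "{y\<in>X. key y < key x} = {y\<in>X. r y < r x} - {y\<in>S. r y < r x}"
        using x LB by (auto simp: key_def split: if_splits)
      have "card {y\<in>X. r y < r x} = r x" using card_below_slot[OF r, of "r x"] x(3) L by simp
      moreover have "card {y\<in>X. key y < key x} + card {y\<in>S. r y < r x} = card {y\<in>X. r y < r x}"
        unfolding e using fin fS S(1) by (subst card_Diff_subset) (auto intro!: le_add_diff_inverse2 card_mono)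
      ultimately show ?thesis using rank[OF x(1)] by simp
    qed
    show "\<rho> x + card {y\<in>S. k x \<le> k y} = L" if x: "x \<in> S" for x
    proof -
      have e: "{y\<in>X. key y < key x} = {y\<in>X. r y < L} - {y\<in>S. k x \<le> k y}"
      proof (rule set_eqI)
        fix y
        have kx: "key x = L + k x" using x S(2)[of x] by (simp add: key_def)
        consider "y \<notin> X" | "y \<in> X" "L \<le> r y" | "y \<in> S" "r y < L" | "y \<in> X" "y \<notin> S" "r y < L"
          using S(2) by fastforce
        then show "y \<in> {y\<in>X. key y < key x} \<longleftrightarrow> y \<in> {y\<in>X. r y < L} - {y\<in>S. k x \<le> k y}"
        proof cases
          case 2
          then have "key y = B + r y" by (simp add: key_def)
          then show ?thesis using kx kB[OF x] 2 by simp
        next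
          case 3
          then have "key y = L + k y" "y \<in> X" using S(1) by (auto simp: key_def)
          then show ?thesis using kx 3 by auto
        next
          case 4
          then have "key y = r y" by (simp add: key_def)
          then show ?thesis using kx 4 by auto
        qed simp
      qed
      have "card {y\<in>X. r y < L} = L" using card_below_slot[OF r L] .
      moreover have "card {y\<in>X. key y < key x} + card {y\<in>S. k x \<le> k y} = card {y\<in>X. r y < L}"
        unfolding e using fin fS S by (subst card_Diff_subset) (auto intro!: le_add_diff_inverse2 card_mono)
      ultimately show ?thesis using rank[of x] x S(1) by auto
    qed
    show "\<rho> x < \<rho> y" if "x \<in> X" "x \<notin> S" "r x < L" "y \<in> S" for x y
      using that S(1) S(2)[OF that(4)] by (intro mono) (auto simp: key_def)
    show "\<rho> x < \<rho> y" if "x \<in> X" "y \<in> X" "x \<notin> S" "y \<notin> S" "r x < r y" for x y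
      using that LB by (intro mono) (auto simp: key_def)
  qed
qed

text \<open>The edges meeting \<open>K\<close> are moved up to position about \<open>L\<close>. A prefix of the new
  order misses some of them, but every member of \<open>K\<close> with two missing neighbours is itself
  no longer adjacent to the prefix; this keeps the neighbourhoods of prefixes small.\<close>

lemma delayed_order:
  fixes b :: "'a \<Rightarrow> nat" and R :: "'a \<Rightarrow> 'f \<Rightarrow> bool"
  assumes fin: "finite X" "finite F" and b: "bij_betw b X {..<N}" and L: "L \<le> N"
    and deg: "\<And>f. f \<in> F \<Longrightarrow> card {x\<in>X. R x f} \<le> 2" and K: "K \<subseteq> F" "card K \<le> \<kappa>"
    and pre: "\<And>t. t \<le> N \<Longrightarrow> card {f\<in>F. \<exists>x\<in>X. b x < t \<and> R x f} \<le> t + w"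
  obtains D where "bij_betw D X {..<N}" "\<And>x. x \<in> X \<Longrightarrow> L \<le> b x \<Longrightarrow> D x = b x"
    "\<And>x. x \<in> X \<Longrightarrow> b x < L \<Longrightarrow> D x < L" "\<And>x. x \<in> X \<Longrightarrow> b x \<le> D x + 2 * \<kappa>"
    "\<And>x f. x \<in> X \<Longrightarrow> f \<in> K \<Longrightarrow> R x f \<Longrightarrow> L \<le> D x + 2 * \<kappa>"
    "\<And>t. t \<le> N \<Longrightarrow> card {f\<in>F. \<exists>x\<in>X. D x < t \<and> R x f} \<le> t + w + \<kappa>"
proof -
  define S where "S = {x\<in>X. b x < L \<and> (\<exists>f\<in>K. R x f)}"
  have fS: "finite S" and fK: "finite K" using fin K finite_subset by (auto simp: S_def)
  have cS: "card S \<le> 2 * \<kappa>"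
  proof -
    have "card S \<le> card (\<Union>f\<in>K. {x\<in>X. R x f})" using fin fK by (intro card_mono) (auto simp: S_def)
    also have "\<dots> \<le> (\<Sum>f\<in>K. card {x\<in>X. R x f})" using fK by (intro card_UN_le)
    also have "\<dots> \<le> card K * 2" using sum_bounded_above[of K "\<lambda>f. card {x\<in>X. R x f}" 2] deg K(1) by auto
    finally show ?thesis using K(2) by linarith
  qed
  have injb: "inj_on b S" using b by (auto simp: bij_betw_def inj_on_def S_def)
  obtain D where D: "bij_betw D X {..<N}" and D1: "\<And>x. x \<in> X \<Longrightarrow> L \<le> b x \<Longrightarrow> D x = b x"
    and D2: "\<And>x. x \<in> X \<Longrightarrow> x \<notin> S \<Longrightarrow> b x < L \<Longrightarrow> D x + card {y\<in>S. b y < b x} = b x"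
    and D3: "\<And>x. x \<in> S \<Longrightarrow> D x + card {y\<in>S. b x \<le> b y} = L"
    and D4: "\<And>x y. x \<in> X \<Longrightarrow> x \<notin> S \<Longrightarrow> b x < L \<Longrightarrow> y \<in> S \<Longrightarrow> D x < D y"
    and D5: "\<And>x y. x \<in> X \<Longrightarrow> y \<in> X \<Longrightarrow> x \<notin> S \<Longrightarrow> y \<notin> S \<Longrightarrow> b x < b y \<Longrightarrow> D x < D y"
  proof (rule delay_permutation[OF fin(1) b L _ _ injb])
    show "S \<subseteq> X" "\<And>x. x \<in> S \<Longrightarrow> b x < L" by (auto simp: S_def)
  qed (rule that)
  have sub: "card {y\<in>S. Q y} \<le> 2 * \<kappa>" for Q
    using card_mono[OF fS, of "{y\<in>S. Q y}"] cS by auto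
  have low: "D x < L" if x: "x \<in> X" "b x < L" for x
  proof (cases "x \<in> S")
    case True
    then have "x \<in> {y\<in>S. b x \<le> b y}" by simp
    then have "0 < card {y\<in>S. b x \<le> b y}" using fS by (auto simp: card_gt_0_iff)
    then show ?thesis using D3[OF True] by linarith
  qed (use D2[OF x(1) _ x(2)] x in linarith)
  show thesis
  proof (rule that[OF D D1 low])
    show "b x \<le> D x + 2 * \<kappa>" if x: "x \<in> X" for x
    proof (cases "b x < L")
      case True
      then show ?thesis using D2[OF x] D3[of x] sub[of "\<lambda>y. b y < b x"] sub[of "\<lambda>y. b x \<le> b y"]
        by (cases "x \<in> S") linarith+
    qed (use D1[OF x] in simp)
    show "L \<le> D x + 2 * \<kappa>" if x: "x \<in> X" "f \<in> K" "R x f" for x f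
    proof (cases "b x < L")
      case True
      then have "x \<in> S" using x by (auto simp: S_def)
      then show ?thesis using D3 sub[of "\<lambda>y. b x \<le> b y"] by fastforce
    qed (use D1[OF x(1)] in simp)
    show "card {f\<in>F. \<exists>x\<in>X. D x < t \<and> R x f} \<le> t + w + \<kappa>" if t: "t \<le> N" for t
    proof -
      define P where "P = {x\<in>X. D x < t}"
      have cP: "card P = t" unfolding P_def by (rule card_below_slot[OF D t])
      have fP: "finite P" using fin by (simp add: P_def)
      \<comment> \<open>A prefix of the new order is compared with a prefix of the old one that
        contains it and exceeds it by delayed elements only.\<close>
      have "\<exists>\<tau>\<le>N. P \<subseteq> {x\<in>X. b x < \<tau>} \<and> {x\<in>X. b x < \<tau>} - P \<subseteq> S"
      proof (cases "L \<le> t")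
        case True
        have "P = {x\<in>X. b x < t}"
        proof -
          have "D x < t \<longleftrightarrow> b x < t" if "x \<in> X" for x using D1[OF that] low[OF that] True by (cases "b x < L") auto
          then show ?thesis by (auto simp: P_def)
        qed
        then show ?thesis using t by (intro exI[of _ t]) auto
      next
        case tL: False
        have PL: "b x < L" if "x \<in> P" for x using D1[of x] that tL by (cases "b x < L") (auto simp: P_def)
        show ?thesis
        proof (cases "P \<inter> S = {}")
          case False
          then obtain y where y: "y \<in> P" "y \<in> S" by auto
          have "x \<in> P" if "x \<in> X" "b x < L" "x \<notin> S" for x
            using D4[OF that(1,3,2) y(2)] y(1) that by (auto simp: P_def)
          then show ?thesis using PL L by (intro exI[of _ L]) (auto simp: P_def)
        next
          case PS: True
          show ?thesis
          proof (cases "P = {}")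
            case True
            then show ?thesis by (intro exI[of _ 0]) auto
          next
            case False
            define m where "m = Max (b ` P)"
            have "m \<in> b ` P" unfolding m_def using fP False by (intro Max_in) auto
            then obtain y where y: "y \<in> P" "b y = m" by auto
            have le: "b x \<le> m" if "x \<in> P" for x unfolding m_def using fP that by (intro Max_ge) auto
            have "x \<in> P" if x: "x \<in> X" "b x < Suc m" "x \<notin> S" for x
            proof (cases "b x = b y")
              case True
              then show ?thesis using b x y by (auto simp: bij_betw_def inj_on_def P_def)
            next
              case False
              then have "D x < D y" using x y PS by (intro D5) (auto simp: P_def)
              then show ?thesis using y x by (auto simp: P_def)
            qed
            moreover have "Suc m \<le> N" using PL[OF y(1)] y L by simp
            ultimately show ?thesis using le by (intro exI[of _ "Suc m"]) (auto simp: P_def less_Suc_eq_le)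
          qed
        qed
      qed
      then obtain \<tau> where \<tau>: "\<tau> \<le> N" "P \<subseteq> {x\<in>X. b x < \<tau>}" "{x\<in>X. b x < \<tau>} - P \<subseteq> S" by blast
      define Q where "Q = {x\<in>X. b x < \<tau>} - P"
      have fQ: "finite Q" using fin by (simp add: Q_def)
      have cQ: "t + card Q = \<tau>"
        using card_below_slot[OF b \<tau>(1)] cP fP \<tau>(2) card_Diff_subset[of P "{x\<in>X. b x < \<tau>}"]
          card_mono[of "{x\<in>X. b x < \<tau>}" P] fin by (simp add: Q_def)
      \<comment> \<open>The members of \<open>K\<close> that lost both neighbours to
        \<open>Q\<close> drop out of the neighbourhood. As
        \<open>card Q \<le> card K + card Y\<close>, they pay for all but \<open>\<kappa>\<close> of
        the missing elements.\<close>
      define Y where "Y = {f\<in>K. card {x\<in>Q. R x f} = 2}"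
      define NP where "NP = {f\<in>F. \<exists>x\<in>X. D x < t \<and> R x f}"
      define NB where "NB = {f\<in>F. \<exists>x\<in>X. b x < \<tau> \<and> R x f}"
      have QX: "Q \<subseteq> X" by (auto simp: Q_def)
      have Ynbr: "{x\<in>X. R x f} = {x\<in>Q. R x f}" if "f \<in> Y" for f
      proof -
        have "f \<in> F" "card {x\<in>Q. R x f} = 2" using that K by (auto simp: Y_def)
        then have "card {x\<in>X. R x f} \<le> card {x\<in>Q. R x f}" using deg by simp
        then show ?thesis using QX fin by (intro card_seteq[symmetric]) auto
      qed
      have "NP \<subseteq> NB - Y"
      proof
        fix f assume "f \<in> NP"
        then obtain x where x: "f \<in> F" "x \<in> P" "R x f" by (auto simp: NP_def P_def)
        then have "f \<in> NB" using \<tau>(2) by (auto simp: NB_def)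
        moreover have "f \<notin> Y"
        proof
          assume "f \<in> Y"
          then have "x \<in> Q" using Ynbr[of f] x \<tau>(2) by blast
          then show False using x(2) by (simp add: Q_def)
        qed
        ultimately show "f \<in> NB - Y" by simp
      qed
      then have "card NP \<le> card (NB - Y)" using fin by (intro card_mono) (auto simp: NB_def)
      moreover have "Y \<subseteq> NB"
      proof
        fix f assume f: "f \<in> Y"
        then have "card {x\<in>Q. R x f} = 2" by (simp add: Y_def)
        then have "{x\<in>Q. R x f} \<noteq> {}" by (metis card.empty zero_neq_numeral)
        then show "f \<in> NB" using f K by (auto simp: NB_def Q_def Y_def)
      qed
      then have "card (NB - Y) + card Y = card NB"
        using fin fK card_mono[of NB Y] by (subst card_Diff_subset) (auto simp: NB_def Y_def)
      moreover have "card NB \<le> \<tau> + w" unfolding NB_def by (rule pre[OF \<tau>(1)])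
      moreover have "card Q \<le> card K + card Y"
      proof -
        have "card Q \<le> card (\<Union>f\<in>K. {x\<in>Q. R x f})"
        proof (rule card_mono)
          show "finite (\<Union>f\<in>K. {x\<in>Q. R x f})" using fK fQ by simp
          have "Q \<subseteq> S" using \<tau>(3) by (simp add: Q_def)
          then show "Q \<subseteq> (\<Union>f\<in>K. {x\<in>Q. R x f})" by (auto simp: S_def)
        qed
        also have "\<dots> \<le> (\<Sum>f\<in>K. card {x\<in>Q. R x f})" by (rule card_UN_le[OF fK])
        also have "\<dots> \<le> (\<Sum>f\<in>K. 1 + (if f \<in> Y then 1 else 0))"
        proof (rule sum_mono)
          fix f assume f: "f \<in> K"
          have "card {x\<in>Q. R x f} \<le> card {x\<in>X. R x f}" using QX fin by (intro card_mono) auto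
          then have "card {x\<in>Q. R x f} \<le> 2" using deg[of f] f K by auto
          then show "card {x\<in>Q. R x f} \<le> 1 + (if f \<in> Y then 1 else 0)" using f by (auto simp: Y_def)
        qed
        also have "\<dots> = card K + card Y"
        proof -
          have "{f\<in>K. f \<in> Y} = Y" by (auto simp: Y_def)
          then show ?thesis using fK by (subst sum.distrib) (simp add: sum.If_cases Int_def)
        qed
        finally show ?thesis .
      qed
      ultimately have "card NP \<le> t + w + \<kappa>" using cQ K(2) by linarith
      then show ?thesis by (simp add: NP_def)
    qed
  qed
qed

text \<open>An element of positive level among the first \<open>K\<close> slots is moved to their
  end, sorted by level; \<open>few\<close> guarantees that it reaches the slot demanded. Its
  neighbour has to be delayed too, to keep \<open>\<rho> e \<le> \<rho>' g + 1\<close>. Since each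
  delayed \<open>e\<close> has only one neighbour, no more of \<open>G\<close> than of
  \<open>E\<close> is delayed, and a compatible order of both preserves the inequality.\<close>

lemma delay_in_alignment:
  fixes r lv :: "'a \<Rightarrow> nat" and r' :: "'b \<Rightarrow> nat"
  assumes fin: "finite E" "finite G" and r: "bij_betw r E {..<N}" and r': "bij_betw r' G {..<N}"
    and K: "K \<le> N" "0 < K"
    and al: "\<And>e g. e \<in> E \<Longrightarrow> g \<in> G \<Longrightarrow> A e g \<Longrightarrow> r e < K \<or> r' g < K \<Longrightarrow> r e \<le> r' g + 1 \<and> r' g \<le> r e + 1"
    and one: "\<And>e. e \<in> E \<Longrightarrow> 0 < lv e \<Longrightarrow> card {g\<in>G. A e g} \<le> 1"
    and few: "\<And>y. 0 < y \<Longrightarrow> card {e\<in>E. y \<le> lv e} + y \<le> K \<or> {e\<in>E. y \<le> lv e} = {}"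
  obtains \<rho> \<rho>' where "bij_betw \<rho> E {..<N}" "bij_betw \<rho>' G {..<N}"
    "\<And>e. e \<in> E \<Longrightarrow> K \<le> r e \<Longrightarrow> \<rho> e = r e" "\<And>g. g \<in> G \<Longrightarrow> K \<le> r' g \<Longrightarrow> \<rho>' g = r' g"
    "\<And>e. e \<in> E \<Longrightarrow> lv e \<le> \<rho> e"
    "\<And>e g. e \<in> E \<Longrightarrow> g \<in> G \<Longrightarrow> A e g \<Longrightarrow> r e < K \<or> r' g < K \<Longrightarrow> \<rho> e \<le> \<rho>' g + 1"
    "\<And>e. e \<in> E \<Longrightarrow> r e < K \<Longrightarrow> \<rho> e < K" "\<And>g. g \<in> G \<Longrightarrow> r' g < K \<Longrightarrow> \<rho>' g < K"
proof -
  define S where "S = {e\<in>E. r e < K \<and> 0 < lv e}"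
  \<comment> \<open>The lexicographic order by level and slot, encoded in one number.\<close>
  define k where "k e = lv e * (N + 1) + r e" for e
  have rN: "r e < N" if "e \<in> E" for e using r that by (auto simp: bij_betw_def)
  have klam: "lv e \<le> lv e'" if "e \<in> E" "e' \<in> E" "k e \<le> k e'" for e e'
  proof (rule ccontr)
    assume "\<not> ?thesis"
    then have "(lv e' + 1) * (N + 1) \<le> lv e * (N + 1)" by (intro mult_le_mono1) simp
    then show False using that(3) rN[OF that(2)] by (simp add: k_def)
  qed
  have kinj: "inj_on k E"
  proof (rule inj_onI)
    fix x y assume H: "x \<in> E" "y \<in> E" "k x = k y"
    then have "lv x = lv y" using klam[of x y] klam[of y x] by simp
    then have "r x = r y" using H by (simp add: k_def)
    then show "x = y" using r H by (auto simp: bij_betw_def inj_on_def)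
  qed
  have SE: "S \<subseteq> E" by (auto simp: S_def)
  have fS: "finite S" using fin by (simp add: S_def)
  \<comment> \<open>A neighbour in slot \<open>K - 1\<close> or later need not move, because no
    element from the first \<open>K\<close> slots is moved beyond slot \<open>K - 1\<close>.\<close>
  define T where "T = {g\<in>G. r' g < K - 1 \<and> (\<exists>e\<in>S. A e g)}"
  have TG: "T \<subseteq> G" by (auto simp: T_def)
  have fT: "finite T" using fin by (simp add: T_def)
  define k' where "k' g = Max (k ` {e\<in>S. A e g})" for g
  have k'in: "\<exists>e\<in>S. A e g \<and> k e = k' g" if "g \<in> T" for g
  proof -
    have "k' g \<in> k ` {e\<in>S. A e g}" unfolding k'_def using that fS by (intro Max_in) (auto simp: T_def)
    then show ?thesis by auto
  qed
  \<comment> \<open>A delayed \<open>g\<close> is assigned its delayed neighbour of largest key.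
    This is injective because that neighbour has no other one in \<open>G\<close>, so tails of
    \<open>T\<close> are no larger than the corresponding tails of \<open>S\<close>.\<close>
  define tp where "tp g = (SOME e. e \<in> S \<and> A e g \<and> k e = k' g)" for g
  have tp: "tp g \<in> S \<and> A (tp g) g \<and> k (tp g) = k' g" if "g \<in> T" for g
  proof -
    have "\<exists>e. e \<in> S \<and> A e g \<and> k e = k' g" using k'in[OF that] by blast
    then show ?thesis unfolding tp_def by (rule someI_ex)
  qed
  have k'ge: "k e \<le> k' g" if "e \<in> S" "A e g" for e g
    unfolding k'_def using that fS by (intro Max_ge) auto
  have uniq: "g = g'" if "e \<in> S" "g \<in> G" "g' \<in> G" "A e g" "A e g'" for e g g'
  proof -
    have "card {g\<in>G. A e g} \<le> 1" using one[of e] that(1) by (auto simp: S_def)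
    then show ?thesis using that fin by (auto simp: card_le_Suc0_iff_eq)
  qed
  have tpinj: "inj_on tp T"
    using tp uniq TG by (intro inj_onI) (metis subsetD)
  have k'inj: "inj_on k' T"
  proof (rule inj_onI)
    fix g g' assume H: "g \<in> T" "g' \<in> T" "k' g = k' g'"
    then have "tp g = tp g'" using tp[of g] tp[of g'] kinj SE by (metis inj_onD subsetD)
    then show "g = g'" using tpinj H by (auto dest: inj_onD)
  qed
  obtain \<rho> where \<rho>: "bij_betw \<rho> E {..<N}" and \<rho>1: "\<And>x. x \<in> E \<Longrightarrow> K \<le> r x \<Longrightarrow> \<rho> x = r x"
    and \<rho>2: "\<And>x. x \<in> E \<Longrightarrow> x \<notin> S \<Longrightarrow> r x < K \<Longrightarrow> \<rho> x + card {y\<in>S. r y < r x} = r x"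
    and \<rho>3: "\<And>x. x \<in> S \<Longrightarrow> \<rho> x + card {y\<in>S. k x \<le> k y} = K"
    and \<rho>4: "\<And>x y. x \<in> E \<Longrightarrow> x \<notin> S \<Longrightarrow> r x < K \<Longrightarrow> y \<in> S \<Longrightarrow> \<rho> x < \<rho> y"
    and \<rho>5: "\<And>x y. x \<in> E \<Longrightarrow> y \<in> E \<Longrightarrow> x \<notin> S \<Longrightarrow> y \<notin> S \<Longrightarrow> r x < r y \<Longrightarrow> \<rho> x < \<rho> y"
  proof (rule delay_permutation[OF fin(1) r K(1) SE _ inj_on_subset[OF kinj SE]])
    show "\<And>x. x \<in> S \<Longrightarrow> r x < K" by (auto simp: S_def)
  qed (rule that)
  have K1: "K - 1 \<le> N" using K by simp
  obtain \<rho>' where \<rho>': "bij_betw \<rho>' G {..<N}" and \<rho>'1: "\<And>x. x \<in> G \<Longrightarrow> K - 1 \<le> r' x \<Longrightarrow> \<rho>' x = r' x"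
    and \<rho>'2: "\<And>x. x \<in> G \<Longrightarrow> x \<notin> T \<Longrightarrow> r' x < K - 1 \<Longrightarrow> \<rho>' x + card {y\<in>T. r' y < r' x} = r' x"
    and \<rho>'3: "\<And>x. x \<in> T \<Longrightarrow> \<rho>' x + card {y\<in>T. k' x \<le> k' y} = K - 1"
    and \<rho>'4: "\<And>x y. x \<in> G \<Longrightarrow> x \<notin> T \<Longrightarrow> r' x < K - 1 \<Longrightarrow> y \<in> T \<Longrightarrow> \<rho>' x < \<rho>' y"
    and \<rho>'5: "\<And>x y. x \<in> G \<Longrightarrow> y \<in> G \<Longrightarrow> x \<notin> T \<Longrightarrow> y \<notin> T \<Longrightarrow> r' x < r' y \<Longrightarrow> \<rho>' x < \<rho>' y"
  proof (rule delay_permutation[OF fin(2) r' K1 TG _ k'inj])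
    show "\<And>x. x \<in> T \<Longrightarrow> r' x < K - 1" by (auto simp: T_def)
  qed (rule that)
  have pos: "0 < card {y\<in>S. k x \<le> k y}" if "x \<in> S" for x using that fS by (auto simp: card_gt_0_iff)
  have \<rho>K: "\<rho> e < K" if "e \<in> E" "r e < K" for e
    using \<rho>2[OF that(1) _ that(2)] \<rho>3[of e] pos[of e] that(2) by (cases "e \<in> S") linarith+
  have pos': "0 < card {y\<in>T. k' x \<le> k' y}" if "x \<in> T" for x using that fT by (auto simp: card_gt_0_iff)
  have \<rho>'K: "\<rho>' g < K" if g: "g \<in> G" "r' g < K" for g
  proof (cases "r' g < K - 1")
    case True
    then show ?thesis using \<rho>'2[OF g(1)] \<rho>'3[of g] pos'[of g] g K by (cases "g \<in> T") linarith+
  qed (use \<rho>'1[OF g(1)] g in simp)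
  have TS: "card {g\<in>T. Q g} \<le> card {e\<in>S. Q' e}" if "\<And>g. g \<in> T \<Longrightarrow> Q g \<Longrightarrow> Q' (tp g)" for Q Q'
  proof (rule card_inj_on_le[of tp])
    show "inj_on tp {g\<in>T. Q g}" using tpinj by (rule inj_on_subset) auto
    show "tp ` {g\<in>T. Q g} \<subseteq> {e\<in>S. Q' e}" using tp that by auto
  qed (use fS in simp)
  have main: "\<rho> e \<le> \<rho>' g + 1" if eg: "e \<in> E" "g \<in> G" "A e g" "r e < K \<or> r' g < K" for e g
  proof -
    have a: "r e \<le> r' g + 1" "r' g \<le> r e + 1" using al[OF eg] by auto
    show ?thesis
    proof (cases "r' g < K - 1")
      case False
      then have "\<rho>' g = r' g" using \<rho>'1[OF eg(2)] by simp
      then show ?thesis using False \<rho>K[OF eg(1)] \<rho>1[OF eg(1)] a by (cases "r e < K") linarith+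
    next
      case gK: True
      then have eK: "r e < K" using a by linarith
      show ?thesis
      proof (cases "g \<in> T")
        case gT: True
        have g3: "\<rho>' g + card {y\<in>T. k' g \<le> k' y} = K - 1" by (rule \<rho>'3[OF gT])
        show ?thesis
        proof (cases "e \<in> S")
          case True
          have "card {y\<in>T. k' g \<le> k' y} \<le> card {y\<in>S. k e \<le> k y}"
            using tp k'ge[OF True eg(3)] by (intro TS) fastforce
          then show ?thesis using \<rho>3[OF True] g3 by linarith
        next
          case False
          define x where "x = tp g"
          have x: "x \<in> S" "k x = k' g" using tp[OF gT] by (auto simp: x_def)
          have "\<rho> e < \<rho> x" by (rule \<rho>4[OF eg(1) False eK x(1)])
          moreover have "card {y\<in>T. k' g \<le> k' y} \<le> card {y\<in>S. k x \<le> k y}"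
            using tp x(2) by (intro TS) fastforce
          ultimately show ?thesis using \<rho>3[OF x(1)] g3 by linarith
        qed
      next
        case gT: False
        then have eS: "e \<notin> S" using eg gK by (auto simp: T_def)
        have "card {y\<in>T. r' y < r' g} \<le> card {y\<in>S. r y < r' g + 1}"
        proof (rule TS)
          fix y assume y: "y \<in> T" "r' y < r' g"
          then have "r (tp y) \<le> r' y + 1" using al[of "tp y" y] tp[OF y(1)] SE TG by (auto simp: S_def)
          then show "r (tp y) < r' g + 1" using y(2) by simp
        qed
        moreover have "\<rho>' g + card {y\<in>T. r' y < r' g} = r' g" by (rule \<rho>'2[OF eg(2) gT gK])
        moreover have "\<rho> e + card {y\<in>S. r y < r e} = r e" by (rule \<rho>2[OF eg(1) eS eK])
        moreover have "card {y\<in>S. r y < r' g + 1} \<le> card {y\<in>S. r y < r e} + (r' g + 1 - r e)"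
        proof -
          have "{y\<in>S. r y < r' g + 1} \<subseteq> {y\<in>S. r y < r e} \<union> {y\<in>E. r e \<le> r y \<and> r y < r' g + 1}" using SE by auto
          then have "card {y\<in>S. r y < r' g + 1} \<le> card ({y\<in>S. r y < r e} \<union> {y\<in>E. r e \<le> r y \<and> r y < r' g + 1})"
            using fin fS by (intro card_mono) auto
          also have "\<dots> \<le> card {y\<in>S. r y < r e} + card {y\<in>E. r e \<le> r y \<and> r y < r' g + 1}" by (rule card_Un_le)
          also have "card {y\<in>E. r e \<le> r y \<and> r y < r' g + 1} \<le> r' g + 1 - r e"
            using r by (intro card_slot_range[of r E]) (auto simp: bij_betw_def)
          finally show ?thesis by simp
        qed
        ultimately show ?thesis using a by linarith
      qed
    qed
  qed
  have lev: "lv e \<le> \<rho> e" if e: "e \<in> E" for e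
  proof (cases "0 < lv e")
    case True
    have f: "card {x\<in>E. lv e \<le> lv x} + lv e \<le> K" using few[OF True] e by auto
    show ?thesis
    proof (cases "r e < K")
      case rK: True
      then have eS: "e \<in> S" using e True by (simp add: S_def)
      have "card {y\<in>S. k e \<le> k y} \<le> card {x\<in>E. lv e \<le> lv x}"
        using fin klam e SE by (intro card_mono) auto
      then show ?thesis using \<rho>3[OF eS] f by linarith
    qed (use \<rho>1[OF e] f in linarith)
  qed simp
  show thesis
    by (rule that[OF \<rho> \<rho>' \<rho>1 _ lev main \<rho>K \<rho>'K]) (use \<rho>'1 in auto)
qed

text \<open>\<open>delay_in_alignment\<close> is applied at the beginning for \<open>lv\<close> and
  then, after reversal and with exchanged roles, at the end for \<open>lw\<close>. Because
  \<open>2 * K + 1 \<le> N\<close>, the slots used second still carry the original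
  alignment.\<close>

lemma delayed_alignment:
  fixes A :: "'a \<Rightarrow> 'b \<Rightarrow> bool" and lv :: "'a \<Rightarrow> nat" and lw :: "'b \<Rightarrow> nat"
  assumes fin: "finite E" "finite G" and c: "card E = N" "card G = N"
    and dE: "\<And>e. e \<in> E \<Longrightarrow> card {g\<in>G. A e g} \<le> 2" and dG: "\<And>g. g \<in> G \<Longrightarrow> card {e\<in>E. A e g} \<le> 2"
    and K: "2 * K + 1 \<le> N" "0 < K"
    and oneE: "\<And>e. e \<in> E \<Longrightarrow> 0 < lv e \<Longrightarrow> card {g\<in>G. A e g} \<le> 1"
    and oneG: "\<And>g. g \<in> G \<Longrightarrow> 0 < lw g \<Longrightarrow> card {e\<in>E. A e g} \<le> 1"
    and fewE: "\<And>y. 0 < y \<Longrightarrow> card {e\<in>E. y \<le> lv e} + y \<le> K \<or> {e\<in>E. y \<le> lv e} = {}"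
    and fewG: "\<And>y. 0 < y \<Longrightarrow> card {g\<in>G. y \<le> lw g} + y \<le> K \<or> {g\<in>G. y \<le> lw g} = {}"
  obtains \<rho> \<rho>' where "bij_betw \<rho> E {..<N}" "bij_betw \<rho>' G {..<N}"
    "\<And>e. e \<in> E \<Longrightarrow> lv e \<le> \<rho> e" "\<And>g. g \<in> G \<Longrightarrow> \<rho>' g + lw g < N"
    "\<And>e g. e \<in> E \<Longrightarrow> g \<in> G \<Longrightarrow> A e g \<Longrightarrow> \<rho> e \<le> \<rho>' g + 1"
proof -
  have "\<exists>r r'. bij_betw r E {..<N} \<and> bij_betw r' G {..<N}
    \<and> (\<forall>e\<in>E. \<forall>g\<in>G. A e g \<longrightarrow> r e \<le> r' g + 1 \<and> r' g \<le> r e + 1)"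
    by (rule aligned_numbering[OF fin c dE dG])
  then obtain r r' where r: "bij_betw r E {..<N}" and r': "bij_betw r' G {..<N}"
    and al: "\<And>e g. e \<in> E \<Longrightarrow> g \<in> G \<Longrightarrow> A e g \<Longrightarrow> r e \<le> r' g + 1 \<and> r' g \<le> r e + 1" by blast
  have KN: "K \<le> N" using K by simp
  obtain p p' where p: "bij_betw p E {..<N}" and p': "bij_betw p' G {..<N}"
    and p1: "\<And>e. e \<in> E \<Longrightarrow> K \<le> r e \<Longrightarrow> p e = r e" and p'1: "\<And>g. g \<in> G \<Longrightarrow> K \<le> r' g \<Longrightarrow> p' g = r' g"
    and plev: "\<And>e. e \<in> E \<Longrightarrow> lv e \<le> p e"
    and pal: "\<And>e g. e \<in> E \<Longrightarrow> g \<in> G \<Longrightarrow> A e g \<Longrightarrow> r e < K \<or> r' g < K \<Longrightarrow> p e \<le> p' g + 1"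
    and pK: "\<And>e. e \<in> E \<Longrightarrow> r e < K \<Longrightarrow> p e < K" and p'K: "\<And>g. g \<in> G \<Longrightarrow> r' g < K \<Longrightarrow> p' g < K"
  proof (rule delay_in_alignment[where A = A and lv = lv, OF fin r r' KN K(2)])
    show "r e \<le> r' g + 1 \<and> r' g \<le> r e + 1" if "e \<in> E" "g \<in> G" "A e g" for e g by (rule al[OF that])
    show "card {g\<in>G. A e g} \<le> 1" if "e \<in> E" "0 < lv e" for e by (rule oneE[OF that])
    show "card {e\<in>E. y \<le> lv e} + y \<le> K \<or> {e\<in>E. y \<le> lv e} = {}" if "0 < y" for y by (rule fewE[OF that])
  qed (rule that)
  have pall: "p e \<le> p' g + 1" if "e \<in> E" "g \<in> G" "A e g" for e g
    using pal[OF that] p1[OF that(1)] p'1[OF that(2)] al[OF that] by (cases "r e < K \<or> r' g < K") auto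
  define t where "t g = N - 1 - p' g" for g
  define t' where "t' e = N - 1 - p e" for e
  have t: "bij_betw t G {..<N}" "bij_betw t' E {..<N}"
    unfolding t_def[abs_def] t'_def[abs_def] by (rule bij_betw_reverse[OF p'], rule bij_betw_reverse[OF p])
  have pN: "p e < N" if "e \<in> E" for e using p that by (auto simp: bij_betw_def)
  have p'N: "p' g < N" if "g \<in> G" for g using p' that by (auto simp: bij_betw_def)
  obtain o1 o2 where o1: "bij_betw o1 G {..<N}" and o2: "bij_betw o2 E {..<N}"
    and o11: "\<And>g. g \<in> G \<Longrightarrow> K \<le> t g \<Longrightarrow> o1 g = t g" and o21: "\<And>e. e \<in> E \<Longrightarrow> K \<le> t' e \<Longrightarrow> o2 e = t' e"
    and olev: "\<And>g. g \<in> G \<Longrightarrow> lw g \<le> o1 g"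
    and oal: "\<And>g e. g \<in> G \<Longrightarrow> e \<in> E \<Longrightarrow> A e g \<Longrightarrow> t g < K \<or> t' e < K \<Longrightarrow> o1 g \<le> o2 e + 1"
    and o1K: "\<And>g. g \<in> G \<Longrightarrow> t g < K \<Longrightarrow> o1 g < K" and o2K: "\<And>e. e \<in> E \<Longrightarrow> t' e < K \<Longrightarrow> o2 e < K"
  proof (rule delay_in_alignment[where A = "\<lambda>g e. A e g" and lv = lw, OF fin(2,1) t KN K(2)])
    show "card {e\<in>E. A e g} \<le> 1" if "g \<in> G" "0 < lw g" for g by (rule oneG[OF that])
    show "card {g\<in>G. y \<le> lw g} + y \<le> K \<or> {g\<in>G. y \<le> lw g} = {}" if "0 < y" for y by (rule fewG[OF that])
  next
    fix g e assume H: "g \<in> G" "e \<in> E" "A e g" "t g < K \<or> t' e < K"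
    have "K + 1 \<le> p' g \<or> K + 1 \<le> p e" using H(4) K(1) by (auto simp: t_def t'_def)
    then have "K + 1 \<le> r' g \<or> K + 1 \<le> r e"
      using p'1[OF H(1)] p1[OF H(2)] p'K[OF H(1)] pK[OF H(2)] by (metis Suc_eq_plus1 Suc_leD leD not_le)
    then have "K \<le> r' g" "K \<le> r e" using al[OF H(2,1,3)] by auto
    then have "p e \<le> p' g + 1 \<and> p' g \<le> p e + 1" using p'1[OF H(1)] p1[OF H(2)] al[OF H(2,1,3)] by simp
    then show "t g \<le> t' e + 1 \<and> t' e \<le> t g + 1" using pN[OF H(2)] p'N[OF H(1)] unfolding t_def t'_def by linarith
  qed (rule that)
  define \<rho> where "\<rho> e = N - 1 - o2 e" for e
  define \<rho>' where "\<rho>' g = N - 1 - o1 g" for g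
  have o1N: "o1 g < N" if "g \<in> G" for g using o1 that by (auto simp: bij_betw_def)
  have o2N: "o2 e < N" if "e \<in> E" for e using o2 that by (auto simp: bij_betw_def)
  show thesis
  proof (rule that[of \<rho> \<rho>'])
    show "bij_betw \<rho> E {..<N}" "bij_betw \<rho>' G {..<N}"
      unfolding \<rho>_def[abs_def] \<rho>'_def[abs_def] by (rule bij_betw_reverse[OF o2], rule bij_betw_reverse[OF o1])
    show "lv e \<le> \<rho> e" if e: "e \<in> E" for e
    proof (cases "t' e < K")
      case True
      have "lv e \<le> K" using fewE[of "lv e"] e by (cases "lv e = 0") auto
      then show ?thesis using o2K[OF e True] K(1) by (simp add: \<rho>_def)
    next
      case False
      then have "\<rho> e = p e" using o21[OF e] pN[OF e] by (simp add: \<rho>_def t'_def)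
      then show ?thesis using plev[OF e] by simp
    qed
    show "\<rho>' g + lw g < N" if g: "g \<in> G" for g
      using olev[OF g] o1N[OF g] by (simp add: \<rho>'_def)
    show "\<rho> e \<le> \<rho>' g + 1" if eg: "e \<in> E" "g \<in> G" "A e g" for e g
    proof (cases "t g < K \<or> t' e < K")
      case True
      then show ?thesis using oal[OF eg(2,1,3)] o1N[OF eg(2)] o2N[OF eg(1)] by (simp add: \<rho>_def \<rho>'_def)
    next
      case False
      then have "\<rho> e = p e" "\<rho>' g = p' g"
        using o21[OF eg(1)] o11[OF eg(2)] pN[OF eg(1)] p'N[OF eg(2)] by (auto simp: \<rho>_def \<rho>'_def t_def t'_def)
      then show ?thesis using pall[OF eg] by simp
    qed
  qed
qed

section \<open>Rotating one alignment against another\<close>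

text \<open>Once round the circle the values are 0, 2, 4, ..., 5, 3, 1, so cyclic neighbours have
  values at most 2 apart. Applied after an arbitrary rotation, it turns an alignment into one with
  tolerance 2.\<close>

definition zigzag :: "nat \<Rightarrow> nat \<Rightarrow> nat" where
  "zigzag q i = (if 2 * i < q then 2 * i else 2 * (q - i) - 1)"

lemma bij_betw_zigzag: "bij_betw (zigzag q) {..<q} {..<q}"
proof -
  have "inj_on (zigzag q) {..<q}"
  proof (rule inj_onI)
    fix x y assume "x \<in> {..<q}" "y \<in> {..<q}" "zigzag q x = zigzag q y"
    then show "x = y" unfolding zigzag_def by (auto split: if_splits) presburger+
  qed
  moreover have "zigzag q ` {..<q} \<subseteq> {..<q}" by (auto simp: zigzag_def)
  ultimately show ?thesis by (simp add: bij_betw_def endo_inj_surj)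
qed

lemma zigzag_step:
  assumes "i < q"
  shows "zigzag q (Suc i mod q) \<le> zigzag q i + 2" "zigzag q i \<le> zigzag q (Suc i mod q) + 2"
  using assms by (cases "Suc i = q"; auto simp: zigzag_def)+

lemma zigzag_near:
  assumes "a \<le> b + 1" "b \<le> a + 1" "0 < q"
  shows "zigzag q ((a + \<theta>) mod q) \<le> zigzag q ((b + \<theta>) mod q) + 2"
proof -
  have s: "Suc x mod q = Suc (x mod q) mod q" for x by (simp add: mod_simps)
  have b: "x mod q < q" for x using assms(3) by simp
  consider "a = b" | "a = Suc b" | "b = Suc a" using assms by linarith
  then show ?thesis
    by cases (use zigzag_step(1)[OF b, of "b + \<theta>"] zigzag_step(2)[OF b, of "a + \<theta>"] s in auto)
qed

text \<open>For fixed \<open>f\<close> the second coordinate takes every value once as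
  \<open>\<theta>\<close> varies, and the first coordinates of all \<open>f\<close> take every value
  once; so each pair is counted once.\<close>

lemma double_count_rotations:
  fixes x :: "'f \<Rightarrow> nat"
  assumes fin: "finite F" and \<sigma>: "bij_betw \<sigma> F {..<q}" and \<sigma>': "\<And>f. f \<in> F \<Longrightarrow> \<sigma>' f < q" and q: "0 < q"
  shows "(\<Sum>\<theta><q. card {f\<in>F. P (\<sigma> f) (zigzag q ((\<sigma>' f + \<theta>) mod q))}) = card {(a, b). a < q \<and> b < q \<and> P a b}"
proof -
  have bz: "bij_betw (\<lambda>\<theta>. zigzag q ((c + \<theta>) mod q)) {..<q} {..<q}" if "c < q" for c
  proof -
    have "bij_betw (\<lambda>\<theta>. \<theta> + c) {..<q} {c..<c + q}"
      by (rule bij_betw_byWitness[where f' = "\<lambda>y. y - c"]) auto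
    from bij_betw_trans[OF bij_betw_trans[OF this bij_betw_mod_window[OF q]] bij_betw_zigzag]
    show ?thesis by (simp add: comp_def add.commute)
  qed
  have row: "card {\<theta>\<in>{..<q}. P a (zigzag q ((c + \<theta>) mod q))} = card {b\<in>{..<q}. P a b}" if "c < q" for a c
    using bij_betw_same_card[OF bij_betw_Collect[OF bz[OF that]]] .
  have "(\<Sum>\<theta><q. card {f\<in>F. P (\<sigma> f) (zigzag q ((\<sigma>' f + \<theta>) mod q))})
      = (\<Sum>\<theta><q. \<Sum>f\<in>F. if P (\<sigma> f) (zigzag q ((\<sigma>' f + \<theta>) mod q)) then 1 else 0)"
    using fin by (simp add: card_sum_indicator)
  also have "\<dots> = (\<Sum>f\<in>F. \<Sum>\<theta><q. if P (\<sigma> f) (zigzag q ((\<sigma>' f + \<theta>) mod q)) then 1 else 0)" by (rule sum.swap)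
  also have "\<dots> = (\<Sum>f\<in>F. card {b\<in>{..<q}. P (\<sigma> f) b})"
  proof (rule sum.cong[OF refl])
    fix f assume "f \<in> F"
    have "(\<Sum>\<theta><q. if P (\<sigma> f) (zigzag q ((\<sigma>' f + \<theta>) mod q)) then 1 else 0)
        = card {\<theta>\<in>{..<q}. P (\<sigma> f) (zigzag q ((\<sigma>' f + \<theta>) mod q))}"
      by (rule card_sum_indicator[symmetric]) simp
    also have "\<dots> = card {b\<in>{..<q}. P (\<sigma> f) b}" by (rule row[OF \<sigma>'[OF \<open>f \<in> F\<close>]])
    finally show "(\<Sum>\<theta><q. if P (\<sigma> f) (zigzag q ((\<sigma>' f + \<theta>) mod q)) then 1 else 0) = card {b\<in>{..<q}. P (\<sigma> f) b}" .
  qed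
  also have "\<dots> = (\<Sum>a<q. card {b\<in>{..<q}. P a b})"
    using sum.reindex_bij_betw[OF \<sigma>, of "\<lambda>a. card {b\<in>{..<q}. P a b}"] .
  also have "\<dots> = card (SIGMA a:{..<q}. {b\<in>{..<q}. P a b})" by (rule card_SigmaI[symmetric]) auto
  also have "(SIGMA a:{..<q}. {b\<in>{..<q}. P a b}) = {(a, b). a < q \<and> b < q \<and> P a b}" by auto
  finally show ?thesis .
qed

text \<open>A rotation by one step changes zigzag coordinates by at most two. So \<open>P1\<close> after the
  step implies \<open>P2\<close> before, and the two averages exclude that all rotations have too few
  \<open>P2\<close>-elements or too many \<open>P1\<close>-elements.\<close>

lemma choose_rotation:
  fixes \<sigma> \<sigma>' :: "'f \<Rightarrow> nat"
  assumes fin: "finite F" and \<sigma>: "bij_betw \<sigma> F {..<q}" and \<sigma>': "\<And>f. f \<in> F \<Longrightarrow> \<sigma>' f < q" and q: "0 < q"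
    and P: "\<And>a b b'. P1 a b' \<Longrightarrow> b \<le> b' + 2 \<Longrightarrow> P2 a b"
    and c1: "card {(a, b). a < q \<and> b < q \<and> P1 a b} < (j + 1) * q"
    and c2: "(j - 1) * q < card {(a, b). a < q \<and> b < q \<and> P2 a b}" and j: "0 < j"
  obtains \<theta> where "card {f\<in>F. P1 (\<sigma> f) (zigzag q ((\<sigma>' f + \<theta>) mod q))} \<le> j"
    "j \<le> card {f\<in>F. P2 (\<sigma> f) (zigzag q ((\<sigma>' f + \<theta>) mod q))}"
proof -
  define n1 where "n1 \<theta> = card {f\<in>F. P1 (\<sigma> f) (zigzag q ((\<sigma>' f + \<theta>) mod q))}" for \<theta>
  define n2 where "n2 \<theta> = card {f\<in>F. P2 (\<sigma> f) (zigzag q ((\<sigma>' f + \<theta>) mod q))}" for \<theta>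
  have s1: "(\<Sum>\<theta><q. n1 \<theta>) < (j + 1) * q" and s2: "(j - 1) * q < (\<Sum>\<theta><q. n2 \<theta>)"
  proof -
    have d: "(\<Sum>\<theta><q. card {f\<in>F. P (\<sigma> f) (zigzag q ((\<sigma>' f + \<theta>) mod q))}) = card {(a, b). a < q \<and> b < q \<and> P a b}" for P
      by (rule double_count_rotations[OF fin \<sigma> _ q]) (rule \<sigma>')
    show "(\<Sum>\<theta><q. n1 \<theta>) < (j + 1) * q" "(j - 1) * q < (\<Sum>\<theta><q. n2 \<theta>)"
      unfolding n1_def n2_def d by (rule c1, rule c2)
  qed
  have step: "n1 (Suc \<theta>) \<le> n2 \<theta>" for \<theta>
    unfolding n1_def n2_def
  proof (rule card_mono)
    show "{f\<in>F. P1 (\<sigma> f) (zigzag q ((\<sigma>' f + Suc \<theta>) mod q))} \<subseteq> {f\<in>F. P2 (\<sigma> f) (zigzag q ((\<sigma>' f + \<theta>) mod q))}"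
      using P zigzag_near[of _ "Suc _" q] q by (fastforce simp del: mod_Suc_eq)
  qed (use fin in simp)
  have per: "n2 (\<theta> + q) = n2 \<theta>" for \<theta>
    by (simp add: n2_def add.assoc[symmetric])
  \<comment> \<open>If this failed, a rotation with \<open>n2 < j\<close> would be followed by one
    with \<open>n1 \<le> j\<close>, hence again \<open>n2 < j\<close>, and so on round the circle.
    The average of \<open>n1\<close> supplies a first such rotation, the average of
    \<open>n2\<close> the contradiction.\<close>
  have "\<exists>\<theta>. n1 \<theta> \<le> j \<and> j \<le> n2 \<theta>"
  proof (rule ccontr)
    assume no: "\<not> ?thesis"
    have stays: "n2 (\<theta> + i) < j" if "n2 \<theta> < j" for \<theta> i
    proof (induction i)
      case (Suc i)
      then have "n1 (Suc (\<theta> + i)) \<le> j" using step[of "\<theta> + i"] by simp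
      then show ?case using no by (metis add_Suc_right not_le)
    qed (use that in simp)
    have "\<exists>\<theta><q. n1 \<theta> \<le> j"
    proof (rule ccontr)
      assume "\<not> ?thesis"
      then have "(\<Sum>\<theta><q. j + 1) \<le> (\<Sum>\<theta><q. n1 \<theta>)" by (intro sum_mono) (auto simp: not_le)
      then show False using s1 by (simp add: mult.commute)
    qed
    then obtain \<theta>0 where \<theta>0: "\<theta>0 < q" "n1 \<theta>0 \<le> j" by blast
    then have low: "n2 \<theta>0 < j" using no by (meson not_le)
    have "n2 \<theta> \<le> j - 1" if "\<theta> < q" for \<theta>
    proof -
      have "\<theta>0 + (\<theta> + q - \<theta>0) = \<theta> + q" using \<theta>0(1) by simp
      then have "n2 (\<theta> + q) < j" using stays[OF low, of "\<theta> + q - \<theta>0"] by simp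
      then show ?thesis using per by simp
    qed
    then have "(\<Sum>\<theta><q. n2 \<theta>) \<le> (\<Sum>\<theta><q. j - 1)" by (intro sum_mono) auto
    then show False using s2 by (simp add: mult.commute)
  qed
  then show thesis using that unfolding n1_def n2_def by blast
qed

lemma card_triangle: "2 * card {(a, b). a + b \<le> w} = (w + 1) * (w + 2 :: nat)"
proof -
  have "{(a, b). a + b \<le> w} = (SIGMA a:{..w}. {..w - a})" by auto
  then have "card {(a, b). a + b \<le> w} = (\<Sum>a\<le>w. w - a + 1)" by (simp add: card_SigmaI)
  also have "\<dots> = (\<Sum>a\<le>w. a + 1)"
    by (rule sum.reindex_bij_witness[of _ "\<lambda>a. w - a" "\<lambda>a. w - a"]) auto
  also have "2 * \<dots> = (w + 1) * (w + 2)" by (induction w) auto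
  finally show ?thesis .
qed

text \<open>A box without a corner; reflection turns the corner into the triangle
  \<open>a + b \<le> w\<close>.\<close>

lemma card_box_below_diagonal:
  fixes m n :: nat
  assumes "m \<le> q" "n \<le> q" "w < m" "w < n" "\<tau> + w + 2 = m + n"
  shows "2 * card {(a, b). a < q \<and> b < q \<and> a < m \<and> b < n \<and> a + b < \<tau>} + (w + 1) * (w + 2) = 2 * (m * n)"
proof -
  define A where "A = {(a, b). a < q \<and> b < q \<and> a < m \<and> b < n \<and> a + b < \<tau>}"
  define B where "B = {(a, b). a < m \<and> b < n \<and> \<tau> \<le> a + b}"
  have AB: "A \<union> B = {..<m} \<times> {..<n}" "A \<inter> B = {}" using assms by (auto simp: A_def B_def)
  then have fin: "finite A" "finite B" by (metis finite_Un finite_cartesian_product finite_lessThan)+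
  have "bij_betw (\<lambda>(a, b). (m - 1 - a, n - 1 - b)) B {(a, b). a + b \<le> w}"
    by (rule bij_betw_byWitness[where f' = "\<lambda>(a, b). (m - 1 - a, n - 1 - b)"])
      (use assms in \<open>auto simp: B_def\<close>)
  then have "2 * card B = (w + 1) * (w + 2)" using card_triangle bij_betw_same_card by metis
  moreover have "card A + card B = m * n"
    using card_Un_disjoint[OF fin AB(2)] AB(1) by (simp add: card_cartesian_product)
  ultimately show ?thesis unfolding A_def by simp
qed

section \<open>Blocks of the third matching and lists of four blocks\<close>

text \<open>\<open>\<sigma>\<close> and \<open>\<xi>\<close> are injective, so Hall's condition only
  needs that the jobs of a window have their \<open>\<xi>\<close>, or their \<open>\<sigma>\<close>
  if the window starts at 0, in a short interval. A deadline bounds \<open>\<sigma> f\<close> from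
  below, and \<open>sum\<close> turns this into an upper bound for \<open>\<xi> f\<close>.\<close>

lemma short_block_scheduling:
  fixes \<sigma> \<xi> :: "'f \<Rightarrow> nat"
  assumes fin: "finite J" "card J = j" and inj: "inj_on \<sigma> J" "inj_on \<xi> J" and j: "0 < j" "2 \<le> h"
    and \<sigma>: "\<And>f. f \<in> J \<Longrightarrow> \<sigma> f + 3 \<le> h + j" and \<xi>: "\<And>f. f \<in> J \<Longrightarrow> \<xi> f + 4 \<le> h + j"
    and sum: "\<And>f. f \<in> J \<Longrightarrow> \<sigma> f + \<xi> f + 4 \<le> 2 * h + j"
  obtains z where "bij_betw z J {..<j}" "\<And>f. f \<in> J \<Longrightarrow> max (\<xi> f + 2) h \<le> z f + h"
    "\<And>f. f \<in> J \<Longrightarrow> z f + max (\<sigma> f + 1) h + 1 \<le> h + j"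
proof -
  define lo where "lo f = \<xi> f + 2 - h" for f
  define up where "up f = min (j - 1) (j + h - 2 - \<sigma> f)" for f
  have "\<exists>z. bij_betw z J {..<j} \<and> (\<forall>f\<in>J. lo f \<le> z f \<and> z f \<le> up f)"
  proof (rule interval_scheduling[OF fin])
    show "up f < j" if "f \<in> J" for f using j by (auto simp: up_def)
    show "card {f\<in>J. l \<le> lo f \<and> up f \<le> t} \<le> Suc t - l" if lt: "l \<le> Suc t" for l t
    proof (cases "j - 1 \<le> t")
      case tj: True
      show ?thesis
      proof (cases "l = 0")
        case True
        have "card {f\<in>J. l \<le> lo f \<and> up f \<le> t} \<le> card J" using fin by (intro card_mono) auto
        then show ?thesis using True tj fin by simp
      next
        case False
        have "card {f\<in>J. l \<le> lo f \<and> up f \<le> t} \<le> (h + j - 3) - (h + l - 2)"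
        proof (rule card_slot_range[OF inj(2)])
          show "{f\<in>J. l \<le> lo f \<and> up f \<le> t} \<subseteq> {f\<in>J. h + l - 2 \<le> \<xi> f \<and> \<xi> f < h + j - 3}"
            using False \<xi> by (fastforce simp: lo_def)
        qed
        then show ?thesis using tj by linarith
      qed
    next
      case tj: False
      have c2: "card {f\<in>J. l \<le> lo f \<and> up f \<le> t} \<le> (h + j - 2) - (j + h - 2 - t)" if "l = 0"
      proof (rule card_slot_range[OF inj(1)])
        show "{f\<in>J. l \<le> lo f \<and> up f \<le> t} \<subseteq> {f\<in>J. j + h - 2 - t \<le> \<sigma> f \<and> \<sigma> f < h + j - 2}"
          using tj \<sigma> by (fastforce simp: up_def)
      qed
      show ?thesis
      proof (cases "l = 0")
        case True
        then show ?thesis using c2 tj by linarith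
      next
        case False
        have "card {f\<in>J. l \<le> lo f \<and> up f \<le> t} \<le> (h + t + 1 - 2) - (h + l - 2)"
        proof (rule card_slot_range[OF inj(2)])
          show "{f\<in>J. l \<le> lo f \<and> up f \<le> t} \<subseteq> {f\<in>J. h + l - 2 \<le> \<xi> f \<and> \<xi> f < h + t + 1 - 2}"
          proof
            fix f assume f: "f \<in> {f\<in>J. l \<le> lo f \<and> up f \<le> t}"
            then have "l \<le> \<xi> f + 2 - h" "j + h - 2 - \<sigma> f \<le> t" "f \<in> J" using tj by (auto simp: lo_def up_def)
            then show "f \<in> {f\<in>J. h + l - 2 \<le> \<xi> f \<and> \<xi> f < h + t + 1 - 2}"
              using False sum[of f] \<sigma>[of f] j by auto
          qed
        qed
        then show ?thesis using lt j by linarith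
      qed
    qed
  qed
  then obtain z where z: "bij_betw z J {..<j}" "\<And>f. f \<in> J \<Longrightarrow> lo f \<le> z f \<and> z f \<le> up f" by blast
  show thesis
  proof (rule that[OF z(1)])
    fix f assume f: "f \<in> J"
    show "max (\<xi> f + 2) h \<le> z f + h" using z(2)[OF f] by (auto simp: lo_def)
    show "z f + max (\<sigma> f + 1) h + 1 \<le> h + j" using z(2)[OF f] \<sigma>[OF f] j by (auto simp: up_def)
  qed
qed

text \<open>In the list \<open>M1\<close>, \<open>J\<close>, \<open>M2\<close>, \<open>F\<close> the
  block \<open>J\<close> is too short to separate \<open>M1\<close> from \<open>M2\<close>, hence
  the condition \<open>c12\<close> across it. \<open>F\<close> still has
  \<open>q - j \<ge> s\<close> edges and separates \<open>M2\<close> from the next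
  \<open>M1\<close>, and \<open>J\<close> and \<open>F\<close> are not adjacent at all.\<close>

lemma cms_graph_ge_of_four_blocks:
  fixes G :: "'a graph"
  assumes fin: "finite (edges G)" and part: "edges G = M1 \<union> J \<union> M2 \<union> F"
    and disj: "M1 \<inter> J = {}" "M1 \<inter> M2 = {}" "M1 \<inter> F = {}" "J \<inter> M2 = {}" "J \<inter> F = {}" "M2 \<inter> F = {}"
    and mat: "\<And>e g. e \<in> M1 \<Longrightarrow> g \<in> M1 \<Longrightarrow> \<not> adjacent e g" "\<And>e g. e \<in> M2 \<Longrightarrow> g \<in> M2 \<Longrightarrow> \<not> adjacent e g"
      "\<And>e g. e \<in> J \<union> F \<Longrightarrow> g \<in> J \<union> F \<Longrightarrow> \<not> adjacent e g"
    and bij: "bij_betw p1 M1 {..<q}" "bij_betw pJ J {..<j}" "bij_betw p2 M2 {..<q}" "bij_betw pF F {..<q - j}"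
    and s: "s + h = q" "j \<le> h" "1 \<le> s"
    and c12: "\<And>e g. e \<in> M1 \<Longrightarrow> g \<in> M2 \<Longrightarrow> adjacent e g \<Longrightarrow> p1 e \<le> p2 g + h + j"
    and c1J: "\<And>e f. e \<in> M1 \<Longrightarrow> f \<in> J \<Longrightarrow> adjacent e f \<Longrightarrow> p1 e \<le> pJ f + h"
    and cJ2: "\<And>g f. g \<in> M2 \<Longrightarrow> f \<in> J \<Longrightarrow> adjacent g f \<Longrightarrow> s + pJ f \<le> j + p2 g"
    and c2F: "\<And>g f. g \<in> M2 \<Longrightarrow> f \<in> F \<Longrightarrow> adjacent g f \<Longrightarrow> p2 g \<le> pF f + h"
    and c1F: "\<And>e f. e \<in> M1 \<Longrightarrow> f \<in> F \<Longrightarrow> adjacent e f \<Longrightarrow> j + pF f \<le> h + p1 e"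
  shows "s \<le> cms_graph G"
proof -
  define l where "l e = (if e \<in> F then (q + j + q) + pF e else if e \<in> M2 then (q + j) + p2 e
    else if e \<in> J then q + pJ e else p1 e)" for e
  have "bij_betw (\<lambda>e. if e \<in> J then q + pJ e else p1 e) (M1 \<union> J) {..<q + j}"
    by (rule bij_betw_append[OF bij(1,2) disj(1)])
  from bij_betw_append[OF this bij(3)] disj
  have "bij_betw (\<lambda>e. if e \<in> M2 then (q + j) + p2 e else if e \<in> J then q + pJ e else p1 e) (M1 \<union> J \<union> M2) {..<q + j + q}"
    by (simp add: Int_Un_distrib2)
  from bij_betw_append[OF this bij(4)] disj
  have bl: "bij_betw l (edges G) {..<q + j + q + (q - j)}"
    unfolding part l_def[abs_def] by (simp add: Int_Un_distrib2)
  have m: "card (edges G) = 3 * q" using bij_betw_same_card[OF bl] s by simp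
  have ord: "ordering G l" unfolding ordering_def m using bl s by (simp add: lessThan_atLeast0 numeral_3_eq_3)
  have l1: "l e = p1 e" "p1 e < q" if "e \<in> M1" for e using that disj bij(1) by (auto simp: l_def bij_betw_def)
  have lJ: "l e = q + pJ e" "pJ e < j" if "e \<in> J" for e using that disj bij(2) by (auto simp: l_def bij_betw_def)
  have l2: "l e = q + j + p2 e" "p2 e < q" if "e \<in> M2" for e using that disj bij(3) by (auto simp: l_def bij_betw_def)
  have lF: "l e = q + j + q + pF e" "pF e < q - j" if "e \<in> F" for e using that disj bij(4) by (auto simp: l_def bij_betw_def)
  have "separated s G l"
    unfolding separated_def m
  proof (intro ballI impI)
    fix e e' assume H: "e \<in> edges G" "e' \<in> edges G" "adjacent e e'" "l e < l e'"
    have H': "adjacent e' e" using H(3) adjacent_sym by blast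
    from H(1) consider "e \<in> M1" | "e \<in> J" | "e \<in> M2" | "e \<in> F" unfolding part by blast
    then show "s + l e \<le> l e' \<and> s + l e' \<le> 3 * q + l e"
    proof cases
      case 1
      note e = l1[OF 1]
      from H(2) consider "e' \<in> M1" | "e' \<in> J" | "e' \<in> M2" | "e' \<in> F" unfolding part by blast
      then show ?thesis
      proof cases
        case a: 1
        then show ?thesis using mat(1)[OF 1 a] H by blast
      next
        case a: 2
        then show ?thesis using c1J[OF 1 a H(3)] e lJ[OF a] s by linarith
      next
        case a: 3
        then show ?thesis using c12[OF 1 a H(3)] e l2[OF a] s by linarith
      next
        case a: 4
        then show ?thesis using c1F[OF 1 a H(3)] e lF[OF a] s by linarith
      qed
    next
      case 2
      note e = lJ[OF 2]
      from H(2) consider "e' \<in> M1" | "e' \<in> J \<union> F" | "e' \<in> M2" unfolding part by blast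
      then show ?thesis
      proof cases
        case a: 1
        then show ?thesis using H(4) e l1[OF a] by linarith
      next
        case a: 2
        then show ?thesis using mat(3)[of e e'] 2 H by blast
      next
        case a: 3
        then show ?thesis using cJ2[OF a 2 H'] e l2[OF a] s by linarith
      qed
    next
      case 3
      note e = l2[OF 3]
      from H(2) consider "e' \<in> M1" | "e' \<in> J" | "e' \<in> M2" | "e' \<in> F" unfolding part by blast
      then show ?thesis
      proof cases
        case a: 1
        then show ?thesis using H(4) e l1[OF a] by linarith
      next
        case a: 2
        then show ?thesis using H(4) e lJ[OF a] by linarith
      next
        case a: 3
        then show ?thesis using mat(2)[OF 3 a] H by blast
      next
        case a: 4
        then show ?thesis using c2F[OF 3 a H(3)] e lF[OF a] s by linarith
      qed
    next
      case 4
      note e = lF[OF 4]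
      from H(2) consider "e' \<in> M1" | "e' \<in> J \<union> F" | "e' \<in> M2" unfolding part by blast
      then show ?thesis
      proof cases
        case a: 1
        then show ?thesis using H(4) e l1[OF a] by linarith
      next
        case a: 2
        then show ?thesis using mat(3)[of e e'] 4 H by blast
      next
        case a: 3
        then show ?thesis using H(4) e l2[OF a] by linarith
      qed
    qed
  qed
  moreover have "edges G \<noteq> {}" "s \<le> card (edges G)" using m s by auto
  ultimately show ?thesis using cms_graph_ge[OF ord _ _ fin] s by blast
qed

text \<open>Up to \<open>u\<close> the sets \<open>d f < t\<close> have between \<open>t\<close> and
  \<open>t + 7\<close> members; beyond \<open>u\<close> they may grow by 2 per step, which is
  compensated by \<open>J\<close>, contained in all of them. An \<open>f\<close> with
  \<open>d f \<le> A\<close> and \<open>x f \<le> B\<close> has \<open>d f \<ge> s - 1 - B\<close>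
  by \<open>lf\<close>, so it lies in a difference of two such sets, and \<open>up\<close> and
  \<open>lo\<close> bound its size. If \<open>A\<close> and \<open>B\<close> are both at least
  \<open>u\<close>, averaging the two growth bounds leaves the requirement
  \<open>s \<le> u + j\<close>.\<close>

lemma long_block_scheduling:
  fixes d x :: "'f \<Rightarrow> nat"
  assumes fin: "finite M" and J: "J \<subseteq> M" "card J = j" and F: "card (M - J) = s + 7" and s: "0 < s" "s \<le> u + j" "u \<le> s"
    and up: "\<And>t. t \<le> u \<Longrightarrow> card {f\<in>M. d f < t} \<le> t + 7" "\<And>t. t \<le> u \<Longrightarrow> card {f\<in>M. x f < t} \<le> t + 7"
    and lo: "\<And>t. t \<le> u \<Longrightarrow> t \<le> card {f\<in>M. d f < t}" "\<And>t. t \<le> u \<Longrightarrow> t \<le> card {f\<in>M. x f < t}"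
    and gr: "\<And>t. u \<le> t \<Longrightarrow> t \<le> s \<Longrightarrow> card {f\<in>M. d f < t} \<le> u + 7 + 2 * (t - u)"
      "\<And>t. u \<le> t \<Longrightarrow> t \<le> s \<Longrightarrow> card {f\<in>M. x f < t} \<le> u + 7 + 2 * (t - u)"
    and Jd: "\<And>f. f \<in> J \<Longrightarrow> d f < u \<and> x f < u"
    and lf: "\<And>f. f \<in> M - J \<Longrightarrow> s \<le> d f + x f + 1"
  obtains z where "bij_betw z (M - J) {..<s + 7}" "\<And>f. f \<in> M - J \<Longrightarrow> s \<le> z f + 1 + d f"
    "\<And>f. f \<in> M - J \<Longrightarrow> z f \<le> 7 + x f"
proof -
  have fJ: "finite J" using J fin finite_subset by blast
  have big: "card {f\<in>M - J. y f < t} + j \<le> u + 7 + 2 * (t - u)"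
    if "u \<le> t" "card {f\<in>M. y f < t} \<le> u + 7 + 2 * (t - u)" "\<And>f. f \<in> J \<Longrightarrow> y f < u" for y :: "'f \<Rightarrow> nat" and t
  proof -
    have "J \<subseteq> {f\<in>M. y f < t}" using that J by fastforce
    moreover have "{f\<in>M - J. y f < t} = {f\<in>M. y f < t} - J" by auto
    ultimately have "card {f\<in>M - J. y f < t} + j = card {f\<in>M. y f < t}"
      using fJ J fin card_mono[of "{f\<in>M. y f < t}" J] by (simp add: card_Diff_subset)
    then show ?thesis using that by simp
  qed
  have one: "card {f\<in>M - J. y f \<le> A} + s \<le> A + 1 + (s + 7)"
    if "A < s" and u1: "\<And>t. t \<le> u \<Longrightarrow> card {f\<in>M. y f < t} \<le> t + 7"
      and u2: "\<And>t. u \<le> t \<Longrightarrow> t \<le> s \<Longrightarrow> card {f\<in>M. y f < t} \<le> u + 7 + 2 * (t - u)"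
      and u3: "\<And>f. f \<in> J \<Longrightarrow> y f < u" for y :: "'f \<Rightarrow> nat" and A
  proof -
    have e: "{f\<in>M - J. y f \<le> A} = {f\<in>M - J. y f < A + 1}" by auto
    show ?thesis
    proof (cases "A + 1 \<le> u")
      case True
      have "card {f\<in>M - J. y f < A + 1} \<le> card {f\<in>M. y f < A + 1}" using fin by (intro card_mono) auto
      then show ?thesis using u1[OF True] e by simp
    next
      case False
      then have "card {f\<in>M - J. y f < A + 1} + j \<le> u + 7 + 2 * (A + 1 - u)" using that by (intro big) auto
      then show ?thesis using e False s that by simp
    qed
  qed
  have window: "card {f\<in>M - J. y f \<le> A \<and> y' f \<le> B} + 2 * s \<le> A + B + 2 + (s + 7)"
    if AB: "B < s" "2 * s \<le> A + B + 2 + (s + 7)" "A < u"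
      and u1: "\<And>t. t \<le> u \<Longrightarrow> card {f\<in>M. y f < t} \<le> t + 7" and u4: "\<And>t. t \<le> u \<Longrightarrow> t \<le> card {f\<in>M. y f < t}"
      and u5: "\<And>f. f \<in> M - J \<Longrightarrow> s \<le> y f + y' f + 1" for y y' :: "'f \<Rightarrow> nat" and A B
  proof -
    define a where "a = s - 1 - B"
    show ?thesis
    proof (cases "a \<le> A + 1")
      case True
      have "{f\<in>M - J. y f \<le> A \<and> y' f \<le> B} \<subseteq> {f\<in>M. y f < A + 1} - {f\<in>M. y f < a}"
        using u5 AB by (fastforce simp: a_def)
      then have "card {f\<in>M - J. y f \<le> A \<and> y' f \<le> B} \<le> card ({f\<in>M. y f < A + 1} - {f\<in>M. y f < a})"
        using fin by (intro card_mono) auto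
      moreover have "card ({f\<in>M. y f < A + 1} - {f\<in>M. y f < a}) + card {f\<in>M. y f < a} = card {f\<in>M. y f < A + 1}"
      proof -
        have "{f\<in>M. y f < a} \<subseteq> {f\<in>M. y f < A + 1}" using True by auto
        then show ?thesis using fin card_mono[of "{f\<in>M. y f < A + 1}" "{f\<in>M. y f < a}"] by (simp add: card_Diff_subset)
      qed
      moreover have "a \<le> card {f\<in>M. y f < a}" using True AB by (intro u4) simp
      moreover have "card {f\<in>M. y f < A + 1} \<le> A + 1 + 7" using AB by (intro u1) simp
      ultimately show ?thesis using AB by (simp add: a_def)
    next
      case False
      have "f \<notin> M - J" if yf: "y f \<le> A" "y' f \<le> B" for f
      proof
        assume "f \<in> M - J"
        then have "s \<le> y f + y' f + 1" by (rule u5)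
        then show False using yf False AB unfolding a_def by linarith
      qed
      then have e: "{f\<in>M - J. y f \<le> A \<and> y' f \<le> B} = {}" by blast
      show ?thesis unfolding e using AB by simp
    qed
  qed
  have "\<exists>z. bij_betw z (M - J) {..<s + 7} \<and> (\<forall>f\<in>M - J. s \<le> z f + 1 + d f \<and> z f + s \<le> s + 7 + x f)"
  proof (rule deadline_scheduling)
    show "card {f\<in>M - J. d f \<le> A} + s \<le> A + 1 + (s + 7)" if "A < s" for A
      using that up gr Jd by (intro one) auto
    show "card {f\<in>M - J. x f \<le> A} + s \<le> A + 1 + (s + 7)" if "A < s" for A
      using that up gr Jd by (intro one) auto
    show "card {f\<in>M - J. d f \<le> A \<and> x f \<le> B} + 2 * s \<le> A + B + 2 + (s + 7)"
      if AB: "A < s" "B < s" "2 * s \<le> A + B + 2 + (s + 7)" for A B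
    proof -
      consider "A < u" | "B < u" | "u \<le> A" "u \<le> B" by linarith
      then show ?thesis
      proof cases
        case 1
        then show ?thesis using AB up lo lf by (intro window) auto
      next
        case 2
        have "card {f\<in>M - J. x f \<le> B \<and> d f \<le> A} + 2 * s \<le> B + A + 2 + (s + 7)"
          using AB up lo lf 2 by (intro window) (auto simp: add.commute)
        moreover have "{f\<in>M - J. x f \<le> B \<and> d f \<le> A} = {f\<in>M - J. d f \<le> A \<and> x f \<le> B}" by auto
        ultimately show ?thesis by simp
      next
        case 3
        have "card {f\<in>M - J. d f < A + 1} + j \<le> u + 7 + 2 * (A + 1 - u)" using 3 AB gr(1) Jd by (intro big) auto
        moreover have "card {f\<in>M - J. x f < B + 1} + j \<le> u + 7 + 2 * (B + 1 - u)" using 3 AB gr(2) Jd by (intro big) auto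
        moreover have "card {f\<in>M - J. d f \<le> A \<and> x f \<le> B} \<le> card {f\<in>M - J. d f < A + 1}"
          "card {f\<in>M - J. d f \<le> A \<and> x f \<le> B} \<le> card {f\<in>M - J. x f < B + 1}"
          using fin by (auto intro!: card_mono)
        ultimately show ?thesis using 3 s by linarith
      qed
    qed
  qed (use fin F s in auto)
  then obtain z where z: "bij_betw z (M - J) {..<s + 7}"
    "\<forall>f\<in>M - J. s \<le> z f + 1 + d f \<and> z f + s \<le> s + 7 + x f" by blast
  then show thesis by (intro that[of z]) auto
qed

text \<open>Both regions are boxes without a corner. The numerical hypotheses give
  \<open>h \<ge> 33\<close>, and substituting \<open>3 * S = 7 * H - 51 - T\<close> with the slack
  \<open>T\<close> makes both differences visibly positive. To leading order, in the extreme case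
  \<open>s = 7 * h / 3\<close>, the regions have areas \<open>47 / 18 * h^2\<close> and
  \<open>7 / 2 * h^2\<close>, with \<open>h * q = 10 / 3 * h^2\<close> in between.\<close>

lemma rotation_counts:
  fixes h s :: nat
  assumes q: "s + h = q" and num: "2 * h \<le> s + 6" "3 * s + 51 \<le> 7 * h"
  shows "card {(a, b). a < q \<and> b < q \<and> (a < 2 * h - 9 \<and> b < 2 * h - 12 \<and> a + b < s + 13)} < (h - 7 + 1) * q"
    and "(h - 7 - 1) * q < card {(a, b). a < q \<and> b < q \<and> (a < 2 * h - 9 \<and> b < 2 * h - 10 \<and> a + b < 3 * h - 10)}"
proof -
  have h: "33 \<le> h" using num by linarith
  define H S T :: int where "H = int h" and "S = int s" and "T = 7 * int h - 51 - 3 * int s"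
  have T: "0 \<le> T" "3 * S = 7 * H - 51 - T" "33 \<le> H" using num h by (simp_all add: T_def S_def H_def)
  define N1 where "N1 = card {(a, b). a < q \<and> b < q \<and> a < 2 * h - 9 \<and> b < 2 * h - 12 \<and> a + b < s + 13}"
  define N2 where "N2 = card {(a, b). a < q \<and> b < q \<and> a < 2 * h - 9 \<and> b < 2 * h - 10 \<and> a + b < 3 * h - 10}"
  have "2 * N1 + (4 * h - 36 - s + 1) * (4 * h - 36 - s + 2) = 2 * ((2 * h - 9) * (2 * h - 12))"
    unfolding N1_def using num q h by (intro card_box_below_diagonal) auto
  then have "int (2 * N1 + (4 * h - 36 - s + 1) * (4 * h - 36 - s + 2)) = int (2 * ((2 * h - 9) * (2 * h - 12)))" by simp
  moreover have "int (4 * h - 36 - s + 1) = 4 * H - 35 - S" "int (4 * h - 36 - s + 2) = 4 * H - 34 - S"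
    "int (2 * h - 9) = 2 * H - 9" "int (2 * h - 12) = 2 * H - 12" "int (2 * h - 10) = 2 * H - 10"
    "int (h - 11 + 1) = H - 10" "int (h - 11 + 2) = H - 9"
    using num h by (simp_all add: H_def S_def)
  note conv = this
  ultimately have e1: "2 * int N1 + (4 * H - 35 - S) * (4 * H - 34 - S) = 2 * ((2 * H - 9) * (2 * H - 12))"
    by (simp only: of_nat_add of_nat_mult of_nat_numeral)
  then have e1': "2 * int N1 = 2 * ((2 * H - 9) * (2 * H - 12)) - (4 * H - 35 - S) * (4 * H - 34 - S)"
    by (simp only: eq_diff_eq)
  have "9 * (2 * ((H - 6) * (S + H)) - 2 * int N1) = 9 * (2 * ((H - 6) * (S + H)) - 2 * ((2 * H - 9) * (2 * H - 12)) + (4 * H - 35 - S) * (4 * H - 34 - S))"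
    by (simp add: e1' right_diff_distrib)
  also have "\<dots> = (3 * S) * (3 * S) - 3 * (6 * H - 57) * (3 * S) + 9 * (10 * (H * H) - 204 * H + 974)"
    by (simp add: algebra_simps)
  also have "\<dots> = 13 * ((H - 33) * (H - 33)) + 423 * (H - 33) + 2448 + T * T + T * (4 * H - 69)"
    unfolding T(2) by (simp add: algebra_simps)
  also have "\<dots> > 0"
  proof -
    have pos: "0 < 13 * A + 423 * (H - 33) + 2448 + B + C" if "0 \<le> A" "0 \<le> B" "0 \<le> C" for A B C :: int
      using that T(3) by auto
    then show ?thesis using T by (intro pos) (auto intro: mult_nonneg_nonneg)
  qed
  finally have "0 < 9 * (2 * ((H - 6) * (S + H)) - 2 * int N1)" .
  then have "int N1 < (H - 6) * (S + H)" by simp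
  moreover have "int ((h - 7 + 1) * q) = (H - 6) * (S + H)"
  proof -
    have "int (h - 7 + 1) = H - 6" "int q = S + H" using h q by (auto simp: H_def S_def)
    then show ?thesis by (simp only: of_nat_mult)
  qed
  ultimately have "int N1 < int ((h - 7 + 1) * q)" by (simp only:)
  then have "N1 < (h - 7 + 1) * q" by (rule of_nat_less_iff[THEN iffD1])
  then show "card {(a, b). a < q \<and> b < q \<and> (a < 2 * h - 9 \<and> b < 2 * h - 12 \<and> a + b < s + 13)} < (h - 7 + 1) * q"
    unfolding N1_def .
  have "2 * N2 + (h - 11 + 1) * (h - 11 + 2) = 2 * ((2 * h - 9) * (2 * h - 10))"
    unfolding N2_def using num q h by (intro card_box_below_diagonal) auto
  then have "int (2 * N2 + (h - 11 + 1) * (h - 11 + 2)) = int (2 * ((2 * h - 9) * (2 * h - 10)))" by simp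
  with conv have e2: "2 * int N2 + (H - 10) * (H - 9) = 2 * ((2 * H - 9) * (2 * H - 10))"
    by (simp only: of_nat_add of_nat_mult of_nat_numeral)
  then have e2': "2 * int N2 = 2 * ((2 * H - 9) * (2 * H - 10)) - (H - 10) * (H - 9)"
    by (simp only: eq_diff_eq)
  have "3 * (2 * int N2 - 2 * ((H - 8) * (S + H))) = 3 * (2 * ((2 * H - 9) * (2 * H - 10)) - (H - 10) * (H - 9) - 2 * ((H - 8) * (S + H)))"
    by (simp add: e2' right_diff_distrib)
  also have "\<dots> = 21 * (H * H) - 171 * H + 270 - 2 * (H - 8) * (3 * S + 3 * H)"
    by (simp add: algebra_simps)
  also have "\<dots> = H * H + 91 * H - 546 + 2 * ((H - 8) * T)"
    unfolding T(2) by (simp add: algebra_simps)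
  also have "\<dots> > 0"
  proof -
    have pos: "0 < A + 91 * H - 546 + 2 * B" if "0 \<le> A" "0 \<le> B" for A B :: int
      using that T(3) by auto
    then show ?thesis using T by (intro pos) (auto intro: mult_nonneg_nonneg)
  qed
  finally have "0 < 3 * (2 * int N2 - 2 * ((H - 8) * (S + H)))" .
  then have "(H - 8) * (S + H) < int N2" by simp
  moreover have "int ((h - 7 - 1) * q) = (H - 8) * (S + H)"
  proof -
    have "int (h - 7 - 1) = H - 8" "int q = S + H" using h q by (auto simp: H_def S_def)
    then show ?thesis by (simp only: of_nat_mult)
  qed
  ultimately have "int ((h - 7 - 1) * q) < int N2" by (simp only:)
  then have "(h - 7 - 1) * q < N2" by (rule of_nat_less_iff[THEN iffD1])
  then show "(h - 7 - 1) * q < card {(a, b). a < q \<and> b < q \<and> (a < 2 * h - 9 \<and> b < 2 * h - 10 \<and> a + b < 3 * h - 10)}"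
    unfolding N2_def .
qed

lemma min_le_iff:
  fixes D :: "'a \<Rightarrow> nat"
  assumes "finite X" "A < c"
  shows "Min (insert c (D ` {x\<in>X. Q x})) \<le> A \<longleftrightarrow> (\<exists>x\<in>X. Q x \<and> D x \<le> A)"
  using assms by (subst Min_le_iff) auto

lemma card_le_of_nbrs:
  assumes "finite M" "finite Y" "\<And>f. f \<in> Y \<Longrightarrow> card {e\<in>M. R e f} \<le> 2" "X \<subseteq> {e\<in>M. \<exists>f\<in>Y. R e f}"
  shows "card X \<le> 2 * card Y"
proof -
  have "card X \<le> card (\<Union>f\<in>Y. {e\<in>M. R e f})" using assms by (intro card_mono) auto
  also have "\<dots> \<le> (\<Sum>f\<in>Y. card {e\<in>M. R e f})" using assms by (intro card_UN_le)
  also have "\<dots> \<le> card Y * 2" using sum_bounded_above[of Y "\<lambda>f. card {e\<in>M. R e f}" 2] assms(3) by simp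
  finally show ?thesis by simp
qed

text \<open>The edges are listed in the order \<open>M1\<close>, \<open>J\<close>, \<open>M2\<close>, \<open>M3 - J\<close> with \<open>J \<subseteq> M3\<close> of
  size \<open>h - 7\<close>. The first \<open>u\<close> edges of \<open>M1\<close> and the last \<open>u\<close> edges of \<open>M2\<close> form intervals of
  the alignments with \<open>M3\<close>, in which \<open>\<xi> f\<close> and \<open>\<sigma> f\<close> are the places of \<open>f \<in> M3\<close>. An edge
  with small \<open>\<xi> f + \<sigma> f\<close> has to lie in \<open>J\<close> (\<open>P1\<close>), while \<open>J\<close> has room only for edges
  satisfying \<open>P2\<close>; an \<open>f\<close> with only one neighbour in these intervals forces the other one to be
  delayed.\<close>

lemma cms_graph_ge_cubic_large:
  fixes G :: "'a graph"
  assumes finE: "finite (edges G)" and part: "edges G = M1 \<union> M2 \<union> M3"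
    and disj: "M1 \<inter> M2 = {}" "M1 \<inter> M3 = {}" "M2 \<inter> M3 = {}"
    and c: "card M1 = q" "card M2 = q" "card M3 = q"
    and mat: "\<And>e g. e \<in> M1 \<Longrightarrow> g \<in> M1 \<Longrightarrow> \<not> adjacent e g" "\<And>e g. e \<in> M2 \<Longrightarrow> g \<in> M2 \<Longrightarrow> \<not> adjacent e g"
      "\<And>e g. e \<in> M3 \<Longrightarrow> g \<in> M3 \<Longrightarrow> \<not> adjacent e g"
    and deg: "\<And>e M. e \<in> edges G \<Longrightarrow> M \<in> {M1, M2, M3} \<Longrightarrow> card {g\<in>M. adjacent e g} \<le> 2"
    and two: "\<And>e. e \<in> M1 \<union> M2 \<Longrightarrow> card {f\<in>M3. adjacent e f} = 2"
    and tri1: "\<And>e f. e \<in> M1 \<Longrightarrow> f \<in> M3 \<Longrightarrow> adjacent e f \<Longrightarrow> \<exists>g\<in>M2. adjacent g e \<and> adjacent g f"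
    and tri2: "\<And>g f. g \<in> M2 \<Longrightarrow> f \<in> M3 \<Longrightarrow> adjacent g f \<Longrightarrow> \<exists>e\<in>M1. adjacent e g \<and> adjacent e f"
    and q: "s + h = q" and num: "2 * h \<le> s + 6" "3 * s + 51 \<le> 7 * h"
  shows "s \<le> cms_graph G"
proof -
  have h: "33 \<le> h" using num by linarith
  have fin: "finite M1" "finite M2" "finite M3" using finE part by auto
  \<comment> \<open>\<open>u = 2 * h - 8\<close> is the largest value for which the parts of
    \<open>M1\<close> and \<open>M2\<close> beyond \<open>u\<close> can satisfy \<open>c12\<close>
    by an alignment: \<open>u + 1 \<le> h + (h - 7)\<close>. \<open>c6 = s - 1 - u\<close> is what
    is missing in \<open>pair\<close> when one of the two places is \<open>u\<close>.
    \<open>LU = s - u + 17\<close> and \<open>LV = s - u + 5\<close> are just what the border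
    elements in \<open>KV\<close> and \<open>KU\<close> need there.\<close>
  define u where "u = 2 * h - 8"
  define LU where "LU = s + 25 - 2 * h"
  define LV where "LV = s + 13 - 2 * h"
  define c6 where "c6 = s + 7 - 2 * h"
  have nu: "u + 8 = 2 * h" "LU + 2 * h = s + 25" "LV + 2 * h = s + 13" "c6 + 2 * h = s + 7"
    "u \<le> s" "u \<le> q" "LU + 2 \<le> u" "LU \<le> h" "LV \<le> h" "LV + 6 \<le> u" "c6 + 14 \<le> u" "LU \<le> q" "LV \<le> q" "0 < q"
    using num h q by (auto simp: u_def LU_def LV_def c6_def)
  have degR: "card {g\<in>M. adjacent g e} \<le> 2" if "e \<in> edges G" "M \<in> {M1, M2, M3}" for e M
    using deg[OF that] by (subst adjacent_sym)
  obtain r \<sigma> where r: "bij_betw r M2 {..<q}" and \<sigma>: "bij_betw \<sigma> M3 {..<q}"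
    and al: "\<And>g f. g \<in> M2 \<Longrightarrow> f \<in> M3 \<Longrightarrow> adjacent g f \<Longrightarrow> r g \<le> \<sigma> f + 1 \<and> \<sigma> f \<le> r g + 1"
  proof -
    have "\<exists>r r'. bij_betw r M2 {..<q} \<and> bij_betw r' M3 {..<q}
      \<and> (\<forall>e\<in>M2. \<forall>g\<in>M3. adjacent e g \<longrightarrow> r e \<le> r' g + 1 \<and> r' g \<le> r e + 1)"
      using deg degR part by (intro aligned_numbering[OF fin(2,3) c(2,3)]) auto
    then show thesis using that by blast
  qed
  obtain r1 \<sigma>' where r1: "bij_betw r1 M1 {..<q}" and \<sigma>': "bij_betw \<sigma>' M3 {..<q}"
    and al1: "\<And>e f. e \<in> M1 \<Longrightarrow> f \<in> M3 \<Longrightarrow> adjacent e f \<Longrightarrow> r1 e \<le> \<sigma>' f + 1 \<and> \<sigma>' f \<le> r1 e + 1"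
  proof -
    have "\<exists>r r'. bij_betw r M1 {..<q} \<and> bij_betw r' M3 {..<q}
      \<and> (\<forall>e\<in>M1. \<forall>g\<in>M3. adjacent e g \<longrightarrow> r e \<le> r' g + 1 \<and> r' g \<le> r e + 1)"
      using deg degR part by (intro aligned_numbering[OF fin(1,3) c(1,3)]) auto
    then show thesis using that by blast
  qed
  have \<sigma>'q: "\<sigma>' f < q" if "f \<in> M3" for f using \<sigma>' that by (auto simp: bij_betw_def)
  \<comment> \<open>\<open>P1\<close> bounds the places by \<open>\<sigma> f + 2 \<le> u\<close> and
    \<open>\<xi> f + 5 \<le> u\<close>; \<open>P2\<close> allows \<open>\<xi>\<close> two more, the
    effect of one rotation step. \<open>3 * h - 10\<close> is the room in a block of
    \<open>h - 7\<close> slots. \<open>s + 13\<close> makes sure that an element outside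
    \<open>J\<close> with both places small has neighbours in \<open>M2\<close> from slot
    \<open>LU\<close> on, and then a sufficient sum.\<close>
  define P1 where "P1 a b \<longleftrightarrow> a < 2 * h - 9 \<and> b < 2 * h - 12 \<and> a + b < s + 13" for a b
  define P2 where "P2 a b \<longleftrightarrow> a < 2 * h - 9 \<and> b < 2 * h - 10 \<and> a + b < 3 * h - 10" for a b
  obtain \<theta> where \<theta>1: "card {f\<in>M3. P1 (\<sigma> f) (zigzag q ((\<sigma>' f + \<theta>) mod q))} \<le> h - 7"
    and \<theta>2: "h - 7 \<le> card {f\<in>M3. P2 (\<sigma> f) (zigzag q ((\<sigma>' f + \<theta>) mod q))}"
  proof (rule choose_rotation[where F = M3 and q = q and \<sigma> = \<sigma> and \<sigma>' = \<sigma>' and j = "h - 7" and ?P1.0 = P1 and ?P2.0 = P2, OF fin(3) \<sigma> _ nu(14)])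
    show "\<sigma>' f < q" if "f \<in> M3" for f by (rule \<sigma>'q[OF that])
    show "P2 a b" if "P1 a b'" "b \<le> b' + 2" for a b b' using that num h by (auto simp: P1_def P2_def)
    show "card {(a, b). a < q \<and> b < q \<and> P1 a b} < (h - 7 + 1) * q" unfolding P1_def by (rule rotation_counts(1)[OF q num])
    show "(h - 7 - 1) * q < card {(a, b). a < q \<and> b < q \<and> P2 a b}" unfolding P2_def by (rule rotation_counts(2)[OF q num])
    show "0 < h - 7" using h by simp
  qed (rule that)
  define \<xi> where "\<xi> f = zigzag q ((\<sigma>' f + \<theta>) mod q)" for f
  define b where "b e = zigzag q ((r1 e + \<theta>) mod q)" for e
  have bz: "bij_betw (\<lambda>y. zigzag q ((y + \<theta>) mod q)) {..<q} {..<q}"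
  proof -
    have "bij_betw (\<lambda>y. y + \<theta>) {..<q} {\<theta>..<\<theta> + q}"
      by (rule bij_betw_byWitness[where f' = "\<lambda>y. y - \<theta>"]) auto
    from bij_betw_trans[OF bij_betw_trans[OF this bij_betw_mod_window[OF nu(14)]] bij_betw_zigzag]
    show ?thesis by (simp add: comp_def)
  qed
  have b: "bij_betw b M1 {..<q}" using bij_betw_trans[OF r1 bz] by (simp add: b_def[abs_def] comp_def)
  have \<xi>: "bij_betw \<xi> M3 {..<q}" using bij_betw_trans[OF \<sigma>' bz] by (simp add: \<xi>_def[abs_def] comp_def)
  have injs: "inj_on \<sigma> M3" "inj_on \<xi> M3" using \<sigma> \<xi> by (auto simp: bij_betw_def)
  have alb: "b e \<le> \<xi> f + 2 \<and> \<xi> f \<le> b e + 2" if "e \<in> M1" "f \<in> M3" "adjacent e f" for e f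
    unfolding b_def \<xi>_def using al1[OF that] zigzag_near[OF _ _ nu(14)] by blast
  have "\<exists>J. {f\<in>M3. P1 (\<sigma> f) (\<xi> f)} \<subseteq> J \<and> J \<subseteq> {f\<in>M3. P2 (\<sigma> f) (\<xi> f)} \<and> card J = h - 7"
  proof (rule superset_of_card)
    show "{f\<in>M3. P1 (\<sigma> f) (\<xi> f)} \<subseteq> {f\<in>M3. P2 (\<sigma> f) (\<xi> f)}" using num h by (auto simp: P1_def P2_def)
  qed (use fin \<theta>1 \<theta>2 in \<open>auto simp: \<xi>_def\<close>)
  then obtain J where J: "{f\<in>M3. P1 (\<sigma> f) (\<xi> f)} \<subseteq> J" "J \<subseteq> {f\<in>M3. P2 (\<sigma> f) (\<xi> f)}" "card J = h - 7" by blast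
  have JM: "J \<subseteq> M3" using J(2) by auto
  have fJ: "finite J" using JM fin finite_subset by blast
  have JP: "\<sigma> f + 2 \<le> u \<and> \<xi> f + 3 \<le> u \<and> \<sigma> f + \<xi> f + 11 \<le> 3 * h" if "f \<in> J" for f
    using J(2) that nu h by (auto simp: P2_def)
  \<comment> \<open>Elements near the border \<open>u\<close> of one interval may have neighbours
    there on either side of it. Their neighbours in the other matching are therefore delayed, to
    about \<open>LU\<close> or \<open>LV\<close>; the 6 and 2 slots bound the cost of this
    delay.\<close>
  define KV where "KV = {f\<in>M3. u - 4 \<le> \<xi> f \<and> \<xi> f < u + 2}"
  define KU where "KU = {f\<in>M3. u - 1 \<le> \<sigma> f \<and> \<sigma> f < u + 1}"
  have cKV: "card KV \<le> 6" using card_slot_range[OF injs(2), of KV "u - 4" "u + 2"] nu h by (simp add: KV_def)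
  have cKU: "card KU \<le> 2" using card_slot_range[OF injs(1), of KU "u - 1" "u + 1"] nu h by (simp add: KU_def)
  obtain D where D: "bij_betw D M2 {..<q}" and D1: "\<And>g. g \<in> M2 \<Longrightarrow> LU \<le> r g \<Longrightarrow> D g = r g"
    and D2: "\<And>g. g \<in> M2 \<Longrightarrow> r g < LU \<Longrightarrow> D g < LU" and D3: "\<And>g. g \<in> M2 \<Longrightarrow> r g \<le> D g + 2 * 6"
    and D4: "\<And>g f. g \<in> M2 \<Longrightarrow> f \<in> KV \<Longrightarrow> adjacent g f \<Longrightarrow> LU \<le> D g + 2 * 6"
    and D5: "\<And>t. t \<le> q \<Longrightarrow> card {f\<in>M3. \<exists>g\<in>M2. D g < t \<and> adjacent g f} \<le> t + 1 + 6"
  proof (rule delayed_order[OF fin(2,3) r nu(12) _ _ cKV, where R = adjacent and w = 1])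
    show "card {g\<in>M2. adjacent g f} \<le> 2" if "f \<in> M3" for f using degR that part by auto
    show "KV \<subseteq> M3" by (auto simp: KV_def)
    show "card {f\<in>M3. \<exists>g\<in>M2. r g < t \<and> adjacent g f} \<le> t + 1" for t
    proof -
      have "card {f\<in>M3. \<exists>g\<in>M2. r g < t \<and> adjacent g f} \<le> t + 1 - 0"
        by (rule card_slot_range[OF injs(1)]) (use al in fastforce)
      then show ?thesis by simp
    qed
  qed (rule that)
  obtain x where x: "bij_betw x M1 {..<q}" and x1: "\<And>e. e \<in> M1 \<Longrightarrow> LV \<le> b e \<Longrightarrow> x e = b e"
    and x2: "\<And>e. e \<in> M1 \<Longrightarrow> b e < LV \<Longrightarrow> x e < LV" and x3: "\<And>e. e \<in> M1 \<Longrightarrow> b e \<le> x e + 2 * 2"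
    and x4: "\<And>e f. e \<in> M1 \<Longrightarrow> f \<in> KU \<Longrightarrow> adjacent e f \<Longrightarrow> LV \<le> x e + 2 * 2"
    and x5: "\<And>t. t \<le> q \<Longrightarrow> card {f\<in>M3. \<exists>e\<in>M1. x e < t \<and> adjacent e f} \<le> t + 2 + 2"
  proof (rule delayed_order[OF fin(1,3) b nu(13) _ _ cKU, where R = adjacent and w = 2])
    show "card {g\<in>M1. adjacent g f} \<le> 2" if "f \<in> M3" for f using degR that part by auto
    show "KU \<subseteq> M3" by (auto simp: KU_def)
    show "card {f\<in>M3. \<exists>e\<in>M1. b e < t \<and> adjacent e f} \<le> t + 2" for t
    proof -
      have "card {f\<in>M3. \<exists>e\<in>M1. b e < t \<and> adjacent e f} \<le> t + 2 - 0"
        by (rule card_slot_range[OF injs(2)]) (use alb in fastforce)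
      then show ?thesis by simp
    qed
  qed (rule that)
  define V where "V = {e\<in>M1. x e < u}"
  define U where "U = {g\<in>M2. D g < u}"
  define E where "E = M1 - V"
  define H where "H = M2 - U"
  define N where "N = q - u"
  have cVU: "card V = u" "card U = u"
    using card_below_slot[OF x nu(6)] card_below_slot[OF D nu(6)] by (simp_all add: V_def U_def)
  have cEH: "card E = N" "card H = N"
    using cVU c fin by (simp_all add: E_def H_def N_def card_Diff_subset V_def U_def)
  have fEH: "finite E" "finite H" using fin by (auto simp: E_def H_def)
  have N: "N + h = s + 8" using nu q h by (simp add: N_def)
  define d0 where "d0 f = Min (insert u (D ` {g\<in>M2. adjacent g f}))" for f
  define x0 where "x0 f = Min (insert u (x ` {e\<in>M1. adjacent e f}))" for f
  have d0le: "d0 f \<le> A \<longleftrightarrow> (\<exists>g\<in>M2. adjacent g f \<and> D g \<le> A)" if "A < u" for A f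
    unfolding d0_def by (rule min_le_iff[OF fin(2) that])
  have x0le: "x0 f \<le> A \<longleftrightarrow> (\<exists>e\<in>M1. adjacent e f \<and> x e \<le> A)" if "A < u" for A f
    unfolding x0_def by (rule min_le_iff[OF fin(1) that])
  have d0b: "d0 f \<le> D g" "d0 f \<le> u" if "g \<in> M2" "adjacent g f" for f g
    unfolding d0_def using that fin by (auto intro!: Min_le)
  have x0b: "x0 f \<le> x e" "x0 f \<le> u" if "e \<in> M1" "adjacent e f" for f e
    unfolding x0_def using that fin by (auto intro!: Min_le)
  have c6u: "c6 - y < u" for y using nu(11) by linarith
  \<comment> \<open>If \<open>f\<close> has its place well beyond \<open>u\<close> in
    \<open>\<xi>\<close>, its neighbour \<open>e\<close> in \<open>M1\<close> comes at
    \<open>u\<close> or later, and \<open>pair\<close> can only fail through an early neighbour of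
    \<open>f\<close> in \<open>M2\<close>. The level is the additional delay
    \<open>c6 - d0 f\<close> that excludes this; \<open>lw\<close> is the mirror image.\<close>
  define lv where "lv e = Max (insert 0 ((\<lambda>f. c6 - d0 f) ` {f\<in>M3. adjacent e f \<and> u + 2 \<le> \<xi> f}))" for e
  define lw where "lw g = Max (insert 0 ((\<lambda>f. c6 - x0 f) ` {f\<in>M3. adjacent g f \<and> u + 1 \<le> \<sigma> f}))" for g
  have lvge: "c6 - d0 f \<le> lv e" if "f \<in> M3" "adjacent e f" "u + 2 \<le> \<xi> f" for e f
    unfolding lv_def using that fin by (intro Max_ge) auto
  have lwge: "c6 - x0 f \<le> lw g" if "f \<in> M3" "adjacent g f" "u + 1 \<le> \<sigma> f" for g f
    unfolding lw_def using that fin by (intro Max_ge) auto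
  have lvex: "\<exists>f\<in>M3. adjacent e f \<and> u + 2 \<le> \<xi> f \<and> d0 f + y \<le> c6" if y: "0 < y" "y \<le> lv e" for e y
  proof -
    have "lv e \<in> insert 0 ((\<lambda>f. c6 - d0 f) ` {f\<in>M3. adjacent e f \<and> u + 2 \<le> \<xi> f})"
      unfolding lv_def using fin by (intro Max_in) auto
    then obtain f where "f \<in> M3" "adjacent e f" "u + 2 \<le> \<xi> f" "lv e = c6 - d0 f" using y by fastforce
    then show ?thesis using y by (intro bexI[of _ f]) auto
  qed
  have lwex: "\<exists>f\<in>M3. adjacent g f \<and> u + 1 \<le> \<sigma> f \<and> x0 f + y \<le> c6" if y: "0 < y" "y \<le> lw g" for g y
  proof -
    have "lw g \<in> insert 0 ((\<lambda>f. c6 - x0 f) ` {f\<in>M3. adjacent g f \<and> u + 1 \<le> \<sigma> f})"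
      unfolding lw_def using fin by (intro Max_in) auto
    then obtain f where "f \<in> M3" "adjacent g f" "u + 1 \<le> \<sigma> f" "lw g = c6 - x0 f" using y by fastforce
    then show ?thesis using y by (intro bexI[of _ f]) auto
  qed
  obtain \<rho> \<rho>' where \<rho>: "bij_betw \<rho> E {..<N}" and \<rho>': "bij_betw \<rho>' H {..<N}"
    and \<rho>lv: "\<And>e. e \<in> E \<Longrightarrow> lv e \<le> \<rho> e" and \<rho>lw: "\<And>g. g \<in> H \<Longrightarrow> \<rho>' g + lw g < N"
    and \<rho>al: "\<And>e g. e \<in> E \<Longrightarrow> g \<in> H \<Longrightarrow> adjacent e g \<Longrightarrow> \<rho> e \<le> \<rho>' g + 1"
  proof (rule delayed_alignment[OF fEH cEH, where A = adjacent and lv = lv and lw = lw and K = "2 * c6 + 15"])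
    show "card {g\<in>H. adjacent e g} \<le> 2" if "e \<in> E" for e
    proof -
      have "card {g\<in>H. adjacent e g} \<le> card {g\<in>M2. adjacent e g}" using fin by (intro card_mono) (auto simp: H_def)
      then show ?thesis using deg[of e M2] that part by (auto simp: E_def)
    qed
    show "card {e\<in>E. adjacent e g} \<le> 2" if "g \<in> H" for g
    proof -
      have "card {e\<in>E. adjacent e g} \<le> card {e\<in>M1. adjacent e g}" using fin by (intro card_mono) (auto simp: E_def)
      then show ?thesis using degR[of g M1] that part by (auto simp: H_def)
    qed
    \<comment> \<open>By the values of \<open>c6\<close> and \<open>N\<close> this is exactly the
      hypothesis \<open>3 * s + 51 \<le> 7 * h\<close>, that is
      \<open>10 * s + 51 \<le> 7 * q\<close>; so the ratio 7/10 is used up here.\<close>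
    show "2 * (2 * c6 + 15) + 1 \<le> N" using N nu(4) num(2) by simp
    show "card {g\<in>H. adjacent e g} \<le> 1" if e: "e \<in> E" "0 < lv e" for e
    proof -
      obtain f where f: "f \<in> M3" "adjacent e f" "d0 f + 1 \<le> c6" using lvex[of 1 e] e by auto
      have eM: "e \<in> M1" using e by (simp add: E_def)
      obtain g where g: "g \<in> M2" "adjacent g f" "D g \<le> c6 - 1" using d0le[OF c6u[of 1], of f] f by auto
      \<comment> \<open>\<open>M2\<close> has an edge adjacent to both \<open>e\<close> and
        \<open>f\<close>. Like the neighbour \<open>g\<close> of \<open>f\<close> it is early, so it
        belongs to \<open>U\<close>, and \<open>e\<close> has at most one neighbour left in
        \<open>H\<close>.\<close>
      obtain g' where g': "g' \<in> M2" "adjacent g' e" "adjacent g' f" using tri1[OF eM f(1,2)] by auto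
      have "r g' < u" using al[OF g(1) f(1) g(2)] al[OF g'(1) f(1) g'(3)] D3[OF g(1)] g(3) f nu by linarith
      then have "g' \<in> U" using D1[OF g'(1)] D2[OF g'(1)] g'(1) nu by (cases "r g' < LU") (auto simp: U_def)
      then have "{g\<in>H. adjacent e g} \<subseteq> {g\<in>M2. adjacent e g} - {g'}" by (auto simp: H_def)
      then have "card {g\<in>H. adjacent e g} \<le> card ({g\<in>M2. adjacent e g} - {g'})" using fin by (intro card_mono) auto
      also have "\<dots> = card {g\<in>M2. adjacent e g} - 1"
        using g' adjacent_sym[of g' e] by (intro card_Diff_singleton) auto
      finally show ?thesis using deg[of e M2] eM part by auto
    qed
    show "card {e\<in>E. adjacent e g} \<le> 1" if g: "g \<in> H" "0 < lw g" for g
    proof -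
      obtain f where f: "f \<in> M3" "adjacent g f" "x0 f + 1 \<le> c6" using lwex[of 1 g] g by auto
      have gM: "g \<in> M2" using g by (simp add: H_def)
      obtain e where e: "e \<in> M1" "adjacent e f" "x e \<le> c6 - 1" using x0le[OF c6u[of 1], of f] f by auto
      obtain e' where e': "e' \<in> M1" "adjacent e' g" "adjacent e' f" using tri2[OF gM f(1,2)] by auto
      have "b e' < u" using alb[OF e(1) f(1) e(2)] alb[OF e'(1) f(1) e'(3)] x3[OF e(1)] e(3) f nu by linarith
      then have "e' \<in> V" using x1[OF e'(1)] x2[OF e'(1)] e'(1) nu by (cases "b e' < LV") (auto simp: V_def)
      then have "{e\<in>E. adjacent e g} \<subseteq> {e\<in>M1. adjacent e g} - {e'}" by (auto simp: E_def)
      then have "card {e\<in>E. adjacent e g} \<le> card ({e\<in>M1. adjacent e g} - {e'})" using fin by (intro card_mono) auto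
      also have "\<dots> = card {e\<in>M1. adjacent e g} - 1" using e' by (intro card_Diff_singleton) auto
      finally show ?thesis using degR[of g M1] gM part by auto
    qed
    show "card {e\<in>E. y \<le> lv e} + y \<le> 2 * c6 + 15 \<or> {e\<in>E. y \<le> lv e} = {}" if y: "0 < y" for y
    proof (cases "y \<le> c6")
      case True
      define Y where "Y = {f\<in>M3. \<exists>g\<in>M2. D g < c6 - y + 1 \<and> adjacent g f}"
      \<comment> \<open>At most \<open>2 * (c6 - y + 8)\<close> elements have level \<open>y\<close>
        or more; adding \<open>y\<close> gives at most \<open>2 * c6 + 15\<close>, because
        \<open>y\<close> is positive.\<close>
      have cY: "card Y \<le> c6 - y + 1 + 1 + 6" unfolding Y_def using nu by (intro D5) simp
      have "card {e\<in>E. y \<le> lv e} \<le> 2 * card Y"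
      proof (rule card_le_of_nbrs[OF fin(1), where R = adjacent])
        show "finite Y" using fin by (simp add: Y_def)
        show "card {e\<in>M1. adjacent e f} \<le> 2" if "f \<in> Y" for f using degR[of f M1] that part by (auto simp: Y_def)
        show "{e\<in>E. y \<le> lv e} \<subseteq> {e\<in>M1. \<exists>f\<in>Y. adjacent e f}"
        proof
          fix e assume e: "e \<in> {e\<in>E. y \<le> lv e}"
          then obtain f where f: "f \<in> M3" "adjacent e f" "d0 f + y \<le> c6" using lvex[OF y, of e] by auto
          then have "\<exists>g\<in>M2. adjacent g f \<and> D g \<le> c6 - y" using d0le[OF c6u[of y], of f] by auto
          then have "f \<in> Y" using f by (auto simp: Y_def less_Suc_eq_le)
          then show "e \<in> {e\<in>M1. \<exists>f\<in>Y. adjacent e f}" using e f by (auto simp: E_def)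
        qed
      qed
      then show ?thesis using cY True y by linarith
    next
      case False
      then have "{e\<in>E. y \<le> lv e} = {}" using lvex[OF y] by fastforce
      then show ?thesis by blast
    qed
    show "card {g\<in>H. y \<le> lw g} + y \<le> 2 * c6 + 15 \<or> {g\<in>H. y \<le> lw g} = {}" if y: "0 < y" for y
    proof (cases "y \<le> c6")
      case True
      define Y where "Y = {f\<in>M3. \<exists>e\<in>M1. x e < c6 - y + 1 \<and> adjacent e f}"
      have cY: "card Y \<le> c6 - y + 1 + 2 + 2" unfolding Y_def using nu by (intro x5) simp
      have "card {g\<in>H. y \<le> lw g} \<le> 2 * card Y"
      proof (rule card_le_of_nbrs[OF fin(2), where R = adjacent])
        show "finite Y" using fin by (simp add: Y_def)
        show "card {g\<in>M2. adjacent g f} \<le> 2" if "f \<in> Y" for f using degR[of f M2] that part by (auto simp: Y_def)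
        show "{g\<in>H. y \<le> lw g} \<subseteq> {g\<in>M2. \<exists>f\<in>Y. adjacent g f}"
        proof
          fix g assume g: "g \<in> {g\<in>H. y \<le> lw g}"
          then obtain f where f: "f \<in> M3" "adjacent g f" "x0 f + y \<le> c6" using lwex[OF y, of g] by auto
          then have "\<exists>e\<in>M1. adjacent e f \<and> x e \<le> c6 - y" using x0le[OF c6u[of y], of f] by auto
          then have "f \<in> Y" using f by (auto simp: Y_def less_Suc_eq_le)
          then show "g \<in> {g\<in>M2. \<exists>f\<in>Y. adjacent g f}" using g f by (auto simp: H_def)
        qed
      qed
      then show ?thesis using cY True y by linarith
    next
      case False
      then have "{g\<in>H. y \<le> lw g} = {}" using lwex[OF y] by fastforce
      then show ?thesis by blast
    qed
  qed (simp, rule that)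
  \<comment> \<open>\<open>M1\<close> is \<open>V\<close> followed by \<open>E\<close>.
    \<open>dp\<close> counts \<open>M2\<close> from its end, so in the list \<open>U\<close> is its
    final part.\<close>
  define p1 where "p1 e = (if e \<in> E then u + \<rho> e else x e)" for e
  define dp where "dp g = (if g \<in> H then u + (N - 1 - \<rho>' g) else D g)" for g
  define p2 where "p2 g = q - 1 - dp g" for g
  have uN: "u + N = q" using nu by (simp add: N_def)
  have bV: "bij_betw x V {..<u}"
  proof -
    have "x ` V = {..<u}"
    proof
      show "{..<u} \<subseteq> x ` V"
      proof
        fix i assume i: "i \<in> {..<u}"
        then have "i \<in> x ` M1" using x nu by (auto simp: bij_betw_def)
        then show "i \<in> x ` V" using i by (auto simp: V_def)
      qed
    qed (auto simp: V_def)
    then show ?thesis using x by (auto simp: bij_betw_def inj_on_def V_def)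
  qed
  have bU: "bij_betw D U {..<u}"
  proof -
    have "D ` U = {..<u}"
    proof
      show "{..<u} \<subseteq> D ` U"
      proof
        fix i assume i: "i \<in> {..<u}"
        then have "i \<in> D ` M2" using D nu by (auto simp: bij_betw_def)
        then show "i \<in> D ` U" using i by (auto simp: U_def)
      qed
    qed (auto simp: U_def)
    then show ?thesis using D by (auto simp: bij_betw_def inj_on_def U_def)
  qed
  have VE: "V \<inter> E = {}" "V \<union> E = M1" "U \<inter> H = {}" "U \<union> H = M2" by (auto simp: V_def E_def U_def H_def)
  have bp1: "bij_betw p1 M1 {..<q}"
    using bij_betw_append[OF bV \<rho> VE(1)] uN VE(2) by (simp add: p1_def[abs_def])
  have bdp: "bij_betw dp M2 {..<q}"
    using bij_betw_append[OF bU bij_betw_reverse[OF \<rho>'] VE(3)] uN VE(4) by (simp add: dp_def[abs_def])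
  have bp2: "bij_betw p2 M2 {..<q}" unfolding p2_def[abs_def] by (rule bij_betw_reverse[OF bdp])
  have dpq: "dp g < q" if "g \<in> M2" for g using bdp that by (auto simp: bij_betw_def)
  have p1q: "p1 e < q" if "e \<in> M1" for e using bp1 that by (auto simp: bij_betw_def)
  have p1V: "p1 e = x e" if "e \<in> M1" "x e < u" for e using that by (simp add: p1_def E_def V_def)
  have p1E: "p1 e = u + \<rho> e" "e \<in> E" if "e \<in> M1" "u \<le> x e" for e using that by (auto simp: p1_def E_def V_def)
  have dpU: "dp g = D g" if "g \<in> M2" "D g < u" for g using that by (simp add: dp_def H_def U_def)
  have dpH: "dp g = u + (N - 1 - \<rho>' g)" "g \<in> H" if "g \<in> M2" "u \<le> D g" for g using that by (auto simp: dp_def H_def U_def)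
  have p1lt: "p1 e < t \<longleftrightarrow> x e < t" if "e \<in> M1" "t \<le> u" for e t
    using p1V[OF that(1)] p1E(1)[OF that(1)] that(2) by (cases "x e < u") auto
  have dplt: "dp g < t \<longleftrightarrow> D g < t" if "g \<in> M2" "t \<le> u" for g t
    using dpU[OF that(1)] dpH(1)[OF that(1)] that(2) by (cases "D g < u") auto
  have p1ge: "x e \<le> p1 e \<or> u \<le> p1 e" if "e \<in> M1" for e
    using p1V[OF that] p1E(1)[OF that] by (cases "x e < u") auto
  have dpge: "D g \<le> dp g \<or> u \<le> dp g" if "g \<in> M2" for g
    using dpU[OF that] dpH(1)[OF that] by (cases "D g < u") auto
  obtain pJ where pJ: "bij_betw pJ J {..<h - 7}" and pJ1: "\<And>f. f \<in> J \<Longrightarrow> max (\<xi> f + 2) h \<le> pJ f + h"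
    and pJ2: "\<And>f. f \<in> J \<Longrightarrow> pJ f + max (\<sigma> f + 1) h + 1 \<le> h + (h - 7)"
  proof (rule short_block_scheduling[OF fJ J(3), of \<sigma> \<xi> h])
    show "inj_on \<sigma> J" "inj_on \<xi> J" using injs JM by (auto intro: inj_on_subset)
    show "\<sigma> f + 3 \<le> h + (h - 7)" "\<xi> f + 4 \<le> h + (h - 7)" "\<sigma> f + \<xi> f + 4 \<le> 2 * h + (h - 7)" if "f \<in> J" for f
      using JP[OF that] nu h by auto
  qed (use h in simp, use h in simp, rule that)
  have Jnbr: "x e < u \<and> x e \<le> max (\<xi> f + 2) h" if "f \<in> J" "e \<in> M1" "adjacent e f" for e f
  proof (cases "b e < LV")
    case True
    then show ?thesis using x2[OF that(2)] nu(9,10) by auto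
  next
    case False
    have "f \<in> M3" using JM that(1) by blast
    then have "b e \<le> \<xi> f + 2" using alb[OF that(2) _ that(3)] by blast
    then show ?thesis using x1[OF that(2)] JP[OF that(1)] False by auto
  qed
  have JnbrD: "D g < u \<and> D g \<le> max (\<sigma> f + 1) h" if "f \<in> J" "g \<in> M2" "adjacent g f" for g f
  proof (cases "r g < LU")
    case True
    then show ?thesis using D2[OF that(2)] nu(7,8) by auto
  next
    case False
    have "f \<in> M3" using JM that(1) by blast
    then have "r g \<le> \<sigma> f + 1" using al[OF that(2) _ that(3)] by blast
    then show ?thesis using D1[OF that(2)] JP[OF that(1)] False by auto
  qed
  define d where "d f = Min (insert s (dp ` {g\<in>M2. adjacent g f}))" for f
  define y where "y f = Min (insert s (p1 ` {e\<in>M1. adjacent e f}))" for f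
  have dlt: "d f < t \<longleftrightarrow> (\<exists>g\<in>M2. dp g < t \<and> adjacent g f)" if "t \<le> s" for t f
  proof (cases t)
    case (Suc A)
    then show ?thesis using min_le_iff[OF fin(2), of A s dp "\<lambda>g. adjacent g f"] that by (auto simp: d_def less_Suc_eq_le)
  qed simp
  have ylt: "y f < t \<longleftrightarrow> (\<exists>e\<in>M1. p1 e < t \<and> adjacent e f)" if "t \<le> s" for t f
  proof (cases t)
    case (Suc A)
    then show ?thesis using min_le_iff[OF fin(1), of A s p1 "\<lambda>e. adjacent e f"] that by (auto simp: y_def less_Suc_eq_le)
  qed simp
  have dD: "{f\<in>M3. d f < t} = {f\<in>M3. \<exists>g\<in>M2. D g < t \<and> adjacent g f}" if "t \<le> u" for t
  proof -
    have "t \<le> s" using that nu by simp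
    then show ?thesis using dlt dplt[OF _ that] by blast
  qed
  have yx: "{f\<in>M3. y f < t} = {f\<in>M3. \<exists>e\<in>M1. x e < t \<and> adjacent e f}" if "t \<le> u" for t
  proof -
    have "t \<le> s" using that nu by simp
    then show ?thesis using ylt p1lt[OF _ that] by blast
  qed
  \<comment> \<open>Each edge of \<open>M1\<close> or \<open>M2\<close> has exactly two neighbours
    in \<open>M3\<close>, and each edge of \<open>M3\<close> has at most two in return, so
    \<open>t\<close> edges have at least \<open>t\<close> neighbours.\<close>
  have hall: "t \<le> card {f\<in>M3. \<exists>e\<in>M. p e < t \<and> adjacent e f}"
    if M: "M = M1 \<or> M = M2" and p: "bij_betw p M {..<q}" and t: "t \<le> q" for M p t
  proof -
    define Y where "Y = {f\<in>M3. \<exists>e\<in>M. p e < t \<and> adjacent e f}"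
    define S where "S = {e\<in>M. p e < t}"
    have fY: "finite Y" and fS: "finite S" using fin M by (auto simp: Y_def S_def)
    have cS: "card S = t" unfolding S_def by (rule card_below_slot[OF p t])
    have "2 * card S = (\<Sum>e\<in>S. card {f\<in>Y. adjacent e f})"
    proof -
      have "card {f\<in>Y. adjacent e f} = 2" if "e \<in> S" for e
      proof -
        have "{f\<in>Y. adjacent e f} = {f\<in>M3. adjacent e f}" using that by (auto simp: Y_def S_def)
        then show ?thesis using two[of e] that M by (auto simp: S_def)
      qed
      then show ?thesis by simp
    qed
    also have "\<dots> = (\<Sum>e\<in>S. \<Sum>f\<in>Y. if adjacent e f then 1 else 0)" using fY by (simp add: card_sum_indicator)
    also have "\<dots> = (\<Sum>f\<in>Y. \<Sum>e\<in>S. if adjacent e f then 1 else 0)" by (rule sum.swap)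
    also have "\<dots> = (\<Sum>f\<in>Y. card {e\<in>S. adjacent e f})" using fS by (simp add: card_sum_indicator)
    also have "\<dots> \<le> (\<Sum>f\<in>Y. 2)"
    proof (rule sum_mono)
      fix f assume f: "f \<in> Y"
      have "card {e\<in>S. adjacent e f} \<le> card {e\<in>M. adjacent e f}" using fin M by (intro card_mono) (auto simp: S_def)
      also have "\<dots> \<le> 2" using degR[of f M] f M part by (auto simp: Y_def)
      finally show "card {e\<in>S. adjacent e f} \<le> 2" .
    qed
    finally show ?thesis using cS by (simp add: Y_def)
  qed
  have grow: "card {f\<in>M3. \<exists>e\<in>M. p e < t \<and> adjacent e f} \<le> u + 7 + 2 * (t - u)"
    if M: "M = M1 \<or> M = M2" and p: "inj_on p M" and u7: "card {f\<in>M3. \<exists>e\<in>M. p e < u \<and> adjacent e f} \<le> u + 7"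
    for M p t
  proof -
    have "card {f\<in>M3. \<exists>e\<in>M. adjacent e f \<and> u \<le> p e \<and> p e < t} \<le> 2 * (t - u)"
      by (rule card_incident_range[where M = M and D = p and F = M3 and A = adjacent]) (use M fin p deg part in auto)
    moreover have "{f\<in>M3. \<exists>e\<in>M. p e < t \<and> adjacent e f} \<subseteq>
      {f\<in>M3. \<exists>e\<in>M. p e < u \<and> adjacent e f} \<union> {f\<in>M3. \<exists>e\<in>M. adjacent e f \<and> u \<le> p e \<and> p e < t}" by force
    then have "card {f\<in>M3. \<exists>e\<in>M. p e < t \<and> adjacent e f} \<le>
      card ({f\<in>M3. \<exists>e\<in>M. p e < u \<and> adjacent e f} \<union> {f\<in>M3. \<exists>e\<in>M. adjacent e f \<and> u \<le> p e \<and> p e < t})"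
      using fin by (intro card_mono) auto
    ultimately show ?thesis using u7 card_Un_le[of "{f\<in>M3. \<exists>e\<in>M. p e < u \<and> adjacent e f}"
        "{f\<in>M3. \<exists>e\<in>M. adjacent e f \<and> u \<le> p e \<and> p e < t}"] by linarith
  qed
  have pair: "s \<le> dp g + p1 e + 1" if f: "f \<in> M3 - J" and g: "g \<in> M2" "adjacent g f" and e: "e \<in> M1" "adjacent e f" for f g e
  proof -
    have fM: "f \<in> M3" using f by simp
    have ag: "r g \<le> \<sigma> f + 1" "\<sigma> f \<le> r g + 1" using al[OF g(1) fM g(2)] by auto
    have ae: "b e \<le> \<xi> f + 2" "\<xi> f \<le> b e + 2" using alb[OF e(1) fM e(2)] by auto
    have xlow: "u \<le> \<xi> f + 4 \<Longrightarrow> \<xi> f \<le> p1 e + 2 \<or> u \<le> p1 e"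
      using x1[OF e(1)] p1ge[OF e(1)] ae nu by linarith
    \<comment> \<open>Border elements rely on the delays. With both places small, \<open>f\<close>
      violates \<open>P1\<close> because it is not in \<open>J\<close>; with one small place the
      levels apply; with both large, both neighbours come at \<open>u\<close> or later and
      \<open>2 * u \<ge> s\<close>.\<close>
    consider "f \<in> KV" | "f \<in> KU" "f \<notin> KV" | "\<sigma> f + 2 \<le> u" "\<xi> f + 5 \<le> u" | "\<sigma> f + 2 \<le> u" "u + 2 \<le> \<xi> f"
      | "u + 1 \<le> \<sigma> f" "\<xi> f + 5 \<le> u" | "u + 1 \<le> \<sigma> f" "u + 2 \<le> \<xi> f"
      using fM unfolding KV_def KU_def mem_Collect_eq by linarith
    then show ?thesis
    proof cases
      case 1
      then have "u \<le> \<xi> f + 4" by (auto simp: KV_def)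
      then show ?thesis using D4[OF g(1) 1 g(2)] dpge[OF g(1)] xlow nu by linarith
    next
      case 2
      then have "u \<le> \<sigma> f + 1" by (auto simp: KU_def)
      then have "u \<le> dp g + 2" using D1[OF g(1)] dpge[OF g(1)] ag nu by linarith
      then show ?thesis using x4[OF e(1) 2(1) e(2)] p1ge[OF e(1)] nu by linarith
    next
      case 3
      then have "\<not> P1 (\<sigma> f) (\<xi> f)" using f J(1) by auto
      then have big: "s + 13 \<le> \<sigma> f + \<xi> f" using 3 nu h by (auto simp: P1_def)
      then have "LU \<le> r g" using 3 ag nu by linarith
      then have "\<sigma> f \<le> dp g + 1" using D1[OF g(1)] dpge[OF g(1)] ag 3 by linarith
      moreover have "\<xi> f \<le> p1 e + 6" using x3[OF e(1)] p1ge[OF e(1)] ae 3 by linarith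
      ultimately show ?thesis using big by linarith
    next
      case 4
      have "u \<le> b e" using 4 ae by linarith
      then have xe: "u \<le> x e" using x1[OF e(1)] nu by linarith
      then have "c6 - d0 f \<le> \<rho> e" using \<rho>lv[OF p1E(2)[OF e(1) xe]] lvge[OF fM e(2) 4(2)] by linarith
      moreover have "d0 f \<le> dp g" using d0b[OF g] dpge[OF g(1)] by linarith
      ultimately show ?thesis using p1E(1)[OF e(1) xe] nu by linarith
    next
      case 5
      have "u \<le> r g" using 5 ag by linarith
      then have Dg: "u \<le> D g" using D1[OF g(1)] nu by linarith
      have "c6 - x0 f \<le> lw g" by (rule lwge[OF fM g(2) 5(1)])
      moreover have "\<rho>' g + lw g < N" by (rule \<rho>lw[OF dpH(2)[OF g(1) Dg]])
      moreover have "x0 f \<le> p1 e" using x0b[OF e] p1ge[OF e(1)] by linarith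
      ultimately show ?thesis using dpH(1)[OF g(1) Dg] nu by linarith
    next
      case 6
      have "u \<le> b e" "u \<le> r g" using 6 ae ag by linarith+
      then have "u \<le> x e" "u \<le> D g" using x1[OF e(1)] D1[OF g(1)] nu by linarith+
      then show ?thesis using p1E(1)[OF e(1)] dpH(1)[OF g(1)] nu num h by linarith
    qed
  qed
  have cF: "card (M3 - J) = s + 7" using c J(3) JM fJ q h by (simp add: card_Diff_subset)
  obtain pF where pF: "bij_betw pF (M3 - J) {..<s + 7}" and pF1: "\<And>f. f \<in> M3 - J \<Longrightarrow> s \<le> pF f + 1 + d f"
    and pF2: "\<And>f. f \<in> M3 - J \<Longrightarrow> pF f \<le> 7 + y f"
  proof (rule long_block_scheduling[OF fin(3) JM J(3) cF, of u d y])
    show "0 < s" "s \<le> u + (h - 7)" "u \<le> s" using nu num h by linarith+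
    show "card {f\<in>M3. d f < t} \<le> t + 7" if "t \<le> u" for t using D5[of t] dD[OF that] that nu by simp
    show "card {f\<in>M3. y f < t} \<le> t + 7" if "t \<le> u" for t using x5[of t] yx[OF that] that nu by simp
    show "t \<le> card {f\<in>M3. d f < t}" if "t \<le> u" for t
      unfolding dD[OF that] using that nu by (intro hall[OF _ D]) auto
    show "t \<le> card {f\<in>M3. y f < t}" if "t \<le> u" for t
      unfolding yx[OF that] using that nu by (intro hall[OF _ x]) auto
    show "card {f\<in>M3. d f < t} \<le> u + 7 + 2 * (t - u)" if "u \<le> t" "t \<le> s" for t
    proof -
      have "card {f\<in>M3. \<exists>g\<in>M2. dp g < t \<and> adjacent g f} \<le> u + 7 + 2 * (t - u)"
      proof (rule grow)
        have "{f\<in>M3. \<exists>g\<in>M2. dp g < u \<and> adjacent g f} = {f\<in>M3. \<exists>g\<in>M2. D g < u \<and> adjacent g f}" using dplt by blast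
        then show "card {f\<in>M3. \<exists>g\<in>M2. dp g < u \<and> adjacent g f} \<le> u + 7" using D5[of u] nu by simp
      qed (use bdp in \<open>auto simp: bij_betw_def\<close>)
      then show ?thesis using dlt[OF that(2)] by simp
    qed
    show "card {f\<in>M3. y f < t} \<le> u + 7 + 2 * (t - u)" if "u \<le> t" "t \<le> s" for t
    proof -
      have "card {f\<in>M3. \<exists>e\<in>M1. p1 e < t \<and> adjacent e f} \<le> u + 7 + 2 * (t - u)"
      proof (rule grow)
        have "{f\<in>M3. \<exists>e\<in>M1. p1 e < u \<and> adjacent e f} = {f\<in>M3. \<exists>e\<in>M1. x e < u \<and> adjacent e f}" using p1lt by blast
        then show "card {f\<in>M3. \<exists>e\<in>M1. p1 e < u \<and> adjacent e f} \<le> u + 7" using x5[of u] nu by simp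
      qed (use bp1 in \<open>auto simp: bij_betw_def\<close>)
      then show ?thesis using ylt[OF that(2)] by simp
    qed
    show "d f < u \<and> y f < u" if f: "f \<in> J" for f
    proof -
      have fM: "f \<in> M3" using f JM by blast
      \<comment> \<open>\<open>hall\<close> at \<open>t = q\<close> shows that every element of
        \<open>M3\<close> has a neighbour in \<open>M2\<close>, and likewise in
        \<open>M1\<close>.\<close>
      obtain g where g: "g \<in> M2" "adjacent g f"
      proof (rule ccontr)
        assume no: "\<not> thesis"
        have "q \<le> card {f\<in>M3. \<exists>g\<in>M2. r g < q \<and> adjacent g f}" by (rule hall[OF _ r]) auto
        moreover have "{f\<in>M3. \<exists>g\<in>M2. r g < q \<and> adjacent g f} \<subseteq> M3 - {f}" using no that by blast
        then have "card {f\<in>M3. \<exists>g\<in>M2. r g < q \<and> adjacent g f} \<le> card (M3 - {f})" using fin by (intro card_mono) auto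
        moreover have "card (M3 - {f}) < q" using fM fin c card_gt_0_iff[of M3] by (auto simp: card_Diff_singleton)
        ultimately show False by simp
      qed
      obtain e where e: "e \<in> M1" "adjacent e f"
      proof (rule ccontr)
        assume no: "\<not> thesis"
        have "q \<le> card {f\<in>M3. \<exists>e\<in>M1. x e < q \<and> adjacent e f}" by (rule hall[OF _ x]) auto
        moreover have "{f\<in>M3. \<exists>e\<in>M1. x e < q \<and> adjacent e f} \<subseteq> M3 - {f}" using no that by blast
        then have "card {f\<in>M3. \<exists>e\<in>M1. x e < q \<and> adjacent e f} \<le> card (M3 - {f})" using fin by (intro card_mono) auto
        moreover have "card (M3 - {f}) < q" using fM fin c card_gt_0_iff[of M3] by (auto simp: card_Diff_singleton)
        ultimately show False by simp
      qed
      have "dp g < u" "p1 e < u" using JnbrD[OF f g] Jnbr[OF f e] dplt[OF g(1)] p1lt[OF e(1)] by auto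
      then show ?thesis using dlt[OF nu(5)] ylt[OF nu(5)] g e by blast
    qed
    show "s \<le> d f + y f + 1" if f: "f \<in> M3 - J" for f
    proof -
      have "d f \<in> insert s (dp ` {g\<in>M2. adjacent g f})" unfolding d_def using fin by (intro Min_in) auto
      moreover have "y f \<in> insert s (p1 ` {e\<in>M1. adjacent e f})" unfolding y_def using fin by (intro Min_in) auto
      ultimately show ?thesis using pair[OF f] by fastforce
    qed
  qed (rule that)
  have dle: "d f \<le> dp g" if "g \<in> M2" "adjacent g f" for g f
    unfolding d_def using fin that by (intro Min_le) auto
  have yle: "y f \<le> p1 e" if "e \<in> M1" "adjacent e f" for e f
    unfolding y_def using fin that by (intro Min_le) auto
  show ?thesis
  proof (rule cms_graph_ge_of_four_blocks[OF finE _ _ _ _ _ _ _ _ _ _ bp1 pJ bp2 _ q])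
    show "edges G = M1 \<union> J \<union> M2 \<union> (M3 - J)" using part JM by auto
    show "bij_betw pF (M3 - J) {..<q - (h - 7)}"
    proof -
      have "q - (h - 7) = s + 7" using q h by simp
      then show ?thesis using pF by simp
    qed
    show "p1 e \<le> p2 g + h + (h - 7)" if eg: "e \<in> M1" "g \<in> M2" "adjacent e g" for e g
    proof (cases "x e < u")
      case True
      then show ?thesis using p1V[OF eg(1)] nu h by linarith
    next
      case False
      then have e: "p1 e = u + \<rho> e" "e \<in> E" using p1E[OF eg(1)] by auto
      show ?thesis
      proof (cases "D g < u")
        case True
        then show ?thesis using dpU[OF eg(2)] p1q[OF eg(1)] nu h unfolding p2_def by linarith
      next
        case False
        then have g: "dp g = u + (N - 1 - \<rho>' g)" "g \<in> H" using dpH[OF eg(2)] by auto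
        have "\<rho>' g < N" using \<rho>' g(2) by (auto simp: bij_betw_def)
        then have "p2 g = \<rho>' g" using g uN by (simp add: p2_def)
        then show ?thesis using e \<rho>al[OF e(2) g(2) eg(3)] nu h by linarith
      qed
    qed
    show "p1 e \<le> pJ f + h" if "e \<in> M1" "f \<in> J" "adjacent e f" for e f
      using Jnbr[OF that(2,1,3)] p1V[OF that(1)] pJ1[OF that(2)] by linarith
    show "s + pJ f \<le> (h - 7) + p2 g" if "g \<in> M2" "f \<in> J" "adjacent g f" for g f
      using JnbrD[OF that(2,1,3)] dpU[OF that(1)] pJ2[OF that(2)] q nu unfolding p2_def by linarith
    show "p2 g \<le> pF f + h" if "g \<in> M2" "f \<in> M3 - J" "adjacent g f" for g f
      using pF1[OF that(2)] dle[OF that(1,3)] dpq[OF that(1)] q unfolding p2_def by linarith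
    show "(h - 7) + pF f \<le> h + p1 e" if "e \<in> M1" "f \<in> M3 - J" "adjacent e f" for e f
      using pF2[OF that(2)] yle[OF that(1,3)] h by linarith
    show "\<not> adjacent e g" if "e \<in> J \<union> (M3 - J)" "g \<in> J \<union> (M3 - J)" for e g using that JM mat(3) by blast
  qed (use disj JM mat h num in auto)
qed

section \<open>Class 1 cubic graphs in both ranges of the distance\<close>

text \<open>The odd case of \<open>many_class_positions\<close> with a single pair:
  \<open>M 0\<close> is \<open>V\<close> and a remainder, \<open>M 1\<close> a remainder and
  \<open>U\<close>, and \<open>M 2\<close> is the free class. There is no ordinary gap, so the
  remainders only need a plain alignment, which loses 1; hence their size
  \<open>s + 1\<close>.\<close>

lemma cms_graph_ge_cubic_small:
  fixes G :: "'a graph" and M :: "nat \<Rightarrow> 'a set set"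
  assumes fin: "finite (edges G)" and part: "edges G = (\<Union>i<3. M i)"
    and disj: "\<And>i j. i < 3 \<Longrightarrow> j < 3 \<Longrightarrow> i \<noteq> j \<Longrightarrow> M i \<inter> M j = {}"
    and size: "\<And>i. i < 3 \<Longrightarrow> card (M i) = q"
    and mat: "\<And>i e g. i < 3 \<Longrightarrow> e \<in> M i \<Longrightarrow> g \<in> M i \<Longrightarrow> \<not> adjacent e g"
    and deg: "\<And>e i. e \<in> edges G \<Longrightarrow> i < 3 \<Longrightarrow> card {g\<in>M i. adjacent e g} \<le> 2"
    and num: "3 * s + 7 \<le> 2 * q" "4 * s + 13 \<le> 3 * q" "1 \<le> s"
  shows "s \<le> cms_graph G"
proof -
  have sub: "M i \<subseteq> edges G" if "i < 3" for i using part that by blast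
  have finM: "finite (M i)" if "i < 3" for i using finite_subset[OF sub[OF that] fin] .
  have deg': "card {g\<in>M j. adjacent e g} \<le> 2" "card {g\<in>M j. adjacent g e} \<le> 2"
    if "e \<in> M i" "i < 3" "j < 3" for e i j
  proof -
    show "card {g\<in>M j. adjacent e g} \<le> 2" using deg[of e j] that sub by blast
    then show "card {g\<in>M j. adjacent g e} \<le> 2" by (subst adjacent_sym)
  qed
  define z where "z = q - (s + 1)"
  define B where "B = z + 1 + 2 * (z + 2 - (q - z) div 2)"
  have zq: "z + s + 1 = q" using num by (simp add: z_def)
  have "\<exists>U V. U \<subseteq> M 1 \<and> V \<subseteq> M 0 \<and> card U = z \<and> card V = z
    \<and> card {f\<in>M 2. \<exists>e\<in>U. adjacent e f} \<le> z + 1 + (card (M 2) - q)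
    \<and> card {f\<in>M 2. \<exists>e\<in>V. adjacent e f} \<le> z + 2 + (card (M 2) - q)
    \<and> 3 * card {f\<in>M 2. (\<exists>e\<in>U. adjacent e f) \<and> (\<exists>e\<in>V. adjacent e f)} \<le> B"
  proof (rule free_class_ends[where L = q and L' = q])
    show "finite (M 1)" "finite (M 0)" "finite (M 2)" using finM by simp_all
    show "card {f\<in>M 2. adjacent e f} \<le> 2" if "e \<in> M 1 \<union> M 0" for e
      using that deg'(1)[of e 1 2] deg'(1)[of e 0 2] by auto
    show "card {e\<in>M 1. adjacent e f} \<le> 2" "card {e\<in>M 0. adjacent e f} \<le> 2" if "f \<in> M 2" for f
      using deg'(2)[OF that, of 1] deg'(2)[OF that, of 0] by simp_all
    show "q = min (card (M 1)) (card (M 2))" "q = min (card (M 0)) (card (M 2))" using size by simp_all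
    show "z \<le> q" "z \<le> q" using zq by simp_all
    show "z + 1 + (card (M 2) - q) + 2 * (z + 2 - (q - z) div 2) + 2 * (card (M 2) - q) \<le> B"
      using size by (simp add: B_def)
  qed
  then obtain U V where UV: "U \<subseteq> M 1" "V \<subseteq> M 0" "card U = z" "card V = z"
    and NU: "card {f\<in>M 2. \<exists>e\<in>U. adjacent e f} \<le> z + 2" and NV: "card {f\<in>M 2. \<exists>e\<in>V. adjacent e f} \<le> z + 2"
    and J: "3 * card {f\<in>M 2. (\<exists>e\<in>U. adjacent e f) \<and> (\<exists>e\<in>V. adjacent e f)} \<le> B"
    using size[of 2] by auto
  have fUV: "finite U" "finite V" using UV finM[of 0] finM[of 1] by (auto intro: finite_subset)
  have cP: "card (M 1 - U) = s + 1" "card (M 0 - V) = s + 1"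
    using UV fUV size[of 0] size[of 1] zq by (simp_all add: card_Diff_subset)
  have "\<exists>r r'. bij_betw r (M 0 - V) {..<s + 1} \<and> bij_betw r' (M 1 - U) {..<s + 1}
    \<and> (\<forall>e\<in>M 0 - V. \<forall>g\<in>M 1 - U. adjacent e g \<longrightarrow> r e \<le> r' g + 1 \<and> r' g \<le> r e + 1)"
  proof (rule aligned_numbering[OF _ _ cP(2,1)])
    show "card {g\<in>M 1 - U. adjacent e g} \<le> 2" if "e \<in> M 0 - V" for e
    proof -
      have "card {g\<in>M 1 - U. adjacent e g} \<le> card {g\<in>M 1. adjacent e g}" using finM[of 1] by (intro card_mono) auto
      then show ?thesis using deg'(1)[of e 0 1] that by simp
    qed
    show "card {e\<in>M 0 - V. adjacent e g} \<le> 2" if "g \<in> M 1 - U" for g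
    proof -
      have "card {e\<in>M 0 - V. adjacent e g} \<le> card {e\<in>M 0. adjacent e g}" using finM[of 0] by (intro card_mono) auto
      then show ?thesis using deg'(2)[of g 1 0] that by simp
    qed
  qed (use finM in auto)
  then obtain \<alpha> \<beta> where \<alpha>: "bij_betw \<alpha> (M 0 - V) {..<s + 1}" and \<beta>: "bij_betw \<beta> (M 1 - U) {..<s + 1}"
    and al: "\<And>e g. e \<in> M 0 - V \<Longrightarrow> g \<in> M 1 - U \<Longrightarrow> adjacent e g \<Longrightarrow> \<alpha> e \<le> \<beta> g + 1" by blast
  define \<iota> where "\<iota> = card {f\<in>M 2. (\<exists>e\<in>U. adjacent e f) \<and> (\<exists>e\<in>V. adjacent e f)}"
  have \<iota>: "2 * \<iota> + 1 + 2 * s \<le> z + z + q" "3 * \<iota> + 2 + 4 * s \<le> z + 2 * z + 2 * q"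
  proof -
    define H where "H = (s + 1) div 2"
    have H: "s \<le> 2 * H" unfolding H_def by linarith
    have qz: "q - z = s + 1" using zq by simp
    have B: "3 * \<iota> \<le> z + 1 + 2 * (z + 2 - H)" using J by (simp only: \<iota>_def B_def H_def qz)
    have "2 * \<iota> + 1 + 2 * s \<le> z + z + q \<and> 3 * \<iota> + 2 + 4 * s \<le> z + 2 * z + 2 * q"
    proof (cases "z + 2 \<le> H")
      case True
      then have "3 * \<iota> \<le> z + 1" using B by simp
      then show ?thesis using zq num by (intro conjI) linarith+
    next
      case False
      then have "3 * \<iota> + s \<le> 3 * z + 5" using B H by linarith
      then show ?thesis using zq num by (intro conjI) linarith+
    qed
    then show "2 * \<iota> + 1 + 2 * s \<le> z + z + q" "3 * \<iota> + 2 + 4 * s \<le> z + 2 * z + 2 * q" by auto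
  qed
  have "\<exists>x y. bij_betw x U {..<z} \<and> bij_betw y V {..<z} \<and> (\<forall>\<alpha> \<beta>.
    bij_betw \<beta> (M 1 - U) {..<s + 1} \<longrightarrow> bij_betw \<alpha> (M 0 - V) {..<s + 1} \<longrightarrow>
    (\<exists>\<zeta>. bij_betw \<zeta> (M 2) {..<q}
      \<and> (\<forall>e\<in>M 1. \<forall>f\<in>M 2. adjacent e f \<longrightarrow> s + (if e \<in> U then (s + 1) + x e else \<beta> e) \<le> (s + 1) + z + \<zeta> f)
      \<and> (\<forall>f\<in>M 2. \<forall>e\<in>M 0. adjacent e f \<longrightarrow> s + \<zeta> f \<le> q + (if e \<in> V then y e else z + \<alpha> e))))"
  proof (rule free_class_orders[where c = 2 and \<iota> = \<iota>])
    show "finite (M 1)" "finite (M 0)" "finite (M 2)" using finM by simp_all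
    show "card (M 2) = q" using size by simp
    show "card {f\<in>M 2. adjacent e f} \<le> 2" if "e \<in> M 1" for e using deg'(1)[OF that, of 2] by simp
    show "card {f\<in>M 2. adjacent e f} \<le> 2" if "e \<in> M 0" for e using deg'(1)[OF that, of 2] by simp
    show "card {e\<in>M 1. adjacent e f} \<le> 2" "card {e\<in>M 0. adjacent e f} \<le> 2" if "f \<in> M 2" for f
      using deg'(2)[OF that, of 1] deg'(2)[OF that, of 0] by simp_all
    show "3 * \<iota> + 2 + 4 * s \<le> z + 2 * z + 2 * q" "3 * \<iota> + 2 + 4 * s \<le> z + 2 * z + 2 * q" by (rule \<iota>(2))+
  qed (use UV NU NV \<iota> zq num in \<open>auto simp: \<iota>_def\<close>)
  then obtain x y \<zeta> where x: "bij_betw x U {..<z}" and y: "bij_betw y V {..<z}" and \<zeta>: "bij_betw \<zeta> (M 2) {..<q}"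
    and c12: "\<And>e f. e \<in> M 1 \<Longrightarrow> f \<in> M 2 \<Longrightarrow> adjacent e f \<Longrightarrow>
      s + (if e \<in> U then (s + 1) + x e else \<beta> e) \<le> (s + 1) + z + \<zeta> f"
    and c20: "\<And>f e. f \<in> M 2 \<Longrightarrow> e \<in> M 0 \<Longrightarrow> adjacent e f \<Longrightarrow> s + \<zeta> f \<le> q + (if e \<in> V then y e else z + \<alpha> e)"
    using \<alpha> \<beta> by blast
  define pos where "pos i = (if i = 0 then (\<lambda>e. if e \<in> V then y e else z + \<alpha> e)
    else if i = 1 then (\<lambda>e. if e \<in> U then (s + 1) + x e else \<beta> e) else \<zeta>)" for i :: nat
  have b0: "bij_betw (pos 0) (M 0) {..<q}"
  proof -
    have "bij_betw (\<lambda>e. if e \<in> M 0 - V then z + \<alpha> e else y e) (V \<union> (M 0 - V)) {..<z + (s + 1)}"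
      by (rule bij_betw_append[OF y \<alpha>]) simp
    moreover have "V \<union> (M 0 - V) = M 0" "z + (s + 1) = q" using UV zq by auto
    ultimately have "bij_betw (\<lambda>e. if e \<in> M 0 - V then z + \<alpha> e else y e) (M 0) {..<q}" by (simp only:)
    then show ?thesis by (rule bij_betw_cong[THEN iffD1, rotated]) (auto simp: pos_def)
  qed
  have b1: "bij_betw (pos 1) (M 1) {..<q}"
  proof -
    have "bij_betw (\<lambda>e. if e \<in> U then (s + 1) + x e else \<beta> e) ((M 1 - U) \<union> U) {..<(s + 1) + z}"
      by (rule bij_betw_append[OF \<beta> x]) auto
    moreover have "(M 1 - U) \<union> U = M 1" "(s + 1) + z = q" using UV zq by auto
    ultimately show ?thesis by (simp only: pos_def if_True if_False one_neq_zero refl)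
  qed
  show ?thesis
  proof (rule cms_graph_ge_of_classes[where K = 3 and M = M and pos = pos, OF fin _ part])
    show "s \<le> card (M i)" if "i < 3" for i using size[OF that] zq by simp
    show "bij_betw (pos i) (M i) {..<card (M i)}" if i: "i < 3" for i
    proof -
      consider "i = 0" | "i = 1" | "i = 2" using i by linarith
      then show ?thesis using b0 b1 \<zeta> size by cases (auto simp: pos_def)
    qed
    show "s + pos i e \<le> card (M i) + pos ((i + 1) mod 3) g"
      if i: "i < 3" and eg: "e \<in> M i" "g \<in> M ((i + 1) mod 3)" "adjacent e g" for i e g
    proof -
      consider "i = 0" | "i = 1" | "i = 2" using i by linarith
      then show ?thesis
      proof cases
        case 1
        then have g: "e \<in> M 0" "g \<in> M 1" using eg by simp_all
        have "s + pos 0 e \<le> q + pos 1 g"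
        proof (cases "e \<in> V")
          case True
          then have "y e < z" using y by (auto simp: bij_betw_def)
          then show ?thesis using True zq by (simp add: pos_def)
        next
          case False
          then have "\<alpha> e < s + 1" using \<alpha> g by (auto simp: bij_betw_def)
          then show ?thesis using False al[of e g] g eg(3) zq by (auto simp: pos_def)
        qed
        then show ?thesis using 1 size by simp
      next
        case 2
        then have g: "e \<in> M 1" "g \<in> M 2" using eg by (simp_all add: numeral_2_eq_2)
        show ?thesis using c12[OF g eg(3)] 2 size zq by (simp add: pos_def numeral_2_eq_2)
      next
        case 3
        then have g: "e \<in> M 2" "g \<in> M 0" using eg by simp_all
        have "adjacent g e" using eg(3) adjacent_sym by metis
        then show ?thesis using c20[OF g] 3 size by (simp add: pos_def)
      qed
    qed
  qed (use disj mat num in auto)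
qed

lemma cubic_colour_at_vertex:
  assumes "regular 3 G" "proper_on (edges G) c" "\<forall>e\<in>edges G. c e < (3 :: nat)" "v \<in> verts G" "i < 3"
  obtains e where "e \<in> edges G" "c e = i" "v \<in> e"
proof -
  define X where "X = {e\<in>edges G. v \<in> e}"
  have X: "card X = 3" using assms(1,4) by (simp add: regular_def X_def)
  have "inj_on c X"
  proof (rule inj_onI)
    fix e g assume "e \<in> X" "g \<in> X" "c e = c g"
    then show "e = g" using assms(2) by (auto simp: X_def proper_on_def adjacent_def)
  qed
  then have "card (c ` X) = card {..<3::nat}" using X by (simp add: card_image)
  moreover have "c ` X \<subseteq> {..<3}" using assms(3) by (auto simp: X_def)
  ultimately have "c ` X = {..<3}" by (intro card_subset_eq) auto
  then have "i \<in> c ` X" using assms(5) by simp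
  then show thesis using that by (auto simp: X_def)
qed

text \<open>Up to about \<open>2 * q / 3\<close> the free class method suffices. Beyond it
  \<open>3 * s + 7 > 2 * q\<close>, which for \<open>h = q - s\<close> means
  \<open>2 * h \<le> s + 6\<close>, the range of the four-block construction.\<close>

lemma cms_graph_ge_cubic:
  fixes c :: "'a set \<Rightarrow> nat"
  assumes G: "simple_graph G" "regular 3 G" and c: "\<forall>e\<in>edges G. c e < 3" "proper_on (edges G) c"
    and size: "\<And>i. i < 3 \<Longrightarrow> card {e\<in>edges G. c e = i} = q"
    and num: "1 \<le> s" "10 * s + 51 \<le> 7 * q"
  shows "s \<le> cms_graph G"
proof -
  define M where "M i = {e\<in>edges G. c e = i}" for i
  have fE: "finite (edges G)" by (rule finite_edges[OF G(1)])
  have mat: "\<not> adjacent e g" if "e \<in> M i" "g \<in> M i" for i e g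
  proof -
    have "e \<in> edges G" "g \<in> edges G" "c e = c g" using that by (auto simp: M_def)
    then show ?thesis using c(2) unfolding proper_on_def by blast
  qed
  have two_verts: "card e = 2" "e \<subseteq> verts G" if "e \<in> edges G" for e
    using G(1) that by (auto simp: simple_graph_def)
  have deg: "card {g\<in>M i. adjacent e g} \<le> 2" if "e \<in> edges G" for e i
    by (intro card_adjacent_in_matching mat two_verts[OF that])
  have part: "edges G = (\<Union>i<3. M i)" using c(1) by (auto simp: M_def)
  show ?thesis
  proof (cases "3 * s + 7 \<le> 2 * q")
    case True
    show ?thesis
    proof (rule cms_graph_ge_cubic_small[where M = M, OF fE part _ _ _ _ True])
      show "4 * s + 13 \<le> 3 * q" using True num by linarith
    qed (use size mat deg num in \<open>auto simp: M_def\<close>)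
  next
    case False
    have at: "\<exists>e\<in>M i. v \<in> e" if "v \<in> verts G" "i < 3" for v i
      by (rule cubic_colour_at_vertex[OF G(2) c(2,1) that]) (auto simp: M_def)
    have triangle: "\<exists>g\<in>M i. adjacent e g \<and> adjacent g e \<and> adjacent g f" 
      if H: "e \<in> edges G" "f \<in> edges G" "adjacent e f" "i < 3" "c e \<noteq> i" "c f \<noteq> i" for e f i
    proof -
      obtain v where v: "v \<in> e" "v \<in> f" using H by (auto simp: adjacent_def)
      then obtain g where "g \<in> M i" "v \<in> g" using at[of v i] two_verts(2)[OF H(1)] H(4) by blast
      then show ?thesis using v H by (intro bexI[of _ g]) (auto simp: adjacent_def M_def)
    qed
    have two: "card {f\<in>M 2. adjacent e f} = 2" if e2: "e \<in> edges G" "c e \<noteq> 2" for e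
    proof -
      obtain a b where e: "e = {a, b}" "a \<noteq> b" using two_verts(1)[OF e2(1)] by (auto simp: card_2_iff)
      have ab: "a \<in> verts G" "b \<in> verts G" using two_verts(2)[OF e2(1)] e by auto
      obtain f g where fg: "f \<in> M 2" "a \<in> f" "g \<in> M 2" "b \<in> g" using at[OF ab(1), of 2] at[OF ab(2), of 2] by auto
      have ne: "f \<noteq> e" "g \<noteq> e" using fg e2 by (auto simp: M_def)
      have "f \<noteq> g"
      proof
        assume "f = g"
        then have "e \<subseteq> f" using fg e by auto
        moreover have "card f = 2" "finite f" using two_verts(1)[of f] fg card.infinite by (fastforce simp: M_def)+
        ultimately have "e = f" using two_verts(1)[OF e2(1)] by (intro card_subset_eq) auto
        then show False using ne by simp
      qed
      then have "2 = card {f, g}" by simp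
      also have "\<dots> \<le> card {f\<in>M 2. adjacent e f}"
      proof (rule card_mono)
        show "finite {f\<in>M 2. adjacent e f}" using fE by (simp add: M_def)
        show "{f, g} \<subseteq> {f\<in>M 2. adjacent e f}" using fg ne e by (auto simp: adjacent_def)
      qed
      finally show ?thesis using deg[OF e2(1), of 2] by simp
    qed
    show ?thesis
    proof (rule cms_graph_ge_cubic_large[where ?M1.0 = "M 0" and ?M2.0 = "M 1" and ?M3.0 = "M 2", OF fE])
      show "edges G = M 0 \<union> M 1 \<union> M 2" unfolding part by (auto simp: numeral_3_eq_3 lessThan_Suc numeral_2_eq_2)
      show "\<exists>g\<in>M 1. adjacent g e \<and> adjacent g f" if "e \<in> M 0" "f \<in> M 2" "adjacent e f" for e f
        using triangle[of e f 1] that by (auto simp: M_def)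
      show "\<exists>e\<in>M 0. adjacent e g \<and> adjacent e f" if "g \<in> M 1" "f \<in> M 2" "adjacent g f" for g f
        using triangle[of g f 0] that by (auto simp: M_def)
      show "card {f\<in>M 2. adjacent e f} = 2" if "e \<in> M 0 \<union> M 1" for e using that by (intro two) (auto simp: M_def)
      show "card {g\<in>N. adjacent e g} \<le> 2" if "e \<in> edges G" "N \<in> {M 0, M 1, M 2}" for e N using that deg by blast
      show "s + (q - s) = q" "2 * (q - s) \<le> s + 6" "3 * s + 51 \<le> 7 * (q - s)" using False num by linarith+
    qed (use mat size in \<open>auto simp: M_def\<close>)
  qed
qed

section \<open>Regular graphs with a dense part\<close>

definition rel_graph :: "nat \<Rightarrow> (nat \<Rightarrow> nat \<Rightarrow> bool) \<Rightarrow> nat graph" where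
  "rel_graph n r = ({..<n}, {{x, y} | x y. x < n \<and> y < n \<and> r x y})"

lemma simple_rel_graph: "(\<And>x. \<not> r x x) \<Longrightarrow> simple_graph (rel_graph n r)"
proof -
  assume irr: "\<And>x. \<not> r x x"
  have "card {x, y} = 2" if "r x y" for x y
  proof -
    have "x \<noteq> y" using irr that by auto
    then show ?thesis by simp
  qed
  then show ?thesis unfolding simple_graph_def rel_graph_def by auto
qed

lemma edges_rel_graph_inside:
  assumes "A \<le> n"
  shows "{e\<in>edges (rel_graph n r). e \<subseteq> {..<A}} = edges (rel_graph A r)"
  using assms unfolding rel_graph_def by fastforce

lemma degree_rel_graph:
  assumes irr: "\<And>x. \<not> r x x" and sym: "\<And>x y. r x y \<Longrightarrow> r y x" and v: "v < n"
  shows "card {e\<in>edges (rel_graph n r). v \<in> e} = card {y. y < n \<and> r v y}"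
proof -
  have "{e\<in>edges (rel_graph n r). v \<in> e} = (\<lambda>y. {v, y}) ` {y. y < n \<and> r v y}"
    using sym v unfolding rel_graph_def by (auto simp: insert_commute)
  moreover have "inj_on (\<lambda>y. {v, y}) {y. y < n \<and> r v y}"
    by (auto simp: inj_on_def doubleton_eq_iff)
  ultimately show ?thesis by (simp add: card_image)
qed

text \<open>The sum of the two truncated differences is the absolute difference. For
  \<open>N = 2 * h + 1\<close> this is the complete graph.\<close>

definition circulant :: "nat \<Rightarrow> nat \<Rightarrow> nat \<Rightarrow> nat \<Rightarrow> bool" where
  "circulant N h x y \<longleftrightarrow> x \<noteq> y \<and> ((x - y) + (y - x) \<le> h \<or> N \<le> (x - y) + (y - x) + h)"

text \<open>The additional pairs form a matching, which for odd \<open>N\<close> misses exactly the vertex \<open>N - 1\<close>.\<close>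

definition near_circulant :: "nat \<Rightarrow> nat \<Rightarrow> nat \<Rightarrow> nat \<Rightarrow> bool" where
  "near_circulant N h x y \<longleftrightarrow> circulant N h x y \<or>
     (x < 2 * (N div 2) \<and> y < 2 * (N div 2) \<and> x \<noteq> y \<and> (x - y) + (y - x) = N div 2)"

lemma degree_circulant:
  assumes "x < N" "2 * h < N"
  shows "card {y. y < N \<and> circulant N h x y} = 2 * h"
proof -
  have "bij_betw (\<lambda>y. if x \<le> y then y - x else y + N - x) {y. y < N \<and> circulant N h x y} ({1..h} \<union> {N - h..<N})"
    by (rule bij_betw_byWitness[where f' = "\<lambda>d. if x + d < N then x + d else x + d - N"])
      (use assms in \<open>auto simp: circulant_def\<close>)
  then have "card {y. y < N \<and> circulant N h x y} = card ({1..h} \<union> {N - h..<N})" by (rule bij_betw_same_card)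
  also have "\<dots> = card {1..h} + card {N - h..<N}" using assms by (intro card_Un_disjoint) auto
  finally show ?thesis using assms by simp
qed

lemma degree_near_circulant:
  assumes "x < N" "2 * h + 2 < N" "odd N"
  shows "card {y. y < N \<and> near_circulant N h x y} = (if x = N - 1 then 2 * h else 2 * h + 1)"
proof -
  define c where "c = N div 2"
  have N: "N = 2 * c + 1" using assms(3) by (simp add: c_def)
  define C where "C = {y. y < N \<and> circulant N h x y}"
  define D where "D = {y. y < N \<and> x < 2 * c \<and> y < 2 * c \<and> x \<noteq> y \<and> (x - y) + (y - x) = c}"
  have D: "D = (if x = N - 1 then {} else {if x < c then x + c else x - c})"
  proof (rule set_eqI)
    fix y show "y \<in> D \<longleftrightarrow> y \<in> (if x = N - 1 then {} else {if x < c then x + c else x - c})"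
      using assms N unfolding D_def mem_Collect_eq by (cases "x \<le> y") auto
  qed
  have "{y. y < N \<and> near_circulant N h x y} = C \<union> D" by (auto simp: C_def D_def near_circulant_def c_def)
  moreover have "C \<inter> D = {}" using assms N by (auto simp: C_def D_def circulant_def)
  moreover have "finite C" "finite D" by (auto simp: C_def D_def)
  ultimately have "card {y. y < N \<and> near_circulant N h x y} = card C + card D" by (simp add: card_Un_disjoint)
  then show ?thesis using degree_circulant[of x N h] assms D by (auto simp: C_def)
qed

text \<open>The optional bridge joins the last vertices of the two parts; for odd degree these are
  the ones lacking a neighbour.\<close>

definition glue :: "nat \<Rightarrow> nat \<Rightarrow> bool \<Rightarrow> (nat \<Rightarrow> nat \<Rightarrow> bool) \<Rightarrow> (nat \<Rightarrow> nat \<Rightarrow> bool) \<Rightarrow> nat \<Rightarrow> nat \<Rightarrow> bool" where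
  "glue A B br ra rb x y \<longleftrightarrow> (x < A \<and> y < A \<and> ra x y) \<or> (A \<le> x \<and> A \<le> y \<and> rb (x - A) (y - A)) \<or>
     (br \<and> ((x = A - 1 \<and> y = A + B - 1) \<or> (x = A + B - 1 \<and> y = A - 1)))"

lemma degree_glue:
  assumes A: "0 < A" "0 < B"
  shows "x < A \<Longrightarrow> card {y. y < A + B \<and> glue A B br ra rb x y} = card {y. y < A \<and> ra x y} + (if br \<and> x = A - 1 then 1 else 0)"
    and "x < B \<Longrightarrow> card {y. y < A + B \<and> glue A B br ra rb (A + x) y} = card {y. y < B \<and> rb x y} + (if br \<and> x = B - 1 then 1 else 0)"
proof -
  assume x: "x < A"
  have "{y. y < A + B \<and> glue A B br ra rb x y} = {y. y < A \<and> ra x y} \<union> (if br \<and> x = A - 1 then {A + B - 1} else {})"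
    using x A by (auto simp: glue_def)
  moreover have "A + B - 1 \<notin> {y. y < A \<and> ra x y}" using A by auto
  ultimately show "card {y. y < A + B \<and> glue A B br ra rb x y} = card {y. y < A \<and> ra x y} + (if br \<and> x = A - 1 then 1 else 0)"
    by (cases br; cases "x = A - 1") simp_all
next
  assume x: "x < B"
  have "{y. y < A + B \<and> glue A B br ra rb (A + x) y} = (+) A ` {y. y < B \<and> rb x y} \<union> (if br \<and> x = B - 1 then {A - 1} else {})"
  proof
    show "{y. y < A + B \<and> glue A B br ra rb (A + x) y} \<subseteq> (+) A ` {y. y < B \<and> rb x y} \<union> (if br \<and> x = B - 1 then {A - 1} else {})"
    proof
      fix y assume "y \<in> {y. y < A + B \<and> glue A B br ra rb (A + x) y}"
      then have y: "y < A + B" "(A \<le> y \<and> rb x (y - A)) \<or> (br \<and> x = B - 1 \<and> y = A - 1)"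
        using x A by (auto simp: glue_def)
      then show "y \<in> (+) A ` {y. y < B \<and> rb x y} \<union> (if br \<and> x = B - 1 then {A - 1} else {})"
      proof (elim disjE)
        assume "A \<le> y \<and> rb x (y - A)"
        then have "y = A + (y - A)" "y - A \<in> {y. y < B \<and> rb x y}" using y(1) by auto
        then show ?thesis by blast
      qed auto
    qed
  qed (use x A in \<open>auto simp: glue_def\<close>)
  moreover have "A - 1 \<notin> (+) A ` {y. y < B \<and> rb x y}" using A by auto
  moreover have "card ((+) A ` {y. y < B \<and> rb x y}) = card {y. y < B \<and> rb x y}" by (rule card_image) simp
  ultimately show "card {y. y < A + B \<and> glue A B br ra rb (A + x) y} = card {y. y < B \<and> rb x y} + (if br \<and> x = B - 1 then 1 else 0)"
    by (cases br; cases "x = B - 1") simp_all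
qed

lemma circulant_sym: "circulant N h x y \<Longrightarrow> circulant N h y x"
  by (auto simp: circulant_def add.commute)

lemma near_circulant_sym: "near_circulant N h x y \<Longrightarrow> near_circulant N h y x"
  using circulant_sym by (auto simp: near_circulant_def add.commute)

lemma circulant_irrefl: "\<not> circulant N h x x" "\<not> near_circulant N h x x"
  by (auto simp: circulant_def near_circulant_def)

text \<open>The first part has \<open>k + 1\<close> vertices, where the circulant is complete, so
  \<open>cms_graph_dense_part_even\<close> applies with \<open>M = h\<close>.\<close>

lemma regular_graph_with_dense_part_even:
  assumes k: "k = 2 * h" "0 < h" and n: "2 * (k + 1) \<le> n"
  shows "\<exists>G\<in>regular_graphs n k. cms_graph G * (k + 1) \<le> card (edges G)"
proof -
  define A where "A = k + 1"
  define B where "B = n - A"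
  have AB: "0 < A" "0 < B" "2 * h < A" "2 * h < B" "A + B = n" using assms by (auto simp: A_def B_def)
  define r where "r = glue A B False (circulant A h) (circulant B h)"
  have irr: "\<not> r x x" for x using circulant_irrefl by (auto simp: r_def glue_def)
  have sym: "r x y \<Longrightarrow> r y x" for x y using circulant_sym by (auto simp: r_def glue_def)
  define G where "G = rel_graph n r"
  have G: "simple_graph G" unfolding G_def by (rule simple_rel_graph[OF irr])
  have vG: "verts G = {..<n}" by (simp add: G_def rel_graph_def)
  have deg: "card {y. y < n \<and> r x y} = k" if "x < n" for x
  proof (cases "x < A")
    case True
    then show ?thesis using degree_glue(1)[OF AB(1,2) True] degree_circulant[OF True AB(3)] AB(5) k
      by (simp add: r_def)
  next
    case False
    then have x: "x - A < B" "x = A + (x - A)" using that AB by auto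
    then show ?thesis using degree_glue(2)[OF AB(1,2) x(1)] degree_circulant[OF x(1) AB(4)] AB(5) k
      by (simp add: r_def)
  qed
  have reg: "regular k G"
    using degree_rel_graph[of r, OF irr sym] deg vG by (simp add: regular_def G_def)
  have rA: "card {y. y < A \<and> r x y} = 2 * h" if "x < A" for x
  proof -
    have "{y. y < A \<and> r x y} = {y. y < A \<and> circulant A h x y}" using that by (auto simp: r_def glue_def)
    then show ?thesis using degree_circulant[OF that AB(3)] by simp
  qed
  have "2 * card (edges (rel_graph A r)) = (\<Sum>v<A. card {e\<in>edges (rel_graph A r). v \<in> e})"
    using degree_sum[OF simple_rel_graph[of r A, OF irr] subset_refl] by (simp add: rel_graph_def)
  also have "\<dots> = A * (2 * h)" using degree_rel_graph[of r, OF irr sym] rA by simp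
  finally have "card {e\<in>edges G. e \<subseteq> {..<A}} = h * (2 * h + 1)"
    using edges_rel_graph_inside[of A n r] AB k by (simp add: G_def A_def)
  then have "cms_graph G * (2 * h + 1) \<le> card (edges G)"
    using AB k by (intro cms_graph_dense_part_even[OF G, of "{..<A}"]) (auto simp: vG A_def)
  then show ?thesis using G reg vG k by (intro bexI[of _ G]) (auto simp: regular_graphs_def)
qed

text \<open>A part with an odd number of vertices cannot be regular of odd degree; one vertex of
  each part has degree \<open>k - 1\<close> and the bridge completes both. With
  \<open>M = h + 1\<close> the part on \<open>k + 2\<close> vertices has \<open>2 * M^2 - 1\<close>
  edges, of which \<open>2 * M - 2\<close> are at the vertex of the bridge.\<close>

lemma regular_graph_with_dense_part_odd:
  assumes k: "k = 2 * h + 1" "0 < h" and n: "2 * (k + 2) \<le> n" "even n"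
  shows "\<exists>G\<in>regular_graphs n k. cms_graph G * (k + 1) \<le> card (edges G)"
proof -
  define A where "A = k + 2"
  define B where "B = n - A"
  have AB: "0 < A" "0 < B" "2 * h + 2 < A" "2 * h + 2 < B" "A + B = n" using assms by (auto simp: A_def B_def)
  have odd: "odd A" "odd B" using AB n k by (auto simp: A_def B_def)
  define r where "r = glue A B True (near_circulant A h) (near_circulant B h)"
  have irr: "\<not> r x x" for x using circulant_irrefl AB by (auto simp: r_def glue_def)
  have sym: "r x y \<Longrightarrow> r y x" for x y using near_circulant_sym by (auto simp: r_def glue_def)
  define G where "G = rel_graph n r"
  have G: "simple_graph G" unfolding G_def by (rule simple_rel_graph[OF irr])
  have vG: "verts G = {..<n}" by (simp add: G_def rel_graph_def)
  have deg: "card {y. y < n \<and> r x y} = k" if "x < n" for x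
  proof (cases "x < A")
    case True
    then show ?thesis using degree_glue(1)[OF AB(1,2) True, of True] degree_near_circulant[OF True AB(3) odd(1)] AB(5) k
      by (simp add: r_def)
  next
    case False
    then have x: "x - A < B" "x = A + (x - A)" using that AB by auto
    then show ?thesis using degree_glue(2)[OF AB(1,2) x(1), of True] degree_near_circulant[OF x(1) AB(4) odd(2)] AB(5) k
      by (simp add: r_def)
  qed
  have reg: "regular k G"
    using degree_rel_graph[of r, OF irr sym] deg vG by (simp add: regular_def G_def)
  have rA: "card {y. y < A \<and> r x y} = (if x = A - 1 then 2 * h else 2 * h + 1)" if "x < A" for x
  proof -
    have "{y. y < A \<and> r x y} = {y. y < A \<and> near_circulant A h x y}" using that AB by (auto simp: r_def glue_def)
    then show ?thesis using degree_near_circulant[OF that AB(3) odd(1)] by simp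
  qed
  have degA: "card {e\<in>edges (rel_graph A r). v \<in> e} = (if v = A - 1 then 2 * h else 2 * h + 1)" if "v < A" for v
    using degree_rel_graph[of r v A, OF irr sym that] rA[OF that] by simp
  have "2 * card (edges (rel_graph A r)) = (\<Sum>v<A. card {e\<in>edges (rel_graph A r). v \<in> e})"
    using degree_sum[OF simple_rel_graph[of r A, OF irr] subset_refl] by (simp add: rel_graph_def)
  also have "\<dots> = (\<Sum>v<A. if v = A - 1 then 2 * h else 2 * h + 1)" using degA by (intro sum.cong) auto
  also have "\<dots> = (\<Sum>v<Suc (A - 1). if v = A - 1 then 2 * h else 2 * h + 1)" using AB by simp
  also have "\<dots> = (A - 1) * (2 * h + 1) + 2 * h" unfolding sum.lessThan_Suc by simp
  finally have "card (edges (rel_graph A r)) = 2 * (h + 1)\<^sup>2 - 1"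
    by (simp add: A_def k power2_eq_square algebra_simps)
  then have S: "card {e\<in>edges G. e \<subseteq> {..<A}} = 2 * (h + 1)\<^sup>2 - 1"
    using edges_rel_graph_inside[of A n r] AB k by (simp add: G_def A_def)
  have "{e\<in>edges G. e \<subseteq> {..<A} \<and> A - 1 \<in> e} = {e\<in>edges (rel_graph A r). A - 1 \<in> e}"
    using edges_rel_graph_inside[of A n r] AB by (auto simp: G_def)
  then have "card {e\<in>edges G. e \<subseteq> {..<A} \<and> A - 1 \<in> e} = 2 * (h + 1) - 2" using degA[of "A - 1"] AB by simp
  then have "cms_graph G * (2 * (h + 1)) \<le> card (edges G)"
    using AB k S by (intro cms_graph_dense_part_odd[OF G, of "{..<A}" "h + 1" "A - 1"]) (auto simp: vG A_def)
  then show ?thesis using G reg vG k by (intro bexI[of _ G]) (auto simp: regular_graphs_def)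
qed

section \<open>Bounds for regular graphs\<close>

lemma regular_graphs_facts:
  assumes "G \<in> regular_graphs n k" "0 < n" "0 < k"
  shows "simple_graph G" "card (verts G) = n" "regular k G" "2 * card (edges G) = n * k" "edges G \<noteq> {}" "finite (edges G)"
    "1 \<le> cms_graph G" "cms_graph G \<le> n * k"
proof -
  show G: "simple_graph G" "card (verts G) = n" "regular k G" using assms by (auto simp: regular_graphs_def)
  show e: "2 * card (edges G) = n * k" using card_edges_regular[OF G(1,3)] G(2) by simp
  show fin: "finite (edges G)" by (rule finite_edges[OF G(1)])
  show ne: "edges G \<noteq> {}" using e assms by auto
  obtain l where "1 \<le> cms_graph G" "cms_graph G \<le> card (edges G)"
    by (rule cms_graph_attained[OF ne fin]) (rule that, assumption+)
  then show "1 \<le> cms_graph G" "cms_graph G \<le> n * k" using e by auto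
qed

lemma finite_cms_values:
  assumes "S \<subseteq> regular_graphs n k" "0 < n" "0 < k"
  shows "finite (cms_graph ` S)"
  using regular_graphs_facts(8)[OF _ assms(2,3)] assms(1)
  by (intro finite_subset[of "cms_graph ` S" "{..n * k}"]) auto

text \<open>Rounding \<open>b\<close> up costs less than 1, so \<open>3 * s + 14\<close> is less
  than \<open>3 * (b + 6) - 1\<close>, and under either alternative this is at most
  \<open>2 * q + 1\<close>. The alternatives belong to four classes and to at least five.\<close>

lemma real_bound_le_of_nat:
  fixes C q :: nat and b \<mu> :: real
  assumes C: "\<And>s. 1 \<le> s \<Longrightarrow> 3 * s + 14 \<le> 2 * q \<Longrightarrow> s \<le> C" "1 \<le> C"
    and b: "(b + 6 \<le> 2 / 3 * \<mu> \<and> \<mu> \<le> real q + 3 / 4) \<or> (b + 6 \<le> 17 / 26 * \<mu> \<and> \<mu> < real q + 1)"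
  shows "b \<le> real C"
proof (cases "b \<le> 1")
  case True
  then show ?thesis using C(2) by linarith
next
  case False
  define s where "s = nat \<lceil>b\<rceil>"
  have s: "b \<le> real s" "real s < b + 1" "1 \<le> s" using False unfolding s_def by linarith+
  have "3 * real s + 14 < 2 * real q + 1"
    using b
  proof (elim disjE conjE)
    assume "b + 6 \<le> 2 / 3 * \<mu>" "\<mu> \<le> real q + 3 / 4"
    then show ?thesis using s by linarith
  next
    assume "b + 6 \<le> 17 / 26 * \<mu>" "\<mu> < real q + 1"
    then show ?thesis using s by linarith
  qed
  then have "3 * s + 14 \<le> 2 * q" by linarith
  then show ?thesis using C(1)[OF s(3)] s(1) by linarith
qed

lemma ratio_le_17_26: "5 \<le> K \<Longrightarrow> (5 * K - 8) / (2 * (4 * K - 7)) \<le> 17 / (26 :: real)"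
  by (simp add: divide_simps)

text \<open>\<open>\<mu>\<close> is the average class size and \<open>q\<close> the smallest, so
  \<open>\<mu> \<le> q + 1 - 1 / K\<close>. The required factor is 2/3 for \<open>K = 4\<close> and
  at most 17/26 afterwards, which selects the alternative in
  \<open>real_bound_le_of_nat\<close>.\<close>

lemma lower_bound_le:
  fixes K q C m :: nat
  assumes K: "4 \<le> K" and C: "\<And>s. 1 \<le> s \<Longrightarrow> 3 * s + 14 \<le> 2 * q \<Longrightarrow> s \<le> C" "1 \<le> C"
    and m: "m < K * (q + 1)"
  shows "max ((5 * real K - 8) / (2 * (4 * real K - 7)) * (real m / real K) - 6)
    (31 / 49 * (real m / real K) - 6) \<le> real C"
proof -
  define \<mu> where "\<mu> = real m / real K"
  have \<mu>0: "0 \<le> \<mu>" by (simp add: \<mu>_def)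
  have "real m + 1 \<le> real (K * (q + 1))" using m by linarith
  then have "\<mu> \<le> (real (K * (q + 1)) - 1) / real K" unfolding \<mu>_def using K by (intro divide_right_mono) auto
  also have "\<dots> = real q + 1 - 1 / real K" using K by (simp add: field_simps)
  finally have \<mu>: "\<mu> \<le> real q + 1 - 1 / real K" .
  have one: "\<sigma> * \<mu> - 6 \<le> real C" if "\<sigma> \<le> 2 / 3" "5 \<le> K \<Longrightarrow> \<sigma> \<le> 17 / 26" for \<sigma>
  proof (rule real_bound_le_of_nat[OF C])
    show "(\<sigma> * \<mu> - 6 + 6 \<le> 2 / 3 * \<mu> \<and> \<mu> \<le> real q + 3 / 4) \<or> (\<sigma> * \<mu> - 6 + 6 \<le> 17 / 26 * \<mu> \<and> \<mu> < real q + 1)"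
    proof (cases "K = 4")
      case True
      then show ?thesis using \<mu> mult_right_mono[OF that(1) \<mu>0] by simp
    next
      case False
      then have "5 \<le> K" using K by simp
      moreover have "0 < 1 / real K" using K by simp
      ultimately show ?thesis using \<mu> mult_right_mono[OF that(2) \<mu>0] by linarith
    qed
  qed
  have "(5 * real K - 8) / (2 * (4 * real K - 7)) \<le> 2 / 3"
    using K by (simp add: divide_simps)
  then have "(5 * real K - 8) / (2 * (4 * real K - 7)) * \<mu> - 6 \<le> real C"
    using ratio_le_17_26[of "real K"] by (intro one) auto
  moreover have "31 / 49 * \<mu> - 6 \<le> real C" by (rule one) auto
  ultimately show ?thesis by (simp add: \<mu>_def)
qed

lemma cms_graph_lower_vizing:
  assumes G: "G \<in> regular_graphs n k" and k: "3 \<le> k" and n: "0 < n"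
  shows "max (real k * (5 * real k - 3) / (4 * (real k + 1) * (4 * real k - 3)) * real n - 6)
           (31 * real k / (98 * (real k + 1)) * real n - 6) \<le> real (cms_graph G)"
proof -
  have k0: "0 < k" using k by simp
  note f = regular_graphs_facts[OF G n k0]
  have "\<exists>c. proper_on (edges G) c \<and> c ` edges G \<subseteq> {..k}"
    using f(3) by (intro vizing[OF f(1)]) (simp add: regular_def)
  then obtain c where c: "proper_on (edges G) c" "c ` edges G \<subseteq> {..<k + 1}" by (auto simp: lessThan_Suc_atMost)
  have e2: "\<forall>e\<in>edges G. card e = 2" using f(1) by (simp add: simple_graph_def)
  obtain c' where c': "proper_on (edges G) c'" "c' ` edges G \<subseteq> {..<k + 1}"
    "\<forall>i<k + 1. \<forall>j<k + 1. card {e\<in>edges G. c' e = i} \<le> card {e\<in>edges G. c' e = j} + 1"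
    using equitable_colouring[OF f(6) e2 c] by blast
  define X where "X i = {e\<in>edges G. c' e = i}" for i
  define q where "q = Min ((\<lambda>i. card (X i)) ` {..<k + 1})"
  have qle: "q \<le> card (X i)" if "i < k + 1" for i unfolding q_def using that by (intro Min_le) auto
  have "q \<in> (\<lambda>i. card (X i)) ` {..<k + 1}" unfolding q_def by (intro Min_in) auto
  then obtain i0 where i0: "i0 < k + 1" "card (X i0) = q" by auto
  have qX: "card (X i) = q \<or> card (X i) = q + 1" if "i < k + 1" for i
    using qle[OF that] c'(3) i0 that by (force simp: X_def)
  have "card (edges G) = (\<Sum>i<k + 1. card (X i))"
  proof -
    have "edges G = (\<Union>i<k + 1. X i)" using c'(2) by (auto simp: X_def)
    moreover have "card (\<Union>i<k + 1. X i) = (\<Sum>i<k + 1. card (X i))"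
      using f(6) by (intro card_UN_disjoint) (auto simp: X_def)
    ultimately show ?thesis by simp
  qed
  also have "\<dots> < (\<Sum>i<k + 1. q + 1)"
  proof (rule sum_strict_mono_ex1)
    show "\<forall>i\<in>{..<k + 1}. card (X i) \<le> q + 1" using qX by fastforce
    show "\<exists>i\<in>{..<k + 1}. card (X i) < q + 1" using i0 by auto
  qed simp
  finally have m: "card (edges G) < (k + 1) * (q + 1)" by simp
  have "max ((5 * real (k + 1) - 8) / (2 * (4 * real (k + 1) - 7)) * (real (card (edges G)) / real (k + 1)) - 6)
    (31 / 49 * (real (card (edges G)) / real (k + 1)) - 6) \<le> real (cms_graph G)"
  proof (rule lower_bound_le[OF _ _ f(7) m])
    show "4 \<le> k + 1" using k by simp
    show "s \<le> cms_graph G" if "1 \<le> s" "3 * s + 14 \<le> 2 * q" for s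
      using k c' qX that by (intro cms_graph_ge_of_colouring[OF f(1), of "k + 1" c' q]) (auto simp: proper_on_def X_def)
  qed
  moreover have "real (card (edges G)) = real n * real k / 2"
    using f(4) by (metis of_nat_mult of_nat_numeral nonzero_mult_div_cancel_left zero_neq_numeral)
  moreover have "(5 * real (k + 1) - 8) / (2 * (4 * real (k + 1) - 7)) * (real n * real k / 2 / real (k + 1))
    = real k * (5 * real k - 3) / (4 * (real k + 1) * (4 * real k - 3)) * real n"
    using k by (simp add: divide_simps) (simp add: algebra_simps)
  moreover have "31 / 49 * (real n * real k / 2 / real (k + 1)) = 31 * real k / (98 * (real k + 1)) * real n"
    by (simp add: divide_simps)
  ultimately show ?thesis by simp
qed

text \<open>Each vertex has \<open>k\<close> edges of \<open>k\<close> different colours, hence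
  exactly one of every colour; the colour classes are perfect matchings.\<close>

lemma card_colour_class:
  assumes G: "simple_graph G" "regular k G" and c: "\<forall>e\<in>edges G. c e < k" "proper_on (edges G) c" and i: "i < k"
  shows "2 * card {e\<in>edges G. c e = i} = card (verts G)"
proof -
  have "card {e\<in>{e\<in>edges G. c e = i}. v \<in> e} = 1" if v: "v \<in> verts G" for v
  proof -
    define S where "S = {e\<in>edges G. v \<in> e}"
    have fS: "finite S" using finite_edges[OF G(1)] by (simp add: S_def)
    have "inj_on c S"
      using c(2) unfolding inj_on_def proper_on_def S_def adjacent_def by blast
    moreover have "card S = k" using G(2) v by (simp add: regular_def S_def)
    moreover have "c ` S \<subseteq> {..<k}" using c(1) by (auto simp: S_def)
    ultimately have im: "c ` S = {..<k}" by (intro card_subset_eq) (auto simp: card_image)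
    then have "i \<in> c ` S" using i by simp
    then obtain e where e: "e \<in> S" "c e = i" by auto
    have "{e\<in>{e\<in>edges G. c e = i}. v \<in> e} = {e}"
      using e \<open>inj_on c S\<close> by (auto simp: S_def inj_on_def)
    then show ?thesis by simp
  qed
  then have "(\<Sum>v\<in>verts G. card {e\<in>{e\<in>edges G. c e = i}. v \<in> e}) = card (verts G)" by simp
  then show ?thesis using degree_sum[OF G(1), of "{e\<in>edges G. c e = i}"] by auto
qed

lemma cms_graph_lower_class1:
  assumes G: "G \<in> class1_regular_graphs n k" and k: "4 \<le> k" and n: "0 < n"
  shows "max ((5 * real k - 8) / (4 * (4 * real k - 7)) * real n - 6) (31 / 98 * real n - 6) \<le> real (cms_graph G)"
proof -
  have k0: "0 < k" and GR: "G \<in> regular_graphs n k" using k G by (auto simp: class1_regular_graphs_def)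
  note f = regular_graphs_facts[OF GR n k0]
  obtain c where c: "\<forall>e\<in>edges G. c e < k" "proper_on (edges G) c"
    using G by (auto simp: class1_regular_graphs_def edge_colourable_def proper_on_def)
  define q where "q = n div 2"
  have X: "card {e\<in>edges G. c e = i} = q" if "i < k" for i
    using card_colour_class[OF f(1,3) c that] f(2) by (simp add: q_def)
  have n2: "n = 2 * q" using card_colour_class[OF f(1,3) c k0] f(2) X[OF k0] by simp
  have m: "card (edges G) = k * q" using f(4) n2 by simp
  have "max ((5 * real k - 8) / (2 * (4 * real k - 7)) * (real (k * q) / real k) - 6)
    (31 / 49 * (real (k * q) / real k) - 6) \<le> real (cms_graph G)"
  proof (rule lower_bound_le[OF k _ f(7)])
    show "k * q < k * (q + 1)" using k by simp
    show "s \<le> cms_graph G" if "1 \<le> s" "3 * s + 14 \<le> 2 * q" for s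
      using k c X that by (intro cms_graph_ge_of_colouring[OF f(1), of k c q]) (auto simp: proper_on_def)
  qed
  moreover have "(5 * real k - 8) / (2 * (4 * real k - 7)) * (real (k * q) / real k)
      = (5 * real k - 8) / (4 * (4 * real k - 7)) * real n"
    using k n2 by (simp add: divide_simps)
  ultimately show ?thesis using k n2 by simp
qed

lemma cms_graph_lower_class1_cubic:
  assumes G: "G \<in> class1_regular_graphs n 3" and n: "0 < n"
  shows "max ((5 * real 3 - 8) / (4 * (4 * real 3 - 7)) * real n - 6) (31 / 98 * real n - 6) \<le> real (cms_graph G)"
proof -
  have GR: "G \<in> regular_graphs n 3" using G by (auto simp: class1_regular_graphs_def)
  note f = regular_graphs_facts[OF GR n, simplified]
  obtain c where c: "\<forall>e\<in>edges G. c e < 3" "proper_on (edges G) c"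
    using G by (auto simp: class1_regular_graphs_def edge_colourable_def proper_on_def)
  define q where "q = n div 2"
  have X: "card {e\<in>edges G. c e = i} = q" if "i < 3" for i
    using card_colour_class[OF f(1,3) c that] f(2) by (simp add: q_def)
  have n2: "n = 2 * q" using card_colour_class[OF f(1,3) c, of 0] f(2) X[of 0] by simp
  \<comment> \<open>\<open>7 / 10\<close> is the value of
    \<open>(5 * k - 8) / (2 * (4 * k - 7))\<close> at \<open>k = 3\<close>, with
    \<open>n = 2 * q\<close>.\<close>
  define b where "b = 7 / 10 * real q - 6"
  have "b \<le> real (cms_graph G)"
  proof (cases "b \<le> 1")
    case True
    then show ?thesis using f(7) by linarith
  next
    case False
    define s where "s = nat \<lceil>b\<rceil>"
    have s: "b \<le> real s" "real s < b + 1" "1 \<le> s" using False unfolding s_def by linarith+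
    have "10 * real s < 7 * real q - 50" using s by (simp add: b_def)
    then have "10 * s + 51 \<le> 7 * q" by linarith
    then show ?thesis using cms_graph_ge_cubic[OF f(1,3) c X s(3)] s(1) by linarith
  qed
  moreover have "31 / 98 * real n - 6 \<le> b" using n2 by (simp add: b_def)
  ultimately show ?thesis using n2 by (simp add: b_def)
qed

theorem theorem1p1:
  fixes k :: nat
  assumes "k \<ge> 3"
  shows "\<exists>f :: nat \<Rightarrow> real. (\<lambda>n. f n / real n) \<longlonglongrightarrow> 0 \<and>
    (\<forall>n :: nat. n \<ge> 6 * (k + 1) \<and> even (n * k) \<longrightarrow>
      (max (real k * (5 * real k - 3) / (4 * (real k + 1) * (4 * real k - 3)) * real n - 6)
           (31 * real k / (98 * (real k + 1)) * real n - f n)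
         \<le> real (cms n k) \<and>
       real (cms n k) \<le> real k * real n / (2 * (real k + 1))) \<and>
      (class1_regular_graphs n k \<noteq> {} \<longrightarrow>
       max ((5 * real k - 8) / (4 * (4 * real k - 7)) * real n - 6)
           (31 / 98 * real n - f n)
         \<le> real (cms1 n k) \<and>
       real (cms1 n k) \<le> (real n - 1) / 2))"
proof (intro exI[of _ "\<lambda>_. 6"] conjI allI impI)
  show "(\<lambda>n. 6 / real n) \<longlonglongrightarrow> 0" by (rule lim_const_over_n)
next
  fix n :: nat
  assume H: "n \<ge> 6 * (k + 1) \<and> even (n * k)"
  then have n: "0 < n" and k: "0 < k" using assms by auto
  have "\<exists>G\<in>regular_graphs n k. cms_graph G * (k + 1) \<le> card (edges G)"
  proof (cases "even k")
    case True
    then show ?thesis using H k by (intro regular_graph_with_dense_part_even[of k "k div 2"]) auto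
  next
    case False
    then show ?thesis using H assms by (intro regular_graph_with_dense_part_odd[of k "k div 2"]) auto
  qed
  then obtain G0 where G0: "G0 \<in> regular_graphs n k" "cms_graph G0 * (k + 1) \<le> card (edges G0)" by blast
  have fin: "finite (cms_graph ` regular_graphs n k)" by (rule finite_cms_values[OF subset_refl n k])
  have "cms n k \<in> cms_graph ` regular_graphs n k" unfolding cms_def using fin G0 by (intro Min_in) auto
  then obtain G where G: "G \<in> regular_graphs n k" "cms n k = cms_graph G" by auto
  show "max (real k * (5 * real k - 3) / (4 * (real k + 1) * (4 * real k - 3)) * real n - 6)
           (31 * real k / (98 * (real k + 1)) * real n - 6) \<le> real (cms n k)"
    unfolding G(2) by (rule cms_graph_lower_vizing[OF G(1) assms n])
  have "cms n k \<le> cms_graph G0" unfolding cms_def using fin G0 by (intro Min_le) auto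
  then have "cms n k * (k + 1) \<le> card (edges G0)" using G0(2) by (meson le_trans mult_le_mono1)
  then have "2 * (cms n k * (k + 1)) \<le> n * k" using regular_graphs_facts(4)[OF G0(1) n k] by linarith
  then have "real (2 * (cms n k * (k + 1))) \<le> real (n * k)" by (simp only: of_nat_le_iff)
  then have "2 * (real (cms n k) * (real k + 1)) \<le> real n * real k" by (simp add: algebra_simps)
  then show "real (cms n k) \<le> real k * real n / (2 * (real k + 1))" by (simp add: field_simps)
next
  fix n :: nat
  assume H: "n \<ge> 6 * (k + 1) \<and> even (n * k)" and ne: "class1_regular_graphs n k \<noteq> {}"
  then have n: "0 < n" and k: "0 < k" using assms by auto
  have sub: "class1_regular_graphs n k \<subseteq> regular_graphs n k" by (auto simp: class1_regular_graphs_def)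
  have "cms1 n k \<in> cms_graph ` class1_regular_graphs n k"
    unfolding cms1_def using finite_cms_values[OF sub n k] ne by (intro Min_in) auto
  then obtain G where G: "G \<in> class1_regular_graphs n k" "cms1 n k = cms_graph G" by auto
  note f = regular_graphs_facts[OF subsetD[OF sub G(1)] n k]
  show "max ((5 * real k - 8) / (4 * (4 * real k - 7)) * real n - 6) (31 / 98 * real n - 6) \<le> real (cms1 n k)"
  proof (cases "k = 3")
    case True
    then show ?thesis unfolding G(2)
      using cms_graph_lower_class1_cubic[of G n] G(1) n by simp
  next
    case False
    then show ?thesis unfolding G(2) using assms by (intro cms_graph_lower_class1[OF G(1) _ n]) simp
  qed
  have "n * 2 \<le> n * k" using assms by (intro mult_le_mono2) simp
  then have "2 * cms_graph G + 1 \<le> card (verts G)"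
    using f(2,4) by (intro cms_graph_le_half[OF f(1) _ f(5)]) linarith
  then show "real (cms1 n k) \<le> (real n - 1) / 2" using G(2) f(2) by (simp add: field_simps)
qed

end
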